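(* Let $T>0$ and let $u$ be a solution on $[0,T]\times\mathbb{T}^3\times\mathbb{R}^3$ of the Boltzmann equation near a global Maxwellian $$\partial_t u+\xi\cdot\nabla_x u+\nu(\xi)u=K(u)+\Gamma(u,u),$$ with $\|(1+|\xi|)^{\gamma}u\|_{H^4([0,T]\times\mathbb{T}^3\times\mathbb{R}^3)}<\infty$. Let $\epsilon>0$. Then there exists $R_0>0$ such that for every $R\ge R_0$ there exist a real number $\lambda_R>0$, an integer $N>5$, and a $\tanh$ neural network $\widehat u=u_\theta^N$ such that the generalization error of $u_\theta=\widehat u$ (with weight $\lambda_R$) satisfies $$\mathcal{E}_G[R;\theta]\le\epsilon .$$
   Context: $\mathbb{T}^3$ is the torus identified with the cube $[-\pi,\pi]^3$ (periodic boundary conditions for $u$); $\partial\mathbb{T}^3$ is the boundary of this cube with surface measure $d\sigma$. For $R>0$, $Q_R\subset\mathbb{R}^3$ is the cube centered at $0$ with diameter $R$; $\chi_A$ is the characteristic function of $A$; products with $\chi_{Q_R}$ are extended by $0$ outside $Q_R$. Collision operator: for functions $f,g$ of $\xi\in\mathbb{R}^3$, $$Q(f,g)=\tfrac12\int_{\mathbb{R}^3\times S^2}q(v,\beta)\,(f'g'_*+f'_*g'-fg_*-f_*g)\,d\xi_*\,d\omega,$$ with $f=f(\xi)$, $f_*=f(\xi_* )$, $f'=f(\xi')$, $f'_*=f(\xi'_* )$ (same for $g$), $v=|\xi-\xi_*|$, $\cos\beta=\frac1v(\xi-\xi_* )\cdot\omega$, $\xi'=\xi-(v\cos\beta)\omega$,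 $\xi'_*=\xi_*+(v\cos\beta)\omega$. With $M(\xi)=(2\pi)^{-3/2}e^{-|\xi|^2/2}$, the operators are defined by $-\nu(\xi)u+Ku=2M^{-1/2}Q(M,M^{1/2}u)$, where $\nu(\xi)=\int q(v,\beta)M(\xi_* )\,d\xi_*d\omega$ is the collision frequency, and $\Gamma(u,w)=M^{-1/2}Q(M^{1/2}u,M^{1/2}w)$. They act in the $\xi$ variable only. Standing assumption: $q$ satisfies the angular cut-off assumption (Ukai–Yang, Mathematical Theory of Boltzmann Equation), under which: $K:L^2(\mathbb{R}^3_\xi)\to L^2\cap L^\infty$ is linear and bounded; there are $\nu_0,\nu_1>0$ and $\gamma\in[0,1]$ with $\nu_0(1+|\xi|)^\gamma\le\nu(\xi)\le\nu_1(1+|\xi|)^\gamma$; and for $p\in[1,\infty]$, $\alpha\in[0,1]$ there is $C_0$ with $\|\nu^{-\alpha}\Gamma(v,\tilde v)\|_{L^p_\xi}\le C_0(\|\nu^{1-\alpha}v\|_{L^p_\xi}\|\tilde v\|_{L^p_\xi}+\|\nu^{1-\alpha}\tilde v\|_{L^p_\xi}\|v\|_{L^p_\xi})$ on $\mathbb{R}^3$. A $\tanh$ neural network is a feedforward neural network with activation function $\tanh$ (here a function of $(t,x,\xi)$), $\theta$ denoting its parameters; the integer $N$ is an index for the size of the network. For a neural network $u_\theta$ define the residuals $$\mathcal{R}_i[R;\theta]=\partial_tu_\theta+\xi\cdot\nabla_xu_\theta+\nu(\xi)u_\theta-K(u_\theta\chi_{Q_R})-\Gamma(u_\theta\chi_{Q_R},u_\theta\chi_{Q_R}),\qquad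 \mathcal{R}_t[\theta](x,\xi)=u_\theta(0,x,\xi)-u(0,x,\xi),$$ $$\mathcal{R}_b[\theta](t,x,\xi)=(u_\theta(t,x_1,x_2,\pi,\xi)-u_\theta(t,x_1,x_2,-\pi,\xi))^2+(u_\theta(t,x_1,\pi,x_3,\xi)-u_\theta(t,x_1,-\pi,x_3,\xi))^2+(u_\theta(t,\pi,x_2,x_3,\xi)-u_\theta(t,-\pi,x_2,x_3,\xi))^2 .$$ The generalization error is $$\mathcal{E}_G[R;\theta]=\left(\mathcal{E}_G^i[R;\theta]^2+\mathcal{E}_G^t[R;\theta]^2+\mathcal{E}_G^b[R;\theta]^2+\lambda_R\,\mathcal{E}_G^p[R;\theta]^2\right)^{1/2},$$ where $\mathcal{E}_G^i[R;\theta]^2=\int_0^T\int_{\mathbb{T}^3}\int_{Q_R}\mathcal{R}_i[R;\theta]^2\,d\xi dxdt$, $\mathcal{E}_G^t[R;\theta]^2=\int_{\mathbb{T}^3}\int_{Q_R}\mathcal{R}_t[\theta]^2\,d\xi dx$, $\mathcal{E}_G^b[R;\theta]^2=\int_0^T\int_{\partial\mathbb{T}^3}\int_{Q_R}\mathcal{R}_b[\theta]^2\,d\xi d\sigma(x)dt$, $\mathcal{E}_G^p[R;\theta]^2=(1+R)^\gamma\int_0^T\|u_\theta(t,\cdot,\cdot)\|_{H^2(\mathbb{T}^3\times Q_R)}^2dt$. *)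

theory Defs
  imports
    "HOL-Analysis.Analysis"
    "HOL-Probability.Essential_Supremum"
    "HOL-Library.Multiset"
begin

section \<open>Partial derivatives, weak derivatives and Sobolev norms\<close>

definition partial :: "'a::euclidean_space \<Rightarrow> ('a \<Rightarrow> real) \<Rightarrow> 'a \<Rightarrow> real" where
  "partial b f p = deriv (\<lambda>s. f (p + s *\<^sub>R b)) 0"

definition partials :: "'a::euclidean_space list \<Rightarrow> ('a \<Rightarrow> real) \<Rightarrow> 'a \<Rightarrow> real" where
  "partials bs f = foldr partial bs f"

definition smooth :: "('a::euclidean_space \<Rightarrow> real) \<Rightarrow> bool" where
  "smooth f \<longleftrightarrow> (\<forall>bs. set bs \<subseteq> Basis \<longrightarrow> (\<forall>p. partials bs f differentiable at p))"

text \<open>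
  A multi-index is a finite multiset of basis vectors; its order is its size.  For smooth functions
  the order of differentiation is irrelevant, so an arbitrary enumeration of the multiset is used.
\<close>

definition multi_indices :: "nat \<Rightarrow> 'a::euclidean_space multiset set" where
  "multi_indices k = {\<alpha>. set_mset \<alpha> \<subseteq> Basis \<and> size \<alpha> \<le> k}"

lemma finite_multi_indices: "finite (multi_indices k :: 'a::euclidean_space multiset set)"
proof (rule finite_subset)
  show "multi_indices k \<subseteq> mset ` {bs :: 'a list. set bs \<subseteq> Basis \<and> length bs \<le> k}"
  proof
    fix \<alpha> :: "'a multiset" assume "\<alpha> \<in> multi_indices k"
    moreover obtain bs where "mset bs = \<alpha>" using ex_mset by blast
    ultimately show "\<alpha> \<in> mset ` {bs. set bs \<subseteq> Basis \<and> length bs \<le> k}"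
      by (auto simp: multi_indices_def)
  qed
  show "finite (mset ` {bs :: 'a list. set bs \<subseteq> Basis \<and> length bs \<le> k})"
    by (intro finite_imageI finite_lists_length_le finite_Basis)
qed

definition mderiv :: "'a::euclidean_space multiset \<Rightarrow> ('a \<Rightarrow> real) \<Rightarrow> 'a \<Rightarrow> real" where
  "mderiv \<alpha> f = partials (SOME bs. mset bs = \<alpha>) f"

definition test_function :: "'a::euclidean_space set \<Rightarrow> ('a \<Rightarrow> real) \<Rightarrow> bool" where
  "test_function \<Omega> \<phi> \<longleftrightarrow> smooth \<phi> \<and> compact (closure {p. \<phi> p \<noteq> 0}) \<and> closure {p. \<phi> p \<noteq> 0} \<subseteq> \<Omega>"

definition locally_integrable :: "'a::euclidean_space set \<Rightarrow> ('a \<Rightarrow> real) \<Rightarrow> bool" where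
  "locally_integrable \<Omega> f \<longleftrightarrow> (\<forall>S. compact S \<and> S \<subseteq> \<Omega> \<longrightarrow> set_integrable lborel S f)"

text \<open>\<open>g\<close> is a weak derivative \<open>\<partial>\<^sup>\<alpha> f\<close> on the open set \<open>\<Omega>\<close>.\<close>

definition weak_deriv ::
    "'a::euclidean_space set \<Rightarrow> 'a multiset \<Rightarrow> ('a \<Rightarrow> real) \<Rightarrow> ('a \<Rightarrow> real) \<Rightarrow> bool" where
  "weak_deriv \<Omega> \<alpha> f g \<longleftrightarrow> locally_integrable \<Omega> f \<and> locally_integrable \<Omega> g \<and>
     (\<forall>\<phi>. test_function \<Omega> \<phi> \<longrightarrow>
        (LINT p:\<Omega>|lborel. f p * mderiv \<alpha> \<phi> p)
          = (- 1) ^ size \<alpha> * (LINT p:\<Omega>|lborel. g p * \<phi> p))"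

text \<open>
  The squared \<open>H\<^sup>k\<close> norm, with weak derivatives taken on the open set \<open>\<Omega>\<close> and integrated over
  \<open>C \<subseteq> \<Omega>\<close>.  For an ordinary domain \<open>C = \<Omega>\<close>; for functions on a torus, \<open>f\<close> is a periodic function,
  \<open>\<Omega>\<close> the periodic domain and \<open>C\<close> a fundamental cell.  Weak derivatives are unique up to null sets,
  so the infimum ranges over at most one value; it is \<open>\<infinity>\<close> if some weak derivative does not exist.
\<close>

definition sobolev_norm_sq ::
    "nat \<Rightarrow> 'a::euclidean_space set \<Rightarrow> 'a set \<Rightarrow> ('a \<Rightarrow> real) \<Rightarrow> ennreal" where
  "sobolev_norm_sq k \<Omega> C f =
     (INF g \<in> {g. \<forall>\<alpha>\<in>multi_indices k. weak_deriv \<Omega> \<alpha> f (g \<alpha>)}.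
        \<Sum>\<alpha>\<in>multi_indices k. \<integral>\<^sup>+ p\<in>C. ennreal ((g \<alpha> p)\<^sup>2) \<partial>lborel)"


section \<open>Lebesgue spaces on velocity space\<close>

definition in_Lp :: "ennreal \<Rightarrow> (real^3 \<Rightarrow> real) \<Rightarrow> bool" where
  "in_Lp p f \<longleftrightarrow> f \<in> borel_measurable lborel \<and>
     (if p = \<infinity> then esssup lborel (\<lambda>\<xi>. ereal \<bar>f \<xi>\<bar>) < \<infinity>
      else integrable lborel (\<lambda>\<xi>. \<bar>f \<xi>\<bar> powr enn2real p))"

definition Lp_norm :: "ennreal \<Rightarrow> (real^3 \<Rightarrow> real) \<Rightarrow> real" where
  "Lp_norm p f =
     (if p = \<infinity> then real_of_ereal (esssup lborel (\<lambda>\<xi>. ereal \<bar>f \<xi>\<bar>))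
      else (LINT \<xi>|lborel. \<bar>f \<xi>\<bar> powr enn2real p) powr (1 / enn2real p))"


section \<open>The collision operator\<close>

text \<open>
  Surface measure on the unit sphere \<open>S\<^sup>2\<close> as the cone measure
  \<open>A \<mapsto> 3 \<cdot> vol {r \<omega> | 0 < r < 1, \<omega> \<in> A}\<close>; the total mass is \<open>3 \<cdot> 4\<pi>/3 = 4\<pi>\<close>.
\<close>

definition sphere_measure :: "(real^3) measure" where
  "sphere_measure =
     scale_measure 3 (distr (restrict_space lborel (ball 0 1 - {0})) borel (\<lambda>x. x /\<^sub>R norm x))"

definition collision_angle :: "real^3 \<Rightarrow> real^3 \<Rightarrow> real^3 \<Rightarrow> real" where
  "collision_angle \<xi> \<xi>s \<omega> = arccos (((\<xi> - \<xi>s) \<bullet> \<omega>) / norm (\<xi> - \<xi>s))"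

definition post :: "real^3 \<Rightarrow> real^3 \<Rightarrow> real^3 \<Rightarrow> real^3" where
  "post \<xi> \<xi>s \<omega> = \<xi> - (norm (\<xi> - \<xi>s) * cos (collision_angle \<xi> \<xi>s \<omega>)) *\<^sub>R \<omega>"

definition post_star :: "real^3 \<Rightarrow> real^3 \<Rightarrow> real^3 \<Rightarrow> real^3" where
  "post_star \<xi> \<xi>s \<omega> = \<xi>s + (norm (\<xi> - \<xi>s) * cos (collision_angle \<xi> \<xi>s \<omega>)) *\<^sub>R \<omega>"

definition collision ::
    "(real \<Rightarrow> real \<Rightarrow> real) \<Rightarrow> (real^3 \<Rightarrow> real) \<Rightarrow> (real^3 \<Rightarrow> real) \<Rightarrow> real^3 \<Rightarrow> real" where
  "collision q f g \<xi> = 1/2 *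
     (LINT (\<xi>s, \<omega>)|(lborel \<Otimes>\<^sub>M sphere_measure).
        q (norm (\<xi> - \<xi>s)) (collision_angle \<xi> \<xi>s \<omega>) *
          (f (post \<xi> \<xi>s \<omega>) * g (post_star \<xi> \<xi>s \<omega>) + f (post_star \<xi> \<xi>s \<omega>) * g (post \<xi> \<xi>s \<omega>)
            - f \<xi> * g \<xi>s - f \<xi>s * g \<xi>))"

definition maxwellian :: "real^3 \<Rightarrow> real" where
  "maxwellian \<xi> = (2 * pi) powr (- 3/2) * exp (- (norm \<xi>)\<^sup>2 / 2)"

definition nu :: "(real \<Rightarrow> real \<Rightarrow> real) \<Rightarrow> real^3 \<Rightarrow> real" where
  "nu q \<xi> = (LINT (\<xi>s, \<omega>)|(lborel \<Otimes>\<^sub>M sphere_measure).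
     q (norm (\<xi> - \<xi>s)) (collision_angle \<xi> \<xi>s \<omega>) * maxwellian \<xi>s)"

definition K_op :: "(real \<Rightarrow> real \<Rightarrow> real) \<Rightarrow> (real^3 \<Rightarrow> real) \<Rightarrow> real^3 \<Rightarrow> real" where
  "K_op q f \<xi> = nu q \<xi> * f \<xi>
     + 2 / sqrt (maxwellian \<xi>) * collision q maxwellian (\<lambda>\<eta>. sqrt (maxwellian \<eta>) * f \<eta>) \<xi>"

definition Gamma_op ::
    "(real \<Rightarrow> real \<Rightarrow> real) \<Rightarrow> (real^3 \<Rightarrow> real) \<Rightarrow> (real^3 \<Rightarrow> real) \<Rightarrow> real^3 \<Rightarrow> real" where
  "Gamma_op q f g \<xi> = 1 / sqrt (maxwellian \<xi>) *
     collision q (\<lambda>\<eta>. sqrt (maxwellian \<eta>) * f \<eta>) (\<lambda>\<eta>. sqrt (maxwellian \<eta>) * g \<eta>) \<xi>"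

text \<open>
  The angular cut-off assumption on the nonnegative collision kernel \<open>q\<close> enters through the
  following properties of \<open>K\<close>, \<open>\<nu>\<close> and \<open>\<Gamma>\<close>, which it guarantees (Ukai and Yang, Mathematical
  Theory of Boltzmann Equation).
\<close>

definition cutoff_kernel :: "(real \<Rightarrow> real \<Rightarrow> real) \<Rightarrow> real \<Rightarrow> bool" where
  "cutoff_kernel q \<gamma> \<longleftrightarrow>
     (\<lambda>(v, \<beta>). q v \<beta>) \<in> borel_measurable borel \<and>
     (\<forall>v\<ge>0. \<forall>\<beta>\<in>{0..pi}. 0 \<le> q v \<beta>) \<and>
     \<comment> \<open>\<open>K : L\<^sup>2 \<rightarrow> L\<^sup>2 \<inter> L\<^sup>\<infinity>\<close> is linear and bounded\<close>
     (\<forall>f g a b. in_Lp 2 f \<and> in_Lp 2 g \<longrightarrow>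
        (AE \<xi> in lborel. K_op q (\<lambda>\<eta>. a * f \<eta> + b * g \<eta>) \<xi> = a * K_op q f \<xi> + b * K_op q g \<xi>)) \<and>
     (\<exists>C. \<forall>f. in_Lp 2 f \<longrightarrow>
        in_Lp 2 (K_op q f) \<and> in_Lp \<infinity> (K_op q f) \<and>
        Lp_norm 2 (K_op q f) \<le> C * Lp_norm 2 f \<and> Lp_norm \<infinity> (K_op q f) \<le> C * Lp_norm 2 f) \<and>
     \<comment> \<open>growth of the collision frequency\<close>
     0 \<le> \<gamma> \<and> \<gamma> \<le> 1 \<and>
     (\<exists>\<nu>0>0. \<exists>\<nu>1>0. \<forall>\<xi>. \<nu>0 * (1 + norm \<xi>) powr \<gamma> \<le> nu q \<xi> \<and> nu q \<xi> \<le> \<nu>1 * (1 + norm \<xi>) powr \<gamma>) \<and>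
     \<comment> \<open>estimate of \<open>\<Gamma>\<close>\<close>
     (\<forall>p\<ge>1. \<forall>\<alpha>\<in>{0..1}. \<exists>C0. \<forall>f g.
        in_Lp p f \<and> in_Lp p g \<and>
        in_Lp p (\<lambda>\<xi>. nu q \<xi> powr (1 - \<alpha>) * f \<xi>) \<and> in_Lp p (\<lambda>\<xi>. nu q \<xi> powr (1 - \<alpha>) * g \<xi>) \<longrightarrow>
        in_Lp p (\<lambda>\<xi>. nu q \<xi> powr (- \<alpha>) * Gamma_op q f g \<xi>) \<and>
        Lp_norm p (\<lambda>\<xi>. nu q \<xi> powr (- \<alpha>) * Gamma_op q f g \<xi>)
          \<le> C0 * (Lp_norm p (\<lambda>\<xi>. nu q \<xi> powr (1 - \<alpha>) * f \<xi>) * Lp_norm p g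
                + Lp_norm p (\<lambda>\<xi>. nu q \<xi> powr (1 - \<alpha>) * g \<xi>) * Lp_norm p f))"


section \<open>Solutions of the Boltzmann equation on the torus\<close>

text \<open>
  Phase space points are triples \<open>(t, x, \<xi>)\<close>.  A function on the torus is represented by its
  periodic extension in \<open>x\<close>; \<open>torus_cube\<close> is the fundamental cell.
\<close>

type_synonym phase = "real \<times> (real^3) \<times> (real^3)"

definition torus_cube :: "(real^3) set" where
  "torus_cube = {x. \<forall>j. x $ j \<in> {- pi..pi}}"

definition phase_domain :: "real \<Rightarrow> phase set" where
  "phase_domain T = {0<..<T} \<times> UNIV \<times> UNIV"

definition phase_cell :: "real \<Rightarrow> phase set" where
  "phase_cell T = {0<..<T} \<times> torus_cube \<times> UNIV"

definition x_periodic :: "(phase \<Rightarrow> real) \<Rightarrow> bool" where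
  "x_periodic u \<longleftrightarrow> (\<forall>t x \<xi> j. u (t, x + axis j (2 * pi), \<xi>) = u (t, x, \<xi>))"

text \<open>
  Strong solutions: \<open>\<partial>\<^sub>t u\<close> and \<open>\<nabla>\<^sub>x u\<close> are weak derivatives and the equation holds almost
  everywhere.  Continuity selects the representative of the \<open>H\<^sup>4\<close> function \<open>u\<close> (there are seven
  variables and \<open>4 > 7/2\<close>), so that the initial values \<open>u (0, x, \<xi>)\<close> are meaningful.
\<close>

definition boltzmann_solution ::
    "(real \<Rightarrow> real \<Rightarrow> real) \<Rightarrow> real \<Rightarrow> (phase \<Rightarrow> real) \<Rightarrow> bool" where
  "boltzmann_solution q T u \<longleftrightarrow>
     x_periodic u \<and>
     continuous_on ({0..T} \<times> UNIV \<times> UNIV) u \<and>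
     (\<exists>ut ux.
        weak_deriv (phase_domain T) {#(1, 0, 0)#} u ut \<and>
        (\<forall>j. weak_deriv (phase_domain T) {#(0, axis j 1, 0)#} u (\<lambda>p. ux p $ j)) \<and>
        (AE p in lborel. p \<in> phase_cell T \<longrightarrow> (case p of (t, x, \<xi>) \<Rightarrow>
           ut (t, x, \<xi>) + \<xi> \<bullet> ux (t, x, \<xi>) + nu q \<xi> * u (t, x, \<xi>)
             = K_op q (\<lambda>\<eta>. u (t, x, \<eta>)) \<xi>
               + Gamma_op q (\<lambda>\<eta>. u (t, x, \<eta>)) (\<lambda>\<eta>. u (t, x, \<eta>)) \<xi>)))"


section \<open>Tanh neural networks\<close>

text \<open>
  A neuron consists of its input weights and its bias.  The parameters \<open>\<theta>\<close> of a network are the list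
  of its layers; \<open>tanh\<close> is applied after every layer except the last one, which is affine.
\<close>

type_synonym neuron = "real list \<times> real"
type_synonym layer = "neuron list"
type_synonym network = "layer list"

definition affine_layer :: "layer \<Rightarrow> real list \<Rightarrow> real list" where
  "affine_layer l xs = map (\<lambda>(w, b). (\<Sum>(a, x)\<leftarrow>zip w xs. a * x) + b) l"

fun feedforward :: "network \<Rightarrow> real list \<Rightarrow> real list" where
  "feedforward [] xs = xs"
| "feedforward [l] xs = affine_layer l xs"
| "feedforward (l # l' # ls) xs = feedforward (l' # ls) (map tanh (affine_layer l xs))"

fun well_formed :: "nat \<Rightarrow> network \<Rightarrow> nat \<Rightarrow> bool" where
  "well_formed m [] n \<longleftrightarrow> m = n"
| "well_formed m (l # ls) n \<longleftrightarrow>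
     l \<noteq> [] \<and> (\<forall>(w, b)\<in>set l. length w = m) \<and> well_formed (length l) ls n"

text \<open>
  The index \<open>N\<close> measures the size of a network by its width, the largest number of neurons in a
  hidden layer.
\<close>

definition tanh_network :: "nat \<Rightarrow> network \<Rightarrow> bool" where
  "tanh_network N \<theta> \<longleftrightarrow>
     length \<theta> \<ge> 2 \<and> well_formed 7 \<theta> 1 \<and> N = Max (set (map length (butlast \<theta>)))"

definition realization :: "network \<Rightarrow> phase \<Rightarrow> real" where
  "realization \<theta> = (\<lambda>(t, x, \<xi>).
     hd (feedforward \<theta> [t, x $ 1, x $ 2, x $ 3, \<xi> $ 1, \<xi> $ 2, \<xi> $ 3]))"


section \<open>Residuals and generalization error\<close>

text \<open>A cube of diameter \<open>R\<close> in three dimensions has side length \<open>R / \<surd>3\<close>.\<close>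

definition vel_cube :: "real \<Rightarrow> (real^3) set" where
  "vel_cube R = {\<xi>. \<forall>j. \<bar>\<xi> $ j\<bar> \<le> R / (2 * sqrt 3)}"

definition residual_i :: "(real \<Rightarrow> real \<Rightarrow> real) \<Rightarrow> real \<Rightarrow> (phase \<Rightarrow> real) \<Rightarrow> phase \<Rightarrow> real" where
  "residual_i q R v = (\<lambda>(t, x, \<xi>).
     let vR = (\<lambda>\<eta>. v (t, x, \<eta>) * indicator (vel_cube R) \<eta>) in
       partial (1, 0, 0) v (t, x, \<xi>)
         + (\<Sum>j\<in>UNIV. \<xi> $ j * partial (0, axis j 1, 0) v (t, x, \<xi>))
         + nu q \<xi> * v (t, x, \<xi>) - K_op q vR \<xi> - Gamma_op q vR vR \<xi>)"

definition residual_t :: "(phase \<Rightarrow> real) \<Rightarrow> (phase \<Rightarrow> real) \<Rightarrow> (real^3) \<Rightarrow> (real^3) \<Rightarrow> real" where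
  "residual_t u v x \<xi> = v (0, x, \<xi>) - u (0, x, \<xi>)"

definition set_coord :: "real^3 \<Rightarrow> 3 \<Rightarrow> real \<Rightarrow> real^3" where
  "set_coord x j s = (\<chi> i. if i = j then s else x $ i)"

definition residual_b :: "(phase \<Rightarrow> real) \<Rightarrow> phase \<Rightarrow> real" where
  "residual_b v = (\<lambda>(t, x, \<xi>).
     \<Sum>j\<in>UNIV. (v (t, set_coord x j pi, \<xi>) - v (t, set_coord x j (- pi), \<xi>))\<^sup>2)"

definition face_point :: "3 \<Rightarrow> real \<Rightarrow> real \<times> real \<Rightarrow> real^3" where
  "face_point j s = (\<lambda>(a, b).
     if j = 1 then vector [s, a, b] else if j = 2 then vector [a, s, b] else vector [a, b, s])"

text \<open>The surface integral over the boundary of \<open>torus_cube\<close>, as a sum over its six faces.\<close>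

definition boundary_integral :: "(real^3 \<Rightarrow> ennreal) \<Rightarrow> ennreal" where
  "boundary_integral f =
     (\<Sum>j\<in>UNIV. \<Sum>s\<in>{- pi, pi}.
        \<integral>\<^sup>+ y\<in>{- pi..pi} \<times> {- pi..pi}. f (face_point j s y) \<partial>lborel)"

text \<open>
  The squared components of the generalization error of an approximation \<open>v\<close>.  They are extended
  nonnegative integrals, so that a residual that is not square integrable has infinite error.
\<close>

definition error_i_sq :: "(real \<Rightarrow> real \<Rightarrow> real) \<Rightarrow> real \<Rightarrow> real \<Rightarrow> (phase \<Rightarrow> real) \<Rightarrow> ennreal" where
  "error_i_sq q T R v =
     (\<integral>\<^sup>+ t\<in>{0..T}. (\<integral>\<^sup>+ x\<in>torus_cube. (\<integral>\<^sup>+ \<xi>\<in>vel_cube R.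
        ennreal ((residual_i q R v (t, x, \<xi>))\<^sup>2) \<partial>lborel) \<partial>lborel) \<partial>lborel)"

definition error_t_sq :: "real \<Rightarrow> (phase \<Rightarrow> real) \<Rightarrow> (phase \<Rightarrow> real) \<Rightarrow> ennreal" where
  "error_t_sq R u v =
     (\<integral>\<^sup>+ x\<in>torus_cube. (\<integral>\<^sup>+ \<xi>\<in>vel_cube R. ennreal ((residual_t u v x \<xi>)\<^sup>2) \<partial>lborel) \<partial>lborel)"

definition error_b_sq :: "real \<Rightarrow> real \<Rightarrow> (phase \<Rightarrow> real) \<Rightarrow> ennreal" where
  "error_b_sq T R v =
     (\<integral>\<^sup>+ t\<in>{0..T}. boundary_integral (\<lambda>x.
        \<integral>\<^sup>+ \<xi>\<in>vel_cube R. ennreal ((residual_b v (t, x, \<xi>))\<^sup>2) \<partial>lborel) \<partial>lborel)"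

definition error_p_sq :: "real \<Rightarrow> real \<Rightarrow> real \<Rightarrow> (phase \<Rightarrow> real) \<Rightarrow> ennreal" where
  "error_p_sq \<gamma> T R v =
     ennreal ((1 + R) powr \<gamma>) *
     (\<integral>\<^sup>+ t\<in>{0..T}.
        sobolev_norm_sq 2 (interior (torus_cube \<times> vel_cube R)) (interior (torus_cube \<times> vel_cube R))
          (\<lambda>(x, \<xi>). v (t, x, \<xi>)) \<partial>lborel)"

definition ennreal_sqrt :: "ennreal \<Rightarrow> ennreal" where
  "ennreal_sqrt a = (if a = \<infinity> then \<infinity> else ennreal (sqrt (enn2real a)))"

definition generalization_error ::
    "(real \<Rightarrow> real \<Rightarrow> real) \<Rightarrow> real \<Rightarrow> real \<Rightarrow> (phase \<Rightarrow> real) \<Rightarrow> real \<Rightarrow> real \<Rightarrow> network \<Rightarrow> ennreal"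
  where
  "generalization_error q \<gamma> T u lam R \<theta> =
     (let v = realization \<theta> in
      ennreal_sqrt (error_i_sq q T R v + error_t_sq R u v + error_b_sq T R v
                    + ennreal lam * error_p_sq \<gamma> T R v))"

end

theory Submission
  imports Defs "HOL-Real_Asymp.Real_Asymp"
begin

text \<open>
  A network with one hidden layer is enough.  The residual of the equation is controlled by four
  quantities: the uniform distance \<open>e\<close> of the network to \<open>u\<close> on the bounded phase cell
  \<open>[0, T] \<times> [-\<pi>, \<pi>]\<^sup>3 \<times> Q\<^sub>R\<close>, the \<open>L\<^sup>2\<close> distance of the transport derivatives
  \<open>(\<partial>\<^sub>t + \<xi> \<bullet> \<nabla>\<^sub>x) u\<close> on this cell, the \<open>L\<^sup>2\<close> norm of \<open>\<nu> u\<close> outside \<open>Q\<^sub>R\<close>, and a bound for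
  \<open>\<nu> u(t, x, \<cdot>)\<close> in \<open>L\<^sup>2\<close> that is uniform in \<open>t\<close> and \<open>x\<close>.  The last two are properties of \<open>u\<close>, the first
  two are made small by the network.

  \<^bold>\<open>Uniform bound and tail.\<close>  A Sobolev inequality with mixed derivatives (\<open>velocity_l2_sup_bound\<close>) uses
  one derivative in each of the variables \<open>t\<close>, \<open>x\<close> and none in \<open>\<xi>\<close>.  Hence four derivatives bound
  \<open>\<nu> u\<close> in \<open>L\<^sup>2\<close> of the velocity uniformly in \<open>t\<close> and \<open>x\<close>.  In particular \<open>\<nu> u\<close> is square integrable,
  and its tail outside \<open>Q\<^sub>R\<close> tends to 0 (\<open>velocity_tail_small\<close>); this determines \<open>R\<^sub>0\<close>.

  \<^bold>\<open>Collision terms.\<close>  The residual differs from the equation for \<open>u\<close> by terms that are linear in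
  \<open>K\<close> or, by the polarization \<open>\<Gamma>(f, f) - \<Gamma>(g, g) = \<Gamma>(f - g, f + g)\<close>, bilinear in \<open>\<Gamma>\<close> with one small
  argument (\<open>Gamma_diff_squares\<close>, \<open>collision_stable_exists\<close>).  Polarization holds only almost everywhere.
  It rests on the integrability of the collision integrand for equal arguments, which follows from the
  invariance of the measure under collisions (\<open>collision_change_of_variables\<close>).

  \<^bold>\<open>Approximation.\<close>  The weak derivatives of a solution are locally integrable.  Their combination
  \<open>g = (\<partial>\<^sub>t + \<xi> \<bullet> \<nabla>\<^sub>x) u\<close> equals the collision terms and is therefore square integrable on
  bounded cells, so the approximation respects the transport operator as a whole
  (\<open>transport_approx\<close>): mollification almost commutes with it if the kernel is much narrower in
  \<open>\<xi>\<close> than in \<open>t\<close>, \<open>x\<close> (\<open>landau_kernel_exists\<close>).  Landau kernels are polynomials, so the mollified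
  function is a polynomial, and polynomials are approximated in \<open>C\<^sup>1\<close> on compact sets by shallow \<open>tanh\<close>
  networks through difference quotients in the weights (\<open>C1_approx_monom_ridge\<close>).  A dilation in \<open>t\<close> and
  \<open>x\<close> keeps the mollification away from the boundary of the cell.

  \<^bold>\<open>Conclusion.\<close>  For \<open>R \<ge> R\<^sub>0\<close> the accuracy \<open>e\<close> is chosen in terms of \<open>R\<close>.  Uniform closeness to the
  continuous periodic function \<open>u\<close> controls the initial and the boundary error.  The penalty of the
  resulting network is some finite number (\<open>error_p_sq_finite\<close>), and the weight \<open>\<lambda>\<^sub>R\<close>, chosen last, makes
  its contribution small.
\<close>

abbreviation borel_maps :: "('a::topological_space \<Rightarrow> 'b::topological_space) set" where
  "borel_maps \<equiv> borel_measurable borel"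

text \<open>
  Short notation for the nonnegative Lebesgue-Borel integral, in analogy to \<open>LBINT\<close>, and for the squared
  \<open>L\<^sup>2\<close> norm on a set.
\<close>

abbreviation lborel_nn_integral :: "('a::euclidean_space \<Rightarrow> ennreal) \<Rightarrow> ennreal" (binder "LBNN " 10) where
  "LBNN p. F p \<equiv> nn_integral lborel F"

abbreviation l2_on :: "'a::euclidean_space set \<Rightarrow> ('a \<Rightarrow> real) \<Rightarrow> ennreal" where
  "l2_on K f \<equiv> LBNN p. ennreal ((f p)\<^sup>2) * indicator K p"

section \<open>Smooth functions of one variable\<close>

definition smooth1 :: "(real \<Rightarrow> real) \<Rightarrow> bool" where
  "smooth1 h \<longleftrightarrow> (\<forall>n x. ((deriv ^^ n) h has_real_derivative (deriv ^^ Suc n) h x) (at x))"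

text \<open>
  A class of functions closed under differentiation consists of smooth functions.  This spares all
  formulas for higher derivatives: it suffices to name a class that contains the function.
\<close>

lemma smooth1_coinduct:
  assumes "h \<in> F" and step: "\<And>f. f \<in> F \<Longrightarrow> \<exists>f'\<in>F. \<forall>x. (f has_real_derivative f' x) (at x)"
  shows "smooth1 h"
proof -
  have der: "deriv f \<in> F \<and> (\<forall>x. (f has_real_derivative deriv f x) (at x))" if f: "f \<in> F" for f
  proof -
    obtain f' where f': "f' \<in> F" "\<And>x. (f has_real_derivative f' x) (at x)"
      using step[OF f] by auto
    have "deriv f = f'" using f'(2) by (auto intro: DERIV_imp_deriv)
    with f' show ?thesis by auto
  qed
  have "(deriv ^^ n) h \<in> F" for n
    by (induction n) (use assms(1) der in auto)
  then show ?thesis using der by (auto simp: smooth1_def)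
qed

lemma smooth1_DERIV: "smooth1 h \<Longrightarrow> (h has_real_derivative deriv h x) (at x)"
  unfolding smooth1_def by (drule spec[of _ 0]) simp

lemma smooth1_deriv: "smooth1 h \<Longrightarrow> smooth1 (deriv h)"
  unfolding smooth1_def
proof (intro allI)
  fix n x assume a: "\<forall>n x. ((deriv ^^ n) h has_real_derivative (deriv ^^ Suc n) h x) (at x)"
  show "((deriv ^^ n) (deriv h) has_real_derivative (deriv ^^ Suc n) (deriv h) x) (at x)"
    using a[rule_format, of "Suc n" x] by (simp add: funpow_swap1)
qed

lemma smooth1_higher_deriv: "smooth1 h \<Longrightarrow> smooth1 ((deriv ^^ n) h)"
  by (induction n) (auto intro: smooth1_deriv)

lemma smooth1_continuous_on: "smooth1 h \<Longrightarrow> continuous_on S h"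
  by (meson DERIV_isCont continuous_at_imp_continuous_on smooth1_DERIV)

lemma smooth1_primitive:
  assumes "smooth1 g" "\<And>x. (h has_real_derivative g x) (at x)"
  shows "smooth1 h"
proof (rule smooth1_coinduct[where F="insert h {f. smooth1 f}"])
  fix f assume "f \<in> insert h {f. smooth1 f}"
  then show "\<exists>f'\<in>insert h {f. smooth1 f}. \<forall>x. (f has_real_derivative f' x) (at x)"
    using assms smooth1_deriv smooth1_DERIV by blast
qed simp

lemma smooth1_const: "smooth1 (\<lambda>x. c)"
proof (rule smooth1_coinduct[where F="{\<lambda>x. c |c. True}"])
  fix f :: "real \<Rightarrow> real" assume "f \<in> {\<lambda>x. c |c. True}"
  then show "\<exists>f'\<in>{\<lambda>x. c |c. True}. \<forall>x. (f has_real_derivative f' x) (at x)"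
    by (intro bexI[of _ "\<lambda>x. 0"]) auto
qed auto

lemma smooth1_ident: "smooth1 (\<lambda>x. x)"
  by (rule smooth1_primitive[OF smooth1_const[of 1]]) simp

lemma smooth1_affine:
  assumes "smooth1 h"
  shows "smooth1 (\<lambda>x. h (a * x + b))"
proof -
  have "smooth1 (\<lambda>x. 1 * h (a * x + b))"
  proof (rule smooth1_coinduct[where F="{\<lambda>x. c * f (a * x + b) |c f. smooth1 f}"])
    fix k assume "k \<in> {\<lambda>x. c * f (a * x + b) |c f. smooth1 f}"
    then obtain c f where k: "k = (\<lambda>x. c * f (a * x + b))" and f: "smooth1 f" by auto
    have "(k has_real_derivative (c * a) * deriv f (a * x + b)) (at x)" for x
      unfolding k
      by (rule DERIV_chain2[OF smooth1_DERIV[OF f], THEN DERIV_cmult, THEN DERIV_cong])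
        (auto intro!: derivative_eq_intros)
    then show "\<exists>f'\<in>{\<lambda>x. c * f (a * x + b) |c f. smooth1 f}. \<forall>x. (k has_real_derivative f' x) (at x)"
      using f smooth1_deriv by (intro bexI[of _ "\<lambda>x. (c * a) * deriv f (a * x + b)"] CollectI
          exI[of _ "c * a"] exI[of _ "deriv f"]) simp_all
  qed (use assms in \<open>intro CollectI exI[of _ 1] exI[of _ h] conjI refl; simp\<close>)
  then show ?thesis by simp
qed

text \<open>
  The class consists of the finite sums of products of two smooth functions; the product rule keeps it closed.
\<close>

lemma smooth1_mult:
  assumes "smooth1 f" "smooth1 g"
  shows "smooth1 (\<lambda>x. f x * g x)"
proof -
  define F where "F = {\<lambda>x. \<Sum>(f, g)\<leftarrow>L. f x * g x |L. \<forall>(f, g)\<in>set L. smooth1 f \<and> smooth1 g}"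
  have step: "\<exists>L'. (\<forall>(f, g)\<in>set L'. smooth1 f \<and> smooth1 g) \<and>
      (\<forall>x. ((\<lambda>x. \<Sum>(f, g)\<leftarrow>L. f x * g x) has_real_derivative (\<Sum>(f, g)\<leftarrow>L'. f x * g x)) (at x))"
    if "\<forall>(f, g)\<in>set L. smooth1 f \<and> smooth1 g" for L :: "((real \<Rightarrow> real) \<times> (real \<Rightarrow> real)) list"
    using that
  proof (induction L)
    case Nil
    then show ?case by (intro exI[of _ "[]"]) auto
  next
    case (Cons p L)
    obtain f g where p: "p = (f, g)" by (cases p)
    have fg: "smooth1 f" "smooth1 g" using Cons.prems p by auto
    obtain L' where L': "\<forall>(f, g)\<in>set L'. smooth1 f \<and> smooth1 g"
      "\<And>x. ((\<lambda>x. \<Sum>(f, g)\<leftarrow>L. f x * g x) has_real_derivative (\<Sum>(f, g)\<leftarrow>L'. f x * g x)) (at x)"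
      using Cons by auto
    have "((\<lambda>x. f x * g x + (\<Sum>(f, g)\<leftarrow>L. f x * g x)) has_real_derivative
        (deriv f x * g x + f x * deriv g x) + (\<Sum>(f, g)\<leftarrow>L'. f x * g x)) (at x)" for x
      by (intro DERIV_add L'(2) DERIV_cong[OF DERIV_mult[OF smooth1_DERIV[OF fg(1)] smooth1_DERIV[OF fg(2)]]])
        simp
    then show ?case
      using L'(1) fg smooth1_deriv
      by (intro exI[of _ "(deriv f, g) # (f, deriv g) # L'"]) (auto simp: p algebra_simps)
  qed
  have "(\<lambda>x. f x * g x) \<in> F"
    unfolding F_def using assms by (intro CollectI exI[of _ "[(f, g)]"]) simp
  moreover have "\<exists>f'\<in>F. \<forall>x. (k has_real_derivative f' x) (at x)" if k: "k \<in> F" for k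
  proof -
    obtain L where k: "k = (\<lambda>x. \<Sum>(f, g)\<leftarrow>L. f x * g x)" and L: "\<forall>(f, g)\<in>set L. smooth1 f \<and> smooth1 g"
      using k unfolding F_def mem_Collect_eq by (elim exE conjE) (rule that)
    obtain L' where L': "\<forall>(f, g)\<in>set L'. smooth1 f \<and> smooth1 g"
      "\<forall>x. ((\<lambda>x. \<Sum>(f, g)\<leftarrow>L. f x * g x) has_real_derivative (\<Sum>(f, g)\<leftarrow>L'. f x * g x)) (at x)"
      using step[OF L] by (elim exE conjE) (rule that)
    have F: "(\<lambda>x. \<Sum>(f, g)\<leftarrow>L'. f x * g x) \<in> F"
      unfolding F_def by (intro CollectI exI conjI) (rule refl, rule L'(1))
    show ?thesis unfolding k by (rule bexI[OF _ F]) (rule L'(2))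
  qed
  ultimately show ?thesis by (rule smooth1_coinduct)
qed

lemma smooth1_cmult: "smooth1 f \<Longrightarrow> smooth1 (\<lambda>x. c * f x)"
  by (rule smooth1_mult[OF smooth1_const])

lemma smooth1_add:
  assumes "smooth1 f" "smooth1 g"
  shows "smooth1 (\<lambda>x. f x + g x)"
proof (rule smooth1_coinduct[where F="{\<lambda>x. f x + g x |f g. smooth1 f \<and> smooth1 g}"])
  fix k assume "k \<in> {\<lambda>x. f x + g x |f g. smooth1 f \<and> smooth1 g}"
  then obtain f g where k: "k = (\<lambda>x. f x + g x)" "smooth1 f" "smooth1 g" by auto
  then have "(k has_real_derivative deriv f x + deriv g x) (at x)" for x
    by (auto intro: DERIV_add smooth1_DERIV)
  then show "\<exists>f'\<in>{\<lambda>x. f x + g x |f g. smooth1 f \<and> smooth1 g}. \<forall>x. (k has_real_derivative f' x) (at x)"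
    using k smooth1_deriv by (intro bexI[of _ "\<lambda>x. deriv f x + deriv g x"] CollectI
        exI[of _ "deriv f"] exI[of _ "deriv g"]) simp_all
qed (use assms in \<open>intro CollectI exI[of _ f] exI[of _ g] conjI refl; simp\<close>)

lemma smooth1_diff: "smooth1 f \<Longrightarrow> smooth1 g \<Longrightarrow> smooth1 (\<lambda>x. f x - g x)"
  using smooth1_add[of f "\<lambda>x. (-1) * g x"] smooth1_cmult[of g "-1"] by simp

lemma smooth1_power: "smooth1 f \<Longrightarrow> smooth1 (\<lambda>x. f x ^ n)"
  by (induction n) (auto intro: smooth1_const smooth1_mult)

text \<open>
  The classical flat function \<open>exp (-1/x)\<close>, times a polynomial in \<open>1/x\<close>.  The polynomial factor makes
  the class closed under differentiation, at the origin included.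
\<close>

definition flat_exp :: "real poly \<Rightarrow> real \<Rightarrow> real" where
  "flat_exp p x = (if x > 0 then poly p (1 / x) * exp (- (1 / x)) else 0)"

lemma poly_exp_tendsto_0: "((\<lambda>y. poly p y * exp (- y)) \<longlongrightarrow> (0::real)) at_top"
proof -
  have "((\<lambda>y. \<Sum>i\<le>degree p. coeff p i * (y ^ i / exp y)) \<longlongrightarrow> (\<Sum>i\<le>degree p. coeff p i * 0)) at_top"
    by (intro tendsto_intros tendsto_power_div_exp_0)
  moreover have "(\<Sum>i\<le>degree p. coeff p i * (y ^ i / exp y)) = poly p y * exp (- y)" for y
    by (simp add: poly_altdef sum_distrib_right exp_minus divide_inverse mult.assoc)
  ultimately show ?thesis by simp
qed

lemma flat_exp_DERIV:
  "(flat_exp p has_real_derivative flat_exp ([:0, 0, 1:] * (p - pderiv p)) x) (at x)"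
proof -
  let ?q = "[:0, 0, 1:] * (p - pderiv p)"
  consider "x > 0" | "x < 0" | "x = 0" by linarith
  then show ?thesis
  proof cases
    case 1
    have "((\<lambda>x. poly p (1 / x) * exp (- (1 / x))) has_real_derivative
        poly ?q (1 / x) * exp (- (1 / x))) (at x)"
      using 1 by (auto intro!: derivative_eq_intros DERIV_chain2[OF poly_DERIV]
          simp: field_simps power2_eq_square)
    then have "(flat_exp p has_real_derivative poly ?q (1 / x) * exp (- (1 / x))) (at x)"
      by (rule has_field_derivative_transform_within_open[where S="{0<..}"])
        (use 1 in \<open>auto simp: flat_exp_def\<close>)
    then show ?thesis using 1 by (simp add: flat_exp_def)
  next
    case 2
    have "((\<lambda>x. 0) has_real_derivative 0) (at x)" by simp
    then have "(flat_exp p has_real_derivative 0) (at x)"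
      by (rule has_field_derivative_transform_within_open[where S="{..<0}"])
        (use 2 in \<open>auto simp: flat_exp_def\<close>)
    then show ?thesis using 2 by (simp add: flat_exp_def)
  next
    case 3
    have "((\<lambda>h. flat_exp p h / h) \<longlongrightarrow> 0) (at_right 0)"
    proof -
      have "((\<lambda>y. poly ([:0, 1:] * p) y * exp (- y)) \<longlongrightarrow> 0) at_top"
        by (rule poly_exp_tendsto_0)
      then have "((\<lambda>h. poly ([:0, 1:] * p) (inverse h) * exp (- inverse h)) \<longlongrightarrow> 0) (at_right 0)"
        by (rule filterlim_compose[OF _ filterlim_inverse_at_top_right])
      moreover have "eventually (\<lambda>h. poly ([:0, 1:] * p) (inverse h) * exp (- inverse h)
          = flat_exp p h / h) (at_right 0)"
        by (auto simp: eventually_at flat_exp_def field_simps intro!: exI[of _ 1])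
      ultimately show ?thesis by (rule Lim_transform_eventually)
    qed
    moreover have "((\<lambda>h. flat_exp p h / h) \<longlongrightarrow> 0) (at_left 0)"
      by (rule Lim_transform_eventually[of "\<lambda>_. 0"])
        (auto simp: eventually_at flat_exp_def intro!: exI[of _ 1])
    ultimately have "((\<lambda>h. flat_exp p h / h) \<longlongrightarrow> 0) (at 0)"
      by (simp add: filterlim_split_at)
    then show ?thesis using 3 by (simp add: DERIV_def flat_exp_def)
  qed
qed

lemma smooth1_flat_exp: "smooth1 (flat_exp p)"
  by (rule smooth1_coinduct[where F="range flat_exp"]) (auto intro!: flat_exp_DERIV)

definition bump :: "real \<Rightarrow> real" where
  "bump x = flat_exp [:1:] (1 + x) * flat_exp [:1:] (1 - x)"

lemma smooth1_bump: "smooth1 bump"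
  unfolding bump_def
  using smooth1_mult[OF smooth1_affine[OF smooth1_flat_exp[of "[:1:]"], of 1 1]
      smooth1_affine[OF smooth1_flat_exp[of "[:1:]"], of "-1" 1]]
  by (simp add: algebra_simps)

lemma bump_nonneg: "bump x \<ge> 0" and bump_zero: "\<bar>x\<bar> \<ge> 1 \<Longrightarrow> bump x = 0"
  and bump_pos: "\<bar>x\<bar> < 1 \<Longrightarrow> bump x > 0"
  by (auto simp: bump_def flat_exp_def)

text \<open>
  The normalized primitive of a bump; its derivative is a mollifier on \<open>[-1, 1]\<close>.
\<close>

lemma smooth_step_exists:
  "\<exists>H \<rho>. smooth1 H \<and> smooth1 \<rho> \<and> (\<forall>x. (H has_real_derivative \<rho> x) (at x)) \<and> (\<forall>x. \<rho> x \<ge> 0) \<and>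
     (\<forall>x. \<bar>x\<bar> \<ge> 1 \<longrightarrow> \<rho> x = 0) \<and> (\<forall>x\<le>-1. H x = 0) \<and> (\<forall>x\<ge>1. H x = 1)"
proof -
  obtain G where "\<forall>x::real. -\<infinity> < ereal x \<longrightarrow> ereal x < \<infinity> \<longrightarrow> (G has_vector_derivative bump x) (at x)"
    using einterval_antiderivative[of "-\<infinity>" \<infinity> bump]
      smooth1_continuous_on[OF smooth1_bump, of UNIV] by (auto simp: continuous_on_eq_continuous_at)
  then have G: "(G has_real_derivative bump x) (at x)" for x
    by (simp add: has_real_derivative_iff_has_vector_derivative)
  have Gc: "continuous_on S G" for S
    by (meson G DERIV_isCont continuous_at_imp_continuous_on)
  have G0: "(G has_real_derivative 0) (at x)" if "\<bar>x\<bar> \<ge> 1" for x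
    using G[of x] bump_zero[OF that] by simp
  have left: "G x = G (-1)" if "x \<le> -1" for x
  proof (cases "x = -1")
    case False
    then have "x < -1" using that by simp
    from DERIV_isconst_end[OF this Gc] show ?thesis using G0 by auto
  qed simp
  have right: "G x = G 1" if "x \<ge> 1" for x
  proof (cases "x = 1")
    case False
    then have "1 < x" using that by simp
    from DERIV_isconst_end[OF this Gc] show ?thesis using G0 by auto
  qed simp
  define c where "c = G 1 - G (-1)"
  have "c > 0"
    unfolding c_def using DERIV_pos_imp_increasing_open[of "-1" 1 G] G Gc bump_pos
    by (auto simp: abs_less_iff)
  have H: "((\<lambda>x. (G x - G (-1)) / c) has_real_derivative (1 / c) * bump x) (at x)" for x
    using \<open>c > 0\<close> by (auto intro!: derivative_eq_intros G)
  have rho: "smooth1 (\<lambda>x. (1 / c) * bump x)"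
    by (rule smooth1_cmult[OF smooth1_bump])
  show ?thesis
  proof (intro exI conjI allI impI)
    show "smooth1 (\<lambda>x. (G x - G (-1)) / c)" by (rule smooth1_primitive[OF rho H])
    show "(G x - G (-1)) / c = 0" if "x \<le> -1" for x using left[OF that] by simp
    show "(G x - G (-1)) / c = 1" if "x \<ge> 1" for x using right[OF that] \<open>c > 0\<close> by (simp add: c_def)
    show "(1 / c) * bump x \<ge> 0" for x using \<open>c > 0\<close> bump_nonneg by simp
    show "(1 / c) * bump x = 0" if "\<bar>x\<bar> \<ge> 1" for x using bump_zero[OF that] by simp
  qed (fact rho, fact H)
qed

definition smooth_step :: "real \<Rightarrow> real" where
  "smooth_step = (SOME H. \<exists>\<rho>. smooth1 H \<and> smooth1 \<rho> \<and> (\<forall>x. (H has_real_derivative \<rho> x) (at x)) \<and>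
     (\<forall>x. \<rho> x \<ge> 0) \<and> (\<forall>x. \<bar>x\<bar> \<ge> 1 \<longrightarrow> \<rho> x = 0) \<and> (\<forall>x\<le>-1. H x = 0) \<and> (\<forall>x\<ge>1. H x = 1))"

abbreviation "mollifier1 \<equiv> deriv smooth_step"

lemma smooth_step:
  shows smooth1_step: "smooth1 smooth_step"
    and step_left: "x \<le> -1 \<Longrightarrow> smooth_step x = 0"
    and step_right: "x \<ge> 1 \<Longrightarrow> smooth_step x = 1"
    and mollifier1_nonneg: "mollifier1 x \<ge> 0"
    and mollifier1_zero: "\<bar>x\<bar> \<ge> 1 \<Longrightarrow> mollifier1 x = 0"
proof -
  obtain \<rho> where \<rho>: "smooth1 smooth_step \<and> smooth1 \<rho> \<and> (\<forall>x. (smooth_step has_real_derivative \<rho> x) (at x)) \<and>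
     (\<forall>x. \<rho> x \<ge> 0) \<and> (\<forall>x. \<bar>x\<bar> \<ge> 1 \<longrightarrow> \<rho> x = 0) \<and> (\<forall>x\<le>-1. smooth_step x = 0) \<and> (\<forall>x\<ge>1. smooth_step x = 1)"
    using someI_ex[OF smooth_step_exists] unfolding smooth_step_def by blast
  then have "deriv smooth_step = \<rho>" by (auto intro: DERIV_imp_deriv)
  with \<rho> show "smooth1 smooth_step" "x \<le> -1 \<Longrightarrow> smooth_step x = 0" "x \<ge> 1 \<Longrightarrow> smooth_step x = 1"
    "mollifier1 x \<ge> 0" "\<bar>x\<bar> \<ge> 1 \<Longrightarrow> mollifier1 x = 0" by auto
qed

lemma smooth_step_mono: "x \<le> y \<Longrightarrow> smooth_step x \<le> smooth_step y"
  using DERIV_nonneg_imp_nondecreasing[of x y smooth_step]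
    smooth1_DERIV[OF smooth1_step] mollifier1_nonneg by blast

lemma smooth_step_range: "0 \<le> smooth_step x" "smooth_step x \<le> 1"
  using smooth_step_mono[of "min x (-1)" x] smooth_step_mono[of x "max x 1"]
    step_left[of "min x (-1)"] step_right[of "max x 1"] by auto

lemma smooth_cutoff_exists:
  assumes "l < (l' :: real)" "l' \<le> r'" "r' < r"
  shows "\<exists>c. smooth1 c \<and> (\<forall>x. x \<notin> {l..r} \<longrightarrow> c x = 0) \<and> (\<forall>x\<in>{l'..r'}. c x = 1) \<and> (\<forall>x. 0 \<le> c x \<and> c x \<le> 1)"
proof -
  define A where "A x = smooth_step (2 / (l' - l) * x + (- (l + l') / (l' - l)))" for x
  define B where "B x = smooth_step (- 2 / (r - r') * x + ((r + r') / (r - r')))" for x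
  have Ae: "A x = smooth_step ((2 * x - (l + l')) / (l' - l))"
    and Be: "B x = smooth_step ((r + r' - 2 * x) / (r - r'))" for x
    unfolding A_def B_def
    by (rule arg_cong[where f=smooth_step]; simp add: diff_divide_distrib add_divide_distrib)+
  have A0: "A x = 0" if "x \<le> l" for x
    unfolding Ae by (rule step_left) (use assms that in \<open>simp add: divide_le_eq le_divide_eq\<close>)
  have A1: "A x = 1" if "x \<ge> l'" for x
    unfolding Ae by (rule step_right) (use assms that in \<open>simp add: divide_le_eq le_divide_eq\<close>)
  have B0: "B x = 0" if "x \<ge> r" for x
    unfolding Be by (rule step_left) (use assms that in \<open>simp add: divide_le_eq le_divide_eq\<close>)
  have B1: "B x = 1" if "x \<le> r'" for x
    unfolding Be by (rule step_right) (use assms that in \<open>simp add: divide_le_eq le_divide_eq\<close>)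
  have "smooth1 (\<lambda>x. A x * B x)"
    unfolding A_def B_def by (intro smooth1_mult smooth1_affine smooth1_step)
  moreover have "0 \<le> A x * B x \<and> A x * B x \<le> 1" for x
    using smooth_step_range unfolding A_def B_def by (simp add: mult_le_one)
  ultimately show ?thesis
    using A0 A1 B0 B1 by (intro exI[of _ "\<lambda>x. A x * B x"]) auto
qed

section \<open>Tensor products as test functions\<close>

text \<open>
  Products of functions of one variable suffice as test functions.  Their partial derivatives, of any
  order, only act on single factors, and so the definition of a weak derivative becomes explicit.
\<close>

definition tens :: "('a::euclidean_space \<Rightarrow> real \<Rightarrow> real) \<Rightarrow> 'a \<Rightarrow> real" where
  "tens h p = (\<Prod>b\<in>Basis. h b (p \<bullet> b))"

lemma smooth_coinduct:
  assumes "f \<in> F"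
    and "\<And>g p. g \<in> F \<Longrightarrow> g differentiable at p"
    and "\<And>g b. g \<in> F \<Longrightarrow> b \<in> Basis \<Longrightarrow> partial b g \<in> F"
  shows "smooth f"
proof -
  have "partials bs f \<in> F" if "set bs \<subseteq> Basis" for bs
    using that by (induction bs) (auto simp: partials_def assms)
  then show ?thesis by (simp add: smooth_def assms(2))
qed

lemma tens_upd: "c \<in> Basis \<Longrightarrow> tens (h(c := k)) p = k (p \<bullet> c) * (\<Prod>b\<in>Basis - {c}. h b (p \<bullet> b))"
  unfolding tens_def by (subst prod.remove[of _ c]) (auto intro!: arg_cong2[where f="(*)"] prod.cong)

lemma tens_split: "c \<in> Basis \<Longrightarrow> tens h p = h c (p \<bullet> c) * (\<Prod>b\<in>Basis - {c}. h b (p \<bullet> b))"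
  using tens_upd[of c h "h c" p] by simp

lemma tens_line_DERIV:
  assumes "c \<in> Basis" and d: "\<And>x. (h c has_real_derivative k x) (at x)"
  shows "((\<lambda>s. tens h (p + s *\<^sub>R c)) has_real_derivative tens (h(c := k)) (p + s *\<^sub>R c)) (at s)"
proof -
  have [simp]: "(\<Prod>b\<in>Basis - {c}. h b ((p + s *\<^sub>R c) \<bullet> b)) = (\<Prod>b\<in>Basis - {c}. h b (p \<bullet> b))" for s
    using assms(1) by (intro prod.cong) (auto simp: inner_add_left inner_Basis)
  have [simp]: "(p + s *\<^sub>R c) \<bullet> c = p \<bullet> c + s" for s
    using assms(1) by (simp add: inner_add_left inner_Basis)
  have "((\<lambda>s. h c (p \<bullet> c + s)) has_real_derivative k (p \<bullet> c + s)) (at s)"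
    by (rule DERIV_chain2[OF d, THEN DERIV_cong]) (auto intro!: derivative_eq_intros)
  then show ?thesis
    using assms(1) by (simp only: tens_split[of c h] tens_upd) (simp add: DERIV_cmult_right)
qed

lemma partial_tens:
  assumes "c \<in> Basis" "smooth1 (h c)"
  shows "partial c (tens h) = tens (h(c := deriv (h c)))"
proof
  fix p
  show "partial c (tens h) p = tens (h(c := deriv (h c))) p"
    unfolding partial_def
    using tens_line_DERIV[OF assms(1), of h "deriv (h c)" p 0] smooth1_DERIV[OF assms(2)]
    by (intro DERIV_imp_deriv) simp
qed

lemma tens_differentiable:
  assumes "\<And>b. b \<in> Basis \<Longrightarrow> smooth1 (h b)"
  shows "tens h differentiable at (p :: 'a::euclidean_space)"
proof -
  have "(\<lambda>p. \<Prod>b\<in>B. h b (p \<bullet> b)) differentiable at p" if "finite B" "B \<subseteq> Basis" for B :: "'a set"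
    using that
  proof (induction B)
    case (insert b B)
    have "h b differentiable at (p \<bullet> b)"
      using smooth1_DERIV[OF assms[of b]] insert.prems real_differentiable_def by blast
    then have "(h b \<circ> (\<lambda>p. p \<bullet> b)) differentiable at p"
      by (rule differentiable_chain_at[OF bounded_linear_imp_differentiable[OF bounded_linear_inner_left]])
    then show ?case using insert by (auto simp: o_def)
  qed simp
  from this[OF finite_Basis subset_refl] show ?thesis by (simp add: tens_def[abs_def])
qed

lemma smooth_tens:
  assumes "\<And>b. b \<in> Basis \<Longrightarrow> smooth1 (h b)"
  shows "smooth (tens h)"
proof (rule smooth_coinduct[where F="{tens h |h. \<forall>b\<in>Basis. smooth1 (h b)}"])
  show "tens h \<in> {tens h |h. \<forall>b\<in>Basis. smooth1 (h b)}" using assms by auto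
next
  fix g :: "'a \<Rightarrow> real" and p
  assume "g \<in> {tens h |h. \<forall>b\<in>Basis. smooth1 (h b)}"
  then show "g differentiable at p" using tens_differentiable by auto
next
  fix g :: "'a \<Rightarrow> real" and c :: 'a assume c: "c \<in> Basis"
  assume "g \<in> {tens h |h. \<forall>b\<in>Basis. smooth1 (h b)}"
  then obtain h where h: "g = tens h" "\<forall>b\<in>Basis. smooth1 (h b)" by auto
  have "partial c g = tens (h(c := deriv (h c)))" using partial_tens c h by blast
  moreover have "\<forall>b\<in>Basis. smooth1 ((h(c := deriv (h c))) b)" using h c smooth1_deriv by auto
  ultimately show "partial c g \<in> {tens h |h. \<forall>b\<in>Basis. smooth1 (h b)}" by blast
qed

lemma partials_tens:
  assumes "set bs \<subseteq> Basis" "\<And>b. b \<in> Basis \<Longrightarrow> smooth1 (h b)"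
  shows "partials bs (tens h) = tens (\<lambda>b. (deriv ^^ count (mset bs) b) (h b))"
  using assms(1)
proof (induction bs)
  case Nil then show ?case by (simp add: partials_def)
next
  case (Cons c bs)
  let ?h = "\<lambda>b. (deriv ^^ count (mset bs) b) (h b)"
  have "partials (c # bs) (tens h) = partial c (tens ?h)"
    using Cons by (simp add: partials_def)
  also have "... = tens (?h(c := deriv (?h c)))"
    using Cons.prems assms(2) by (intro partial_tens smooth1_higher_deriv) auto
  also have "?h(c := deriv (?h c)) = (\<lambda>b. (deriv ^^ count (mset (c # bs)) b) (h b))"
    by auto
  finally show ?case .
qed

lemma mderiv_tens:
  assumes "set_mset \<alpha> \<subseteq> Basis" "\<And>b. b \<in> Basis \<Longrightarrow> smooth1 (h b)"
  shows "mderiv \<alpha> (tens h) = tens (\<lambda>b. (deriv ^^ count \<alpha> b) (h b))"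
proof -
  have "mset (SOME bs. mset bs = \<alpha>) = \<alpha>" by (rule someI_ex) (rule ex_mset)
  then show ?thesis
    unfolding mderiv_def using partials_tens[of "SOME bs. mset bs = \<alpha>" h] assms
    by (metis set_mset_mset)
qed

lemma tens_outside:
  assumes "\<And>b s. b \<in> Basis \<Longrightarrow> s \<notin> {l \<bullet> b..r \<bullet> b} \<Longrightarrow> h b s = 0" and "p \<notin> cbox l r"
  shows "tens h p = 0"
proof -
  obtain b where b: "b \<in> Basis" "p \<bullet> b \<notin> {l \<bullet> b..r \<bullet> b}" using assms(2) by (auto simp: mem_box)
  then have "h b (p \<bullet> b) = 0" by (rule assms(1))
  then show ?thesis unfolding tens_def using b by (intro prod_zero) auto
qed

lemma test_function_tens:
  assumes "\<And>b. b \<in> Basis \<Longrightarrow> smooth1 (h b)"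
    and "\<And>b s. b \<in> Basis \<Longrightarrow> s \<notin> {l \<bullet> b..r \<bullet> b} \<Longrightarrow> h b s = 0" and "cbox l r \<subseteq> \<Omega>"
  shows "test_function \<Omega> (tens h)"
proof -
  have "{p. tens h p \<noteq> 0} \<subseteq> cbox l r" using tens_outside[of l r h] assms(2) by blast
  then have "closure {p. tens h p \<noteq> 0} \<subseteq> cbox l r" by (intro closure_minimal closed_cbox)
  moreover have "compact (closure {p. tens h p \<noteq> 0})"
    using calculation by (meson closed_closure compact_cbox compact_closure bounded_cbox bounded_closure bounded_subset compact_eq_bounded_closed)
  ultimately show ?thesis
    using smooth_tens[of h] assms(1,3) by (auto simp: test_function_def)
qed

lemma smooth_imp_continuous: "smooth f \<Longrightarrow> continuous_on S f"
  unfolding smooth_def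
  by (metis continuous_at_imp_continuous_on differentiable_imp_continuous_within empty_subsetI
      foldr_Nil id_apply list.set(1) partials_def)

text \<open>
  Both integrals may be restricted to the box that carries the test function: outside it one factor
  vanishes together with all its derivatives.
\<close>

lemma weak_deriv_tens:
  assumes w: "weak_deriv \<Omega> \<alpha> f g" and \<alpha>: "set_mset \<alpha> \<subseteq> Basis"
    and h: "\<And>b. b \<in> Basis \<Longrightarrow> smooth1 (h b)"
    and z: "\<And>b s. b \<in> Basis \<Longrightarrow> s \<notin> {l \<bullet> b..r \<bullet> b} \<Longrightarrow> h b s = 0" and \<Omega>: "cbox l r \<subseteq> \<Omega>"
  shows "(LBINT p:cbox l r. f p * tens (\<lambda>b. (deriv ^^ count \<alpha> b) (h b)) p)
     = (-1) ^ size \<alpha> * (LBINT p:cbox l r. g p * tens h p)"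
proof -
  have z': "(deriv ^^ n) (h b) s = 0" if "b \<in> Basis" "s \<notin> {l \<bullet> b..r \<bullet> b}" for n b s
    using that
  proof (induction n arbitrary: s)
    case (Suc n)
    have "((deriv ^^ n) (h b) has_real_derivative (deriv ^^ Suc n) (h b) s) (at s)"
      using h[OF \<open>b \<in> Basis\<close>] by (simp add: smooth1_def)
    moreover have "((\<lambda>s. 0) has_real_derivative 0) (at s)" by simp
    then have "((deriv ^^ n) (h b) has_real_derivative 0) (at s)"
      by (rule has_field_derivative_transform_within_open[where S="- {l \<bullet> b..r \<bullet> b}"])
        (use Suc in \<open>auto simp: open_Compl\<close>)
    ultimately show ?case by (rule DERIV_unique)
  qed (simp add: z)
  have "(LBINT p:\<Omega>. f p * mderiv \<alpha> (tens h) p) = (-1) ^ size \<alpha> * (LBINT p:\<Omega>. g p * tens h p)"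
    using w test_function_tens[of h l r \<Omega>, OF h z \<Omega>] unfolding weak_deriv_def by blast
  moreover have "(LBINT p:\<Omega>. F p * tens k p) = (LBINT p:cbox l r. F p * tens k p)"
    if "\<And>b s. b \<in> Basis \<Longrightarrow> s \<notin> {l \<bullet> b..r \<bullet> b} \<Longrightarrow> k b s = 0" for F k
    unfolding set_lebesgue_integral_def
    using \<Omega> tens_outside[of l r k, OF that]
    by (intro Bochner_Integration.integral_cong) (auto simp: indicator_def)
  ultimately show ?thesis
    using z z' mderiv_tens[OF \<alpha> h] by simp
qed

lemma weak_deriv_set_integrable:
  assumes "weak_deriv \<Omega> \<alpha> f g" "compact S" "S \<subseteq> \<Omega>"
  shows "set_integrable lborel S f" "set_integrable lborel S g"
  using assms by (auto simp: weak_deriv_def locally_integrable_def)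

lemma set_integrable_times_continuous:
  fixes f k :: "'a::euclidean_space \<Rightarrow> real"
  assumes "set_integrable lborel S f" "compact S" "continuous_on S k"
  shows "set_integrable lborel S (\<lambda>p. f p * k p)"
proof -
  have "bounded (k ` S)" using assms by (intro compact_imp_bounded compact_continuous_image)
  then obtain C where C: "\<And>p. p \<in> S \<Longrightarrow> \<bar>k p\<bar> \<le> C" by (auto simp: bounded_iff)
  have m: "(\<lambda>p. indicator S p * k p) \<in> borel_measurable lborel"
    using borel_measurable_continuous_on_indicator[OF _ assms(3)] assms(2)
    by (simp add: borel_compact)
  have i: "integrable lborel (\<lambda>p. indicator S p * f p)"
    using assms(1) by (simp add: set_integrable_def)
  have "integrable lborel (\<lambda>p. (indicator S p * k p) * (indicator S p * f p))"
  proof (rule Bochner_Integration.integrable_bound[where f="\<lambda>p. C * (indicator S p * f p)"])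
    show "integrable lborel (\<lambda>p. C * (indicator S p * f p))" using i by simp
    show "(\<lambda>p. (indicator S p * k p) * (indicator S p * f p)) \<in> borel_measurable lborel"
      using m borel_measurable_integrable[OF i] by simp
    show "AE p in lborel. norm ((indicator S p * k p) * (indicator S p * f p)) \<le> norm (C * (indicator S p * f p))"
      using C by (intro AE_I2) (auto simp: indicator_def abs_mult intro!: mult_right_mono order_trans[OF C])
  qed
  then show ?thesis unfolding set_integrable_def
    by (rule Bochner_Integration.integrable_cong[THEN iffD1, rotated -1]) (auto simp: indicator_def)
qed

lemma continuous_on_tens:
  assumes "\<And>b. b \<in> Basis \<Longrightarrow> continuous_on UNIV (h b)"
  shows "continuous_on S (tens h)"
  unfolding tens_def[abs_def]
  by (intro continuous_on_prod continuous_on_compose2[OF assms] continuous_intros) auto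

section \<open>Approximate identities\<close>

lemma nn_integral_lborel_reflect:
  fixes f :: "'a::euclidean_space \<Rightarrow> ennreal"
  assumes [measurable]: "f \<in> borel_maps"
  shows "(LBNN z. f (p - z)) = (LBNN z. f z)"
  by (subst (2) lborel_affine[of "-1" p]) (simp_all add: nn_integral_density nn_integral_distr)

lemma nn_integral_lborel_translate:
  fixes f :: "'a::euclidean_space \<Rightarrow> ennreal"
  assumes [measurable]: "f \<in> borel_maps"
  shows "(LBNN z. f (z - p)) = (LBNN z. f z)"
  by (subst (2) lborel_affine[of "1" "-p"]) (simp_all add: nn_integral_density nn_integral_distr)

text \<open>
  A single smallness parameter measures concentration: at most \<open>\<eta>\<close> of the mass lies farther than
  \<open>\<eta>\<close> from the origin.  Boundedness makes convolutions with integrable functions exist everywhere.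
\<close>

definition approx_kernel :: "real \<Rightarrow> ('a::euclidean_space \<Rightarrow> real) \<Rightarrow> bool" where
  "approx_kernel \<eta> k \<longleftrightarrow> k \<in> borel_maps \<and> (\<forall>z. 0 \<le> k z) \<and> (\<exists>C. \<forall>z. k z \<le> C) \<and>
     (LBNN z. ennreal (k z)) = 1 \<and>
     (LBNN z. ennreal (k z) * indicator {z. norm z > \<eta>} z) \<le> ennreal \<eta>"

definition conv :: "('a::euclidean_space \<Rightarrow> real) \<Rightarrow> ('a \<Rightarrow> real) \<Rightarrow> 'a \<Rightarrow> real" where
  "conv w k p = (LBINT z. w z * k (p - z))"

lemma approx_kernel_measurable[measurable_dest]: "approx_kernel \<eta> k \<Longrightarrow> k \<in> borel_maps"
  by (simp add: approx_kernel_def)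

lemma approx_kernel_nn:
  assumes "approx_kernel \<eta> k"
  shows "(LBNN z. ennreal (k (p - z))) = 1"
    "(LBNN z. ennreal (k (p - z)) * indicator {z. norm z > \<eta>} (p - z)) \<le> ennreal \<eta>"
    "(LBNN p. ennreal (k (p - z))) = 1"
proof -
  note [measurable] = approx_kernel_measurable[OF assms]
  show "(LBNN z. ennreal (k (p - z))) = 1" "(LBNN p. ennreal (k (p - z))) = 1"
    using assms nn_integral_lborel_reflect[of "\<lambda>z. ennreal (k z)" p]
      nn_integral_lborel_translate[of "\<lambda>z. ennreal (k z)" z] by (auto simp: approx_kernel_def)
  show "(LBNN z. ennreal (k (p - z)) * indicator {z. norm z > \<eta>} (p - z)) \<le> ennreal \<eta>"
    using assms nn_integral_lborel_reflect[of "\<lambda>z. ennreal (k z) * indicator {z. norm z > \<eta>} z" p]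
    by (auto simp: approx_kernel_def)
qed

lemma approx_kernel_integral:
  assumes "approx_kernel \<eta> k"
  shows "integrable lborel (\<lambda>z. k (p - z))" "(LBINT z. k (p - z)) = 1"
proof -
  note [measurable] = approx_kernel_measurable[OF assms]
  have k0: "0 \<le> k z" for z using assms by (simp add: approx_kernel_def)
  show "integrable lborel (\<lambda>z. k (p - z))"
    using approx_kernel_nn(1)[OF assms, of p] k0 by (intro integrableI_nonneg) auto
  show "(LBINT z. k (p - z)) = 1"
    using approx_kernel_nn(1)[OF assms, of p] k0 by (subst integral_eq_nn_integral) auto
qed

lemma conv_close:
  assumes k: "approx_kernel \<eta> k" and "\<eta> \<ge> 0" and [measurable]: "w \<in> borel_maps"
    and bd: "\<And>z. \<bar>w z\<bar> \<le> B" and unif: "\<And>z. norm (p - z) \<le> \<eta> \<Longrightarrow> \<bar>w z - w p\<bar> \<le> d" and d: "d \<ge> 0"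
  shows "\<bar>conv w k p - w p\<bar> \<le> d + 2 * B * \<eta>"
proof -
  note [measurable] = approx_kernel_measurable[OF k]
  have k0: "0 \<le> k z" for z using k by (simp add: approx_kernel_def)
  have B: "B \<ge> 0" using bd[of p] by linarith
  have i1: "integrable lborel (\<lambda>z. w z * k (p - z))"
  proof (rule Bochner_Integration.integrable_bound)
    show "integrable lborel (\<lambda>z. B * k (p - z))" using approx_kernel_integral(1)[OF k] by simp
    show "AE z in lborel. norm (w z * k (p - z)) \<le> norm (B * k (p - z))"
      using bd B k0 by (intro AE_I2) (auto simp: abs_mult intro!: mult_right_mono)
  qed measurable
  have i2: "integrable lborel (\<lambda>z. w p * k (p - z))" using approx_kernel_integral(1)[OF k] by simp
  have "conv w k p - w p = (LBINT z. w z * k (p - z) - w p * k (p - z))"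
    using i1 i2 approx_kernel_integral(2)[OF k, of p]
    by (simp add: conv_def Bochner_Integration.integral_diff)
  then have "ennreal \<bar>conv w k p - w p\<bar> \<le> (LBNN z. norm (w z * k (p - z) - w p * k (p - z)))"
    using integral_norm_bound_ennreal[OF Bochner_Integration.integrable_diff[OF i1 i2]] by simp
  also have "... \<le> (LBNN z. ennreal d * ennreal (k (p - z))
      + ennreal (2 * B) * (ennreal (k (p - z)) * indicator {z. norm z > \<eta>} (p - z)))"
  proof (rule nn_integral_mono)
    fix z
    have e: "norm (w z * k (p - z) - w p * k (p - z)) = \<bar>w z - w p\<bar> * k (p - z)"
      using k0 by (simp add: left_diff_distrib[symmetric] abs_mult)
    show "ennreal (norm (w z * k (p - z) - w p * k (p - z))) \<le> ennreal d * ennreal (k (p - z))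
      + ennreal (2 * B) * (ennreal (k (p - z)) * indicator {z. norm z > \<eta>} (p - z))"
    proof (cases "norm (p - z) \<le> \<eta>")
      case True
      have "\<bar>w z - w p\<bar> * k (p - z) \<le> d * k (p - z)" using unif[OF True] k0 by (intro mult_right_mono) auto
      then show ?thesis unfolding e using True k0 d by (simp add: ennreal_mult[symmetric])
    next
      case False
      have "\<bar>w z - w p\<bar> \<le> 2 * B" using bd[of z] bd[of p] by linarith
      then have "\<bar>w z - w p\<bar> * k (p - z) \<le> (2 * B) * k (p - z)" using k0 by (intro mult_right_mono) auto
      then have "ennreal (\<bar>w z - w p\<bar> * k (p - z)) \<le> ennreal (2 * B) * ennreal (k (p - z))"
        using B k0 by (simp add: ennreal_mult[symmetric])
      then show ?thesis unfolding e using False by (simp add: add_increasing)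
    qed
  qed
  also have "... = ennreal d * (LBNN z. ennreal (k (p - z)))
      + ennreal (2 * B) * (LBNN z. ennreal (k (p - z)) * indicator {z. norm z > \<eta>} (p - z))"
    by (subst nn_integral_add, simp, simp) (simp add: nn_integral_cmult)
  also have "... \<le> ennreal d * 1 + ennreal (2 * B) * ennreal \<eta>"
    using approx_kernel_nn[OF k] by (intro add_mono mult_left_mono) auto
  also have "... = ennreal (d + 2 * B * \<eta>)"
    using d B \<open>\<eta> \<ge> 0\<close> by (simp add: ennreal_mult[symmetric] ennreal_plus[symmetric] del: ennreal_plus)
  finally show ?thesis using d B \<open>\<eta> \<ge> 0\<close> by (subst (asm) ennreal_le_iff) auto
qed

definition l2sq :: "('a::euclidean_space \<Rightarrow> real) \<Rightarrow> ennreal" where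
  "l2sq f = (LBNN p. ennreal ((f p)\<^sup>2))"

lemma l2sq_mono: "(\<And>p. \<bar>f p\<bar> \<le> \<bar>g p\<bar>) \<Longrightarrow> l2sq f \<le> l2sq g"
  unfolding l2sq_def by (intro nn_integral_mono ennreal_leI) (simp add: abs_le_square_iff)

lemma l2sq_cmult: "f \<in> borel_maps \<Longrightarrow> l2sq (\<lambda>p. c * f p) = ennreal (c\<^sup>2) * l2sq f"
  unfolding l2sq_def
  by (subst nn_integral_cmult[symmetric]) (auto simp: power_mult_distrib ennreal_mult intro!: nn_integral_cong)

lemma l2sq_add:
  assumes [measurable]: "f \<in> borel_maps" "g \<in> borel_maps"
  shows "l2sq (\<lambda>p. f p + g p) \<le> 2 * l2sq f + 2 * l2sq g"
proof -
  have e: "(x + y)\<^sup>2 \<le> 2 * x\<^sup>2 + 2 * y\<^sup>2" for x y :: real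
    using sum_squares_bound[of x y] by (simp add: power2_sum)
  have "l2sq (\<lambda>p. f p + g p) \<le> (LBNN p. 2 * ennreal ((f p)\<^sup>2) + 2 * ennreal ((g p)\<^sup>2))"
    unfolding l2sq_def
  proof (rule nn_integral_mono)
    fix p
    have "ennreal ((f p + g p)\<^sup>2) \<le> ennreal (2 * (f p)\<^sup>2 + 2 * (g p)\<^sup>2)" using e by (intro ennreal_leI)
    also have "... = 2 * ennreal ((f p)\<^sup>2) + 2 * ennreal ((g p)\<^sup>2)"
      by (simp add: ennreal_plus ennreal_mult)
    finally show "ennreal ((f p + g p)\<^sup>2) \<le> 2 * ennreal ((f p)\<^sup>2) + 2 * ennreal ((g p)\<^sup>2)" .
  qed
  also have "... = 2 * l2sq f + 2 * l2sq g"
    unfolding l2sq_def by (subst nn_integral_add) (auto simp: nn_integral_cmult)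
  finally show ?thesis .
qed

lemma l2sq_diff:
  assumes [measurable]: "f \<in> borel_maps" "g \<in> borel_maps"
  shows "l2sq (\<lambda>p. f p - g p) \<le> 2 * l2sq f + 2 * l2sq g"
  using l2sq_add[of f "\<lambda>p. - g p"] by (simp add: l2sq_def)

lemma conv_measurable:
  assumes [measurable]: "w \<in> borel_maps" "k \<in> borel_maps"
  shows "conv w k \<in> borel_maps"
  unfolding conv_def[abs_def]
  by (rule lborel.borel_measurable_lebesgue_integral) measurable

text \<open>
  Young's inequality for a probability density: Cauchy and Schwarz for the measure with density
  \<open>z \<mapsto> k (p - z)\<close>, followed by an exchange of the integrals.
\<close>

lemma conv_young:
  assumes k: "approx_kernel \<eta> k" and [measurable]: "a \<in> borel_maps"
  shows "l2sq (conv a k) \<le> l2sq a"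
proof -
  note [measurable] = approx_kernel_measurable[OF k] conv_measurable[of a k]
  have k0: "0 \<le> k z" for z using k by (simp add: approx_kernel_def)
  have pt: "ennreal ((conv a k p)\<^sup>2) \<le> (LBNN z. ennreal ((a z)\<^sup>2) * ennreal (k (p - z)))" for p
  proof -
    have "ennreal \<bar>conv a k p\<bar> \<le> (LBNN z. norm (a z * k (p - z)))"
      using integral_norm_bound_ennreal[of lborel "\<lambda>z. a z * k (p - z)"]
      by (cases "integrable lborel (\<lambda>z. a z * k (p - z))") (auto simp: conv_def not_integrable_integral_eq)
    also have "... = (LBNN z. ennreal (\<bar>a z\<bar> * sqrt (k (p - z))) * ennreal (sqrt (k (p - z))))"
      using k0 by (intro nn_integral_cong) (simp add: ennreal_mult[symmetric] abs_mult)
    finally have "(ennreal \<bar>conv a k p\<bar>)\<^sup>2 \<le> ...\<^sup>2" by (intro power_mono) auto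
    also have "... \<le> (LBNN z. (ennreal (\<bar>a z\<bar> * sqrt (k (p - z))))\<^sup>2) *
        (LBNN z. (ennreal (sqrt (k (p - z))))\<^sup>2)"
      by (rule Cauchy_Schwarz_nn_integral) measurable
    also have "(LBNN z. (ennreal (sqrt (k (p - z))))\<^sup>2) = 1"
      using approx_kernel_nn(1)[OF k, of p] k0 by (simp add: ennreal_power)
    also have "(LBNN z. (ennreal (\<bar>a z\<bar> * sqrt (k (p - z))))\<^sup>2)
        = (LBNN z. ennreal ((a z)\<^sup>2) * ennreal (k (p - z)))"
      using k0 by (intro nn_integral_cong) (simp add: ennreal_power power_mult_distrib ennreal_mult)
    finally show ?thesis by (simp add: ennreal_power)
  qed
  have "l2sq (conv a k) \<le> (LBNN p. (LBNN z. ennreal ((a z)\<^sup>2) * ennreal (k (p - z))))"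
    unfolding l2sq_def by (intro nn_integral_mono pt)
  also have "... = (LBNN z. (LBNN p. ennreal ((a z)\<^sup>2) * ennreal (k (p - z))))"
    by (rule lborel_pair.Fubini') measurable
  also have "... = (LBNN z. ennreal ((a z)\<^sup>2) * (LBNN p. ennreal (k (p - z))))"
    by (intro nn_integral_cong nn_integral_cmult) measurable
  also have "... = l2sq a" using approx_kernel_nn(3)[OF k] by (simp add: l2sq_def)
  finally show ?thesis .
qed

lemma l2_truncate:
  fixes g :: "'a::euclidean_space \<Rightarrow> real"
  assumes [measurable]: "g \<in> borel_maps" and fin: "l2sq g < \<infinity>" and e: "e > (0::real)"
  shows "\<exists>n::nat. l2sq (\<lambda>z. g z - max (- real n) (min (real n) (g z))) \<le> ennreal e"
proof -
  let ?u = "\<lambda>n z. (g z - max (- real n) (min (real n) (g z)))\<^sup>2"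
  have "(\<lambda>n. (LBNN z. norm (0 - ?u n z))) \<longlonglongrightarrow> 0"
  proof (rule nn_integral_dominated_convergence_norm[where w="\<lambda>z. (g z)\<^sup>2"])
    show "AE z in lborel. norm (?u n z) \<le> (g z)\<^sup>2" for n
      by (intro AE_I2) (auto simp: abs_le_square_iff[symmetric])
    show "(LBNN z. ennreal ((g z)\<^sup>2)) < \<infinity>" using fin by (simp add: l2sq_def)
    show "AE z in lborel. (\<lambda>n. ?u n z) \<longlonglongrightarrow> 0"
    proof (intro AE_I2)
      fix z
      have "?u n z = 0" if "n \<ge> nat \<lceil>\<bar>g z\<bar>\<rceil>" for n
      proof -
        have "\<bar>g z\<bar> \<le> real n" using that by linarith
        then show ?thesis by auto
      qed
      then show "(\<lambda>n. ?u n z) \<longlonglongrightarrow> 0"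
        by (intro tendsto_eventually) (unfold eventually_sequentially, blast)
    qed
  qed measurable
  then have "eventually (\<lambda>n. (LBNN z. norm (0 - ?u n z)) < ennreal e) sequentially"
    using e by (intro order_tendstoD) auto
  then obtain n where "(LBNN z. norm (0 - ?u n z)) < ennreal e"
    by (auto simp: eventually_sequentially)
  then show ?thesis by (intro exI[of _ n]) (simp add: l2sq_def)
qed

text \<open>
  Truncation makes the function bounded; a bounded measurable function of bounded support is a limit
  almost everywhere of continuous functions, and the limit can be taken under the integral.
\<close>

lemma l2_density:
  fixes g :: "'a::euclidean_space \<Rightarrow> real"
  assumes [measurable]: "g \<in> borel_maps" and fin: "l2sq g < \<infinity>"
    and supp: "\<And>z. norm z > r \<Longrightarrow> g z = 0" and e: "e > (0::real)"
  shows "\<exists>h. continuous_on UNIV h \<and> (\<forall>z. norm z > r + 1 \<longrightarrow> h z = 0) \<and> l2sq (\<lambda>z. g z - h z) \<le> ennreal e"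
proof -
  have [measurable]: "cball (0::'a) s \<in> sets borel" for s by (simp add: borel_closed)
  obtain n :: nat where n: "l2sq (\<lambda>z. g z - max (- real n) (min (real n) (g z))) \<le> ennreal (e/4)"
    using l2_truncate[OF assms(1) fin, of "e/4"] e by auto
  define M where "M = real n"
  define gM where "gM z = max (- M) (min M (g z))" for z
  have M: "M \<ge> 0" by (simp add: M_def)
  have [measurable]: "gM \<in> borel_maps" unfolding gM_def by measurable
  have "gM \<in> borel_measurable lebesgue"
    using \<open>gM \<in> borel_maps\<close> by (simp add: measurable_completion)
  then have "gM measurable_on UNIV" by (rule lebesgue_measurable_imp_measurable_on) simp
  then obtain N c where N: "negligible N" and c: "\<And>n. continuous_on UNIV (c n)"
    and lim: "\<And>z. z \<notin> N \<Longrightarrow> (\<lambda>n. c n z) \<longlonglongrightarrow> gM z"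
    unfolding measurable_on_def by auto
  define \<theta> where "\<theta> z = max 0 (min 1 (r + 1 - norm z))" for z :: 'a
  define h where "h n z = max (- M) (min M (c n z)) * \<theta> z" for n z
  have hc: "continuous_on UNIV (h n)" for n
    unfolding h_def \<theta>_def by (intro continuous_intros c)
  have [measurable]: "h n \<in> borel_maps" for n
    using hc by (rule borel_measurable_continuous_onI)
  have \<theta>: "0 \<le> \<theta> z" "\<theta> z \<le> 1" "norm z \<le> r \<Longrightarrow> \<theta> z = 1" "norm z > r + 1 \<Longrightarrow> \<theta> z = 0" for z
    by (auto simp: \<theta>_def)
  have hb: "\<bar>h n z\<bar> \<le> M" for n z
    unfolding h_def abs_mult using \<theta>[of z] M
    by (intro order_trans[OF mult_right_le_one_le]) auto
  have g\<theta>: "gM z * \<theta> z = gM z" for z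
    using \<theta>(3)[of z] supp[of z] M by (cases "norm z \<le> r") (auto simp: gM_def)
  have "(\<lambda>n. (LBNN z. norm (0 - (gM z - h n z)\<^sup>2))) \<longlonglongrightarrow> 0"
  proof (rule nn_integral_dominated_convergence_norm[where w="\<lambda>z. 4 * M\<^sup>2 * indicator (cball 0 (r + 1)) z"])
    show "AE z in lborel. norm ((gM z - h n z)\<^sup>2) \<le> 4 * M\<^sup>2 * indicator (cball 0 (r + 1)) z" for n
    proof (intro AE_I2)
      fix z
      have "\<bar>gM z\<bar> \<le> M" using M by (auto simp: gM_def)
      then have "\<bar>gM z - h n z\<bar> \<le> \<bar>2 * M\<bar>" using hb[of n z] by linarith
      then have "(gM z - h n z)\<^sup>2 \<le> (2 * M)\<^sup>2" by (simp only: abs_le_square_iff)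
      moreover have "gM z - h n z = 0" if "norm z > r + 1"
        using that \<theta>(4)[OF that] supp[of z] M by (auto simp: gM_def h_def)
      ultimately show "norm ((gM z - h n z)\<^sup>2) \<le> 4 * M\<^sup>2 * indicator (cball 0 (r + 1)) z"
        by (auto simp: indicator_def power_mult_distrib)
    qed
    have "(LBNN z. ennreal (4 * M\<^sup>2 * indicator (cball 0 (r + 1) :: 'a set) z))
        = (LBNN z. ennreal (4 * M\<^sup>2) * indicator (cball 0 (r + 1) :: 'a set) z)"
      by (intro nn_integral_cong) (auto simp: indicator_def)
    also have "... < \<infinity>"
      using emeasure_lborel_cball_finite[of "0::'a" "r + 1"]
      by (subst nn_integral_cmult_indicator) (auto simp: ennreal_mult_less_top)
    finally show "(LBNN z. ennreal (4 * M\<^sup>2 * indicator (cball 0 (r + 1) :: 'a set) z)) < \<infinity>" .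
    show "AE z in lborel. (\<lambda>n. (gM z - h n z)\<^sup>2) \<longlonglongrightarrow> 0"
    proof -
      have "AE z in lebesgue. z \<notin> N" using N by (intro AE_not_in) (simp add: negligible_iff_null_sets)
      then have "AE z in lborel. z \<notin> N" by (simp add: AE_completion_iff)
      then show ?thesis
      proof eventually_elim
        case (elim z)
        have "(\<lambda>n. (gM z - h n z)\<^sup>2) \<longlonglongrightarrow> (gM z - max (- M) (min M (gM z)) * \<theta> z)\<^sup>2"
          unfolding h_def by (intro tendsto_intros lim elim)
        also have "max (- M) (min M (gM z)) = gM z" using M by (auto simp: gM_def)
        finally show ?case by (simp add: g\<theta>)
      qed
    qed
  qed measurable
  then have "eventually (\<lambda>n. (LBNN z. norm (0 - (gM z - h n z)\<^sup>2)) < ennreal (e/4)) sequentially"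
    using e by (intro order_tendstoD) auto
  then obtain m where "(LBNN z. norm (0 - (gM z - h m z)\<^sup>2)) < ennreal (e/4)"
    by (auto simp: eventually_sequentially)
  then have m: "l2sq (\<lambda>z. gM z - h m z) \<le> ennreal (e/4)" by (simp add: l2sq_def)
  have "l2sq (\<lambda>z. g z - h m z) = l2sq (\<lambda>z. (g z - gM z) + (gM z - h m z))" by simp
  also have "... \<le> 2 * l2sq (\<lambda>z. g z - gM z) + 2 * l2sq (\<lambda>z. gM z - h m z)"
    by (rule l2sq_add) measurable
  also have "... \<le> 2 * ennreal (e/4) + 2 * ennreal (e/4)"
    using n m by (intro add_mono mult_left_mono) (auto simp: gM_def M_def)
  also have "... = ennreal e"
    using e by (simp add: mult_2 ennreal_plus[symmetric] del: ennreal_plus)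
  finally show ?thesis using hc[of m] \<theta>(4) by (intro exI[of _ "h m"]) (auto simp: h_def)
qed

lemma bounded_support_unif_cont:
  fixes h :: "'a::euclidean_space \<Rightarrow> real"
  assumes c: "continuous_on UNIV h" and s: "\<And>z. norm z > r \<Longrightarrow> h z = 0"
  shows "\<exists>B. \<forall>z. \<bar>h z\<bar> \<le> B"
    and "d > 0 \<Longrightarrow> \<exists>\<delta>>0. \<forall>x y. norm (x - y) \<le> \<delta> \<longrightarrow> \<bar>h y - h x\<bar> \<le> d"
proof -
  have cc: "continuous_on (cball 0 (r + 1)) h" using c continuous_on_subset by blast
  have "bounded (h ` cball 0 (r + 1))" using cc by (intro compact_imp_bounded compact_continuous_image) auto
  then obtain B where "\<forall>z\<in>h ` cball 0 (r + 1). norm z \<le> B" unfolding bounded_iff by blast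
  then have B: "\<bar>h z\<bar> \<le> B" if "norm z \<le> r + 1" for z using that by simp
  then have "\<bar>h z\<bar> \<le> max B 0" for z using B[of z] s[of z] by (cases "norm z \<le> r + 1") fastforce+
  then show "\<exists>B. \<forall>z. \<bar>h z\<bar> \<le> B" by blast
  assume d: "d > 0"
  have "uniformly_continuous_on (cball 0 (r + 1)) h" using cc by (intro compact_uniformly_continuous) auto
  then obtain \<delta> where \<delta>: "\<delta> > 0" "\<And>x y. norm x \<le> r + 1 \<Longrightarrow> norm y \<le> r + 1 \<Longrightarrow> dist y x < \<delta> \<Longrightarrow> dist (h y) (h x) < d"
    using d unfolding uniformly_continuous_on_def by (metis mem_cball_0)
  have "\<bar>h y - h x\<bar> \<le> d" if xy: "norm (x - y) \<le> min (\<delta>/2) 1" for x y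
  proof (cases "norm x \<le> r + 1 \<and> norm y \<le> r + 1")
    case True
    then show ?thesis using \<delta>(2)[of x y] xy \<delta>(1) by (auto simp: dist_norm norm_minus_commute)
  next
    case False
    then have "norm x > r \<and> norm y > r"
      using xy norm_triangle_ineq2[of x y] norm_triangle_ineq2[of y x] by (auto simp: norm_minus_commute)
    then show ?thesis using s[of x] s[of y] d by simp
  qed
  then show "\<exists>\<delta>>0. \<forall>x y. norm (x - y) \<le> \<delta> \<longrightarrow> \<bar>h y - h x\<bar> \<le> d"
    using \<delta>(1) by (intro exI[of _ "min (\<delta>/2) 1"]) auto
qed

lemma conv_diff:
  assumes "integrable lborel (\<lambda>z. f z * k (p - z))" "integrable lborel (\<lambda>z. g z * k (p - z))"
  shows "conv (\<lambda>z. f z - g z) k p = conv f k p - conv g k p"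
  unfolding conv_def by (subst Bochner_Integration.integral_diff[symmetric]) (auto simp: assms left_diff_distrib)

lemma integrable_times_bounded:
  fixes f k :: "'a \<Rightarrow> real"
  assumes "integrable M f" "k \<in> borel_measurable M" "\<And>z. \<bar>k z\<bar> \<le> C"
  shows "integrable M (\<lambda>z. f z * k z)"
proof (rule Bochner_Integration.integrable_bound)
  show "integrable M (\<lambda>z. C * f z)" using assms by simp
  show "AE z in M. norm (f z * k z) \<le> norm (C * f z)"
    using assms(3) by (intro AE_I2) (auto simp: abs_mult mult.commute[of _ "\<bar>f _\<bar>"]
        intro!: mult_left_mono order_trans[OF assms(3)])
qed (use assms in measurable)

lemma l2_bounded_support_integrable:
  fixes g :: "'a::euclidean_space \<Rightarrow> real"
  assumes [measurable]: "g \<in> borel_maps" and fin: "l2sq g < \<infinity>"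
    and supp: "\<And>z. norm z > r \<Longrightarrow> g z = 0"
  shows "integrable lborel g"
proof (rule integrableI_bounded)
  have [measurable]: "cball (0::'a) s \<in> sets borel" for s by (simp add: borel_closed)
  have "(LBNN z. ennreal (norm (g z)))
      \<le> (LBNN z. indicator (cball 0 r) z + ennreal ((g z)\<^sup>2))"
  proof (rule nn_integral_mono)
    fix z
    have "\<bar>g z\<bar> \<le> 1 + (g z)\<^sup>2" using zero_le_power2[of "\<bar>g z\<bar> - 1"] zero_le_power2[of "g z"]
      unfolding power2_diff by simp
    then have "ennreal \<bar>g z\<bar> \<le> 1 + ennreal ((g z)\<^sup>2)"
      by (metis ennreal_1 ennreal_leI ennreal_plus zero_le_one zero_le_power2)
    then show "ennreal (norm (g z)) \<le> indicator (cball 0 r) z + ennreal ((g z)\<^sup>2)"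
      using supp[of z] by (cases "norm z \<le> r") auto
  qed
  also have "... = emeasure lborel (cball 0 r :: 'a set) + l2sq g"
    unfolding l2sq_def by (subst nn_integral_add) auto
  also have "... < \<infinity>" using fin emeasure_lborel_cball_finite[of "0::'a" r] by simp
  finally show "(LBNN z. ennreal (norm (g z))) < \<infinity>" .
qed measurable

text \<open>
  The three-term estimate behind \<open>L\<^sup>2\<close> convergence of a family of operators \<open>A\<close>, with \<open>a = A g\<close> and
  \<open>b = A h\<close>.  It is enough that \<open>h\<close> is \<open>L\<^sup>2\<close>-close to \<open>g\<close>, that \<open>A\<close> is bounded on \<open>g - h\<close>, and that
  \<open>A h\<close> is uniformly close to \<open>h\<close> on the bounded set where the difference is measured.
\<close>

lemma l2_three_terms:
  fixes a b g h :: "'a::euclidean_space \<Rightarrow> real"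
  assumes [measurable]: "a \<in> borel_maps" "b \<in> borel_maps"
      "g \<in> borel_maps" "h \<in> borel_maps" "S \<in> sets borel"
    and bS: "bounded S" and e: "e > (0::real)"
    and ab: "l2sq (\<lambda>p. a p - b p) \<le> ennreal (e / 16)" and gh: "l2sq (\<lambda>p. g p - h p) \<le> ennreal (e / 16)"
    and bh: "\<And>p. p \<in> S \<Longrightarrow> \<bar>b p - h p\<bar> \<le> sqrt (e / (16 * (measure lborel S + 1)))"
  shows "l2_on S (\<lambda>p. a p - g p) \<le> ennreal e"
proof -
  define V where "V = measure lborel S"
  have V: "emeasure lborel S = ennreal V" "V \<ge> 0"
    using bS emeasure_bounded_finite[of S] by (auto simp: V_def emeasure_eq_ennreal_measure less_top)
  define d where "d = e / (16 * (V + 1))"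
  have d: "d \<ge> 0" "d * V \<le> e / 16"
  proof -
    show "d \<ge> 0" using e V by (simp add: d_def)
    then have "d * V \<le> d * (V + 1)" by (intro mult_left_mono) auto
    also have "... = e / 16" using V by (simp add: d_def field_simps)
    finally show "d * V \<le> e / 16" .
  qed
  have sq: "(x + y + z)\<^sup>2 \<le> 4 * x\<^sup>2 + 4 * y\<^sup>2 + 2 * z\<^sup>2" for x y z :: real
    using sum_squares_bound[of x y] sum_squares_bound[of "x + y" z] by (simp add: power2_sum power2_eq_square algebra_simps)
  have "l2_on S (\<lambda>p. a p - g p)
    \<le> (LBNN p. 4 * ennreal ((a p - b p)\<^sup>2) + 4 * ennreal ((g p - h p)\<^sup>2) + ennreal (2 * d) * indicator S p)"
  proof (rule nn_integral_mono)
    fix p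
    show "ennreal ((a p - g p)\<^sup>2) * indicator S p
      \<le> 4 * ennreal ((a p - b p)\<^sup>2) + 4 * ennreal ((g p - h p)\<^sup>2) + ennreal (2 * d) * indicator S p"
    proof (cases "p \<in> S")
      case True
      have "(a p - g p)\<^sup>2 = ((a p - b p) + - (g p - h p) + (b p - h p))\<^sup>2" by simp
      also have "... \<le> 4 * (a p - b p)\<^sup>2 + 4 * (- (g p - h p))\<^sup>2 + 2 * (b p - h p)\<^sup>2" by (rule sq)
      also have "(b p - h p)\<^sup>2 \<le> (sqrt d)\<^sup>2"
        using bh[OF True] d(1) by (simp add: abs_le_square_iff[symmetric] d_def V_def del: real_sqrt_pow2)
      also have "(sqrt d)\<^sup>2 = d" using d(1) by simp
      finally have "ennreal ((a p - g p)\<^sup>2) \<le> ennreal (4 * (a p - b p)\<^sup>2 + 4 * (g p - h p)\<^sup>2 + 2 * d)"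
        by (intro ennreal_leI) (simp only: power2_minus)
      also have "... = 4 * ennreal ((a p - b p)\<^sup>2) + 4 * ennreal ((g p - h p)\<^sup>2) + ennreal (2 * d)"
        using d(1) by (simp add: ennreal_plus ennreal_mult)
      finally show ?thesis using True by simp
    qed simp
  qed
  also have "... = 4 * l2sq (\<lambda>p. a p - b p) + 4 * l2sq (\<lambda>p. g p - h p) + ennreal (2 * d) * emeasure lborel S"
    unfolding l2sq_def by (simp add: nn_integral_add nn_integral_cmult)
  also have "... \<le> 4 * ennreal (e/16) + 4 * ennreal (e/16) + ennreal (2 * d) * ennreal V"
    unfolding V(1) by (intro add_mono mult_left_mono ab gh order_refl) auto
  also have "4 * ennreal (e/16) = ennreal (e / 4)" using e ennreal_mult[of 4 "e/16"] by simp
  also have "ennreal (2 * d) * ennreal V = ennreal (2 * (d * V))"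
    using V d(1) ennreal_mult[of "2 * d" V] by (simp add: mult.assoc)
  also have "ennreal (e / 4) + ennreal (e / 4) + ennreal (2 * (d * V)) = ennreal (e / 4 + e / 4 + 2 * (d * V))"
    using e V d(1) by (simp add: ennreal_plus[symmetric] del: ennreal_plus)
  also have "... \<le> ennreal e" using d e by (intro ennreal_leI) auto
  finally show ?thesis .
qed

lemma conv_l2_close:
  fixes g :: "'a::euclidean_space \<Rightarrow> real"
  assumes [measurable]: "g \<in> borel_maps" and fin: "l2sq g < \<infinity>"
    and supp: "\<And>z. norm z > r \<Longrightarrow> g z = 0" and e: "e > (0::real)"
    and S[measurable]: "S \<in> sets borel" and bS: "bounded S"
  shows "\<exists>\<eta>>0. \<forall>k \<eta>'. approx_kernel \<eta>' k \<and> 0 \<le> \<eta>' \<and> \<eta>' \<le> \<eta> \<longrightarrow>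
    l2_on S (\<lambda>p. conv g k p - g p) \<le> ennreal e"
proof -
  obtain h where h: "continuous_on UNIV h" "\<And>z. norm z > r + 1 \<Longrightarrow> h z = 0"
    and gh: "l2sq (\<lambda>z. g z - h z) \<le> ennreal (e / 16)"
    using l2_density[of g r "e/16"] assms(1) fin supp e by auto
  have [measurable]: "h \<in> borel_maps" using h(1) by (rule borel_measurable_continuous_onI)
  have hi: "\<exists>B. \<forall>z. \<bar>h z\<bar> \<le> B" "d > 0 \<Longrightarrow> \<exists>\<delta>>0. \<forall>x y. norm (x - y) \<le> \<delta> \<longrightarrow> \<bar>h y - h x\<bar> \<le> d" for d
    using bounded_support_unif_cont[OF h] by blast+
  obtain B where B: "\<And>z. \<bar>h z\<bar> \<le> B" using hi(1) by blast
  have B0: "B \<ge> 0" using B[of 0] by linarith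
  define d where "d = sqrt (e / (16 * (measure lborel S + 1)))"
  have d: "d > 0" using e by (simp add: d_def add_nonneg_pos)
  obtain \<delta> where \<delta>: "\<delta> > 0" "\<And>x y. norm (x - y) \<le> \<delta> \<Longrightarrow> \<bar>h y - h x\<bar> \<le> d / 2" using hi(2)[of "d/2"] d by auto
  define \<eta> where "\<eta> = min \<delta> (d / (4 * (B + 1)))"
  have \<eta>: "\<eta> > 0" using \<delta> d B0 by (simp add: \<eta>_def)
  have "l2_on S (\<lambda>p. conv g k p - g p) \<le> ennreal e"
    if k: "approx_kernel \<eta>' k" and \<eta>': "0 \<le> \<eta>'" "\<eta>' \<le> \<eta>" for k \<eta>'
  proof -
    note [measurable] = approx_kernel_measurable[OF k] conv_measurable[of _ k]
    obtain C where C: "\<And>z. \<bar>k z\<bar> \<le> C" using k unfolding approx_kernel_def by (metis abs_of_nonneg)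
    have gi: "integrable lborel g" by (rule l2_bounded_support_integrable[OF _ fin supp]) auto
    have "l2sq h \<le> 2 * l2sq g + 2 * l2sq (\<lambda>z. g z - h z)"
      using l2sq_diff[of g "\<lambda>z. g z - h z"] by simp
    also have "... < \<infinity>"
      using fin le_less_trans[OF gh ennreal_less_top] by (simp add: ennreal_mult_less_top)
    finally have hint: "integrable lborel h"
      by (intro l2_bounded_support_integrable[where r="r+1"] h(2)) auto
    have cd: "conv (\<lambda>z. g z - h z) k p = conv g k p - conv h k p" for p
      by (rule conv_diff; rule integrable_times_bounded[where C=C]) (auto simp: gi hint C)
    have hc: "\<bar>conv h k p - h p\<bar> \<le> d" for p
    proof -
      have "\<bar>conv h k p - h p\<bar> \<le> d / 2 + 2 * B * \<eta>'"
        by (rule conv_close[OF k \<eta>'(1)]) (use B d \<delta>(2)[of p] \<eta>' in \<open>auto simp: \<eta>_def\<close>)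
      also have "2 * B * \<eta>' \<le> 2 * (B + 1) * (d / (4 * (B + 1)))"
        using \<eta>' B0 d by (intro mult_mono) (auto simp: \<eta>_def)
      also have "... = d / 2" using B0 by (simp add: field_simps)
      finally show ?thesis by simp
    qed
    show ?thesis
      by (rule l2_three_terms[where b="conv h k" and h=h])
        (use bS e gh hc order_trans[OF conv_young[OF k, of "\<lambda>z. g z - h z"] gh] in \<open>auto simp: cd[symmetric] d_def\<close>)
  qed
  then show ?thesis using \<eta> by blast
qed

text \<open>
  A contraction (\<open>\<kappa> < 1\<close>) of the coordinates in \<open>J\<close> towards the centre \<open>c\<close>.  In these
  directions it moves a closed box into its interior and leaves a margin for mollification.
\<close>

definition dil :: "'a::euclidean_space set \<Rightarrow> 'a \<Rightarrow> real \<Rightarrow> 'a \<Rightarrow> 'a" where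
  "dil J c \<kappa> p = p + (\<kappa> - 1) *\<^sub>R (\<Sum>j\<in>J. ((p - c) \<bullet> j) *\<^sub>R j)"

lemma dil_inner:
  assumes "J \<subseteq> Basis" "b \<in> Basis"
  shows "dil J c \<kappa> p \<bullet> b = (if b \<in> J then c \<bullet> b + \<kappa> * (p \<bullet> b - c \<bullet> b) else p \<bullet> b)"
proof -
  have f: "finite J" using assms(1) finite_Basis finite_subset by blast
  have "(\<Sum>j\<in>J. ((p - c) \<bullet> j) *\<^sub>R j) \<bullet> b = (\<Sum>j\<in>J. if j = b then (p - c) \<bullet> b else 0)"
    unfolding inner_sum_left using assms by (intro sum.cong) (auto simp: inner_Basis)
  also have "... = (if b \<in> J then (p - c) \<bullet> b else 0)" using f by simp
  finally show ?thesis by (simp add: dil_def inner_add_left inner_diff_left algebra_simps)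
qed

lemma continuous_on_dil: "continuous_on S (dil J c \<kappa>)"
  unfolding dil_def[abs_def] by (intro continuous_intros)

lemma dil_measurable[measurable]: "dil J c \<kappa> \<in> borel_maps"
  by (intro borel_measurable_continuous_onI continuous_on_dil)

lemma nn_integral_dil:
  assumes J: "J \<subseteq> Basis" and \<kappa>: "\<kappa> > 0" and [measurable]: "f \<in> borel_maps"
  shows "(LBNN p. f p) = ennreal (\<kappa> ^ card J) * (LBNN p. f (dil J c \<kappa> p))"
proof -
  define a where "a j = (if j \<in> J then \<kappa> else 1)" for j :: 'a
  define t where "t = (\<Sum>j\<in>J. ((1 - \<kappa>) * (c \<bullet> j)) *\<^sub>R j)"
  have f: "finite J" using J finite_Basis finite_subset by blast
  have "dil J c \<kappa> x = t + (\<Sum>j\<in>Basis. (a j * (x \<bullet> j)) *\<^sub>R j)" for x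
  proof (rule euclidean_eqI)
    fix b :: 'a assume b: "b \<in> Basis"
    have "t \<bullet> b = (\<Sum>j\<in>J. if j = b then (1 - \<kappa>) * (c \<bullet> b) else 0)"
      unfolding t_def inner_sum_left using J b by (intro sum.cong) (auto simp: inner_Basis)
    also have "... = (if b \<in> J then (1 - \<kappa>) * (c \<bullet> b) else 0)" using f by simp
    finally show "dil J c \<kappa> x \<bullet> b = (t + (\<Sum>j\<in>Basis. (a j * (x \<bullet> j)) *\<^sub>R j)) \<bullet> b"
      using b by (simp add: dil_inner[OF J] inner_add_left a_def algebra_simps)
  qed
  then have T: "(\<lambda>x. t + (\<Sum>j\<in>Basis. (a j * (x \<bullet> j)) *\<^sub>R j)) = dil J c \<kappa>" by auto
  have "(\<Prod>j\<in>Basis. \<bar>a j\<bar>) = (\<Prod>j\<in>J. \<kappa>)"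
    using J \<kappa> by (intro prod.mono_neutral_cong_right) (auto simp: a_def)
  then have P: "(\<Prod>j\<in>Basis. \<bar>a j\<bar>) = \<kappa> ^ card J" by simp
  have "lborel = density (distr lborel borel (dil J c \<kappa>)) (\<lambda>_. ennreal (\<kappa> ^ card J))"
    using lborel_affine_euclidean[of a t] \<kappa> unfolding T P by (auto simp: a_def split: if_splits)
  then have "(LBNN p. f p) = (\<integral>\<^sup>+p. f p \<partial>density (distr lborel borel (dil J c \<kappa>)) (\<lambda>_. ennreal (\<kappa> ^ card J)))"
    by simp
  also have "... = ennreal (\<kappa> ^ card J) * (LBNN p. f (dil J c \<kappa> p))"
    by (simp add: nn_integral_density nn_integral_distr nn_integral_cmult)
  finally show ?thesis .
qed

lemma norm_dil_diff:
  assumes "J \<subseteq> Basis"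
  shows "norm (dil J c \<kappa> p - p) \<le> \<bar>\<kappa> - 1\<bar> * (real (card J) * norm (p - c))"
proof -
  have "norm (\<Sum>j\<in>J. ((p - c) \<bullet> j) *\<^sub>R j) \<le> real (card J) * norm (p - c)"
    using assms by (intro sum_norm_bound) (auto simp: norm_Basis Basis_le_norm subset_iff)
  then show ?thesis by (simp add: dil_def mult_left_mono)
qed

lemma dil_l2_close:
  fixes g :: "'a::euclidean_space \<Rightarrow> real"
  assumes [measurable]: "g \<in> borel_maps" and fin: "l2sq g < \<infinity>"
    and supp: "\<And>z. norm z > r \<Longrightarrow> g z = 0" and e: "e > (0::real)"
    and S[measurable]: "S \<in> sets borel" and bS: "bounded S" and J: "J \<subseteq> Basis"
  shows "\<exists>\<kappa>0<1. \<forall>\<kappa>. \<kappa>0 < \<kappa> \<and> \<kappa> < 1 \<longrightarrow>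
    l2_on S (\<lambda>p. g (dil J c \<kappa> p) - g p) \<le> ennreal e"
proof -
  define D where "D = (2::real) ^ card J"
  have D: "D \<ge> 1" by (simp add: D_def)
  obtain h where h: "continuous_on UNIV h" "\<And>z. norm z > r + 1 \<Longrightarrow> h z = 0"
    and gh: "l2sq (\<lambda>z. g z - h z) \<le> ennreal (e / (16 * D))"
    using l2_density[of g r "e/(16*D)"] assms(1) fin supp e D by auto
  have [measurable]: "h \<in> borel_maps" using h(1) by (rule borel_measurable_continuous_onI)
  have hi: "d > 0 \<Longrightarrow> \<exists>\<delta>>0. \<forall>x y. norm (x - y) \<le> \<delta> \<longrightarrow> \<bar>h y - h x\<bar> \<le> d" for d
    using bounded_support_unif_cont[OF h] by blast+
  define d where "d = sqrt (e / (16 * (measure lborel S + 1)))"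
  have d: "d > 0" using e by (simp add: d_def add_nonneg_pos)
  obtain \<delta> where \<delta>: "\<delta> > 0" "\<And>x y. norm (x - y) \<le> \<delta> \<Longrightarrow> \<bar>h y - h x\<bar> \<le> d" using hi[of "d"] d by auto
  obtain b where b: "b > 0" "\<And>p. p \<in> S \<Longrightarrow> norm p \<le> b" using bS bounded_pos by metis
  define m where "m = real (card J) * (b + norm c) + 1"
  have m: "m > 0" using b by (simp add: m_def add_nonneg_pos)
  define \<kappa>0 where "\<kappa>0 = max (1/2) (1 - \<delta> / m)"
  have "\<kappa>0 < 1" using \<delta> m by (simp add: \<kappa>0_def)
  moreover have "l2_on S (\<lambda>p. g (dil J c \<kappa> p) - g p) \<le> ennreal e"
    if k: "\<kappa>0 < \<kappa>" "\<kappa> < 1" for \<kappa>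
  proof -
    let ?A = "dil J c \<kappa>"
    have k': "1/2 < \<kappa>" "1 - \<kappa> < \<delta> / m" using k by (auto simp: \<kappa>0_def)
    have hc: "\<bar>h (?A p) - h p\<bar> \<le> d" if "p \<in> S" for p
    proof -
      have "norm (?A p - p) \<le> \<bar>\<kappa> - 1\<bar> * (real (card J) * norm (p - c))" by (rule norm_dil_diff[OF J])
      also have "... \<le> (\<delta> / m) * m"
      proof (rule mult_mono)
        have "real (card J) * norm (p - c) \<le> real (card J) * (b + norm c)"
          using b(2)[OF that] norm_triangle_ineq4[of p c] by (intro mult_left_mono) auto
        then show "real (card J) * norm (p - c) \<le> m" by (simp add: m_def)
      qed (use k k' \<delta> m in auto)
      also have "... = \<delta>" using m by simp
      finally show ?thesis using \<delta>(2)[of p "?A p"] by (simp add: norm_minus_commute)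
    qed
    have "ennreal ((1/2) ^ card J) * (LBNN p. ennreal ((g (?A p) - h (?A p))\<^sup>2))
       \<le> ennreal (\<kappa> ^ card J) * (LBNN p. ennreal ((g (?A p) - h (?A p))\<^sup>2))"
      using k' by (intro mult_right_mono ennreal_leI power_mono) auto
    also have "... = l2sq (\<lambda>z. g z - h z)"
      unfolding l2sq_def using k' by (intro nn_integral_dil[symmetric] J) auto
    finally have "ennreal D * (ennreal ((1/2) ^ card J) * (LBNN p. ennreal ((g (?A p) - h (?A p))\<^sup>2)))
        \<le> ennreal D * l2sq (\<lambda>z. g z - h z)" by (intro mult_left_mono) auto
    moreover have "ennreal D * ennreal ((1/2) ^ card J) = 1"
      by (simp add: D_def ennreal_mult[symmetric] power_mult_distrib[symmetric])
    ultimately have gA: "(LBNN p. ennreal ((g (?A p) - h (?A p))\<^sup>2)) \<le> ennreal D * l2sq (\<lambda>z. g z - h z)"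
      by (simp add: mult.assoc[symmetric])
    also have "... \<le> ennreal D * ennreal (e / (16 * D))" using gh by (intro mult_left_mono) auto
    also have "... = ennreal (e / 16)" using D e by (simp add: ennreal_mult[symmetric])
    finally have gA: "(LBNN p. ennreal ((g (?A p) - h (?A p))\<^sup>2)) \<le> ennreal (e / 16)" .
    have gh': "l2sq (\<lambda>z. g z - h z) \<le> ennreal (e / 16)"
      using gh D e by (rule_tac order_trans[OF gh]) (auto intro!: ennreal_leI simp: field_simps)
    show ?thesis
      by (rule l2_three_terms[where b="\<lambda>p. h (?A p)" and h=h]) (use bS e gA gh' hc in \<open>auto simp: d_def l2sq_def\<close>)
  qed
  ultimately show ?thesis by blast
qed

section \<open>Landau kernels\<close>

definition landau_mass :: "real \<Rightarrow> nat \<Rightarrow> real" where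
  "landau_mass L n = enn2real (LBNN s. ennreal ((1 - (s / L)\<^sup>2) ^ n) * indicator {-L..L} s)"

text \<open>
  A power of \<open>1 - (s/L)\<^sup>2\<close>, normalized on \<open>[-L, L]\<close>.  These approximate identities are polynomials, so that
  a convolution with them is a polynomial in the free variable.
\<close>

definition landau :: "real \<Rightarrow> nat \<Rightarrow> real \<Rightarrow> real" where
  "landau L n s = (1 / landau_mass L n) * (1 - (s / L)\<^sup>2) ^ n"

lemma sq_le_one: "L > 0 \<Longrightarrow> s \<in> {-L..L} \<Longrightarrow> (s / L)\<^sup>2 \<le> (1::real)"
  by (simp add: abs_square_le_1 abs_le_iff divide_le_eq le_divide_eq)

lemma landau_mass:
  assumes L: "L > 0"
  shows "(LBNN s. ennreal ((1 - (s / L)\<^sup>2) ^ n) * indicator {-L..L} s) = ennreal (landau_mass L n)" (is ?A)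
    and "landau_mass L n \<ge> L / (real n + 1)" (is ?B)
    and "landau_mass L n > 0"
proof -
  let ?I = "LBNN s. ennreal ((1 - (s / L)\<^sup>2) ^ n) * indicator {-L..L} s"
  have "?I \<le> (LBNN s. 1 * indicator {-L..L} s)"
  proof (rule nn_integral_mono)
    fix s
    have "(1 - (s / L)\<^sup>2) ^ n \<le> 1" if "s \<in> {-L..L}"
      using sq_le_one[OF L that] by (intro power_le_one) auto
    then show "ennreal ((1 - (s / L)\<^sup>2) ^ n) * indicator {-L..L} s \<le> 1 * indicator {-L..L} s"
      by (auto simp: indicator_def)
  qed
  also have "... < \<infinity>" by (simp add: emeasure_lborel_Icc_eq)
  finally have fin: "?I < \<infinity>" .
  then show A: ?A by (simp add: landau_mass_def)
  have "ennreal (L / (real n + 1)) = (LBNN s. ennreal ((1 - s / L) ^ n) * indicator {0..L} s)"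
  proof -
    have "(LBNN s. ennreal ((1 - s / L) ^ n) * indicator {0..L} s)
       = ennreal (- (L / (real n + 1)) * (1 - L / L) ^ (n + 1) - - (L / (real n + 1)) * (1 - 0 / L) ^ (n + 1))"
    proof (rule nn_integral_FTC_Icc)
      fix s assume "s \<in> {0..L}"
      then show "0 \<le> (1 - s / L) ^ n" using L by simp
      show "((\<lambda>s. - (L / (real n + 1)) * (1 - s / L) ^ (n + 1)) has_real_derivative (1 - s / L) ^ n) (at s)"
      proof -
        have "((\<lambda>s. 1 - s / L) has_real_derivative - (1 / L)) (at s)"
          using L by (auto intro!: derivative_eq_intros)
        from DERIV_cmult[OF DERIV_power[OF this, of "n + 1"], of "- (L / (real n + 1))"]
        have der: "((\<lambda>s. - (L / (real n + 1)) * (1 - s / L) ^ (n + 1)) has_real_derivative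
           - (L / (real n + 1)) * (real (n + 1) * (- (1 / L) * (1 - s / L) ^ n))) (at s)" by simp
        have "- (L / m) * (m * (- (1 / L) * X)) = X" if "m \<noteq> 0" for m X
          using L that by (simp add: field_simps)
        moreover have "real n + 1 \<noteq> 0" by linarith
        ultimately have "- (L / (real n + 1)) * ((real n + 1) * (- (1 / L) * (1 - s / L) ^ n)) = (1 - s / L) ^ n"
          by blast
        with der show ?thesis by (simp only: of_nat_add of_nat_1)
      qed
    qed (use L in auto)
    then show ?thesis by simp
  qed
  also have "... \<le> ?I"
  proof (rule nn_integral_mono)
    fix s
    have "(1 - s / L) ^ n \<le> (1 - (s / L)\<^sup>2) ^ n" if "s \<in> {0..L}"
    proof -
      have "(s / L)\<^sup>2 \<le> s / L"
        unfolding power2_eq_square using that L by (intro mult_left_le) auto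
      then show ?thesis using that L by (intro power_mono) auto
    qed
    then show "ennreal ((1 - s / L) ^ n) * indicator {0..L} s \<le> ennreal ((1 - (s / L)\<^sup>2) ^ n) * indicator {-L..L} s"
      using L by (auto simp: indicator_def intro!: ennreal_leI)
  qed
  finally have "ennreal (L / (real n + 1)) \<le> ennreal (landau_mass L n)" using A by simp
  then show B: ?B using landau_mass_def by (subst (asm) ennreal_le_iff) auto
  show "landau_mass L n > 0" using B L by (smt (verit) divide_pos_pos of_nat_0_le_iff)
qed

lemma smooth1_landau: "smooth1 (landau L n)"
proof -
  have "smooth1 (\<lambda>s. (1 / landau_mass L n) * (1 - (1 / L * s + 0) ^ 2) ^ n)"
    by (intro smooth1_cmult smooth1_power smooth1_diff smooth1_const)
      (rule smooth1_affine[OF smooth1_ident])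
  then show ?thesis by (simp add: landau_def[abs_def])
qed

lemma landau_nonneg: "L > 0 \<Longrightarrow> s \<in> {-L..L} \<Longrightarrow> landau L n s \<ge> 0"
  using landau_mass(3)[of L n] sq_le_one[of L s] by (simp add: landau_def)

lemma landau_measurable[measurable]: "landau L n \<in> borel_maps"
  unfolding landau_def[abs_def] by measurable

lemma landau_integral:
  assumes "L > 0"
  shows "(LBNN s. ennreal (landau L n s) * indicator {-L..L} s) = 1"
proof -
  have "(LBNN s. ennreal (landau L n s) * indicator {-L..L} s)
      = (LBNN s. ennreal (1 / landau_mass L n) * (ennreal ((1 - (s / L)\<^sup>2) ^ n) * indicator {-L..L} s))"
    using less_imp_le[OF landau_mass(3)[OF assms]] sq_le_one[OF assms]
    by (intro nn_integral_cong) (auto simp: landau_def ennreal_mult[symmetric] indicator_def)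
  also have "... = ennreal (1 / landau_mass L n) * ennreal (landau_mass L n)"
    by (simp add: nn_integral_cmult landau_mass(1)[OF assms])
  also have "... = 1" using landau_mass(3)[OF assms, of n] by (simp add: ennreal_mult[symmetric])
  finally show ?thesis .
qed

text \<open>
  Off \<open>[-\<eta>, \<eta>]\<close> the power decays geometrically, whereas the mass on \<open>[-L, L]\<close> decays only like \<open>1/n\<close>.
\<close>

lemma landau_tail:
  assumes L: "L > 0" and \<eta>: "\<eta> > 0"
  shows "eventually (\<lambda>n. (LBNN s. ennreal (landau L n s) * indicator ({-L..L} \<inter> {s. \<bar>s\<bar> > \<eta>}) s) \<le> ennreal \<eta>) sequentially"
proof (cases "\<eta> < L")
  case False
  then have "({-L..L} \<inter> {s. \<bar>s\<bar> > \<eta>}) = {}" by auto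
  then show ?thesis by simp
next
  case True
  define r where "r = 1 - (\<eta> / L)\<^sup>2"
  have "0 < \<eta> / L" "\<eta> / L < 1" using True \<eta> L by auto
  then have r: "0 < r" "r < 1" by (auto simp: r_def abs_square_less_1)
  have "(\<lambda>n. 2 * ((real n + 1) * r ^ n)) \<longlonglongrightarrow> 2 * 0"
  proof (intro tendsto_mult tendsto_const)
    have "(\<lambda>n. real n * r ^ n + r ^ n) \<longlonglongrightarrow> 0 + 0"
      using r by (intro tendsto_add powser_times_n_limit_0[of r, simplified] LIMSEQ_realpow_zero) auto
    then show "(\<lambda>n. (real n + 1) * r ^ n) \<longlonglongrightarrow> 0" by (simp add: algebra_simps)
  qed
  then have "eventually (\<lambda>n. 2 * ((real n + 1) * r ^ n) < \<eta>) sequentially"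
    using \<eta> by (intro order_tendstoD) auto
  then show ?thesis
  proof eventually_elim
    case (elim n)
    have "(LBNN s. ennreal (landau L n s) * indicator ({-L..L} \<inter> {s. \<bar>s\<bar> > \<eta>}) s)
       \<le> (LBNN s. ennreal ((real n + 1) / L * r ^ n) * indicator {-L..L} s)"
    proof (rule nn_integral_mono)
      fix s
      have "landau L n s \<le> (real n + 1) / L * r ^ n" if s: "s \<in> {-L..L}" "\<bar>s\<bar> > \<eta>"
        unfolding landau_def
      proof (rule mult_mono)
        show "1 / landau_mass L n \<le> (real n + 1) / L"
          using landau_mass(2,3)[OF L, of n] L by (simp add: field_simps)
        have "(\<eta> / L)\<^sup>2 \<le> (s / L)\<^sup>2" using s \<eta> L
          by (simp add: abs_le_square_iff[symmetric] divide_right_mono)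
        then show "(1 - (s / L)\<^sup>2) ^ n \<le> r ^ n"
          using sq_le_one[OF L s(1)] by (intro power_mono) (auto simp: r_def)
        show "0 \<le> (1 - (s / L)\<^sup>2) ^ n" using sq_le_one[OF L s(1)] by simp
      qed (use L in auto)
      then show "ennreal (landau L n s) * indicator ({-L..L} \<inter> {s. \<bar>s\<bar> > \<eta>}) s
          \<le> ennreal ((real n + 1) / L * r ^ n) * indicator {-L..L} s"
        by (auto simp: indicator_def intro!: ennreal_leI)
    qed
    also have "... = ennreal ((real n + 1) / L * r ^ n) * ennreal (2 * L)"
      using L by (simp add: nn_integral_cmult_indicator)
    also have "... = ennreal (2 * ((real n + 1) * r ^ n))"
      using L r by (simp add: ennreal_mult[symmetric])
    also have "... \<le> ennreal \<eta>" using elim by (intro ennreal_leI) auto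
    finally show ?case .
  qed
qed

lemma landau_moment:
  assumes L: "L > 0" and \<eta>: "\<eta> > 0"
    and t: "(LBNN s. ennreal (landau L n s) * indicator ({-L..L} \<inter> {s. \<bar>s\<bar> > \<eta>}) s) \<le> ennreal \<eta>"
  shows "(LBNN s. ennreal (\<bar>s\<bar> * landau L n s) * indicator {-L..L} s) \<le> ennreal (\<eta> + L * \<eta>)"
proof -
  have "(LBNN s. ennreal (\<bar>s\<bar> * landau L n s) * indicator {-L..L} s)
    \<le> (LBNN s. ennreal \<eta> * (ennreal (landau L n s) * indicator {-L..L} s)
        + ennreal L * (ennreal (landau L n s) * indicator ({-L..L} \<inter> {s. \<bar>s\<bar> > \<eta>}) s))"
  proof (rule nn_integral_mono)
    fix s
    show "ennreal (\<bar>s\<bar> * landau L n s) * indicator {-L..L} s \<le> ennreal \<eta> * (ennreal (landau L n s) * indicator {-L..L} s)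
        + ennreal L * (ennreal (landau L n s) * indicator ({-L..L} \<inter> {s. \<bar>s\<bar> > \<eta>}) s)"
    proof (cases "s \<in> {-L..L}")
      case True
      note l0 = landau_nonneg[OF L True, of n]
      show ?thesis
      proof (cases "\<bar>s\<bar> > \<eta>")
        case a: True
        have "\<bar>s\<bar> * landau L n s \<le> L * landau L n s" using True l0 by (intro mult_right_mono) auto
        then have "ennreal (\<bar>s\<bar> * landau L n s) \<le> ennreal L * ennreal (landau L n s)"
          using L l0 by (simp add: ennreal_mult[symmetric])
        then show ?thesis using True a by (simp add: add_increasing)
      next
        case a: False
        have "\<bar>s\<bar> * landau L n s \<le> \<eta> * landau L n s" using a l0 by (intro mult_right_mono) auto
        then have "ennreal (\<bar>s\<bar> * landau L n s) \<le> ennreal \<eta> * ennreal (landau L n s)"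
          using \<eta> l0 by (simp add: ennreal_mult[symmetric])
        then show ?thesis using True a by (simp add: add_increasing2)
      qed
    qed simp
  qed
  also have "... = ennreal \<eta> * (LBNN s. ennreal (landau L n s) * indicator {-L..L} s)
     + ennreal L * (LBNN s. ennreal (landau L n s) * indicator ({-L..L} \<inter> {s. \<bar>s\<bar> > \<eta>}) s)"
    by (subst nn_integral_add) (auto simp: nn_integral_cmult)
  also have "... \<le> ennreal \<eta> * 1 + ennreal L * ennreal \<eta>"
    using t landau_integral[OF L, of n] by (intro add_mono mult_left_mono) auto
  also have "... = ennreal (\<eta> + L * \<eta>)" using L \<eta> by (simp add: ennreal_mult ennreal_plus)
  finally show ?thesis .
qed

definition sym_box :: "real \<Rightarrow> 'a::euclidean_space set" where
  "sym_box L = {z. \<forall>b\<in>Basis. \<bar>z \<bullet> b\<bar> \<le> L}"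

lemma sym_box_cbox: "sym_box L = cbox (\<Sum>b\<in>Basis. (-L) *\<^sub>R b) (\<Sum>b\<in>Basis. L *\<^sub>R b)"
  unfolding sym_box_def cbox_def
  by (intro Collect_cong ball_cong refl) (simp only: inner_sum_left_Basis, linarith)

lemma sym_box_measurable[measurable]: "sym_box L \<in> sets borel"
  by (simp add: sym_box_cbox)

lemma compact_sym_box: "compact (sym_box L)"
  by (simp add: sym_box_cbox)

lemma indicator_sym_box: "(indicator (sym_box L) z :: 'b::comm_semiring_1) = (\<Prod>b\<in>Basis. indicator {-L..L} (z \<bullet> b))"
proof (cases "z \<in> sym_box L")
  case True
  then show ?thesis by (auto simp: sym_box_def abs_le_iff minus_le_iff intro!: prod.neutral[symmetric])
next
  case False
  then obtain b where "b \<in> Basis" "z \<bullet> b \<notin> {-L..L}" by (auto simp: sym_box_def abs_le_iff)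
  then have "(\<Prod>b\<in>Basis. indicator {-L..L} (z \<bullet> b)) = (0::'b)"
    by (intro prod_zero finite_Basis bexI[of _ b]) auto
  with False show ?thesis by simp
qed

lemma nn_integral_tens_box:
  assumes "\<And>b. b \<in> Basis \<Longrightarrow> h b \<in> borel_maps"
    and "\<And>b s. b \<in> Basis \<Longrightarrow> s \<in> {-L..L} \<Longrightarrow> 0 \<le> h b s"
  shows "(LBNN z. ennreal (tens h z) * indicator (sym_box L) z)
    = (\<Prod>b\<in>Basis. LBNN s. ennreal (h b s) * indicator {-L..L} s)"
proof -
  have "ennreal (tens h z) * indicator (sym_box L) z = (\<Prod>b\<in>Basis. ennreal (h b (z \<bullet> b)) * indicator {-L..L} (z \<bullet> b))" for z
  proof (cases "z \<in> sym_box L")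
    case True
    then have "ennreal (tens h z) = (\<Prod>b\<in>Basis. ennreal (h b (z \<bullet> b)))"
      unfolding tens_def using assms(2) by (intro prod_ennreal[symmetric]) (auto simp: sym_box_def abs_le_iff)
    then show ?thesis by (simp add: prod.distrib indicator_sym_box)
  next
    case False
    then have "(\<Prod>b\<in>Basis. indicator {-L..L} (z \<bullet> b)) = (0::ennreal)"
      using indicator_sym_box[of L z, where 'b=ennreal] by simp
    then show ?thesis using False by (simp add: prod.distrib)
  qed
  then show ?thesis
    using assms(1) by (subst nn_integral_lborel_prod[symmetric]) auto
qed

definition landau_kernel :: "real \<Rightarrow> ('a \<Rightarrow> nat) \<Rightarrow> 'a::euclidean_space \<Rightarrow> real" where
  "landau_kernel L N = tens (\<lambda>b. landau L (N b))"

text \<open>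
  The coordinates in \<open>D\<close> receive a much larger exponent than the others.  With \<open>D\<close> the velocity
  directions, the second property makes the commutator of mollification and transport small: the
  commutator contains \<open>(p - z)\<^sub>d \<partial>\<^sub>c k\<close> with \<open>d \<in> D\<close> and \<open>c \<notin> D\<close>.  The derivative in the direction
  \<open>c\<close> has an \<open>L\<^sup>1\<close> norm that depends on the smaller exponent only; once this exponent is fixed, the
  first moment in the direction \<open>d\<close> can be made as small as desired.
\<close>

lemma landau_kernel_exists:
  assumes L: "L > 0" and \<eta>: "\<eta> > 0" and D: "D \<subseteq> (Basis :: 'a::euclidean_space set)"
  shows "\<exists>N. approx_kernel \<eta> (\<lambda>z::'a. landau_kernel L N z * indicator (sym_box L) z) \<and>
    (\<forall>c\<in>Basis - D. \<forall>d\<in>D. (LBNN z. ennreal (\<bar>z \<bullet> d\<bar> * \<bar>tens ((\<lambda>b. landau L (N b))(c := deriv (landau L (N c)))) z\<bar>)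
        * indicator (sym_box L) z) \<le> ennreal \<eta>)"
proof -
  define \<eta>1 where "\<eta>1 = \<eta> / DIM('a)"
  have \<eta>1: "\<eta>1 > 0" using \<eta> by (simp add: \<eta>1_def)
  obtain n where n: "(LBNN s. ennreal (landau L n s) * indicator ({-L..L} \<inter> {s. \<bar>s\<bar> > \<eta>1}) s) \<le> ennreal \<eta>1"
    using landau_tail[OF L \<eta>1] by (auto simp: eventually_sequentially)
  have dc: "continuous_on UNIV (deriv (landau L n))"
    by (intro smooth1_continuous_on smooth1_deriv smooth1_landau)
  have [measurable]: "deriv (landau L n) \<in> borel_maps" using dc by (rule borel_measurable_continuous_onI)
  have "bounded (deriv (landau L n) ` {-L..L})"
    using continuous_on_subset[OF dc] by (intro compact_imp_bounded compact_continuous_image) auto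
  then obtain C0 where "\<forall>y\<in>deriv (landau L n) ` {-L..L}. norm y \<le> C0" unfolding bounded_iff by blast
  then have C0: "\<bar>deriv (landau L n) s\<bar> \<le> C0" if "s \<in> {-L..L}" for s using that by simp
  have C00: "C0 \<ge> 0" using C0[of 0] L by (simp add: abs_ge_zero order_trans[OF abs_ge_zero])
  define C where "C = C0 * (2 * L)"
  have C: "(LBNN s. ennreal \<bar>deriv (landau L n) s\<bar> * indicator {-L..L} s) \<le> ennreal C"
  proof -
    have "(LBNN s. ennreal \<bar>deriv (landau L n) s\<bar> * indicator {-L..L} s) \<le> (LBNN s. ennreal C0 * indicator {-L..L} s)"
      using C0 by (intro nn_integral_mono) (auto simp: indicator_def intro!: ennreal_leI)
    also have "... = ennreal C" using L C00 by (simp add: nn_integral_cmult_indicator C_def ennreal_mult)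
    finally show ?thesis .
  qed
  have C': "C \<ge> 0" using C00 L by (simp add: C_def)
  \<comment> \<open>\<open>C\<close> bounds the \<open>L\<^sup>1\<close> norm of the derivative for the exponent \<open>n\<close>; the exponent \<open>m\<close> of the directions in \<open>D\<close> is chosen afterwards.\<close>
  define \<eta>2 where "\<eta>2 = min \<eta>1 (\<eta> / ((1 + L) * (C + 1)))"
  have \<eta>2: "\<eta>2 > 0" "\<eta>2 \<le> \<eta>1" using \<eta>1 \<eta> L C' by (auto simp: \<eta>2_def)
  have \<eta>2': "(\<eta>2 + L * \<eta>2) * C \<le> \<eta>"
  proof -
    have "(1 + L) * (C + 1) > 0" "\<eta>2 \<le> \<eta> / ((1 + L) * (C + 1))" using L C' by (auto simp: \<eta>2_def)
    then have "\<eta>2 * ((1 + L) * (C + 1)) \<le> \<eta>" by (simp only: pos_le_divide_eq)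
    moreover have "\<eta>2 * ((1 + L) * C) \<le> \<eta>2 * ((1 + L) * (C + 1))"
      using \<eta>2 L C' by (intro mult_left_mono) auto
    ultimately show ?thesis by (simp add: algebra_simps)
  qed
  obtain m where m: "(LBNN s. ennreal (landau L m s) * indicator ({-L..L} \<inter> {s. \<bar>s\<bar> > \<eta>2}) s) \<le> ennreal \<eta>2"
    using landau_tail[OF L \<eta>2(1)] by (auto simp: eventually_sequentially)
  define N where "N b = (if b \<in> D then m else n)" for b
  let ?k = "\<lambda>z::'a. landau_kernel L N z * indicator (sym_box L) z"
  have [measurable]: "landau_kernel L N \<in> borel_maps"
    unfolding landau_kernel_def
    by (intro borel_measurable_continuous_onI continuous_on_tens smooth1_continuous_on smooth1_landau)
  have k0: "0 \<le> landau_kernel L N z" if "z \<in> sym_box L" for z :: 'a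
    unfolding landau_kernel_def tens_def using that
    by (intro prod_nonneg ballI landau_nonneg[OF L]) (auto simp: sym_box_def abs_le_iff)
  have ke: "ennreal (?k z) = ennreal (landau_kernel L N z) * indicator (sym_box L) z" for z
    by (auto simp: indicator_def)
  have int1: "(LBNN z. ennreal (?k z)) = 1"
    unfolding ke unfolding landau_kernel_def
    using landau_integral[OF L] landau_nonneg[OF L] by (subst nn_integral_tens_box) auto
  have tailb: "(LBNN z. ennreal (?k z) * indicator {z. \<bar>z \<bullet> b\<bar> > \<eta>1} z) \<le> ennreal \<eta>1" if b: "b \<in> Basis" for b :: 'a
  proof -
    let ?h = "(\<lambda>b. landau L (N b))(b := \<lambda>s. landau L (N b) s * indicator {s. \<bar>s\<bar> > \<eta>1} s)"
    have e: "ennreal (?k z) * indicator {z. \<bar>z \<bullet> b\<bar> > \<eta>1} z = ennreal (tens ?h z) * indicator (sym_box L) z" for z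
      unfolding landau_kernel_def tens_upd[OF b] tens_split[OF b, of "\<lambda>b. landau L (N b)"]
      by (auto simp: indicator_def)
    have "(LBNN z. ennreal (?k z) * indicator {z. \<bar>z \<bullet> b\<bar> > \<eta>1} z)
       = (\<Prod>c\<in>Basis. LBNN s. ennreal (?h c s) * indicator {-L..L} s)"
      unfolding e using landau_nonneg[OF L] by (intro nn_integral_tens_box) auto
    also have "... = (LBNN s. ennreal (?h b s) * indicator {-L..L} s) *
        (\<Prod>c\<in>Basis - {b}. LBNN s. ennreal (?h c s) * indicator {-L..L} s)"
      using b by (intro prod.remove) auto
    also have "(\<Prod>c\<in>Basis - {b}. LBNN s. ennreal (?h c s) * indicator {-L..L} s) = 1"
      using landau_integral[OF L] by (intro prod.neutral) auto
    also have "(LBNN s. ennreal (?h b s) * indicator {-L..L} s)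
      = (LBNN s. ennreal (landau L (N b) s) * indicator ({-L..L} \<inter> {s. \<bar>s\<bar> > \<eta>1}) s)"
      by (intro nn_integral_cong) (auto simp: indicator_def)
    also have "... \<le> ennreal \<eta>1"
    proof (cases "b \<in> D")
      case True
      have "(LBNN s. ennreal (landau L m s) * indicator ({-L..L} \<inter> {s. \<bar>s\<bar> > \<eta>1}) s)
        \<le> (LBNN s. ennreal (landau L m s) * indicator ({-L..L} \<inter> {s. \<bar>s\<bar> > \<eta>2}) s)"
        using \<eta>2 by (intro nn_integral_mono) (auto simp: indicator_def)
      also have "... \<le> ennreal \<eta>1" using m \<eta>2 by (rule_tac order_trans[OF m]) (auto intro: ennreal_leI)
      finally show ?thesis using True by (simp add: N_def)
    qed (use n in \<open>simp add: N_def\<close>)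
    finally show ?thesis by simp
  qed
  have "approx_kernel \<eta> ?k"
    unfolding approx_kernel_def
  proof (intro conjI allI)
    show "?k \<in> borel_maps" by measurable
    show "0 \<le> ?k z" for z using k0[of z] by (auto simp: indicator_def)
    have "bounded (landau_kernel L N ` (sym_box L :: 'a set))"
      unfolding landau_kernel_def
      by (intro compact_imp_bounded compact_continuous_image continuous_on_tens compact_sym_box
          smooth1_continuous_on smooth1_landau)
    then obtain B where "\<forall>y\<in>landau_kernel L N ` (sym_box L :: 'a set). norm y \<le> B" unfolding bounded_iff by blast
    then have "?k z \<le> max 0 B" for z
      by (cases "z \<in> sym_box L") (auto dest!: bspec abs_le_D1)
    then show "\<exists>C. \<forall>z. ?k z \<le> C" by blast
    show "(LBNN z. ennreal (?k z)) = 1" by (rule int1)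
    have "(LBNN z. ennreal (?k z) * indicator {z. norm z > \<eta>} z)
        \<le> (LBNN z. (\<Sum>b\<in>Basis. ennreal (?k z) * indicator {z. \<bar>z \<bullet> b\<bar> > \<eta>1} z))"
    proof (rule nn_integral_mono)
      fix z :: 'a
      show "ennreal (?k z) * indicator {z. norm z > \<eta>} z \<le> (\<Sum>b\<in>Basis. ennreal (?k z) * indicator {z. \<bar>z \<bullet> b\<bar> > \<eta>1} z)"
      proof (cases "norm z > \<eta>")
        case True
        have "\<exists>b\<in>Basis. \<bar>z \<bullet> b\<bar> > \<eta>1"
        proof (rule ccontr)
          assume "\<not> ?thesis"
          then have "(\<Sum>b\<in>Basis. \<bar>z \<bullet> b\<bar>) \<le> of_nat DIM('a) * \<eta>1" by (intro sum_bounded_above) auto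
          then show False using True norm_le_l1[of z] by (simp add: \<eta>1_def)
        qed
        then obtain b where b: "b \<in> Basis" "\<bar>z \<bullet> b\<bar> > \<eta>1" by blast
        have "ennreal (?k z) * indicator {z. norm z > \<eta>} z = ennreal (?k z) * indicator {z. \<bar>z \<bullet> b\<bar> > \<eta>1} z"
          using True b by simp
        also have "... \<le> (\<Sum>b\<in>Basis. ennreal (?k z) * indicator {z. \<bar>z \<bullet> b\<bar> > \<eta>1} z)"
          using b(1) by (intro member_le_sum) auto
        finally show ?thesis .
      qed simp
    qed
    also have "... = (\<Sum>b\<in>Basis. LBNN z. ennreal (?k z) * indicator {z. \<bar>z \<bullet> b\<bar> > \<eta>1} z)"
      by (intro nn_integral_sum) measurable
    also have "... \<le> (\<Sum>b\<in>(Basis::'a set). ennreal \<eta>1)" by (intro sum_mono tailb)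
    also have "... = ennreal \<eta>" using \<eta> by (simp add: \<eta>1_def ennreal_of_nat_eq_real_of_nat ennreal_mult[symmetric])
    finally show "(LBNN z. ennreal (?k z) * indicator {z. norm z > \<eta>} z) \<le> ennreal \<eta>" .
  qed
  moreover have "(LBNN z. ennreal (\<bar>z \<bullet> d\<bar> * \<bar>tens ((\<lambda>b. landau L (N b))(c := deriv (landau L (N c)))) z\<bar>)
        * indicator (sym_box L) z) \<le> ennreal \<eta>" if c: "c \<in> Basis - D" and d: "d \<in> D" for c d :: 'a
  proof -
    have cd: "c \<noteq> d" "d \<in> Basis" "c \<in> Basis" "N c = n" "N d = m" using c d D by (auto simp: N_def)
    let ?h = "((\<lambda>b s. \<bar>landau L (N b) s\<bar>)(c := \<lambda>s. \<bar>deriv (landau L n) s\<bar>))(d := \<lambda>s. \<bar>s\<bar> * \<bar>landau L m s\<bar>)"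
    have e: "\<bar>z \<bullet> d\<bar> * \<bar>tens ((\<lambda>b. landau L (N b))(c := deriv (landau L (N c)))) z\<bar> = tens ?h z" for z
    proof -
      have "tens ?h z = \<bar>z \<bullet> d\<bar> * (\<bar>landau L m (z \<bullet> d)\<bar> * (\<Prod>b\<in>Basis - {d}. ((\<lambda>b s. \<bar>landau L (N b) s\<bar>)(c := \<lambda>s. \<bar>deriv (landau L n) s\<bar>)) b (z \<bullet> b)))"
        unfolding tens_upd[OF cd(2)] by simp
      also have "\<bar>landau L m (z \<bullet> d)\<bar> * (\<Prod>b\<in>Basis - {d}. ((\<lambda>b s. \<bar>landau L (N b) s\<bar>)(c := \<lambda>s. \<bar>deriv (landau L n) s\<bar>)) b (z \<bullet> b))
         = tens ((\<lambda>b s. \<bar>landau L (N b) s\<bar>)(c := \<lambda>s. \<bar>deriv (landau L n) s\<bar>)) z"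
        using cd by (subst tens_split[OF cd(2)]) auto
      also have "... = \<bar>tens ((\<lambda>b. landau L (N b))(c := deriv (landau L (N c)))) z\<bar>"
        unfolding tens_def abs_prod by (intro prod.cong) (auto simp: cd)
      finally show ?thesis by (rule sym)
    qed
    let ?I = "\<lambda>b. LBNN s. ennreal (?h b s) * indicator {-L..L} s"
    have "(LBNN z. ennreal (tens ?h z) * indicator (sym_box L) z) = (\<Prod>b\<in>Basis. ?I b)"
      by (intro nn_integral_tens_box) auto
    also have "... = ?I d * (?I c * (\<Prod>b\<in>Basis - {d} - {c}. ?I b))"
      using cd by (subst prod.remove[of _ d], simp, simp, subst prod.remove[of _ c]) auto
    also have "(\<Prod>b\<in>Basis - {d} - {c}. ?I b) = 1"
    proof (intro prod.neutral ballI)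
      fix b assume b: "b \<in> Basis - {d} - {c}"
      have "?I b = (LBNN s. ennreal (landau L (N b) s) * indicator {-L..L} s)"
        using landau_nonneg[OF L] b by (intro nn_integral_cong) (auto simp: indicator_def)
      then show "?I b = 1" using landau_integral[OF L] by simp
    qed
    also have "?I d = (LBNN s. ennreal (\<bar>s\<bar> * landau L m s) * indicator {-L..L} s)"
      using landau_nonneg[OF L] by (intro nn_integral_cong) (auto simp: indicator_def)
    also have "?I c = (LBNN s. ennreal \<bar>deriv (landau L n) s\<bar> * indicator {-L..L} s)"
      using cd by (intro nn_integral_cong) auto
    also have "(LBNN s. ennreal (\<bar>s\<bar> * landau L m s) * indicator {-L..L} s) *
        ((LBNN s. ennreal \<bar>deriv (landau L n) s\<bar> * indicator {-L..L} s) * 1) \<le> ennreal (\<eta>2 + L * \<eta>2) * ennreal C"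
      using landau_moment[OF L \<eta>2(1) m] C by (simp add: mult_mono)
    also have "... = ennreal ((\<eta>2 + L * \<eta>2) * C)" using \<eta>2 L C' by (intro ennreal_mult[symmetric]) auto
    also have "... \<le> ennreal \<eta>" using \<eta>2' by (rule ennreal_leI)
    finally show ?thesis unfolding e .
  qed
  ultimately show ?thesis by blast
qed

section \<open>Shallow tanh networks\<close>

text \<open>
  Every derivative of \<open>tanh\<close> is a polynomial in \<open>tanh\<close>, because \<open>tanh' = 1 - tanh\<^sup>2\<close>.  Hence all derivatives
  are bounded, and none vanishes identically.
\<close>

fun tanh_poly :: "nat \<Rightarrow> real poly" where
  "tanh_poly 0 = [:0, 1:]"
| "tanh_poly (Suc k) = pderiv (tanh_poly k) * [:1, 0, -1:]"

definition dtanh :: "nat \<Rightarrow> real \<Rightarrow> real" where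
  "dtanh k s = poly (tanh_poly k) (tanh s)"

lemma dtanh_0 [simp]: "dtanh 0 = tanh"
  by (simp add: dtanh_def[abs_def])

lemma dtanh_DERIV: "(dtanh k has_real_derivative dtanh (Suc k) s) (at s)"
proof -
  have "((\<lambda>s. tanh s) has_real_derivative (1 - (tanh s)\<^sup>2)) (at s)"
    using cosh_real_nonzero[of s] by (auto intro!: derivative_eq_intros)
  from DERIV_chain2[OF poly_DERIV this]
  have "((\<lambda>s. poly (tanh_poly k) (tanh s)) has_real_derivative poly (pderiv (tanh_poly k)) (tanh s) * (1 - (tanh s)\<^sup>2)) (at s)" .
  then show ?thesis by (simp add: dtanh_def[abs_def] power2_eq_square algebra_simps)
qed

lemma dtanh_bounded: "\<exists>C\<ge>0. \<forall>s. \<bar>dtanh k s\<bar> \<le> C"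
proof -
  have "bounded (poly (tanh_poly k) ` {-1..1})"
    by (intro compact_imp_bounded compact_continuous_image continuous_intros) auto
  then obtain C where C: "\<forall>y\<in>poly (tanh_poly k) ` {-1..1}. norm y \<le> C" unfolding bounded_iff by blast
  have "\<bar>dtanh k s\<bar> \<le> C" for s
  proof -
    have "tanh s \<in> {-1..1}" using tanh_real_bounds[of s] by auto
    then show ?thesis using C by (auto simp: dtanh_def)
  qed
  moreover from this[of 0] have "C \<ge> 0" by linarith
  ultimately show ?thesis by blast
qed

lemma degree_tanh_poly: "degree (tanh_poly k) = Suc k"
proof (induction k)
  case (Suc k)
  have "pderiv (tanh_poly k) \<noteq> 0" using Suc by (simp add: pderiv_eq_0_iff)
  then show ?case using Suc by (simp add: degree_mult_eq degree_pderiv del: mult_pCons_right)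
qed simp

lemma dtanh_nonzero: "\<exists>b. dtanh k b \<noteq> 0"
proof (rule ccontr)
  assume "\<not> ?thesis"
  then have "range tanh \<subseteq> {x::real. poly (tanh_poly k) x = 0}" by (auto simp: dtanh_def)
  moreover have "finite {x. poly (tanh_poly k) x = 0}"
    using degree_tanh_poly[of k] by (intro poly_roots_finite) auto
  ultimately have "finite (range (tanh :: real \<Rightarrow> real))" by (rule finite_subset)
  moreover have "inj (tanh :: real \<Rightarrow> real)" by (auto intro!: injI)
  ultimately have "finite (UNIV :: real set)" by (rule finite_imageD)
  then show False using infinite_UNIV_char_0 by blast
qed

type_synonym 'a units = "(real \<times> 'a \<times> real) list"

text \<open>
  A unit \<open>(c, a, b)\<close> computes \<open>c tanh (a \<bullet> p + b)\<close>.  The list \<open>bs\<close> records directions of differentiation,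
  so that all derivatives of a network stay within one family of functions.
\<close>

definition dnet :: "'a::euclidean_space units \<Rightarrow> 'a list \<Rightarrow> 'a \<Rightarrow> real" where
  "dnet L bs p = (\<Sum>(c, a, b)\<leftarrow>L. c * (\<Prod>e\<leftarrow>bs. a \<bullet> e) * dtanh (length bs) (a \<bullet> p + b))"

abbreviation net :: "'a::euclidean_space units \<Rightarrow> 'a \<Rightarrow> real" where
  "net L \<equiv> dnet L []"

lemma dnet_simps [simp]:
  "dnet [] bs p = 0"
  "dnet ((c, a, b) # L) bs p = c * (\<Prod>e\<leftarrow>bs. a \<bullet> e) * dtanh (length bs) (a \<bullet> p + b) + dnet L bs p"
  "dnet (L @ L') bs p = dnet L bs p + dnet L' bs p"
  by (simp_all add: dnet_def)

lemma dnet_line_DERIV: "((\<lambda>s. dnet L bs (p + s *\<^sub>R e)) has_real_derivative dnet L (e # bs) (p + s *\<^sub>R e)) (at s)"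
proof (induction L)
  case (Cons x L)
  obtain c a b where x: "x = (c, a, b)" by (cases x) auto
  have "((\<lambda>s. dtanh (length bs) (a \<bullet> (p + s *\<^sub>R e) + b)) has_real_derivative
      dtanh (Suc (length bs)) (a \<bullet> (p + s *\<^sub>R e) + b) * (a \<bullet> e)) (at s)"
    by (rule DERIV_chain2[OF dtanh_DERIV]) (auto intro!: derivative_eq_intros simp: inner_add_right)
  then have "((\<lambda>s. (c * (\<Prod>e\<leftarrow>bs. a \<bullet> e)) * dtanh (length bs) (a \<bullet> (p + s *\<^sub>R e) + b)) has_real_derivative
      (c * (\<Prod>e\<leftarrow>bs. a \<bullet> e)) * (dtanh (Suc (length bs)) (a \<bullet> (p + s *\<^sub>R e) + b) * (a \<bullet> e))) (at s)"
    by (rule DERIV_cmult)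
  from DERIV_add[OF this Cons.IH] show ?case by (simp add: x algebra_simps)
qed simp

lemma partial_dnet: "partial e (dnet L bs) = dnet L (e # bs)"
proof
  fix p
  show "partial e (dnet L bs) p = dnet L (e # bs) p"
    unfolding partial_def using dnet_line_DERIV[of L bs p e 0] by (intro DERIV_imp_deriv) simp
qed

lemma dnet_differentiable: "dnet L bs differentiable at p"
proof -
  have "(\<lambda>p. dnet L bs p) differentiable at p"
  proof (induction L)
    case (Cons x L)
    obtain c a b where x: "x = (c, a, b)" by (cases x) auto
    have "dtanh (length bs) differentiable at (a \<bullet> p + b)"
      using dtanh_DERIV real_differentiable_def by blast
    moreover have "(\<lambda>p. a \<bullet> p + b) differentiable at p"
      by (intro differentiable_add differentiable_const bounded_linear_imp_differentiable bounded_linear_inner_right)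
    ultimately have "(dtanh (length bs) \<circ> (\<lambda>p. a \<bullet> p + b)) differentiable at p"
      by (intro differentiable_chain_at)
    then show ?case using Cons by (auto simp: x o_def)
  qed simp
  then show ?thesis by simp
qed

lemma smooth_dnet: "smooth (dnet L bs)"
  by (rule smooth_coinduct[where F="range (dnet L)"]) (auto simp: partial_dnet dnet_differentiable)

lemma partials_net: "partials bs (net L) = dnet L bs"
  by (induction bs) (auto simp: partials_def partial_dnet)

text \<open>
  The family \<open>f'\<close> stands for the partial derivatives of \<open>f\<close>, without the claim that it is this family.
  Limits and linear combinations can then be formed before differentiability is known.
\<close>

definition C1_approx :: "('a::euclidean_space \<Rightarrow> real) \<Rightarrow> ('a \<Rightarrow> 'a \<Rightarrow> real) \<Rightarrow> bool" where
  "C1_approx f f' \<longleftrightarrow> (\<forall>S e. compact S \<and> e > 0 \<longrightarrow>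
     (\<exists>L. \<forall>p\<in>S. \<bar>net L p - f p\<bar> \<le> e \<and> (\<forall>c\<in>Basis. \<bar>dnet L [c] p - f' c p\<bar> \<le> e)))"

lemma C1_approxD:
  assumes "C1_approx f f'" "compact S" "e > 0"
  obtains L where "\<And>p. p \<in> S \<Longrightarrow> \<bar>net L p - f p\<bar> \<le> e" "\<And>p c. p \<in> S \<Longrightarrow> c \<in> Basis \<Longrightarrow> \<bar>dnet L [c] p - f' c p\<bar> \<le> e"
proof -
  have "\<exists>L. \<forall>p\<in>S. \<bar>net L p - f p\<bar> \<le> e \<and> (\<forall>c\<in>Basis. \<bar>dnet L [c] p - f' c p\<bar> \<le> e)"
    using assms(1)[unfolded C1_approx_def, rule_format, OF conjI[OF assms(2,3)]] .
  then obtain L where L: "\<forall>p\<in>S. \<bar>net L p - f p\<bar> \<le> e \<and> (\<forall>c\<in>Basis. \<bar>dnet L [c] p - f' c p\<bar> \<le> e)" ..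
  show ?thesis by (rule that[of L]) (use L in auto)
qed

lemma C1_approx_net: "C1_approx (net L) (\<lambda>c. dnet L [c])"
  unfolding C1_approx_def
proof (intro allI impI exI)
  fix S :: "'a set" and e :: real assume "compact S \<and> e > 0"
  then show "\<forall>p\<in>S. \<bar>net L p - net L p\<bar> \<le> e \<and> (\<forall>c\<in>Basis. \<bar>dnet L [c] p - dnet L [c] p\<bar> \<le> e)" by auto
qed

lemma C1_approx_add:
  assumes "C1_approx f f'" "C1_approx g g'"
  shows "C1_approx (\<lambda>p. f p + g p) (\<lambda>c p. f' c p + g' c p)"
  unfolding C1_approx_def
proof (intro allI impI)
  fix S :: "'a set" and e :: real assume S: "compact S \<and> e > 0"
  then have e2: "e/2 > 0" by simp
  obtain L where L: "\<And>p. p \<in> S \<Longrightarrow> \<bar>net L p - f p\<bar> \<le> e/2" "\<And>p c. p \<in> S \<Longrightarrow> c \<in> Basis \<Longrightarrow> \<bar>dnet L [c] p - f' c p\<bar> \<le> e/2"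
    using C1_approxD[OF assms(1) conjunct1[OF S] e2] by blast
  obtain M where M: "\<And>p. p \<in> S \<Longrightarrow> \<bar>net M p - g p\<bar> \<le> e/2" "\<And>p c. p \<in> S \<Longrightarrow> c \<in> Basis \<Longrightarrow> \<bar>dnet M [c] p - g' c p\<bar> \<le> e/2"
    using C1_approxD[OF assms(2) conjunct1[OF S] e2] by blast
  have "\<bar>net (L @ M) p - (f p + g p)\<bar> \<le> e" if "p \<in> S" for p
    using L(1)[OF that] M(1)[OF that] unfolding dnet_simps by linarith
  moreover have "\<bar>dnet (L @ M) [c] p - (f' c p + g' c p)\<bar> \<le> e" if "p \<in> S" "c \<in> Basis" for p c
    using L(2)[OF that] M(2)[OF that] unfolding dnet_simps by linarith
  ultimately show "\<exists>L. \<forall>p\<in>S. \<bar>net L p - (f p + g p)\<bar> \<le> e \<and> (\<forall>c\<in>Basis. \<bar>dnet L [c] p - (f' c p + g' c p)\<bar> \<le> e)"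
    by blast
qed

lemma dnet_scale: "dnet (map (\<lambda>(c, ab). (k * c, ab)) L) bs p = k * dnet L bs p"
  by (induction L) (auto simp: algebra_simps)

lemma C1_approx_cmult:
  assumes "C1_approx f f'"
  shows "C1_approx (\<lambda>p. k * f p) (\<lambda>c p. k * f' c p)"
  unfolding C1_approx_def
proof (intro allI impI)
  fix S :: "'a set" and e :: real assume S: "compact S \<and> e > 0"
  then have e2: "e / (\<bar>k\<bar> + 1) > 0" by (simp add: add_nonneg_pos)
  obtain L where L: "\<And>p. p \<in> S \<Longrightarrow> \<bar>net L p - f p\<bar> \<le> e / (\<bar>k\<bar> + 1)" "\<And>p c. p \<in> S \<Longrightarrow> c \<in> Basis \<Longrightarrow> \<bar>dnet L [c] p - f' c p\<bar> \<le> e / (\<bar>k\<bar> + 1)"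
    using C1_approxD[OF assms(1) conjunct1[OF S] e2] by blast
  have *: "\<bar>k * x - k * y\<bar> \<le> e" if "\<bar>x - y\<bar> \<le> e / (\<bar>k\<bar> + 1)" for x y
  proof -
    have "\<bar>k * x - k * y\<bar> = \<bar>k\<bar> * \<bar>x - y\<bar>" by (simp add: right_diff_distrib[symmetric] abs_mult)
    also have "... \<le> \<bar>k\<bar> * (e / (\<bar>k\<bar> + 1))" using that by (intro mult_left_mono) auto
    also have "... \<le> (\<bar>k\<bar> + 1) * (e / (\<bar>k\<bar> + 1))" using e2 by (intro mult_right_mono) auto
    also have "... = e" by (simp add: add_nonneg_pos[of "\<bar>k\<bar>" 1, THEN less_imp_neq, symmetric])
    finally show ?thesis .
  qed
  show "\<exists>L. \<forall>p\<in>S. \<bar>net L p - k * f p\<bar> \<le> e \<and> (\<forall>c\<in>Basis. \<bar>dnet L [c] p - k * f' c p\<bar> \<le> e)"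
    using L * by (intro exI[of _ "map (\<lambda>(c, ab). (k * c, ab)) L"]) (simp add: dnet_scale)
qed

lemma C1_approx_limit:
  assumes "\<And>S e. compact S \<Longrightarrow> e > 0 \<Longrightarrow> \<exists>g g'. C1_approx g g' \<and>
    (\<forall>p\<in>S. \<bar>g p - f p\<bar> \<le> e \<and> (\<forall>c\<in>Basis. \<bar>g' c p - f' c p\<bar> \<le> e))"
  shows "C1_approx f f'"
  unfolding C1_approx_def
proof (intro allI impI)
  fix S :: "'a set" and e :: real assume S: "compact S \<and> e > 0"
  then have e2: "e/2 > 0" by simp
  obtain g g' where g: "C1_approx g g'" "\<forall>p\<in>S. \<bar>g p - f p\<bar> \<le> e/2 \<and> (\<forall>c\<in>Basis. \<bar>g' c p - f' c p\<bar> \<le> e/2)"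
    using assms[OF conjunct1[OF S] e2] by blast
  obtain L where L: "\<And>p. p \<in> S \<Longrightarrow> \<bar>net L p - g p\<bar> \<le> e/2" "\<And>p c. p \<in> S \<Longrightarrow> c \<in> Basis \<Longrightarrow> \<bar>dnet L [c] p - g' c p\<bar> \<le> e/2"
    using C1_approxD[OF g(1) conjunct1[OF S] e2] by blast
  have "\<bar>net L p - f p\<bar> \<le> e" if "p \<in> S" for p
  proof -
    have "\<bar>g p - f p\<bar> \<le> e/2" using g(2) that by blast
    with L(1)[OF that] show ?thesis by linarith
  qed
  moreover have "\<bar>dnet L [c] p - f' c p\<bar> \<le> e" if "p \<in> S" "c \<in> Basis" for p c
  proof -
    have "\<bar>g' c p - f' c p\<bar> \<le> e/2" using g(2) that by blast
    with L(2)[OF that] show ?thesis by linarith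
  qed
  ultimately show "\<exists>L. \<forall>p\<in>S. \<bar>net L p - f p\<bar> \<le> e \<and> (\<forall>c\<in>Basis. \<bar>dnet L [c] p - f' c p\<bar> \<le> e)" by blast
qed

definition monom_at :: "'a::euclidean_space list \<Rightarrow> 'a \<Rightarrow> real" where
  "monom_at bs p = (\<Prod>c\<leftarrow>bs. p \<bullet> c)"

fun dmonom :: "'a::euclidean_space list \<Rightarrow> 'a \<Rightarrow> 'a \<Rightarrow> real" where
  "dmonom [] c p = 0"
| "dmonom (d # bs) c p = (c \<bullet> d) * monom_at bs p + (p \<bullet> d) * dmonom bs c p"

lemma monom_at_simps [simp]: "monom_at [] p = 1" "monom_at (d # bs) p = (p \<bullet> d) * monom_at bs p"
  "monom_at (bs @ cs) p = monom_at bs p * monom_at cs p"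
  by (simp_all add: monom_at_def)

lemma monom_line_DERIV: "((\<lambda>s. monom_at bs (p + s *\<^sub>R c)) has_real_derivative dmonom bs c (p + s *\<^sub>R c)) (at s)"
proof (induction bs)
  case (Cons d bs)
  have "((\<lambda>s. (p + s *\<^sub>R c) \<bullet> d) has_real_derivative c \<bullet> d) (at s)"
    by (auto intro!: derivative_eq_intros simp: inner_add_left)
  from DERIV_mult[OF this Cons.IH] show ?case by (simp add: algebra_simps)
qed simp

lemma continuous_on_monom: "continuous_on S (monom_at bs)" "continuous_on S (dmonom bs c)"
proof -
  show m: "continuous_on S (monom_at bs)" for bs
    by (induction bs) (auto intro!: continuous_intros)
  show "continuous_on S (dmonom bs c)"
    by (induction bs) (auto intro!: continuous_intros m)
qed

text \<open>
  Taylor estimates, uniform in \<open>s\<close> because the next derivative is bounded.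
\<close>

lemma dtanh_quotient:
  assumes "\<And>s. \<bar>dtanh (Suc (Suc k)) s\<bar> \<le> C" and h: "h > 0"
  shows "\<bar>(dtanh k (s + h * \<tau>) - dtanh k s) / h - \<tau> * dtanh (Suc k) s\<bar> \<le> h * \<tau>\<^sup>2 * C"
    "\<bar>dtanh (Suc k) (s + h * \<tau>) - dtanh (Suc k) s\<bar> \<le> h * \<bar>\<tau>\<bar> * C"
proof -
  have lip: "\<bar>dtanh (Suc k) x - dtanh (Suc k) y\<bar> \<le> C * \<bar>x - y\<bar>" for x y
  proof -
    have "norm (dtanh (Suc k) x - dtanh (Suc k) y) \<le> C * norm (x - y)"
      by (rule field_differentiable_bound[where S=UNIV and f'="dtanh (Suc (Suc k))", OF convex_UNIV
            has_field_derivative_at_within[OF dtanh_DERIV]])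
        (simp_all add: assms(1))
    then show ?thesis by simp
  qed
  show "\<bar>dtanh (Suc k) (s + h * \<tau>) - dtanh (Suc k) s\<bar> \<le> h * \<bar>\<tau>\<bar> * C"
    using lip[of "s + h * \<tau>" s] h by (simp add: abs_mult algebra_simps)
  have "\<bar>(dtanh k (s + h * \<tau>) - (s + h * \<tau>) * dtanh (Suc k) s) - (dtanh k s - s * dtanh (Suc k) s)\<bar> \<le> (C * \<bar>h * \<tau>\<bar>) * \<bar>h * \<tau>\<bar>"
  proof -
    have "norm ((dtanh k (s + h * \<tau>) - (s + h * \<tau>) * dtanh (Suc k) s) - (dtanh k s - s * dtanh (Suc k) s))
       \<le> (C * \<bar>h * \<tau>\<bar>) * norm ((s + h * \<tau>) - s)"
    proof (rule field_differentiable_bound[where S="closed_segment s (s + h * \<tau>)" and f'="\<lambda>x. dtanh (Suc k) x - dtanh (Suc k) s"])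
      fix x assume x: "x \<in> closed_segment s (s + h * \<tau>)"
      show "((\<lambda>x. dtanh k x - x * dtanh (Suc k) s) has_field_derivative dtanh (Suc k) x - dtanh (Suc k) s) (at x within closed_segment s (s + h * \<tau>))"
        by (rule has_field_derivative_at_within) (auto intro!: derivative_eq_intros dtanh_DERIV)
      have "\<bar>x - s\<bar> \<le> \<bar>h * \<tau>\<bar>" using segment_bound1[OF x] by simp
      moreover have "C \<ge> 0" using assms(1)[of 0] by linarith
      ultimately show "norm (dtanh (Suc k) x - dtanh (Suc k) s) \<le> C * \<bar>h * \<tau>\<bar>"
        using lip[of x s] by (simp add: order_trans[OF _ mult_left_mono])
    qed auto
    then show ?thesis by simp
  qed
  also have "(C * \<bar>h * \<tau>\<bar>) * \<bar>h * \<tau>\<bar> = h * \<tau>\<^sup>2 * C * h"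
    using abs_mult_self_eq[of "h * \<tau>"] by (simp add: power2_eq_square)
  finally have X: "\<bar>(dtanh k (s + h * \<tau>) - (s + h * \<tau>) * dtanh (Suc k) s) - (dtanh k s - s * dtanh (Suc k) s)\<bar>
    \<le> h * \<tau>\<^sup>2 * C * h" .
  have e: "(dtanh k (s + h * \<tau>) - dtanh k s) / h - \<tau> * dtanh (Suc k) s
     = ((dtanh k (s + h * \<tau>) - (s + h * \<tau>) * dtanh (Suc k) s) - (dtanh k s - s * dtanh (Suc k) s)) / h"
    using h by (simp add: field_simps)
  show "\<bar>(dtanh k (s + h * \<tau>) - dtanh k s) / h - \<tau> * dtanh (Suc k) s\<bar> \<le> h * \<tau>\<^sup>2 * C"
    unfolding e abs_divide abs_of_pos[OF h] pos_divide_le_eq[OF h] by (rule X)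
qed

text \<open>
  Differentiation of a ridge function in its weight vector produces monomials: the derivative of
  \<open>dtanh k (a \<bullet> p + b)\<close> in \<open>a\<close> along \<open>d\<close> is \<open>(p \<bullet> d) dtanh (k + 1) (a \<bullet> p + b)\<close>.  A difference quotient in
  \<open>a\<close> is a linear combination of two functions that are approximable already, and it converges together
  with the first derivatives in \<open>p\<close>, uniformly on compact sets.
\<close>

lemma C1_approx_monom_ridge:
  "C1_approx (\<lambda>p. monom_at bs p * dtanh (length bs) (a \<bullet> p + b))
     (\<lambda>c p. dmonom bs c p * dtanh (length bs) (a \<bullet> p + b) + monom_at bs p * ((a \<bullet> c) * dtanh (Suc (length bs)) (a \<bullet> p + b)))"
proof (induction bs arbitrary: a b)
  case Nil
  have "net [(1, a, b)] = (\<lambda>p. tanh (a \<bullet> p + b))"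
    "(\<lambda>c. dnet [(1, a, b)] [c]) = (\<lambda>c p. (a \<bullet> c) * dtanh (Suc 0) (a \<bullet> p + b))"
    by (intro ext; simp)+
  then show ?case using C1_approx_net[of "[(1, a, b)]"] by simp
next
  case (Cons d bs)
  define k where "k = length bs"
  define F where "F a p = monom_at bs p * dtanh k (a \<bullet> p + b)" for a p
  define F' where "F' a c p = dmonom bs c p * dtanh k (a \<bullet> p + b) + monom_at bs p * ((a \<bullet> c) * dtanh (Suc k) (a \<bullet> p + b))" for a c p
  have F: "C1_approx (F a) (F' a)" for a using Cons.IH[of a b] by (simp add: F_def[abs_def] F'_def[abs_def] k_def)
  show ?case
  proof (rule C1_approx_limit)
    fix S :: "'a set" and e :: real assume S: "compact S" and e: "e > 0"
    obtain C1 where C1: "C1 \<ge> 0" "\<And>s. \<bar>dtanh (Suc k) s\<bar> \<le> C1" using dtanh_bounded by blast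
    obtain C2 where C2: "C2 \<ge> 0" "\<And>s. \<bar>dtanh (Suc (Suc k)) s\<bar> \<le> C2" using dtanh_bounded by blast
    obtain C3 where C3: "C3 \<ge> 0" "\<And>s. \<bar>dtanh (Suc (Suc (Suc k))) s\<bar> \<le> C3" using dtanh_bounded by blast
    define B where "B p = \<bar>monom_at bs p\<bar> + (\<Sum>c\<in>Basis. \<bar>dmonom bs c p\<bar>) + \<bar>p \<bullet> d\<bar> + (p \<bullet> d)\<^sup>2 + norm a + norm d + 1" for p
    have "bounded (B ` S)" unfolding B_def
      by (intro compact_imp_bounded compact_continuous_image continuous_intros continuous_on_monom S)
    then obtain K where "\<forall>y\<in>B ` S. norm y \<le> K" unfolding bounded_iff by blast
    then have "B p \<le> \<bar>K\<bar>" if "p \<in> S" for p using that by fastforce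
    then obtain M where M: "M \<ge> 1" and BM: "\<And>p. p \<in> S \<Longrightarrow> B p \<le> M" by (metis (no_types) max.cobounded1 max.cobounded2 order_trans)
    have nn: "0 \<le> (\<Sum>c\<in>Basis. \<bar>dmonom bs c p\<bar>)" for p by (intro sum_nonneg) auto
    have b1: "\<bar>monom_at bs p\<bar> \<le> M" "\<bar>p \<bullet> d\<bar> \<le> M" "(p \<bullet> d)\<^sup>2 \<le> M" if "p \<in> S" for p
      using BM[OF that] nn[of p] zero_le_power2[of "p \<bullet> d"] norm_ge_zero[of a] norm_ge_zero[of d]
      unfolding B_def by linarith+
    have b2: "\<bar>dmonom bs c p\<bar> \<le> M" if "p \<in> S" "c \<in> Basis" for p c
    proof -
      have "\<bar>dmonom bs c p\<bar> \<le> (\<Sum>c\<in>Basis. \<bar>dmonom bs c p\<bar>)" using that by (intro member_le_sum) auto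
      then show ?thesis using BM[OF that(1)] zero_le_power2[of "p \<bullet> d"] norm_ge_zero[of a] norm_ge_zero[of d]
        unfolding B_def by linarith
    qed
    \<comment> \<open>The error of the difference quotient and of its derivatives is at most \<open>h * Q\<close> on \<open>S\<close>.\<close>
    define Q where "Q = M * (M * C2) + M * (M * (M * C3) + M * (M * C2)) + 1"
    have Q: "Q > 0" using M C2 C3 by (simp add: Q_def add_nonneg_pos)
    define h where "h = e / Q"
    have h: "h > 0" using e Q by (simp add: h_def)
    define G where "G p = (1/h) * F (a + h *\<^sub>R d) p + (- (1/h)) * F a p" for p
    define G' where "G' c p = (1/h) * F' (a + h *\<^sub>R d) c p + (- (1/h)) * F' a c p" for c p
    have "C1_approx G G'"
      unfolding G_def[abs_def] G'_def[abs_def] by (intro C1_approx_add C1_approx_cmult F)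
    moreover have "\<bar>G p - monom_at (d # bs) p * dtanh (length (d # bs)) (a \<bullet> p + b)\<bar> \<le> e" if p: "p \<in> S" for p
    proof -
      define s where "s = a \<bullet> p + b"
      define \<tau> where "\<tau> = p \<bullet> d"
      have sh: "(a + h *\<^sub>R d) \<bullet> p + b = s + h * \<tau>" unfolding s_def \<tau>_def by (simp add: inner_add_left inner_commute[of d p])
      have "G p - monom_at (d # bs) p * dtanh (length (d # bs)) (a \<bullet> p + b)
        = monom_at bs p * ((dtanh k (s + h * \<tau>) - dtanh k s) / h - \<tau> * dtanh (Suc k) s)"
        unfolding G_def F_def sh monom_at_simps s_def[symmetric] \<tau>_def[symmetric] using h by (simp add: k_def field_simps)
      also have "\<bar>...\<bar> \<le> M * (h * \<tau>\<^sup>2 * C2)"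
        unfolding abs_mult using b1(1)[OF p] dtanh_quotient(1)[OF C2(2) h, of s \<tau>] M
        by (intro mult_mono) auto
      also have "... \<le> M * (h * M * C2)"
        using b1(3)[OF p] M h C2 by (intro mult_left_mono mult_right_mono) (auto simp: \<tau>_def)
      also have "... = h * (M * (M * C2))" by simp
      also have "... \<le> h * Q" using h M C2 C3 by (intro mult_left_mono) (auto simp: Q_def)
      also have "... = e" using Q by (simp add: h_def)
      finally show ?thesis .
    qed
    moreover have "\<bar>G' c p - (dmonom (d # bs) c p * dtanh (length (d # bs)) (a \<bullet> p + b)
         + monom_at (d # bs) p * ((a \<bullet> c) * dtanh (Suc (length (d # bs))) (a \<bullet> p + b)))\<bar> \<le> e"
      if p: "p \<in> S" and c: "c \<in> Basis" for c p
    proof -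
      define s where "s = a \<bullet> p + b"
      define \<tau> where "\<tau> = p \<bullet> d"
      have sh: "(a + h *\<^sub>R d) \<bullet> p + b = s + h * \<tau>" unfolding s_def \<tau>_def by (simp add: inner_add_left inner_commute[of d p])
      let ?A = "(dtanh k (s + h * \<tau>) - dtanh k s) / h - \<tau> * dtanh (Suc k) s"
      let ?B = "(dtanh (Suc k) (s + h * \<tau>) - dtanh (Suc k) s) / h - \<tau> * dtanh (Suc (Suc k)) s"
      let ?C = "dtanh (Suc k) (s + h * \<tau>) - dtanh (Suc k) s"
      have e1: "G' c p - (dmonom (d # bs) c p * dtanh (length (d # bs)) (a \<bullet> p + b)
         + monom_at (d # bs) p * ((a \<bullet> c) * dtanh (Suc (length (d # bs))) (a \<bullet> p + b)))
        = dmonom bs c p * ?A + monom_at bs p * ((a \<bullet> c) * ?B + (c \<bullet> d) * ?C)"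
        unfolding G'_def F'_def sh monom_at_simps dmonom.simps s_def[symmetric] \<tau>_def[symmetric] list.size
        unfolding inner_add_left inner_scaleR_left inner_commute[of d c]
        using h by (simp add: k_def[symmetric] field_simps)
      have t2: "\<tau>\<^sup>2 \<le> M" "\<bar>\<tau>\<bar> \<le> M" using b1[OF p] by (auto simp: \<tau>_def)
      have A: "\<bar>?A\<bar> \<le> h * (M * C2)"
      proof -
        have "h * \<tau>\<^sup>2 * C2 \<le> h * M * C2" using t2 h C2 by (intro mult_left_mono mult_right_mono) auto
        then show ?thesis using dtanh_quotient(1)[OF C2(2) h, of s \<tau>] by (simp add: mult.assoc)
      qed
      have B: "\<bar>?B\<bar> \<le> h * (M * C3)"
      proof -
        have "h * \<tau>\<^sup>2 * C3 \<le> h * M * C3" using t2 h C3 by (intro mult_left_mono mult_right_mono) auto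
        then show ?thesis using dtanh_quotient(1)[OF C3(2) h, of s \<tau>] by (simp add: mult.assoc)
      qed
      have C: "\<bar>?C\<bar> \<le> h * (M * C2)"
      proof -
        have "h * \<bar>\<tau>\<bar> * C2 \<le> h * M * C2" using t2 h C2 by (intro mult_left_mono mult_right_mono) auto
        then show ?thesis using dtanh_quotient(2)[OF C2(2) h, of s \<tau>] by (simp add: mult.assoc)
      qed
      have ac: "\<bar>a \<bullet> c\<bar> \<le> M" "\<bar>c \<bullet> d\<bar> \<le> M"
      proof -
        have "norm a \<le> M" "norm d \<le> M"
          using BM[OF p] nn[of p] zero_le_power2[of "p \<bullet> d"] abs_ge_zero[of "monom_at bs p"] abs_ge_zero[of "p \<bullet> d"]
            norm_ge_zero[of a] norm_ge_zero[of d]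
          unfolding B_def by linarith+
        then show "\<bar>a \<bullet> c\<bar> \<le> M" "\<bar>c \<bullet> d\<bar> \<le> M"
          using Basis_le_norm[OF c, of a] Basis_le_norm[OF c, of d] by (auto simp: inner_commute)
      qed
      have "\<bar>dmonom bs c p * ?A + monom_at bs p * ((a \<bullet> c) * ?B + (c \<bullet> d) * ?C)\<bar>
        \<le> \<bar>dmonom bs c p\<bar> * \<bar>?A\<bar> + \<bar>monom_at bs p\<bar> * (\<bar>a \<bullet> c\<bar> * \<bar>?B\<bar> + \<bar>c \<bullet> d\<bar> * \<bar>?C\<bar>)"
        unfolding abs_mult[symmetric]
        by (rule order_trans[OF abs_triangle_ineq])
          (simp add: abs_mult, intro mult_left_mono order_trans[OF abs_triangle_ineq]; simp add: abs_mult)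
      also have "... \<le> M * (h * (M * C2)) + M * (M * (h * (M * C3)) + M * (h * (M * C2)))"
        using M
        by (intro add_mono mult_mono[OF b2[OF p c] A] mult_mono[OF b1(1)[OF p]] mult_mono[OF ac(1) B] mult_mono[OF ac(2) C])
          (simp_all add: add_nonneg_nonneg)
      also have "... \<le> h * Q" using h by (simp add: Q_def algebra_simps)
      also have "... = e" using Q by (simp add: h_def)
      finally show ?thesis unfolding e1 .
    qed
    ultimately show "\<exists>g g'. C1_approx g g' \<and> (\<forall>p\<in>S. \<bar>g p - monom_at (d # bs) p * dtanh (length (d # bs)) (a \<bullet> p + b)\<bar> \<le> e \<and>
        (\<forall>c\<in>Basis. \<bar>g' c p - (dmonom (d # bs) c p * dtanh (length (d # bs)) (a \<bullet> p + b)
         + monom_at (d # bs) p * ((a \<bullet> c) * dtanh (Suc (length (d # bs))) (a \<bullet> p + b)))\<bar> \<le> e))"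
      by (intro exI[of _ G] exI[of _ G']) auto
  qed
qed

text \<open>
  With the weight vector \<open>0\<close> the ridge function is a constant, and some bias makes this constant nonzero.
\<close>

lemma C1_approx_monom: "C1_approx (monom_at bs) (dmonom bs)"
proof -
  obtain b where b: "dtanh (length bs) b \<noteq> 0" using dtanh_nonzero by blast
  from C1_approx_cmult[OF C1_approx_monom_ridge[of bs 0 b], of "1 / dtanh (length bs) b"]
  show ?thesis using b by simp
qed

section \<open>Polynomial kernels\<close>

text \<open>
  A polynomial in \<open>p\<close> whose coefficients are continuous functions of \<open>z\<close>, given by its list of terms.
\<close>

definition sepsum :: "('a::euclidean_space list \<times> ('a \<Rightarrow> real)) list \<Rightarrow> 'a \<Rightarrow> 'a \<Rightarrow> real" where
  "sepsum M p z = (\<Sum>(bs, \<beta>)\<leftarrow>M. monom_at bs p * \<beta> z)"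

definition sep :: "('a::euclidean_space \<Rightarrow> 'a \<Rightarrow> real) \<Rightarrow> bool" where
  "sep q \<longleftrightarrow> (\<exists>M. (\<forall>x\<in>set M. continuous_on UNIV (snd x)) \<and> q = sepsum M)"

lemma sepsum_simps [simp]:
  "sepsum [] p z = 0"
  "sepsum (x # M) p z = monom_at (fst x) p * snd x z + sepsum M p z"
  "sepsum (M @ M') p z = sepsum M p z + sepsum M' p z"
  by (simp_all add: sepsum_def case_prod_beta)

lemma sepI: "(\<forall>x\<in>set M. continuous_on UNIV (snd x)) \<Longrightarrow> (\<And>p z. q p z = sepsum M p z) \<Longrightarrow> sep q"
  unfolding sep_def by (intro exI[of _ M] conjI ext) auto

lemma sep_const: "sep (\<lambda>p z. c)"
  by (rule sepI[of "[([], \<lambda>z. c)]"]) auto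

lemma sep_coord: "sep (\<lambda>p z. (p - z) \<bullet> b)"
  by (rule sepI[of "[([b], \<lambda>z. 1), ([], \<lambda>z. - (z \<bullet> b))]"]) (auto intro!: continuous_intros simp: inner_diff_left)

lemma sep_add:
  assumes "sep q" "sep r" shows "sep (\<lambda>p z. q p z + r p z)"
proof -
  obtain M where M: "\<forall>x\<in>set M. continuous_on UNIV (snd x)" "q = sepsum M" using assms(1) unfolding sep_def by blast
  obtain M' where M': "\<forall>x\<in>set M'. continuous_on UNIV (snd x)" "r = sepsum M'" using assms(2) unfolding sep_def by blast
  show ?thesis by (rule sepI[of "M @ M'"]) (use M M' in auto)
qed

lemma sep_mult:
  assumes "sep q" "sep r" shows "sep (\<lambda>p z. q p z * r p z)"
proof -
  obtain M where M: "\<forall>x\<in>set M. continuous_on UNIV (snd x)" "q = sepsum M" using assms(1) unfolding sep_def by blast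
  obtain M' where M': "\<forall>x\<in>set M'. continuous_on UNIV (snd x)" "r = sepsum M'" using assms(2) unfolding sep_def by blast
  have 1: "sepsum (map (\<lambda>y. (bs @ fst y, \<lambda>z. \<beta> z * snd y z)) M') p z = monom_at bs p * \<beta> z * sepsum M' p z" for bs \<beta> p z
    by (induction M') (auto simp: algebra_simps)
  have 2: "sepsum (concat (map (\<lambda>x. map (\<lambda>y. (fst x @ fst y, \<lambda>z. snd x z * snd y z)) M') M)) p z = sepsum M p z * sepsum M' p z" for p z
    by (induction M) (auto simp: algebra_simps 1)
  show ?thesis
    by (rule sepI[of "concat (map (\<lambda>x. map (\<lambda>y. (fst x @ fst y, \<lambda>z. snd x z * snd y z)) M') M)"])
      (use M M' 2 in \<open>auto intro!: continuous_on_mult\<close>)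
qed

lemma sep_power: "sep q \<Longrightarrow> sep (\<lambda>p z. q p z ^ n)"
  by (induction n) (auto intro: sep_const sep_mult)

lemma sep_prod: "finite B \<Longrightarrow> (\<And>b. b \<in> B \<Longrightarrow> sep (q b)) \<Longrightarrow> sep (\<lambda>p z. \<Prod>b\<in>B. q b p z)"
  by (induction B rule: finite_induct) (auto intro: sep_const sep_mult)

lemma sep_landau_kernel: "sep (\<lambda>p z. landau_kernel L N (p - z))"
proof -
  have "sep (\<lambda>p z. \<Prod>b\<in>Basis. (1 / landau_mass L (N b)) * (1 + (- 1 / L\<^sup>2) * ((p - z) \<bullet> b) ^ 2) ^ N b)"
    by (intro sep_prod sep_mult sep_const sep_power sep_add sep_coord) auto
  then show ?thesis
    by (simp add: landau_kernel_def[abs_def] tens_def landau_def power_divide)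
qed

lemma C1_approx_cong:
  assumes "C1_approx f f'" "\<And>p. f p = g p" "\<And>c p. c \<in> Basis \<Longrightarrow> f' c p = g' c p"
  shows "C1_approx g g'"
proof (rule C1_approx_limit)
  fix S :: "'a set" and e :: real assume "compact S" "e > 0"
  then have "C1_approx f f' \<and> (\<forall>p\<in>S. \<bar>f p - g p\<bar> \<le> e \<and> (\<forall>c\<in>Basis. \<bar>f' c p - g' c p\<bar> \<le> e))"
    using assms by auto
  then show "\<exists>h h'. C1_approx h h' \<and> (\<forall>p\<in>S. \<bar>h p - g p\<bar> \<le> e \<and> (\<forall>c\<in>Basis. \<bar>h' c p - g' c p\<bar> \<le> e))" by blast
qed

definition dsepsum :: "('a::euclidean_space list \<times> ('a \<Rightarrow> real)) list \<Rightarrow> 'a \<Rightarrow> 'a \<Rightarrow> 'a \<Rightarrow> real" where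
  "dsepsum M c p z = (\<Sum>x\<leftarrow>M. dmonom (fst x) c p * snd x z)"

text \<open>
  Integration against \<open>w\<close> turns the coefficients into numbers, and the result is a polynomial in \<open>p\<close>; the
  same holds for the derivative of the kernel.
\<close>

lemma C1_approx_sep_integral:
  assumes "sep q" and int: "\<And>\<beta>. continuous_on UNIV \<beta> \<Longrightarrow> integrable lborel (\<lambda>z. w z * \<beta> z)"
    and der: "\<And>p c z. c \<in> Basis \<Longrightarrow> ((\<lambda>s. q (p + s *\<^sub>R c) z) has_real_derivative q' c p z) (at 0)"
  shows "C1_approx (\<lambda>p. LBINT z. w z * q p z) (\<lambda>c p. LBINT z. w z * q' c p z)"
proof -
  obtain M where M: "\<forall>x\<in>set M. continuous_on UNIV (snd x)" "q = sepsum M" using assms(1) unfolding sep_def by blast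
  have "((\<lambda>s. sepsum M (p + s *\<^sub>R c) z) has_real_derivative dsepsum M c (p + s *\<^sub>R c) z) (at s)" for M c p z s
    unfolding sepsum_def dsepsum_def case_prod_beta
  proof (induction M)
    case (Cons x M)
    from DERIV_add[OF DERIV_cmult_right[OF monom_line_DERIV[of "fst x" p c s], of "snd x z"] Cons.IH]
    show ?case by simp
  qed simp
  from this[of M p c z 0 for p c z] have "((\<lambda>s. q (p + s *\<^sub>R c) z) has_real_derivative dsepsum M c p z) (at 0)" for p c z
    by (simp add: M(2))
  then have q': "q' c p z = dsepsum M c p z" if "c \<in> Basis" for c p z
    using der[OF that] DERIV_unique by blast
  have sc: "continuous_on UNIV (sepsum M p)" "continuous_on UNIV (dsepsum M c p)" if "\<forall>x\<in>set M. continuous_on UNIV (snd x)" for M p c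
  proof -
    have "continuous_on UNIV (\<lambda>z. sepsum M p z)" "continuous_on UNIV (\<lambda>z. dsepsum M c p z)"
      using that unfolding dsepsum_def by (induction M) (auto intro!: continuous_intros)
    then show "continuous_on UNIV (sepsum M p)" "continuous_on UNIV (dsepsum M c p)" by simp_all
  qed
  have "C1_approx (\<lambda>p. LBINT z. w z * sepsum M p z) (\<lambda>c p. LBINT z. w z * dsepsum M c p z)"
    using M(1)
  proof (induction M)
    case Nil
    have "net ([] :: 'a units) = (\<lambda>p. 0)" "(\<lambda>c. dnet ([] :: 'a units) [c]) = (\<lambda>c p. 0)" by (intro ext; simp)+
    then have "C1_approx (\<lambda>p::'a. 0) (\<lambda>c p. 0)" using C1_approx_net[of "[] :: 'a units"] by simp
    then show ?case by (simp add: dsepsum_def)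
  next
    case (Cons x M)
    have 1: "(LBINT z. w z * sepsum (x # M) p z) = (LBINT z. w z * snd x z) * monom_at (fst x) p + (LBINT z. w z * sepsum M p z)" for p
    proof -
      have "(LBINT z. w z * sepsum (x # M) p z) = (LBINT z. monom_at (fst x) p * (w z * snd x z) + w z * sepsum M p z)"
        by (intro Bochner_Integration.integral_cong) (auto simp: algebra_simps)
      also have "... = (LBINT z. monom_at (fst x) p * (w z * snd x z)) + (LBINT z. w z * sepsum M p z)"
        using Cons.prems by (intro Bochner_Integration.integral_add Bochner_Integration.integrable_mult_right int sc) auto
      finally show ?thesis by simp
    qed
    have 2: "(LBINT z. w z * dsepsum (x # M) c p z) = (LBINT z. w z * snd x z) * dmonom (fst x) c p + (LBINT z. w z * dsepsum M c p z)" for c p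
    proof -
      have "(LBINT z. w z * dsepsum (x # M) c p z) = (LBINT z. dmonom (fst x) c p * (w z * snd x z) + w z * dsepsum M c p z)"
        by (intro Bochner_Integration.integral_cong) (auto simp: algebra_simps dsepsum_def)
      also have "... = (LBINT z. dmonom (fst x) c p * (w z * snd x z)) + (LBINT z. w z * dsepsum M c p z)"
        using Cons.prems by (intro Bochner_Integration.integral_add Bochner_Integration.integrable_mult_right int sc) auto
      finally show ?thesis by simp
    qed
    show ?case unfolding 1 2
      using Cons by (intro C1_approx_add C1_approx_cmult C1_approx_monom) auto
  qed
  then show ?thesis by (rule C1_approx_cong) (auto simp: M(2) q')
qed

section \<open>Mollifying the transport equation\<close>

abbreviation e_t :: phase where "e_t \<equiv> (1, 0, 0)"
abbreviation e_x :: "3 \<Rightarrow> phase" where "e_x j \<equiv> (0, axis j 1, 0)"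
abbreviation e_v :: "3 \<Rightarrow> phase" where "e_v j \<equiv> (0, 0, axis j 1)"

lemma phase_Basis: "(Basis :: phase set) = {e_t} \<union> range e_x \<union> range e_v"
  by (auto simp: Basis_prod_def Basis_vec_def image_iff zero_prod_def)

lemma phase_Basis_mem [simp]: "e_t \<in> Basis" "e_x j \<in> Basis" "e_v j \<in> Basis"
  by (auto simp: phase_Basis)

lemma phase_basis_distinct [simp]:
  "e_t \<noteq> e_x j" "e_t \<noteq> e_v j" "e_x i \<noteq> e_v j" "e_x j \<noteq> e_t" "e_v j \<noteq> e_t" "e_v j \<noteq> e_x i"
  by (auto simp: axis_eq_0_iff)

definition dlandau_kernel :: "real \<Rightarrow> ('a \<Rightarrow> nat) \<Rightarrow> 'a \<Rightarrow> 'a::euclidean_space \<Rightarrow> real" where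
  "dlandau_kernel L N c = tens ((\<lambda>b. landau L (N b))(c := deriv (landau L (N c))))"

lemma continuous_on_landau_kernel:
  "continuous_on S (landau_kernel L N)" "continuous_on S (dlandau_kernel L N c)"
  unfolding landau_kernel_def dlandau_kernel_def
  by (intro continuous_on_tens; auto intro!: smooth1_continuous_on smooth1_landau smooth1_deriv)+

lemma landau_kernel_line_DERIV:
  assumes "c \<in> Basis"
  shows "((\<lambda>s. landau_kernel L N ((p + s *\<^sub>R c) - z)) has_real_derivative dlandau_kernel L N c (p - z)) (at 0)"
  using tens_line_DERIV[OF assms, of "\<lambda>b. landau L (N b)" "deriv (landau L (N c))" "p - z" 0]
    smooth1_DERIV[OF smooth1_landau, of L "N c"]
  by (simp add: landau_kernel_def dlandau_kernel_def algebra_simps)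

lemma tens_times: "tens h p * tens k p = tens (\<lambda>b s. h b s * k b s) p"
  by (simp add: tens_def prod.distrib)

text \<open>
  A derivative of the kernel in \<open>p\<close> is minus a derivative in \<open>z\<close>, so the weak derivative of \<open>u\<close> can be
  tested with the product of the cut-off and the kernel; both are tensor products.
\<close>

lemma weak_conv:
  fixes u g :: "'a::euclidean_space \<Rightarrow> real"
  assumes w: "weak_deriv \<Omega> {#c#} u g" and c: "c \<in> Basis"
    and h: "\<And>b. b \<in> Basis \<Longrightarrow> smooth1 (\<chi>' b)"
    and z: "\<And>b s. b \<in> Basis \<Longrightarrow> s \<notin> {l \<bullet> b..r \<bullet> b} \<Longrightarrow> \<chi>' b s = 0" and \<Omega>: "cbox l r \<subseteq> \<Omega>"
  shows "(LBINT z:cbox l r. u z * tens \<chi>' z * dlandau_kernel L N c (p - z))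
    = (LBINT z:cbox l r. u z * tens (\<chi>'(c := deriv (\<chi>' c))) z * landau_kernel L N (p - z))
    + (LBINT z:cbox l r. g z * tens \<chi>' z * landau_kernel L N (p - z))"
proof -
  define h where "h b s = \<chi>' b s * landau L (N b) ((-1) * s + p \<bullet> b)" for b s
  have sh: "smooth1 (h b)" if "b \<in> Basis" for b
    unfolding h_def by (intro smooth1_mult h that smooth1_affine smooth1_landau)
  have zh: "h b s = 0" if "b \<in> Basis" "s \<notin> {l \<bullet> b..r \<bullet> b}" for b s
    using z[OF that] by (simp add: h_def)
  have k: "landau_kernel L N (p - z) = tens (\<lambda>b s. landau L (N b) ((-1) * s + p \<bullet> b)) z" for z
    by (simp add: landau_kernel_def tens_def inner_diff_left algebra_simps)
  have th: "tens h z = tens \<chi>' z * landau_kernel L N (p - z)" for z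
    by (simp add: k tens_times h_def[abs_def])
  have dhc: "deriv (h c) s = deriv (\<chi>' c) s * landau L (N c) ((-1) * s + p \<bullet> c)
      - \<chi>' c s * deriv (landau L (N c)) ((-1) * s + p \<bullet> c)" for s
  proof (rule DERIV_imp_deriv)
    have "((\<lambda>s. landau L (N c) ((-1) * s + p \<bullet> c)) has_real_derivative deriv (landau L (N c)) ((-1) * s + p \<bullet> c) * (-1)) (at s)"
      by (rule DERIV_chain2[OF smooth1_DERIV[OF smooth1_landau]]) (auto intro!: derivative_eq_intros)
    note d = DERIV_mult[OF smooth1_DERIV[OF h[OF c]] this]
    have "h c = (\<lambda>s. \<chi>' c s * landau L (N c) ((-1) * s + p \<bullet> c))" by (simp add: h_def[abs_def])
    then show "(h c has_real_derivative deriv (\<chi>' c) s * landau L (N c) ((-1) * s + p \<bullet> c)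
      - \<chi>' c s * deriv (landau L (N c)) ((-1) * s + p \<bullet> c)) (at s)"
      by (simp only:) (rule DERIV_cong[OF d], simp add: algebra_simps)
  qed
  have dh: "(\<lambda>b. (deriv ^^ count {#c#} b) (h b)) = h(c := deriv (h c))" by auto
  have tdh: "tens (h(c := deriv (h c))) z = tens (\<chi>'(c := deriv (\<chi>' c))) z * landau_kernel L N (p - z)
      - tens \<chi>' z * dlandau_kernel L N c (p - z)" for z
  proof -
    have r: "(\<Prod>b\<in>Basis - {c}. h b (z \<bullet> b)) = (\<Prod>b\<in>Basis - {c}. \<chi>' b (z \<bullet> b)) * (\<Prod>b\<in>Basis - {c}. landau L (N b) ((p - z) \<bullet> b))"
      by (simp add: h_def prod.distrib inner_diff_left algebra_simps)
    show ?thesis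
      unfolding landau_kernel_def dlandau_kernel_def tens_upd[OF c] tens_split[OF c, of \<chi>'] tens_split[OF c, of "\<lambda>b. landau L (N b)"] r dhc
      by (simp add: inner_diff_left algebra_simps)
  qed
  have si: "set_integrable lborel (cbox l r) u" "set_integrable lborel (cbox l r) g"
    using weak_deriv_set_integrable[OF w compact_cbox \<Omega>] .
  have ck: "continuous_on S (\<lambda>z. landau_kernel L N (p - z))" "continuous_on S (\<lambda>z. dlandau_kernel L N c (p - z))" for S
    by (rule continuous_on_compose2[OF continuous_on_landau_kernel(1)[of UNIV]], auto intro!: continuous_intros)
       (rule continuous_on_compose2[OF continuous_on_landau_kernel(2)[of UNIV]], auto intro!: continuous_intros)
  have cc: "continuous_on S (tens \<chi>')" "continuous_on S (tens (\<chi>'(c := deriv (\<chi>' c))))" for S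
    using h c by (auto intro!: continuous_on_tens smooth1_continuous_on smooth1_deriv)
  have i1: "set_integrable lborel (cbox l r) (\<lambda>z. u z * (tens (\<chi>'(c := deriv (\<chi>' c))) z * landau_kernel L N (p - z)))"
    and i2: "set_integrable lborel (cbox l r) (\<lambda>z. u z * (tens \<chi>' z * dlandau_kernel L N c (p - z)))"
    by (intro set_integrable_times_continuous si compact_cbox continuous_on_mult ck cc)+
  have "(LBINT z:cbox l r. u z * tens (h(c := deriv (h c))) z) = (-1) ^ size {#c#} * (LBINT z:cbox l r. g z * tens h z)"
    using weak_deriv_tens[of \<Omega> "{#c#}" u g h l r, OF w _ sh zh \<Omega>] c unfolding dh by simp
  also have "(LBINT z:cbox l r. u z * tens (h(c := deriv (h c))) z)
     = (LBINT z:cbox l r. u z * (tens (\<chi>'(c := deriv (\<chi>' c))) z * landau_kernel L N (p - z)) - u z * (tens \<chi>' z * dlandau_kernel L N c (p - z)))"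
    by (simp add: tdh algebra_simps)
  also have "... = (LBINT z:cbox l r. u z * (tens (\<chi>'(c := deriv (\<chi>' c))) z * landau_kernel L N (p - z)))
     - (LBINT z:cbox l r. u z * (tens \<chi>' z * dlandau_kernel L N c (p - z)))"
    by (rule set_integral_diff[OF i1 i2])
  finally show ?thesis by (simp add: th mult.assoc)
qed

text \<open>
  The transport operator \<open>\<partial>\<^sub>t + \<xi> \<bullet> \<nabla>\<^sub>x\<close> applied to the cut-off function.
\<close>

definition transport_cutoff :: "(phase \<Rightarrow> real \<Rightarrow> real) \<Rightarrow> phase \<Rightarrow> real" where
  "transport_cutoff \<chi>' z = tens (\<chi>'(e_t := deriv (\<chi>' e_t))) z
     + (\<Sum>j\<in>UNIV. (z \<bullet> e_v j) * tens (\<chi>'(e_x j := deriv (\<chi>' (e_x j)))) z)"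

text \<open>
  The transport derivative of the mollified function is the mollified transport derivative, up to a
  term where the cut-off function is differentiated and a commutator.  The commutator arises because the
  velocity at \<open>p\<close> multiplies the derivative of the kernel in place of the velocity at \<open>z\<close>.
\<close>

lemma transport_conv:
  fixes u ut :: "phase \<Rightarrow> real" and ux :: "phase \<Rightarrow> real^3" and L :: real and N :: "phase \<Rightarrow> nat"
  assumes wt: "weak_deriv \<Omega> {#e_t#} u ut" and wx: "\<And>j. weak_deriv \<Omega> {#e_x j#} u (\<lambda>p. ux p $ j)"
    and h: "\<And>b. b \<in> Basis \<Longrightarrow> smooth1 (\<chi>' b)"
    and z: "\<And>b s. b \<in> Basis \<Longrightarrow> s \<notin> {l \<bullet> b..r \<bullet> b} \<Longrightarrow> \<chi>' b s = 0" and \<Omega>: "cbox l r \<subseteq> \<Omega>"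
  defines "dP c p \<equiv> (LBINT z:cbox l r. u z * tens \<chi>' z * dlandau_kernel L N c (p - z))"
  shows "dP e_t p + (\<Sum>j\<in>UNIV. (p \<bullet> e_v j) * dP (e_x j) p)
    = (LBINT z:cbox l r. (ut z + (\<Sum>j\<in>UNIV. (z \<bullet> e_v j) * ux z $ j)) * tens \<chi>' z * landau_kernel L N (p - z))
    + (LBINT z:cbox l r. u z * transport_cutoff \<chi>' z * landau_kernel L N (p - z))
    + (\<Sum>j\<in>UNIV. LBINT z:cbox l r. u z * tens \<chi>' z * (((p - z) \<bullet> e_v j) * dlandau_kernel L N (e_x j) (p - z)))"
proof -
  define X where "X j = \<chi>'(e_v j := \<lambda>s. s * \<chi>' (e_v j) s)" for j
  have X: "tens (X j) z = (z \<bullet> e_v j) * tens \<chi>' z" for j z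
    unfolding X_def tens_upd[OF phase_Basis_mem(3)] tens_split[OF phase_Basis_mem(3)[of j], of \<chi>'] by simp
  have dX: "tens ((X j)(e_x j := deriv (X j (e_x j)))) z = (z \<bullet> e_v j) * tens (\<chi>'(e_x j := deriv (\<chi>' (e_x j)))) z" for j z
  proof -
    have "(X j)(e_x j := deriv (X j (e_x j))) = (\<chi>'(e_x j := deriv (\<chi>' (e_x j))))(e_v j := \<lambda>s. s * (\<chi>'(e_x j := deriv (\<chi>' (e_x j)))) (e_v j) s)"
      by (auto simp: X_def fun_eq_iff)
    then show ?thesis
      by (simp only: tens_upd[OF phase_Basis_mem(3)] tens_split[OF phase_Basis_mem(3)[of j], of "\<chi>'(e_x j := deriv (\<chi>' (e_x j)))"])
  qed
  have sX: "smooth1 (X j b)" if "b \<in> Basis" for j b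
    using h[OF that] by (auto simp: X_def intro!: smooth1_mult smooth1_ident)
  have zX: "X j b s = 0" if "b \<in> Basis" "s \<notin> {l \<bullet> b..r \<bullet> b}" for j b s
    using z[OF that] by (auto simp: X_def)
  let ?k = "\<lambda>z. landau_kernel L N (p - z)"
  have t: "dP e_t p = (LBINT z:cbox l r. u z * tens (\<chi>'(e_t := deriv (\<chi>' e_t))) z * ?k z) + (LBINT z:cbox l r. ut z * tens \<chi>' z * ?k z)"
    unfolding dP_def by (rule weak_conv[OF wt _ h z \<Omega>]) auto
  have x: "(LBINT z:cbox l r. u z * ((z \<bullet> e_v j) * tens \<chi>' z) * dlandau_kernel L N (e_x j) (p - z))
     = (LBINT z:cbox l r. u z * ((z \<bullet> e_v j) * tens (\<chi>'(e_x j := deriv (\<chi>' (e_x j)))) z) * ?k z)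
      + (LBINT z:cbox l r. ux z $ j * ((z \<bullet> e_v j) * tens \<chi>' z) * ?k z)" for j
    using weak_conv[of \<Omega> "e_x j" u "\<lambda>p. ux p $ j" "X j" l r L N p, OF wx _ sX zX \<Omega>]
    by (simp only: X dX phase_Basis_mem simp_thms)
  have sit: "set_integrable lborel (cbox l r) u" "set_integrable lborel (cbox l r) ut"
    using weak_deriv_set_integrable[OF wt compact_cbox \<Omega>] .
  have six: "set_integrable lborel (cbox l r) (\<lambda>p. ux p $ j)" for j
    using weak_deriv_set_integrable(2)[OF wx compact_cbox \<Omega>] .
  have ck: "continuous_on S ?k" "continuous_on S (\<lambda>z. dlandau_kernel L N c (p - z))" for S c
    by (rule continuous_on_compose2[OF continuous_on_landau_kernel(1)[of UNIV]], auto intro!: continuous_intros)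
       (rule continuous_on_compose2[OF continuous_on_landau_kernel(2)[of UNIV]], auto intro!: continuous_intros)
  have cc: "continuous_on S (tens \<chi>')" "c \<in> Basis \<Longrightarrow> continuous_on S (tens (\<chi>'(c := deriv (\<chi>' c))))" for S c
    using h by (auto intro!: continuous_on_tens smooth1_continuous_on smooth1_deriv)
  have I: "set_integrable lborel (cbox l r) (\<lambda>z. f z * k z)" if "set_integrable lborel (cbox l r) f" "continuous_on (cbox l r) k" for f k :: "phase \<Rightarrow> real"
    using set_integrable_times_continuous[OF that(1) compact_cbox that(2)] .
  note ci = continuous_on_mult continuous_on_diff continuous_intros ck cc
  have comm: "(p \<bullet> e_v j) * dP (e_x j) p = (LBINT z:cbox l r. u z * ((z \<bullet> e_v j) * tens \<chi>' z) * dlandau_kernel L N (e_x j) (p - z))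
      + (LBINT z:cbox l r. u z * tens \<chi>' z * (((p - z) \<bullet> e_v j) * dlandau_kernel L N (e_x j) (p - z)))" for j
  proof -
    have "(p \<bullet> e_v j) * dP (e_x j) p = (LBINT z:cbox l r. (p \<bullet> e_v j) * (u z * tens \<chi>' z * dlandau_kernel L N (e_x j) (p - z)))"
      unfolding dP_def by simp
    also have "... = (LBINT z:cbox l r. u z * (((z \<bullet> e_v j) * tens \<chi>' z) * dlandau_kernel L N (e_x j) (p - z))
        + u z * (tens \<chi>' z * (((p - z) \<bullet> e_v j) * dlandau_kernel L N (e_x j) (p - z))))"
      by (intro arg_cong[where f="\<lambda>f. set_lebesgue_integral lborel (cbox l r) f"] ext) (simp add: inner_diff_left algebra_simps)
    also have "... = (LBINT z:cbox l r. u z * (((z \<bullet> e_v j) * tens \<chi>' z) * dlandau_kernel L N (e_x j) (p - z)))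
       + (LBINT z:cbox l r. u z * (tens \<chi>' z * (((p - z) \<bullet> e_v j) * dlandau_kernel L N (e_x j) (p - z))))"
      by (intro set_integral_add I sit) (intro ci)+
    finally show ?thesis by (simp only: mult.assoc)
  qed
  have G: "(LBINT z:cbox l r. (ut z + (\<Sum>j\<in>UNIV. (z \<bullet> e_v j) * ux z $ j)) * tens \<chi>' z * ?k z)
    = (LBINT z:cbox l r. ut z * tens \<chi>' z * ?k z) + (\<Sum>j\<in>UNIV. LBINT z:cbox l r. ux z $ j * ((z \<bullet> e_v j) * tens \<chi>' z) * ?k z)"
  proof -
    have "(LBINT z:cbox l r. (ut z + (\<Sum>j\<in>UNIV. (z \<bullet> e_v j) * ux z $ j)) * tens \<chi>' z * ?k z)
      = (LBINT z:cbox l r. ut z * (tens \<chi>' z * ?k z) + (ux z $ 1 * (((z \<bullet> e_v 1) * tens \<chi>' z) * ?k z)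
         + (ux z $ 2 * (((z \<bullet> e_v 2) * tens \<chi>' z) * ?k z) + ux z $ 3 * (((z \<bullet> e_v 3) * tens \<chi>' z) * ?k z))))"
      by (intro arg_cong[where f="\<lambda>f. set_lebesgue_integral lborel (cbox l r) f"] ext) (simp add: sum_3 algebra_simps)
    also have "... = (LBINT z:cbox l r. ut z * (tens \<chi>' z * ?k z)) + ((LBINT z:cbox l r. ux z $ 1 * (((z \<bullet> e_v 1) * tens \<chi>' z) * ?k z))
         + ((LBINT z:cbox l r. ux z $ 2 * (((z \<bullet> e_v 2) * tens \<chi>' z) * ?k z)) + (LBINT z:cbox l r. ux z $ 3 * (((z \<bullet> e_v 3) * tens \<chi>' z) * ?k z))))"
      by (subst set_integral_add, (intro set_integral_add I sit six; intro ci)+)+ simp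
    finally show ?thesis by (simp add: sum_3 mult.assoc)
  qed
  have C: "(LBINT z:cbox l r. u z * transport_cutoff \<chi>' z * ?k z)
    = (LBINT z:cbox l r. u z * tens (\<chi>'(e_t := deriv (\<chi>' e_t))) z * ?k z)
     + (\<Sum>j\<in>UNIV. LBINT z:cbox l r. u z * ((z \<bullet> e_v j) * tens (\<chi>'(e_x j := deriv (\<chi>' (e_x j)))) z) * ?k z)"
  proof -
    let ?D = "\<lambda>c z. tens (\<chi>'(c := deriv (\<chi>' c))) z"
    have "(LBINT z:cbox l r. u z * transport_cutoff \<chi>' z * ?k z)
      = (LBINT z:cbox l r. u z * (?D e_t z * ?k z) + (u z * (((z \<bullet> e_v 1) * ?D (e_x 1) z) * ?k z)
         + (u z * (((z \<bullet> e_v 2) * ?D (e_x 2) z) * ?k z) + u z * (((z \<bullet> e_v 3) * ?D (e_x 3) z) * ?k z))))"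
      by (intro arg_cong[where f="\<lambda>f. set_lebesgue_integral lborel (cbox l r) f"] ext) (simp add: sum_3 transport_cutoff_def algebra_simps)
    also have "... = (LBINT z:cbox l r. u z * (?D e_t z * ?k z)) + ((LBINT z:cbox l r. u z * (((z \<bullet> e_v 1) * ?D (e_x 1) z) * ?k z))
         + ((LBINT z:cbox l r. u z * (((z \<bullet> e_v 2) * ?D (e_x 2) z) * ?k z)) + (LBINT z:cbox l r. u z * (((z \<bullet> e_v 3) * ?D (e_x 3) z) * ?k z))))"
      by (subst set_integral_add, (intro set_integral_add I sit six; intro ci phase_Basis_mem)+)+ simp
    finally show ?thesis by (simp add: sum_3 mult.assoc)
  qed
  show ?thesis unfolding t comm x G C by (simp add: sum.distrib)
qed

section \<open>Approximation together with the transport derivative\<close>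

lemma power2_sum6:
  "(a + b + c + d + e + f)\<^sup>2 \<le> 6 * (a\<^sup>2 + b\<^sup>2 + c\<^sup>2 + d\<^sup>2 + e\<^sup>2 + (f::real)\<^sup>2)"
proof -
  have 2: "(x + y)\<^sup>2 \<le> 2 * x\<^sup>2 + 2 * y\<^sup>2" for x y :: real
    using sum_squares_bound[of x y] by (simp add: power2_sum)
  have 3: "(x + y + z)\<^sup>2 \<le> 3 * x\<^sup>2 + 3 * y\<^sup>2 + 3 * z\<^sup>2" for x y z :: real
    using sum_squares_bound[of x y] sum_squares_bound[of x z] sum_squares_bound[of y z]
    by (simp add: power2_sum algebra_simps)
  have "(a + b + c + d + e + f)\<^sup>2 \<le> 2 * (a + b + c)\<^sup>2 + 2 * (d + e + f)\<^sup>2"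
    using 2[of "a + b + c" "d + e + f"] by (simp add: add.assoc)
  also have "... \<le> 2 * (3 * a\<^sup>2 + 3 * b\<^sup>2 + 3 * c\<^sup>2) + 2 * (3 * d\<^sup>2 + 3 * e\<^sup>2 + 3 * f\<^sup>2)"
    by (intro add_mono mult_left_mono 3) auto
  also have "... = 6 * (a\<^sup>2 + b\<^sup>2 + c\<^sup>2 + d\<^sup>2 + e\<^sup>2 + f\<^sup>2)" by simp
  finally show ?thesis .
qed

definition cbox_at :: "'a::euclidean_space \<Rightarrow> ('a \<Rightarrow> real) \<Rightarrow> 'a set" where
  "cbox_at c h = {p. \<forall>b\<in>Basis. \<bar>p \<bullet> b - c \<bullet> b\<bar> \<le> h b}"

definition box_at :: "'a::euclidean_space \<Rightarrow> ('a \<Rightarrow> real) \<Rightarrow> 'a set" where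
  "box_at c h = {p. \<forall>b\<in>Basis. \<bar>p \<bullet> b - c \<bullet> b\<bar> < h b}"

lemma cbox_at_eq: "cbox_at c h = cbox (\<Sum>b\<in>Basis. (c \<bullet> b - h b) *\<^sub>R b) (\<Sum>b\<in>Basis. (c \<bullet> b + h b) *\<^sub>R b)"
  unfolding cbox_at_def cbox_def
  by (intro Collect_cong ball_cong refl) (simp only: inner_sum_left_Basis, linarith)

lemma box_at_eq: "box_at c h = box (\<Sum>b\<in>Basis. (c \<bullet> b - h b) *\<^sub>R b) (\<Sum>b\<in>Basis. (c \<bullet> b + h b) *\<^sub>R b)"
  unfolding box_at_def box_def
  by (intro Collect_cong ball_cong refl) (simp only: inner_sum_left_Basis, linarith)

lemma box_at_facts: "compact (cbox_at c h)" "open (box_at c h)" "cbox_at c h \<in> sets borel" "box_at c h \<in> sets borel"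
  by (auto simp: cbox_at_eq box_at_eq)

lemma AE_cbox_box: "AE p in lborel. p \<in> cbox_at c h \<longrightarrow> p \<in> box_at c h"
proof -
  have "cbox_at c h - box_at c h \<in> null_sets lebesgue"
    using negligible_frontier_interval unfolding cbox_at_eq box_at_eq by (simp add: negligible_iff_null_sets)
  then have "AE p in lebesgue. p \<notin> cbox_at c h - box_at c h" by (rule AE_not_in)
  then have "AE p in lborel. p \<notin> cbox_at c h - box_at c h" by (simp add: AE_completion_iff)
  then show ?thesis by eventually_elim auto
qed

lemma smooth1_deriv_zero_open:
  assumes "smooth1 h" "open U" "x \<in> U" "\<And>y. y \<in> U \<Longrightarrow> h y = a"
  shows "deriv h x = 0"
proof -
  have "((\<lambda>s. a) has_real_derivative 0) (at x)" by simp
  then have "(h has_real_derivative 0) (at x)"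
    by (rule has_field_derivative_transform_within_open[OF _ assms(2,3)]) (simp add: assms(4))
  then show ?thesis by (rule DERIV_imp_deriv)
qed

lemma continuous_zero_extension:
  fixes u \<phi> :: "'a::euclidean_space \<Rightarrow> real"
  assumes "open U" "continuous_on U u" "continuous_on UNIV \<phi>" "closed B" "B \<subseteq> U" "\<And>z. z \<notin> B \<Longrightarrow> \<phi> z = 0"
  shows "continuous_on UNIV (\<lambda>z. indicator B z * (u z * \<phi> z))"
proof -
  have "continuous_on U (\<lambda>z. u z * \<phi> z)"
    using assms(2,3) by (intro continuous_on_mult) (auto intro: continuous_on_subset)
  then have 1: "continuous_on U (\<lambda>z. indicator B z * (u z * \<phi> z))"
    by (rule continuous_on_eq) (use assms(6) in \<open>auto simp: indicator_def\<close>)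
  have "continuous_on (- B) (\<lambda>z. 0 :: real)" by simp
  then have 2: "continuous_on (- B) (\<lambda>z. indicator B z * (u z * \<phi> z))"
    by (rule continuous_on_eq) (auto simp: indicator_def)
  have "continuous_on (U \<union> - B) (\<lambda>z. indicator B z * (u z * \<phi> z))"
    by (rule continuous_on_open_Un[OF assms(1) _ 1 2]) (use assms(4) in auto)
  moreover have "U \<union> - B = UNIV" using assms(5) by auto
  ultimately show ?thesis by simp
qed

lemma integrable_continuous_compact_support:
  fixes f :: "'a::euclidean_space \<Rightarrow> real"
  assumes "continuous_on UNIV f" "compact B" "\<And>z. z \<notin> B \<Longrightarrow> f z = 0"
  shows "integrable lborel f"
proof -
  have "integrable lborel (\<lambda>z. indicator B z *\<^sub>R f z)"
    using assms(1,2) by (intro borel_integrable_compact) (auto intro: continuous_on_subset)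
  moreover have "(\<lambda>z. indicator B z *\<^sub>R f z) = f"
  proof
    fix z show "indicator B z *\<^sub>R f z = f z" using assms(3)[of z] by (cases "z \<in> B") auto
  qed
  ultimately show ?thesis by simp
qed

lemma cutoff_tensor_exists:
  fixes c :: "'a::euclidean_space"
  assumes "\<And>b. b \<in> Basis \<Longrightarrow> 0 < i b \<and> i b < o' b"
  shows "\<exists>\<chi>'. \<forall>b\<in>Basis. smooth1 (\<chi>' b) \<and> (\<forall>s. \<bar>s - c \<bullet> b\<bar> > o' b \<longrightarrow> \<chi>' b s = 0) \<and>
    (\<forall>s. \<bar>s - c \<bullet> b\<bar> \<le> i b \<longrightarrow> \<chi>' b s = 1) \<and> (\<forall>s. 0 \<le> \<chi>' b s \<and> \<chi>' b s \<le> 1)"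
proof (rule bchoice, rule ballI)
  fix b :: 'a assume b: "b \<in> Basis"
  obtain k where k: "smooth1 k" "\<forall>x. x \<notin> {c \<bullet> b - o' b..c \<bullet> b + o' b} \<longrightarrow> k x = 0"
    "\<forall>x\<in>{c \<bullet> b - i b..c \<bullet> b + i b}. k x = 1" "\<forall>x. 0 \<le> k x \<and> k x \<le> 1"
    using smooth_cutoff_exists[of "c \<bullet> b - o' b" "c \<bullet> b - i b" "c \<bullet> b + i b" "c \<bullet> b + o' b"] assms[OF b] by auto
  show "\<exists>y. smooth1 y \<and> (\<forall>s. \<bar>s - c \<bullet> b\<bar> > o' b \<longrightarrow> y s = 0) \<and> (\<forall>s. \<bar>s - c \<bullet> b\<bar> \<le> i b \<longrightarrow> y s = 1) \<and> (\<forall>s. 0 \<le> y s \<and> y s \<le> 1)"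
  proof (intro exI[of _ k] conjI allI impI)
    fix s
    show "k s = 0" if "\<bar>s - c \<bullet> b\<bar> > o' b"
      by (rule k(2)[rule_format]) (unfold atLeastAtMost_iff, use that in linarith)
    show "k s = 1" if "\<bar>s - c \<bullet> b\<bar> \<le> i b"
      by (rule k(3)[rule_format]) (unfold atLeastAtMost_iff, use that in linarith)
  qed (use k in auto)
qed

text \<open>
  The composition of a network with a dilation is a network again.
\<close>

definition pull_units :: "'a::euclidean_space set \<Rightarrow> 'a \<Rightarrow> real \<Rightarrow> 'a units \<Rightarrow> 'a units" where
  "pull_units J c \<kappa> L = map (\<lambda>(k, a, b). (k, dil J 0 \<kappa> a, a \<bullet> dil J c \<kappa> 0 + b)) L"

lemma inner_dil: "a \<bullet> dil J c \<kappa> p = dil J 0 \<kappa> a \<bullet> p + a \<bullet> dil J c \<kappa> 0"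
  by (simp add: dil_def inner_add_right inner_add_left inner_sum_left inner_sum_right inner_diff_left
      sum_subtractf sum_negf algebra_simps inner_commute)

lemma net_pull: "net (pull_units J c \<kappa> L) p = net L (dil J c \<kappa> p)"
  by (induction L) (auto simp: pull_units_def inner_dil[of _ J c \<kappa> p] add.assoc)

lemma dnet_pull:
  assumes "J \<subseteq> Basis" "b \<in> J"
  shows "dnet (pull_units J c \<kappa> L) [b] p = \<kappa> * dnet L [b] (dil J c \<kappa> p)"
  using assms
  by (induction L) (auto simp: pull_units_def inner_dil[of _ J c \<kappa> p] add.assoc dil_inner subset_iff algebra_simps)

abbreviation tx_basis :: "phase set" where "tx_basis \<equiv> insert e_t (range e_x)"

abbreviation cell_centre :: "real \<Rightarrow> phase" where "cell_centre T \<equiv> (T / 2, 0, 0)"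

text \<open>
  Half side lengths of \<open>[0, T] \<times> [-\<pi>, \<pi>]\<^sup>3 \<times> [-r, r]\<^sup>3\<close>, one for each basis direction.
\<close>

definition cell_radius :: "real \<Rightarrow> real \<Rightarrow> phase \<Rightarrow> real" where
  "cell_radius T r b = (if b = e_t then T / 2 else if b \<in> range e_x then pi else r)"

lemma cell_radius_simps [simp]:
  "cell_radius T r e_t = T / 2" "cell_radius T r (e_x j) = pi" "cell_radius T r (e_v j) = r"
  by (auto simp: cell_radius_def)

lemma tx_basis_facts: "tx_basis \<subseteq> Basis" "e_v j \<notin> tx_basis" "b \<in> Basis \<Longrightarrow> b \<notin> tx_basis \<Longrightarrow> b \<in> range e_v"
  by (auto simp: phase_Basis)

text \<open>
  The approximation needed for the interior residual.  The hypotheses give square integrability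
  of the combination \<open>g\<close> alone, and only inside the cell.  Therefore \<open>u\<close> is cut off to a box \<open>B\<close> inside
  the cell, mollified with a Landau kernel into a polynomial \<open>P\<close>, and \<open>P\<close> is replaced by a network close to
  it in \<open>C\<^sup>1\<close>.  The result is good on a slightly smaller box; composition with the dilation \<open>A\<close>, which
  contracts \<open>K\<close> into that box, makes it good on all of \<open>K\<close>.  No dilation is applied to the velocity, so
  the composition multiplies the transport derivative by \<open>\<kappa>\<close> and leaves its form unchanged.
\<close>

lemma transport_approx:
  fixes u ut :: "phase \<Rightarrow> real" and ux :: "phase \<Rightarrow> real^3"
  assumes T: "T > 0" and r: "0 < r" "r < r'" and e: "e > (0::real)"
    and uc: "continuous_on ({0..T} \<times> UNIV \<times> UNIV) u"
    and wt: "weak_deriv (phase_domain T) {#e_t#} u ut"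
    and wx: "\<And>j. weak_deriv (phase_domain T) {#e_x j#} u (\<lambda>p. ux p $ j)"
  defines "g \<equiv> \<lambda>z. ut z + (\<Sum>j\<in>UNIV. (z \<bullet> e_v j) * ux z $ j)"
  defines "G \<equiv> \<lambda>z. indicator (box_at (cell_centre T) (cell_radius T r')) z * g z"
  defines "K \<equiv> cbox_at (cell_centre T) (cell_radius T r)"
  assumes Gm[measurable]: "G \<in> borel_maps" and Gfin: "l2sq G < \<infinity>"
  shows "\<exists>L. (\<forall>p\<in>K. \<bar>net L p - u p\<bar> \<le> e) \<and>
    l2_on K (\<lambda>p. dnet L [e_t] p + (\<Sum>j\<in>UNIV. (p \<bullet> e_v j) * dnet L [e_x j] p) - g p) \<le> ennreal e"
proof -
  let ?c = "cell_centre T" and ?J = tx_basis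
  let ?h = "cell_radius T r" and ?h' = "cell_radius T r'"
  note J = tx_basis_facts(1)
  have hpos: "?h b > 0" "?h' b > 0" "?h b \<le> ?h' b" for b using T r pi_gt_zero by (auto simp: cell_radius_def)
  have hJ: "?h b = ?h' b" if "b \<in> ?J" for b using that by auto
  have hv: "?h b = r" "?h' b = r'" if "b \<in> Basis" "b \<notin> ?J" for b
    using tx_basis_facts(3)[OF that] by auto
  have Kc: "compact K" and [measurable]: "K \<in> sets borel" unfolding K_def by (rule box_at_facts)+
  have Kdom: "K \<subseteq> {0..T} \<times> UNIV \<times> UNIV"
    unfolding K_def cbox_at_def using T phase_Basis_mem(1) by (auto simp: abs_le_iff dest!: bspec[OF _ phase_Basis_mem(1)])
  define V where "V = measure lborel K"
  have V: "emeasure lborel K = ennreal V" "V \<ge> 0"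
    using Kc emeasure_bounded_finite[of K] by (auto simp: V_def emeasure_eq_ennreal_measure less_top compact_imp_bounded)
  define e1 where "e1 = min 1 (min (e / 3) (e / (6 * (3 * V + 18))))"
  have e1: "0 < e1" "e1 \<le> 1" "3 * e1 \<le> e" using e V by (auto simp: e1_def)
  have e1V: "6 * (e1 * (3 * V + 18)) \<le> e"
  proof -
    have "e1 \<le> e / (6 * (3 * V + 18))" "6 * (3 * V + 18) > 0" using V by (auto simp: e1_def)
    then have "e1 * (6 * (3 * V + 18)) \<le> e" by (simp only: pos_le_divide_eq)
    then show ?thesis by (simp add: algebra_simps)
  qed
  have e1sq: "e1\<^sup>2 \<le> e1" using e1 by (simp add: power2_eq_square mult_left_le)
  have bG: "\<exists>R. \<forall>z. norm z > R \<longrightarrow> G z = 0"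
  proof -
    have "bounded (box_at ?c ?h')" unfolding box_at_eq by (rule bounded_box)
    then obtain R where R: "\<And>z. z \<in> box_at ?c ?h' \<Longrightarrow> norm z \<le> R" unfolding bounded_iff by blast
    have "G z = 0" if "norm z > R" for z using R[of z] that by (auto simp: G_def indicator_def)
    then show ?thesis by blast
  qed
  then obtain RG where RG: "\<And>z. norm z > RG \<Longrightarrow> G z = 0" by blast
  obtain \<kappa>1 where \<kappa>1: "\<kappa>1 < 1" "\<And>\<kappa>. \<kappa>1 < \<kappa> \<Longrightarrow> \<kappa> < 1 \<Longrightarrow>
      l2_on K (\<lambda>p. G (dil ?J ?c \<kappa> p) - G p) \<le> ennreal e1"
    using dil_l2_close[of G RG e1 K ?J ?c] Gm Gfin RG e1(1) compact_imp_bounded[OF Kc] J \<open>K \<in> sets borel\<close> by blast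
  have "uniformly_continuous_on K u"
    by (rule compact_uniformly_continuous[OF continuous_on_subset[OF uc Kdom] Kc])
  then obtain \<delta> where \<delta>: "\<delta> > 0" "\<And>p p'. p \<in> K \<Longrightarrow> p' \<in> K \<Longrightarrow> dist p' p < \<delta> \<Longrightarrow> dist (u p') (u p) < e1"
    using e1(1) unfolding uniformly_continuous_on_def by metis
  obtain bK where bK: "bK > 0" "\<And>p. p \<in> K \<Longrightarrow> norm p \<le> bK"
    using compact_imp_bounded[OF Kc] bounded_pos by metis
  define m where "m = real (card ?J) * (bK + norm ?c) + 1"
  have m: "m > 0" using bK by (simp add: m_def add_nonneg_pos del: card_insert_if)
  define N0 where "N0 = enn2real (l2sq G)"
  have N0: "l2sq G = ennreal N0" "N0 \<ge> 0" using Gfin by (auto simp: N0_def less_top)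
  \<comment> \<open>\<open>\<kappa>\<close> is so close to 1 that the dilation changes neither \<open>u\<close> uniformly nor \<open>G\<close> in \<open>L\<^sup>2\<close> by much.\<close>
  define \<kappa>m where "\<kappa>m = max (1/2) (max \<kappa>1 (max (1 - \<delta> / m) (1 - e1 / (N0 + 1))))"
  define \<kappa> where "\<kappa> = (1 + \<kappa>m) / 2"
  have "\<kappa>m < 1" using \<kappa>1 \<delta> m e1 N0 by (simp add: \<kappa>m_def)
  then have \<kappa>m: "\<kappa>m < \<kappa>" "\<kappa> < 1" by (auto simp: \<kappa>_def)
  have "1/2 \<le> \<kappa>m" "\<kappa>1 \<le> \<kappa>m" "1 - \<delta> / m \<le> \<kappa>m" "1 - e1 / (N0 + 1) \<le> \<kappa>m" by (auto simp: \<kappa>m_def)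
  then have \<kappa>: "1/2 < \<kappa>" "\<kappa>1 < \<kappa>" "1 - \<kappa> < \<delta> / m" "1 - \<kappa> < e1 / (N0 + 1)" "\<kappa> < 1" using \<kappa>m by linarith+
  define A where "A = dil ?J ?c \<kappa>"
  have dilG: "l2_on K (\<lambda>p. G (A p) - G p) \<le> ennreal e1"
    unfolding A_def by (rule \<kappa>1(2)[OF \<kappa>(2) \<kappa>(5)])
  have \<kappa>N: "(1 - \<kappa>)\<^sup>2 * N0 \<le> e1"
  proof -
    have "(1 - \<kappa>) * (N0 + 1) \<le> e1" using \<kappa>(4) N0(2) by (simp add: pos_less_divide_eq less_imp_le)
    moreover have "(1 - \<kappa>)\<^sup>2 \<le> (1 - \<kappa>) * 1" unfolding power2_eq_square using \<kappa> by (intro mult_left_mono) auto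
    then have "(1 - \<kappa>)\<^sup>2 * N0 \<le> (1 - \<kappa>) * (N0 + 1)" using N0(2) \<kappa> by (intro mult_mono) auto
    ultimately show ?thesis by linarith
  qed
  \<comment> \<open>The dilated \<open>K\<close> has the half side lengths \<open>a\<close>. The cut-off equals 1 up to \<open>i\<close>, vanishes beyond \<open>o'\<close>, and \<open>a < i < o'\<close> stays below the half side lengths of the cell.\<close>
  define a where "a b = (if b \<in> ?J then \<kappa> * ?h b else r)" for b
  have Ainner: "A p \<bullet> b - ?c \<bullet> b = (if b \<in> ?J then \<kappa> * (p \<bullet> b - ?c \<bullet> b) else p \<bullet> b - ?c \<bullet> b)" if "b \<in> Basis" for p b
    unfolding A_def dil_inner[OF J that] by auto
  have Aa: "\<bar>A p \<bullet> b - ?c \<bullet> b\<bar> \<le> a b" if "p \<in> K" "b \<in> Basis" for p b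
  proof -
    have p: "\<bar>p \<bullet> b - ?c \<bullet> b\<bar> \<le> ?h b" using that by (auto simp: K_def cbox_at_def)
    show ?thesis
    proof (cases "b \<in> ?J")
      case True
      then show ?thesis using p \<kappa> unfolding Ainner[OF that(2)] a_def by (simp add: abs_mult mult_left_mono del: insert_iff)
    next
      case False
      then show ?thesis using p hv(1)[OF that(2) False] unfolding Ainner[OF that(2)] a_def by (simp del: insert_iff)
    qed
  qed
  have ah: "a b \<le> ?h b" if "b \<in> Basis" for b
    using \<kappa> hpos(1)[of b] hv(1)[OF that] by (auto simp: a_def mult_le_cancel_right1 simp del: insert_iff)
  have AK: "A p \<in> K" if "p \<in> K" for p
    using Aa[OF that] ah unfolding K_def cbox_at_def by fastforce
  have uA: "\<bar>u (A p) - u p\<bar> \<le> e1" if "p \<in> K" for p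
  proof -
    have "norm (A p - p) \<le> \<bar>\<kappa> - 1\<bar> * (real (card ?J) * norm (p - ?c))" unfolding A_def by (rule norm_dil_diff[OF J])
    also have "... \<le> \<bar>\<kappa> - 1\<bar> * m"
    proof (rule mult_left_mono)
      have "real (card ?J) * norm (p - ?c) \<le> real (card ?J) * (bK + norm ?c)"
        using bK(2)[OF that] norm_triangle_ineq4[of p ?c] by (intro mult_left_mono) auto
      then show "real (card ?J) * norm (p - ?c) \<le> m" by (simp add: m_def del: card_insert_if)
    qed auto
    also have "... < (\<delta> / m) * m" using \<kappa> m by (intro mult_strict_right_mono) auto
    also have "... = \<delta>" using m by simp
    finally have "dist (A p) p < \<delta>" by (simp add: dist_norm)
    from \<delta>(2)[OF that AK[OF that] this] show ?thesis by (simp add: dist_real_def)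
  qed
  define i where "i b = (if b \<in> ?J then (1 + 2 * \<kappa>) / 3 * ?h b else (2 * r + r') / 3)" for b
  define o' where "o' b = (if b \<in> ?J then (2 + \<kappa>) / 3 * ?h b else (r + 2 * r') / 3)" for b
  have io: "0 < i b" "a b < i b" "i b < o' b" "o' b < ?h' b" if "b \<in> Basis" for b
  proof -
    have "0 < i b \<and> a b < i b \<and> i b < o' b \<and> o' b < ?h' b"
    proof (cases "b \<in> ?J")
      case True
      have "\<kappa> * ?h b < (1 + 2 * \<kappa>) / 3 * ?h b" "(1 + 2 * \<kappa>) / 3 * ?h b < (2 + \<kappa>) / 3 * ?h b" "(2 + \<kappa>) / 3 * ?h b < 1 * ?h b"
        using \<kappa> hpos(1)[of b] by (intro mult_strict_right_mono; simp)+
      moreover have "0 < (1 + 2 * \<kappa>) / 3 * ?h b" using \<kappa> hpos(1)[of b] by simp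
      ultimately show ?thesis using True hJ[OF True] unfolding a_def i_def o'_def if_P[OF True] by simp
    next
      case False
      then show ?thesis using r hv[OF that False] unfolding a_def i_def o'_def if_not_P[OF False] by simp
    qed
    then show "0 < i b" "a b < i b" "i b < o' b" "o' b < ?h' b" by auto
  qed
  obtain \<chi>' where chi: "\<And>b. b \<in> Basis \<Longrightarrow> smooth1 (\<chi>' b)"
    "\<And>b s. b \<in> Basis \<Longrightarrow> \<bar>s - ?c \<bullet> b\<bar> > o' b \<Longrightarrow> \<chi>' b s = 0"
    "\<And>b s. b \<in> Basis \<Longrightarrow> \<bar>s - ?c \<bullet> b\<bar> \<le> i b \<Longrightarrow> \<chi>' b s = 1"
    "\<And>b s. b \<in> Basis \<Longrightarrow> 0 \<le> \<chi>' b s \<and> \<chi>' b s \<le> 1"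
  proof -
    let ?Q = "\<lambda>\<chi>' b. smooth1 (\<chi>' b) \<and> (\<forall>s. \<bar>s - ?c \<bullet> b\<bar> > o' b \<longrightarrow> \<chi>' b s = 0) \<and>
      (\<forall>s. \<bar>s - ?c \<bullet> b\<bar> \<le> i b \<longrightarrow> \<chi>' b s = 1) \<and> (\<forall>s. 0 \<le> \<chi>' b s \<and> \<chi>' b s \<le> 1)"
    have "\<exists>\<chi>'. \<forall>b\<in>Basis. ?Q \<chi>' b" using io by (intro cutoff_tensor_exists) auto
    then obtain \<chi>' where *: "\<forall>b\<in>Basis. ?Q \<chi>' b" ..
    show ?thesis by (rule that[of \<chi>']) (use * in auto)
  qed
  define l where "l = (\<Sum>b\<in>Basis. (?c \<bullet> b - o' b) *\<^sub>R b)"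
  define rr where "rr = (\<Sum>b\<in>Basis. (?c \<bullet> b + o' b) *\<^sub>R b)"
  define B where "B = cbox l rr"
  have Bat: "B = cbox_at ?c o'" unfolding B_def l_def rr_def cbox_at_eq ..
  have lb: "l \<bullet> b = ?c \<bullet> b - o' b" "rr \<bullet> b = ?c \<bullet> b + o' b" if "b \<in> Basis" for b
    using that unfolding l_def rr_def by (simp_all only: inner_sum_left_Basis)
  have chi0: "\<chi>' b s = 0" if "b \<in> Basis" "s \<notin> {l \<bullet> b..rr \<bullet> b}" for b s
    using that(2) unfolding lb[OF that(1)] by (intro chi(2)[OF that(1)]) auto
  have Bcell: "B \<subseteq> box_at ?c ?h'"
    unfolding Bat cbox_at_def box_at_def using io(4) by fastforce
  have celldom: "box_at ?c ?h' \<subseteq> phase_domain T"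
  proof
    fix z assume "z \<in> box_at ?c ?h'"
    then have "\<bar>z \<bullet> e_t - ?c \<bullet> e_t\<bar> < ?h' e_t" unfolding box_at_def using phase_Basis_mem(1) by blast
    moreover obtain t x \<xi> where zt: "z = (t, x, \<xi>)" by (cases z) auto
    ultimately have "\<bar>t - T / 2\<bar> < T / 2" by simp
    then have "0 < t" "t < T" by linarith+
    then show "z \<in> phase_domain T" by (auto simp: zt phase_domain_def)
  qed
  have Bdom: "B \<subseteq> phase_domain T" using Bcell celldom by blast
  have Bc: "compact B" and Bm[measurable]: "B \<in> sets borel" unfolding B_def by auto
  have inB: "y \<in> B" "tens \<chi>' y = 1" "transport_cutoff \<chi>' y = 0" if y: "\<And>b. b \<in> Basis \<Longrightarrow> \<bar>y \<bullet> b - ?c \<bullet> b\<bar> \<le> a b" for y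
  proof -
    show "y \<in> B" unfolding Bat cbox_at_def using y io by fastforce
    show "tens \<chi>' y = 1" unfolding tens_def
      by (intro prod.neutral ballI chi(3)) (use y io(2) in fastforce)+
    have d0: "deriv (\<chi>' b) (y \<bullet> b) = 0" if b: "b \<in> Basis" for b
    proof (rule smooth1_deriv_zero_open[OF chi(1)[OF b]])
      show "open {?c \<bullet> b - i b<..<?c \<bullet> b + i b}" by simp
      show "y \<bullet> b \<in> {?c \<bullet> b - i b<..<?c \<bullet> b + i b}" using y[OF b] io(2)[OF b] by auto
      show "\<chi>' b s = 1" if "s \<in> {?c \<bullet> b - i b<..<?c \<bullet> b + i b}" for s
        using that by (intro chi(3)[OF b]) auto
    qed
    have "tens (\<chi>'(b := deriv (\<chi>' b))) y = 0" if "b \<in> Basis" for b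
      unfolding tens_upd[OF that] d0[OF that] by simp
    then show "transport_cutoff \<chi>' y = 0" by (simp add: transport_cutoff_def)
  qed
  have ychi: "tens \<chi>' z = 0" "transport_cutoff \<chi>' z = 0" if z: "z \<notin> B" for z
  proof -
    have dz: "deriv (\<chi>' b) s = 0" if b: "b \<in> Basis" "s \<notin> {l \<bullet> b..rr \<bullet> b}" for b s
      by (rule smooth1_deriv_zero_open[OF chi(1)[OF b(1)], of "- {l \<bullet> b..rr \<bullet> b}"])
        (use b chi0[OF b(1)] in \<open>auto simp: open_Compl\<close>)
    show "tens \<chi>' z = 0" by (rule tens_outside[of l rr]) (use chi0 z in \<open>auto simp: B_def\<close>)
    have "tens (\<chi>'(b := deriv (\<chi>' b))) z = 0" for b
      by (rule tens_outside[of l rr]) (use chi0 dz z in \<open>auto simp: B_def\<close>)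
    then show "transport_cutoff \<chi>' z = 0" by (simp add: transport_cutoff_def)
  qed
  have chic: "continuous_on UNIV (tens \<chi>')" "continuous_on UNIV (transport_cutoff \<chi>')"
  proof -
    show "continuous_on UNIV (tens \<chi>')" by (intro continuous_on_tens smooth1_continuous_on chi(1))
    have "continuous_on UNIV (tens (\<chi>'(b := deriv (\<chi>' b))))" if "b \<in> Basis" for b
      using chi(1) that by (intro continuous_on_tens) (auto intro!: smooth1_continuous_on smooth1_deriv)
    then show "continuous_on UNIV (transport_cutoff \<chi>')"
      unfolding transport_cutoff_def[abs_def] by (intro continuous_intros) auto
  qed
  define w where "w z = indicator B z * (u z * tens \<chi>' z)" for z
  define v where "v z = indicator B z * (u z * transport_cutoff \<chi>' z)" for z
  define g1 where "g1 z = indicator B z * (g z * tens \<chi>' z)" for z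
  have ucell: "continuous_on (box_at ?c ?h') u"
  proof (rule continuous_on_subset[OF uc])
    show "box_at ?c ?h' \<subseteq> {0..T} \<times> UNIV \<times> UNIV" using celldom by (auto simp: phase_domain_def)
  qed
  have wc: "continuous_on UNIV w" and vc: "continuous_on UNIV v"
    unfolding w_def[abs_def] v_def[abs_def]
    by (rule continuous_zero_extension[OF box_at_facts(2) ucell chic(1) compact_imp_closed[OF Bc] Bcell ychi(1)], assumption)
      (rule continuous_zero_extension[OF box_at_facts(2) ucell chic(2) compact_imp_closed[OF Bc] Bcell ychi(2)], assumption)
  obtain bB where bB: "bB > 0" "\<And>p. p \<in> B \<Longrightarrow> norm p \<le> bB"
    using compact_imp_bounded[OF Bc] bounded_pos by metis
  have w0: "w z = 0" "v z = 0" "g1 z = 0" if "norm z > bB" for z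
    using that bB(2)[of z] by (auto simp: w_def v_def g1_def indicator_def)
  have [measurable]: "w \<in> borel_maps" "v \<in> borel_maps" "tens \<chi>' \<in> borel_maps"
    using wc vc chic by (auto intro: borel_measurable_continuous_onI)
  have g1G: "g1 z = indicator B z * tens \<chi>' z * G z" for z
    using Bcell by (auto simp: g1_def G_def indicator_def)
  have g1m[measurable]: "g1 \<in> borel_maps" unfolding g1G[abs_def] by measurable
  have "l2sq g1 \<le> l2sq G"
  proof (rule l2sq_mono)
    fix z
    have "0 \<le> tens \<chi>' z \<and> tens \<chi>' z \<le> 1"
      unfolding tens_def using chi(4) by (auto intro!: prod_nonneg prod_le_1)
    then show "\<bar>g1 z\<bar> \<le> \<bar>G z\<bar>" unfolding g1G by (auto simp: indicator_def abs_mult mult_left_le_one_le)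
  qed
  then have g1fin: "l2sq g1 < \<infinity>" using Gfin by (rule le_less_trans)
  obtain Bw where Bw: "\<And>z. \<bar>w z\<bar> \<le> Bw" using bounded_support_unif_cont(1)[OF wc w0(1)] by blast
  obtain Bv where Bv: "\<And>z. \<bar>v z\<bar> \<le> Bv" using bounded_support_unif_cont(1)[OF vc w0(2)] by blast
  have Bw0: "Bw \<ge> 0" "Bv \<ge> 0" using Bw[of 0] Bv[of 0] by linarith+
  obtain \<delta>w where \<delta>w: "\<delta>w > 0" "\<And>x y. norm (x - y) \<le> \<delta>w \<Longrightarrow> \<bar>w y - w x\<bar> \<le> e1 / 2"
    using bounded_support_unif_cont(2)[where h=w and r=bB and d="e1/2", OF wc w0(1)] e1(1) by auto
  obtain \<delta>v where \<delta>v: "\<delta>v > 0" "\<And>x y. norm (x - y) \<le> \<delta>v \<Longrightarrow> \<bar>v y - v x\<bar> \<le> e1 / 2"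
    using bounded_support_unif_cont(2)[where h=v and r=bB and d="e1/2", OF vc w0(2)] e1(1) by auto
  \<comment> \<open>On the dilated \<open>K\<close> the functions \<open>w\<close>, \<open>v\<close>, \<open>g1\<close> equal \<open>u\<close>, \<open>0\<close>, \<open>g\<close>; one kernel has to serve all three.\<close>
  obtain \<eta>3 where \<eta>3: "\<eta>3 > 0" "\<And>k \<eta>'. approx_kernel \<eta>' k \<Longrightarrow> 0 \<le> \<eta>' \<Longrightarrow> \<eta>' \<le> \<eta>3 \<Longrightarrow>
      l2_on K (\<lambda>p. conv g1 k p - g1 p) \<le> ennreal e1"
    using conv_l2_close[of g1 bB e1 K] g1m g1fin w0(3) e1(1) compact_imp_bounded[OF Kc] \<open>K \<in> sets borel\<close> by blast
  define \<eta> where "\<eta> = min (min \<delta>w \<delta>v) (min \<eta>3 (e1 / (4 * (Bw + Bv + 1))))"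
  have \<eta>: "\<eta> > 0" "\<eta> \<le> \<delta>w" "\<eta> \<le> \<delta>v" "\<eta> \<le> \<eta>3" using \<delta>w \<delta>v \<eta>3 e1 Bw0 by (auto simp: \<eta>_def)
  have \<eta>B: "4 * Bw * \<eta> \<le> e1" "4 * Bv * \<eta> \<le> e1"
  proof -
    have "\<eta> \<le> e1 / (4 * (Bw + Bv + 1))" "4 * (Bw + Bv + 1) > 0" using Bw0 by (auto simp: \<eta>_def)
    then have *: "\<eta> * (4 * (Bw + Bv + 1)) \<le> e1" by (simp only: pos_le_divide_eq)
    have "\<eta> * (4 * Bw) \<le> \<eta> * (4 * (Bw + Bv + 1))" "\<eta> * (4 * Bv) \<le> \<eta> * (4 * (Bw + Bv + 1))"
      using \<eta>(1) Bw0 by (auto intro!: mult_left_mono)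
    then show "4 * Bw * \<eta> \<le> e1" "4 * Bv * \<eta> \<le> e1" using * by (auto simp: algebra_simps)
  qed
  \<comment> \<open>Differences of points of \<open>K\<close> and \<open>B\<close> lie in the box of the kernel, so its truncation is invisible and the convolution is a polynomial on \<open>K\<close>.\<close>
  define Lk where "Lk = bK + bB"
  have Lk: "Lk > 0" using bK bB by (simp add: Lk_def)
  have sym: "y - z \<in> sym_box Lk" if "y \<in> K" "z \<in> B" for y z
  proof -
    have "norm (y - z) \<le> Lk" using norm_triangle_ineq4[of y z] bK(2)[OF that(1)] bB(2)[OF that(2)] by (simp add: Lk_def)
    then show ?thesis unfolding sym_box_def using Basis_le_norm order_trans by blast
  qed
  have Dv: "range e_v \<subseteq> (Basis :: phase set)" by (auto simp: phase_Basis)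
  obtain N where N: "approx_kernel \<eta> (\<lambda>z. landau_kernel Lk N z * indicator (sym_box Lk) z)"
    "\<And>c d. c \<in> Basis - range e_v \<Longrightarrow> d \<in> range e_v \<Longrightarrow>
      (LBNN z. ennreal (\<bar>z \<bullet> d\<bar> * \<bar>dlandau_kernel Lk N c z\<bar>) * indicator (sym_box Lk) z) \<le> ennreal \<eta>"
    using landau_kernel_exists[OF Lk \<eta>(1) Dv] unfolding dlandau_kernel_def by blast
  define k where "k z = landau_kernel Lk N z * indicator (sym_box Lk) z" for z
  have kA: "approx_kernel \<eta> k" using N(1) by (simp add: k_def[abs_def])
  have convK: "conv (\<lambda>z. indicator B z * F z) k y = (LBINT z:B. F z * landau_kernel Lk N (y - z))" if "y \<in> K" for F y
    unfolding conv_def set_lebesgue_integral_def k_def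
    by (intro Bochner_Integration.integral_cong) (use sym[OF that] in \<open>auto simp: indicator_def\<close>)
  define P where "P p = (LBINT z. w z * landau_kernel Lk N (p - z))" for p
  define dP where "dP c p = (LBINT z. w z * dlandau_kernel Lk N c (p - z))" for c p
  have PC1: "C1_approx P dP"
    unfolding P_def[abs_def] dP_def[abs_def]
  proof (rule C1_approx_sep_integral[OF sep_landau_kernel])
    fix \<beta> :: "phase \<Rightarrow> real" assume "continuous_on UNIV \<beta>"
    then show "integrable lborel (\<lambda>z. w z * \<beta> z)"
      by (intro integrable_continuous_compact_support[OF _ Bc] continuous_on_mult wc) (auto simp: w_def)
  qed (rule landau_kernel_line_DERIV)
  have Pconv: "P y = conv w k y" if "y \<in> K" for y
  proof -
    have "conv w k y = (LBINT z:B. (u z * tens \<chi>' z) * landau_kernel Lk N (y - z))"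
      unfolding w_def[abs_def] by (rule convK[OF that])
    also have "... = P y" unfolding P_def w_def set_lebesgue_integral_def by (simp add: mult.assoc)
    finally show ?thesis by simp
  qed
  have dPB: "dP c p = (LBINT z:cbox l rr. u z * tens \<chi>' z * dlandau_kernel Lk N c (p - z))" for c p
    unfolding dP_def w_def set_lebesgue_integral_def B_def[symmetric] by (simp add: mult.assoc)
  define LP where "LP y = dP e_t y + (\<Sum>j\<in>UNIV. (y \<bullet> e_v j) * dP (e_x j) y)" for y
  \<comment> \<open>The commutator of mollification and transport.\<close>
  define com where "com y = (\<Sum>j\<in>UNIV. LBINT z:B. u z * tens \<chi>' z * (((y - z) \<bullet> e_v j) * dlandau_kernel Lk N (e_x j) (y - z)))" for y
  have LP: "LP y = conv g1 k y + conv v k y + com y" if y: "y \<in> K" for y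
  proof -
    have "LP y = (LBINT z:B. (ut z + (\<Sum>j\<in>UNIV. (z \<bullet> e_v j) * ux z $ j)) * tens \<chi>' z * landau_kernel Lk N (y - z))
      + (LBINT z:B. u z * transport_cutoff \<chi>' z * landau_kernel Lk N (y - z)) + com y"
      unfolding LP_def dPB com_def B_def
      by (rule transport_conv[OF wt wx chi(1) chi0]) (use Bdom in \<open>auto simp: B_def\<close>)
    then show ?thesis unfolding g1_def[abs_def] v_def[abs_def] convK[OF y] g_def .
  qed
  have com: "\<bar>com y\<bar> \<le> e1" if y: "y \<in> K" for y
  proof -
    have "\<bar>LBINT z:B. u z * tens \<chi>' z * (((y - z) \<bullet> e_v j) * dlandau_kernel Lk N (e_x j) (y - z))\<bar> \<le> Bw * \<eta>" for j
    proof -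
      let ?F = "\<lambda>z. (z \<bullet> e_v j) * dlandau_kernel Lk N (e_x j) z"
      have [measurable]: "?F \<in> borel_maps"
        by (intro borel_measurable_continuous_onI continuous_on_mult continuous_on_landau_kernel continuous_intros)
      have int: "integrable lborel (\<lambda>z. w z * ?F (y - z))"
        by (intro integrable_continuous_compact_support[OF _ Bc] continuous_on_mult wc
            continuous_on_compose2[OF continuous_on_landau_kernel(2)[of UNIV]] continuous_intros) (auto simp: w_def)
      have "(LBINT z:B. u z * tens \<chi>' z * ?F (y - z)) = (LBINT z. w z * ?F (y - z))"
        unfolding w_def set_lebesgue_integral_def by (simp add: mult.assoc)
      then have "ennreal \<bar>LBINT z:B. u z * tens \<chi>' z * ?F (y - z)\<bar> \<le> (LBNN z. norm (w z * ?F (y - z)))"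
        using integral_norm_bound_ennreal[OF int] by simp
      also have "... \<le> (LBNN z. ennreal Bw * (ennreal (\<bar>(y - z) \<bullet> e_v j\<bar> * \<bar>dlandau_kernel Lk N (e_x j) (y - z)\<bar>) * indicator (sym_box Lk) (y - z)))"
      proof (rule nn_integral_mono)
        fix z
        show "ennreal (norm (w z * ?F (y - z))) \<le> ennreal Bw * (ennreal (\<bar>(y - z) \<bullet> e_v j\<bar> * \<bar>dlandau_kernel Lk N (e_x j) (y - z)\<bar>) * indicator (sym_box Lk) (y - z))"
        proof (cases "z \<in> B")
          case True
          have "\<bar>w z\<bar> * \<bar>?F (y - z)\<bar> \<le> Bw * \<bar>?F (y - z)\<bar>" using Bw by (intro mult_right_mono) auto
          then have "ennreal (\<bar>w z\<bar> * \<bar>?F (y - z)\<bar>) \<le> ennreal Bw * ennreal \<bar>?F (y - z)\<bar>"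
            using Bw0 by (simp add: ennreal_mult[symmetric])
          then show ?thesis using sym[OF y True] by (simp add: abs_mult)
        qed (simp add: w_def)
      qed
      also have "... = ennreal Bw * (LBNN z. ennreal (\<bar>(y - z) \<bullet> e_v j\<bar> * \<bar>dlandau_kernel Lk N (e_x j) (y - z)\<bar>) * indicator (sym_box Lk) (y - z))"
      proof (rule nn_integral_cmult)
        have [measurable]: "dlandau_kernel Lk N (e_x j) \<in> borel_maps"
          by (intro borel_measurable_continuous_onI continuous_on_landau_kernel)
        show "(\<lambda>z. ennreal (\<bar>(y - z) \<bullet> e_v j\<bar> * \<bar>dlandau_kernel Lk N (e_x j) (y - z)\<bar>) * indicator (sym_box Lk) (y - z)) \<in> borel_measurable lborel"
          by measurable
      qed
      also have "(LBNN z. ennreal (\<bar>(y - z) \<bullet> e_v j\<bar> * \<bar>dlandau_kernel Lk N (e_x j) (y - z)\<bar>) * indicator (sym_box Lk) (y - z))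
        = (LBNN z. ennreal (\<bar>z \<bullet> e_v j\<bar> * \<bar>dlandau_kernel Lk N (e_x j) z\<bar>) * indicator (sym_box Lk) z)"
      proof (rule nn_integral_lborel_reflect)
        have [measurable]: "dlandau_kernel Lk N (e_x j) \<in> borel_maps"
          by (intro borel_measurable_continuous_onI continuous_on_landau_kernel)
        show "(\<lambda>z. ennreal (\<bar>z \<bullet> e_v j\<bar> * \<bar>dlandau_kernel Lk N (e_x j) z\<bar>) * indicator (sym_box Lk) z) \<in> borel_maps"
          by measurable
      qed
      also have "ennreal Bw * ... \<le> ennreal Bw * ennreal \<eta>"
      proof (intro mult_left_mono N(2))
        have "e_x j \<noteq> e_v i" for i by (rule phase_basis_distinct(3))
        then show "e_x j \<in> Basis - range e_v" by (simp only: Diff_iff phase_Basis_mem image_iff) blast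
      qed auto
      also have "... = ennreal (Bw * \<eta>)" using Bw0 \<eta> by (simp add: ennreal_mult)
      finally show ?thesis using Bw0 \<eta> by (subst (asm) ennreal_le_iff) auto
    qed
    then have "\<bar>com y\<bar> \<le> (\<Sum>j\<in>(UNIV::3 set). Bw * \<eta>)"
      unfolding com_def by (intro order_trans[OF sum_abs] sum_mono)
    then show ?thesis using \<eta>B(1) Bw0 \<eta>(1) mult_nonneg_nonneg[of Bw \<eta>] by simp
  qed
  have Pw: "\<bar>P y - w y\<bar> \<le> e1" if "y \<in> K" for y
  proof -
    have "\<bar>conv w k y - w y\<bar> \<le> e1 / 2 + 2 * Bw * \<eta>"
      by (rule conv_close[OF kA]) (use \<eta> Bw e1 \<delta>w(2)[of y] in auto)
    then show ?thesis using \<eta>B(1) Pconv[OF that] by simp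
  qed
  have vA: "\<bar>conv v k (A p)\<bar> \<le> e1" if "p \<in> K" for p
  proof -
    have "\<bar>conv v k (A p) - v (A p)\<bar> \<le> e1 / 2 + 2 * Bv * \<eta>"
      by (rule conv_close[OF kA]) (use \<eta> Bv e1 \<delta>v(2)[of "A p"] in auto)
    moreover have "v (A p) = 0" using inB(3)[OF Aa[OF that]] by (simp add: v_def)
    ultimately show ?thesis using \<eta>B(2) by simp
  qed
  have wA: "w (A p) = u (A p)" "g1 (A p) = G (A p)" if "p \<in> K" for p
    using inB(1,2)[OF Aa[OF that]] by (auto simp: w_def g1G)
  have gA: "l2_on K (\<lambda>p. conv g1 k (A p) - g1 (A p)) \<le> 16 * ennreal e1"
  proof -
    have [measurable]: "conv g1 k \<in> borel_maps" by (rule conv_measurable[OF g1m approx_kernel_measurable[OF kA]])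
    let ?f = "\<lambda>p. ennreal ((conv g1 k p - g1 p)\<^sup>2) * indicator K p"
    have fm: "?f \<in> borel_maps" by measurable
    have cJ: "card ?J = 4"
    proof -
      have "inj e_x" by (auto simp: inj_def axis_eq_axis)
      then have "card (range e_x) = 3" by (simp add: card_image)
      moreover have "e_t \<notin> range e_x" by auto
      ultimately show ?thesis by simp
    qed
    have "ennreal (\<kappa> ^ 4) * (LBNN p. ?f (A p)) = (LBNN p. ?f p)"
      using nn_integral_dil[OF J _ fm, of \<kappa> ?c] \<kappa> unfolding cJ A_def by simp
    also have "... \<le> ennreal e1" using \<eta>3(2)[OF kA] \<eta> by simp
    finally have 1: "ennreal (\<kappa> ^ 4) * (LBNN p. ?f (A p)) \<le> ennreal e1" .
    have "(1/2::real) ^ 4 \<le> \<kappa> ^ 4" using \<kappa> by (intro power_mono) auto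
    then have "ennreal 1 \<le> ennreal (16 * \<kappa> ^ 4)" by (intro ennreal_leI) (simp add: power_divide)
    then have "1 * (LBNN p. ?f (A p)) \<le> ennreal (16 * \<kappa> ^ 4) * (LBNN p. ?f (A p))"
      by (intro mult_right_mono) auto
    also have "... = 16 * (ennreal (\<kappa> ^ 4) * (LBNN p. ?f (A p)))"
      using \<kappa> by (simp add: ennreal_mult mult.assoc)
    also have "... \<le> 16 * ennreal e1" by (rule mult_left_mono[OF 1]) auto
    finally have 2: "(LBNN p. ?f (A p)) \<le> 16 * ennreal e1" by simp
    have "l2_on K (\<lambda>p. conv g1 k (A p) - g1 (A p)) \<le> (LBNN p. ?f (A p))"
      by (intro nn_integral_mono) (use AK in \<open>auto simp: indicator_def\<close>)
    with 2 show ?thesis by (rule order_trans[rotated])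
  qed
  define e2 where "e2 = e1 / (1 + 3 * r)"
  have e2: "e2 > 0" "e2 * (1 + 3 * r) = e1" "e2 \<le> e1"
    using e1 r by (auto simp: e2_def divide_le_eq mult_le_cancel_left1)
  obtain L0 where L0: "\<And>p. p \<in> K \<Longrightarrow> \<bar>net L0 p - P p\<bar> \<le> e2" "\<And>p c. p \<in> K \<Longrightarrow> c \<in> Basis \<Longrightarrow> \<bar>dnet L0 [c] p - dP c p\<bar> \<le> e2"
    using C1_approxD[OF PC1 Kc e2(1)] by blast
  define L where "L = pull_units ?J ?c \<kappa> L0"
  define D where "D y = dnet L0 [e_t] y + (\<Sum>j\<in>UNIV. (y \<bullet> e_v j) * dnet L0 [e_x j] y)" for y
  have DLP: "\<bar>D y - LP y\<bar> \<le> e1" if y: "y \<in> K" for y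
  proof -
    have yv: "\<bar>y \<bullet> e_v j\<bar> \<le> r" for j
    proof -
      have "\<bar>y \<bullet> e_v j - ?c \<bullet> e_v j\<bar> \<le> ?h (e_v j)" using y phase_Basis_mem(3) unfolding K_def cbox_at_def by blast
      then show ?thesis by simp
    qed
    have "D y - LP y = (dnet L0 [e_t] y - dP e_t y) + (\<Sum>j\<in>UNIV. (y \<bullet> e_v j) * (dnet L0 [e_x j] y - dP (e_x j) y))"
      by (simp add: D_def LP_def right_diff_distrib sum_subtractf)
    also have "\<bar>...\<bar> \<le> \<bar>dnet L0 [e_t] y - dP e_t y\<bar> + (\<Sum>j\<in>UNIV. \<bar>(y \<bullet> e_v j) * (dnet L0 [e_x j] y - dP (e_x j) y)\<bar>)"
      by (intro order_trans[OF abs_triangle_ineq] add_left_mono sum_abs)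
    also have "... \<le> e2 + (\<Sum>j\<in>(UNIV::3 set). r * e2)"
      unfolding abs_mult using L0(2)[OF y] yv r by (intro add_mono sum_mono mult_mono) auto
    also have "... = e1" using e2(2) by (simp add: algebra_simps)
    finally show ?thesis .
  qed
  have Lu: "\<bar>net L p - u p\<bar> \<le> e" if p: "p \<in> K" for p
  proof -
    have "net L p = net L0 (A p)" by (simp add: L_def net_pull A_def)
    then show ?thesis
      using L0(1)[OF AK[OF p]] Pw[OF AK[OF p]] wA(1)[OF p] uA[OF p] e2(3) e1(3) by linarith
  qed
  have LD: "dnet L [e_t] p + (\<Sum>j\<in>UNIV. (p \<bullet> e_v j) * dnet L [e_x j] p) = \<kappa> * D (A p)" for p
  proof -
    have "A p \<bullet> e_v j = p \<bullet> e_v j" for j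
      unfolding A_def dil_inner[OF J phase_Basis_mem(3)] using tx_basis_facts(2) by simp
    moreover have "dnet L [e_t] p = \<kappa> * dnet L0 [e_t] (A p)" "dnet L [e_x j] p = \<kappa> * dnet L0 [e_x j] (A p)" for j
      unfolding L_def A_def by (auto intro!: dnet_pull[OF J])
    ultimately show ?thesis by (simp add: D_def sum_distrib_left algebra_simps)
  qed
  have pt: "(\<kappa> * D (A p) - G p)\<^sup>2 \<le> 6 * (3 * e1 + (conv g1 k (A p) - g1 (A p))\<^sup>2 + (G (A p) - G p)\<^sup>2 + (1 - \<kappa>)\<^sup>2 * (G p)\<^sup>2)"
    if p: "p \<in> K" for p
  proof -
    have eq: "\<kappa> * D (A p) - G p = \<kappa> * (D (A p) - LP (A p)) + \<kappa> * (conv g1 k (A p) - g1 (A p)) + \<kappa> * conv v k (A p)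
       + \<kappa> * com (A p) + \<kappa> * (G (A p) - G p) + (\<kappa> - 1) * G p"
      unfolding LP[OF AK[OF p]] wA(2)[OF p] by (simp add: algebra_simps)
    have k2: "(\<kappa> * x)\<^sup>2 \<le> x\<^sup>2" for x
      unfolding power_mult_distrib using \<kappa> by (intro mult_left_le_one_le) (auto simp: power_le_one)
    have k3: "(\<kappa> * x)\<^sup>2 \<le> e1" if "\<bar>x\<bar> \<le> e1" for x
    proof -
      have "x\<^sup>2 \<le> e1\<^sup>2" using that e1(1) by (simp add: abs_le_square_iff[symmetric])
      then show ?thesis using k2[of x] e1sq by linarith
    qed
    have "(\<kappa> * D (A p) - G p)\<^sup>2 \<le> 6 * ((\<kappa> * (D (A p) - LP (A p)))\<^sup>2 + (\<kappa> * (conv g1 k (A p) - g1 (A p)))\<^sup>2 + (\<kappa> * conv v k (A p))\<^sup>2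
       + (\<kappa> * com (A p))\<^sup>2 + (\<kappa> * (G (A p) - G p))\<^sup>2 + ((\<kappa> - 1) * G p)\<^sup>2)"
      unfolding eq by (rule power2_sum6)
    moreover have "((\<kappa> - 1) * G p)\<^sup>2 = (1 - \<kappa>)\<^sup>2 * (G p)\<^sup>2" by (simp add: power_mult_distrib power2_commute)
    moreover have "X \<le> 6 * (x1 + x2 + x3 + x4 + x5 + x6) \<Longrightarrow> x6 = y6 \<Longrightarrow> x1 \<le> e1 \<Longrightarrow> x2 \<le> y2 \<Longrightarrow> x3 \<le> e1 \<Longrightarrow> x4 \<le> e1 \<Longrightarrow> x5 \<le> y5
        \<Longrightarrow> X \<le> 6 * (3 * e1 + y2 + y5 + y6)" for X x1 x2 x3 x4 x5 x6 y2 y5 y6 :: real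
    proof -
      assume a: "X \<le> 6 * (x1 + x2 + x3 + x4 + x5 + x6)" "x6 = y6" "x1 \<le> e1" "x2 \<le> y2" "x3 \<le> e1" "x4 \<le> e1" "x5 \<le> y5"
      have "x1 + x2 + x3 + x4 + x5 + x6 \<le> e1 + y2 + e1 + e1 + y5 + y6"
        using a(2-) by (intro add_mono) auto
      then have "6 * (x1 + x2 + x3 + x4 + x5 + x6) \<le> 6 * (3 * e1 + y2 + y5 + y6)" by simp
      with a(1) show ?thesis by (rule order_trans)
    qed
    ultimately show ?thesis
      using k3[OF DLP[OF AK[OF p]]] k2[of "conv g1 k (A p) - g1 (A p)"] k3[OF vA[OF p]] k3[OF com[OF AK[OF p]]] k2[of "G (A p) - G p"]
      by blast
  qed
  have "l2_on K (\<lambda>p. \<kappa> * D (A p) - g p) = l2_on K (\<lambda>p. \<kappa> * D (A p) - G p)"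
  proof (rule nn_integral_cong_AE)
    show "AE p in lborel. ennreal ((\<kappa> * D (A p) - g p)\<^sup>2) * indicator K p = ennreal ((\<kappa> * D (A p) - G p)\<^sup>2) * indicator K p"
      using AE_cbox_box[of ?c ?h]
    proof eventually_elim
      case (elim p)
      have "G p = g p" if "p \<in> K"
      proof -
        have "p \<in> box_at ?c ?h" using elim that by (simp add: K_def)
        then have "p \<in> box_at ?c ?h'" unfolding box_at_def mem_Collect_eq using hpos(3) less_le_trans by blast
        then show ?thesis by (simp add: G_def)
      qed
      then show ?case by (auto simp: indicator_def)
    qed
  qed
  also have "... \<le> (LBNN p. ennreal (18 * e1) * indicator K p + 6 * (ennreal ((conv g1 k (A p) - g1 (A p))\<^sup>2) * indicator K p)
      + 6 * (ennreal ((G (A p) - G p)\<^sup>2) * indicator K p) + ennreal (6 * (1 - \<kappa>)\<^sup>2) * ennreal ((G p)\<^sup>2))"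
  proof (rule nn_integral_mono)
    fix p
    show "ennreal ((\<kappa> * D (A p) - G p)\<^sup>2) * indicator K p \<le> ennreal (18 * e1) * indicator K p + 6 * (ennreal ((conv g1 k (A p) - g1 (A p))\<^sup>2) * indicator K p)
      + 6 * (ennreal ((G (A p) - G p)\<^sup>2) * indicator K p) + ennreal (6 * (1 - \<kappa>)\<^sup>2) * ennreal ((G p)\<^sup>2)"
    proof (cases "p \<in> K")
      case True
      have "ennreal ((\<kappa> * D (A p) - G p)\<^sup>2) \<le> ennreal (18 * e1 + 6 * (conv g1 k (A p) - g1 (A p))\<^sup>2 + 6 * (G (A p) - G p)\<^sup>2 + 6 * (1 - \<kappa>)\<^sup>2 * (G p)\<^sup>2)"
        using pt[OF True] by (intro ennreal_leI) (simp add: algebra_simps)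
      also have "... = ennreal (18 * e1) + 6 * ennreal ((conv g1 k (A p) - g1 (A p))\<^sup>2) + 6 * ennreal ((G (A p) - G p)\<^sup>2) + ennreal (6 * (1 - \<kappa>)\<^sup>2) * ennreal ((G p)\<^sup>2)"
        using e1 by (simp add: ennreal_plus ennreal_mult)
      finally show ?thesis using True by simp
    qed simp
  qed
  also have "... = ennreal (18 * e1) * ennreal V + 6 * l2_on K (\<lambda>p. conv g1 k (A p) - g1 (A p))
      + 6 * l2_on K (\<lambda>p. G (A p) - G p) + ennreal (6 * (1 - \<kappa>)\<^sup>2) * l2sq G"
  proof -
    have [measurable]: "conv g1 k \<in> borel_maps" by (rule conv_measurable[OF g1m approx_kernel_measurable[OF kA]])
    have [measurable]: "A \<in> borel_maps" unfolding A_def by measurable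
    show ?thesis unfolding l2sq_def by (simp add: nn_integral_add nn_integral_cmult V)
  qed
  also have "... \<le> ennreal (18 * e1) * ennreal V + 6 * (16 * ennreal e1) + 6 * ennreal e1 + ennreal (6 * (1 - \<kappa>)\<^sup>2) * ennreal N0"
    unfolding N0(1) using gA dilG by (intro add_mono mult_left_mono) auto
  also have "ennreal (18 * e1) * ennreal V = ennreal (18 * e1 * V)" using e1(1) V(2) by (intro ennreal_mult[symmetric]) auto
  also have "6 * (16 * ennreal e1) = ennreal (96 * e1)"
    using e1(1) ennreal_mult[of 96 e1] by (simp add: mult.assoc[symmetric])
  also have "6 * ennreal e1 = ennreal (6 * e1)" using e1(1) ennreal_mult[of 6 e1] by simp
  also have "ennreal (6 * (1 - \<kappa>)\<^sup>2) * ennreal N0 = ennreal (6 * (1 - \<kappa>)\<^sup>2 * N0)"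
    using N0(2) by (intro ennreal_mult[symmetric]) auto
  also have "ennreal (18 * e1 * V) + ennreal (96 * e1) + ennreal (6 * e1) + ennreal (6 * (1 - \<kappa>)\<^sup>2 * N0)
     = ennreal (18 * e1 * V + 96 * e1 + 6 * e1 + 6 * (1 - \<kappa>)\<^sup>2 * N0)"
    using e1(1) V(2) N0(2) by (simp add: ennreal_plus[symmetric] del: ennreal_plus)
  also have "... \<le> ennreal e"
  proof (rule ennreal_leI)
    have "6 * (1 - \<kappa>)\<^sup>2 * N0 \<le> 6 * e1" using \<kappa>N by (simp add: mult.assoc)
    moreover have "18 * e1 * V + 96 * e1 + 6 * e1 + 6 * e1 = 6 * (e1 * (3 * V + 18))" by (simp add: algebra_simps)
    ultimately show "18 * e1 * V + 96 * e1 + 6 * e1 + 6 * (1 - \<kappa>)\<^sup>2 * N0 \<le> e" using e1V by linarith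
  qed
  finally have "l2_on K (\<lambda>p. \<kappa> * D (A p) - g p) \<le> ennreal e" .
  then show ?thesis using Lu by (intro exI[of _ L]) (simp add: LD)
qed

section \<open>A mixed-derivative Sobolev bound\<close>

lemma locally_integrable_measurable:
  fixes g :: "'a::euclidean_space \<Rightarrow> real"
  assumes "open \<Omega>" "locally_integrable \<Omega> g"
  shows "(\<lambda>p. indicator \<Omega> p * g p) \<in> borel_maps"
proof -
  obtain C where C: "\<And>n. compact (C n)" "\<And>n. C n \<subseteq> \<Omega>" "\<And>n. C n \<subseteq> interior (C (Suc n))" "\<Union>(range C) = \<Omega>"
    using open_Union_compact_subsets[OF assms(1)] by metis
  have inc: "C m \<subseteq> C n" if "m \<le> n" for m n
    using C(3) interior_subset by (intro lift_Suc_mono_le[OF _ that]) blast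
  show ?thesis
  proof (rule borel_measurable_LIMSEQ_real)
    show "(\<lambda>p. indicator (C n) p * g p) \<in> borel_maps" for n
    proof -
      have "integrable lborel (\<lambda>p. indicator (C n) p *\<^sub>R g p)"
        using assms(2) C(1,2) unfolding locally_integrable_def set_integrable_def by blast
      then show ?thesis using borel_measurable_integrable by fastforce
    qed
    fix p
    show "(\<lambda>n. indicator (C n) p * g p) \<longlonglongrightarrow> indicator \<Omega> p * g p"
    proof (cases "p \<in> \<Omega>")
      case True
      then obtain m where m: "p \<in> C m" using C(4) by blast
      have "indicator (C n) p * g p = indicator \<Omega> p * g p" if "n \<ge> m" for n
        using m inc[OF that] True by (auto simp: indicator_def)
      then show ?thesis by (intro tendsto_eventually) (unfold eventually_sequentially, blast)
    next
      case False
      then have "p \<notin> C n" for n using C(2) by blast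
      then have "(\<lambda>n. indicator (C n) p * g p) = (\<lambda>n. indicator \<Omega> p * g p)" using False by simp
      then show ?thesis by (simp only: tendsto_const)
    qed
  qed
qed

text \<open>
  The smoothed Heaviside function at \<open>c\<close> of width \<open>\<eta>\<close>; its derivative \<open>moll_at\<close> is a mollifier around \<open>c\<close>.
\<close>

definition step_at :: "real \<Rightarrow> real \<Rightarrow> real \<Rightarrow> real" where
  "step_at c \<eta> s = smooth_step ((1 / \<eta>) * s + (- c / \<eta>))"

definition moll_at :: "real \<Rightarrow> real \<Rightarrow> real \<Rightarrow> real" where
  "moll_at c \<eta> s = (1 / \<eta>) * mollifier1 ((1 / \<eta>) * s + (- c / \<eta>))"

lemma step_at:
  assumes "\<eta> > 0"
  shows "smooth1 (step_at c \<eta>)" "smooth1 (moll_at c \<eta>)" "(step_at c \<eta> has_real_derivative moll_at c \<eta> s) (at s)"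
    "0 \<le> step_at c \<eta> s" "step_at c \<eta> s \<le> 1" "s \<le> c - \<eta> \<Longrightarrow> step_at c \<eta> s = 0" "s \<ge> c + \<eta> \<Longrightarrow> step_at c \<eta> s = 1"
    "0 \<le> moll_at c \<eta> s" "\<bar>s - c\<bar> \<ge> \<eta> \<Longrightarrow> moll_at c \<eta> s = 0"
proof -
  have a: "(1 / \<eta>) * s + (- c / \<eta>) = (s - c) / \<eta>" for s by (simp add: diff_divide_distrib)
  show "smooth1 (step_at c \<eta>)" "smooth1 (moll_at c \<eta>)" unfolding step_at_def[abs_def] moll_at_def[abs_def]
    by (intro smooth1_affine smooth1_step smooth1_cmult smooth1_deriv)+
  show "(step_at c \<eta> has_real_derivative moll_at c \<eta> s) (at s)"
    unfolding step_at_def[abs_def] moll_at_def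
    by (rule DERIV_cong[OF DERIV_chain2[OF smooth1_DERIV[OF smooth1_step]]])
      (use assms in \<open>auto intro!: derivative_eq_intros\<close>)
  show "0 \<le> step_at c \<eta> s" "step_at c \<eta> s \<le> 1" unfolding step_at_def by (rule smooth_step_range)+
  show "s \<le> c - \<eta> \<Longrightarrow> step_at c \<eta> s = 0" unfolding step_at_def a
    by (rule step_left) (use assms in \<open>simp add: divide_le_eq\<close>)
  show "s \<ge> c + \<eta> \<Longrightarrow> step_at c \<eta> s = 1" unfolding step_at_def a
    by (rule step_right) (use assms in \<open>simp add: le_divide_eq\<close>)
  show "0 \<le> moll_at c \<eta> s" unfolding moll_at_def using mollifier1_nonneg assms by simp
  show "moll_at c \<eta> s = 0" if "\<bar>s - c\<bar> \<ge> \<eta>"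
  proof -
    have "\<bar>(s - c) / \<eta>\<bar> \<ge> 1" using that assms by (simp add: le_divide_eq)
    then show ?thesis unfolding moll_at_def a using mollifier1_zero by simp
  qed
qed

lemma moll_at_measurable [measurable]: "\<eta> > 0 \<Longrightarrow> moll_at c \<eta> \<in> borel_maps"
  by (intro borel_measurable_continuous_onI smooth1_continuous_on step_at)

lemma moll_at_integral:
  assumes "\<eta> > 0"
  shows "(LBNN s. ennreal (moll_at c \<eta> s)) = 1"
proof -
  have "(LBNN s. ennreal (moll_at c \<eta> s)) = (LBNN s. ennreal (moll_at c \<eta> s) * indicator {c - \<eta>..c + \<eta>} s)"
    using step_at(9)[OF assms] by (intro nn_integral_cong) (auto simp: indicator_def abs_le_iff)
  also have "... = ennreal (step_at c \<eta> (c + \<eta>) - step_at c \<eta> (c - \<eta>))"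
    using assms by (intro nn_integral_FTC_Icc moll_at_measurable step_at) auto
  also have "... = 1" using step_at(6)[OF assms, of "c - \<eta>" c] step_at(7)[OF assms, of c "c + \<eta>"] by simp
  finally show ?thesis .
qed

lemma moll_at_integral_centre:
  assumes "\<eta> > 0"
  shows "(LBNN c. ennreal (moll_at c \<eta> s)) = 1"
proof -
  have *: "moll_at c \<eta> s = moll_at 0 \<eta> (s - c)" for c by (simp add: moll_at_def diff_divide_distrib)
  have "(\<lambda>s. ennreal (moll_at 0 \<eta> s)) \<in> borel_maps" using assms by measurable
  from nn_integral_lborel_reflect[OF this, of s] show ?thesis
    unfolding * using moll_at_integral[OF assms, of 0] by simp
qed

lemma mollifier1_bound: "\<exists>M>0. \<forall>s. mollifier1 s \<le> M"
proof -
  have "bounded (mollifier1 ` {-1..1})"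
    by (intro compact_imp_bounded compact_continuous_image smooth1_continuous_on smooth1_deriv smooth1_step) auto
  then obtain M where "\<forall>y\<in>mollifier1 ` {-1..1}. norm y \<le> M" unfolding bounded_iff by blast
  then have "mollifier1 s \<le> \<bar>M\<bar> + 1" for s
    using mollifier1_zero[of s] by (cases "\<bar>s\<bar> \<ge> 1") (auto simp: abs_le_iff dest!: bspec[of _ _ s])
  then show ?thesis by (intro exI[of _ "\<bar>M\<bar> + 1"]) auto
qed

lemma sum_square_le:
  fixes a :: "'i \<Rightarrow> real"
  assumes "finite I"
  shows "(\<Sum>i\<in>I. a i)\<^sup>2 \<le> real (card I) * (\<Sum>i\<in>I. (a i)\<^sup>2)"
  using Cauchy_Schwarz_ineq_sum[of "\<lambda>_. 1" a I] by simp

lemma tx_card: "finite tx_basis" "card tx_basis = 4"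
proof -
  have "inj e_x" by (auto simp: inj_def axis_eq_axis)
  then have "card (range e_x) = 3" by (simp add: card_image)
  moreover have "e_t \<notin> range e_x" by auto
  ultimately show "card tx_basis = 4" by simp
qed simp

lemma prod_phase_v: "(\<Prod>b\<in>Basis - tx_basis. f b) = (\<Prod>b\<in>(Basis :: (real^3) set). f (0, 0, b))"
proof -
  have "Basis - tx_basis = (\<lambda>b. (0, 0, b)) ` (Basis :: (real^3) set)"
    unfolding phase_Basis by (auto simp: Basis_vec_def image_iff)
  moreover have "inj_on (\<lambda>b. (0, 0, b) :: phase) (Basis :: (real^3) set)" by (auto simp: inj_on_def)
  ultimately show ?thesis by (simp add: prod.reindex)
qed

lemma tens_moll:
  assumes \<eta>: "\<eta> > 0"
  shows "0 \<le> tens (\<lambda>b. moll_at (p0 \<bullet> b) \<eta>) p"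
    and "p \<notin> cbox_at p0 (\<lambda>b. \<eta>) \<Longrightarrow> tens (\<lambda>b. moll_at (p0 \<bullet> b) \<eta>) p = 0"
    and "(LBNN p. ennreal (tens (\<lambda>b. moll_at (p0 \<bullet> b) \<eta>) p)) = 1"
    and "continuous_on UNIV (tens (\<lambda>b. moll_at (p0 \<bullet> b) \<eta>))"
proof -
  show "0 \<le> tens (\<lambda>b. moll_at (p0 \<bullet> b) \<eta>) p" unfolding tens_def by (intro prod_nonneg ballI step_at \<eta>)
  show "tens (\<lambda>b. moll_at (p0 \<bullet> b) \<eta>) p = 0" if out: "p \<notin> cbox_at p0 (\<lambda>b. \<eta>)"
  proof -
    obtain b where b: "b \<in> Basis" "\<bar>p \<bullet> b - p0 \<bullet> b\<bar> > \<eta>" using out by (auto simp: cbox_at_def)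
    then show ?thesis unfolding tens_def
      by (intro prod_zero finite_Basis bexI[of _ b] step_at(9)[OF \<eta>]) auto
  qed
  have "(LBNN p. ennreal (tens (\<lambda>b. moll_at (p0 \<bullet> b) \<eta>) p))
     = (LBNN p. (\<Prod>b\<in>Basis. ennreal (moll_at (p0 \<bullet> b) \<eta> (p \<bullet> b))))"
    unfolding tens_def by (intro nn_integral_cong prod_ennreal[symmetric] step_at \<eta>)
  also have "... = (\<Prod>b\<in>Basis. LBNN s. ennreal (moll_at (p0 \<bullet> b) \<eta> s))"
    using moll_at_measurable[OF \<eta>] by (intro nn_integral_lborel_prod) auto
  also have "... = 1" by (simp add: moll_at_integral[OF \<eta>])
  finally show "(LBNN p. ennreal (tens (\<lambda>b. moll_at (p0 \<bullet> b) \<eta>) p)) = 1" .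
  show "continuous_on UNIV (tens (\<lambda>b. moll_at (p0 \<bullet> b) \<eta>))"
    by (intro continuous_on_tens smooth1_continuous_on step_at \<eta>)
qed

definition mollified :: "(phase \<Rightarrow> real) \<Rightarrow> real \<Rightarrow> phase \<Rightarrow> real" where
  "mollified f \<eta> p0 = (LBINT p:cbox_at p0 (\<lambda>b. \<eta>). f p * tens (\<lambda>b. moll_at (p0 \<bullet> b) \<eta>) p)"

text \<open>
  Four weak derivatives bound \<open>f\<close> uniformly in \<open>(t, x)\<close> with values in \<open>L\<^sup>2\<close> of the velocity, because one
  derivative in each of the four variables \<open>t\<close>, \<open>x\<close> is enough.  In one variable, write the mollifier
  \<open>k\<close> at the point as \<open>A - B'\<close>, with a fixed wide mollifier \<open>A\<close> and the difference \<open>B\<close> of two smoothed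
  Heaviside functions; \<open>A\<close> and \<open>B\<close> are bounded independently of \<open>\<eta>\<close>, and \<open>B\<close> has compact support.
  The product over the four variables expands into 16 terms, one for each set \<open>Q\<close> of variables with the
  factor \<open>-B'\<close>.  Integration by parts moves these derivatives to \<open>f\<close>.  The remaining kernel is at most a
  constant times the mollifier \<open>\<psi>\<close> in the velocity; the Cauchy-Schwarz inequality with the weight \<open>\<psi>\<close>
  and integration over \<open>\<xi>\<close> give the bound.  The constant is \<open>256 = 16 * 16\<close>: the square of a sum of 16
  terms is at most 16 times the sum of their 16 squares.
\<close>

lemma mixed_sobolev_mollified:
  fixes f :: "phase \<Rightarrow> real" and t :: real and x :: "real^3"
  assumes T: "T > 0"
    and G: "\<And>\<alpha>. \<alpha> \<in> multi_indices 4 \<Longrightarrow> weak_deriv (phase_domain T) \<alpha> f (G \<alpha>)"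
    and S: "\<And>\<alpha>. \<alpha> \<in> multi_indices 4 \<Longrightarrow> l2_on (phase_cell T) (\<lambda>p. G \<alpha> p) \<le> ennreal s"
    and s: "s \<ge> 0"
    and M: "M > 0" "\<And>y. mollifier1 y \<le> M"
    and y: "\<And>b. b \<in> tx_basis \<Longrightarrow> \<bar>(t, x, 0) \<bullet> b - cell_centre T \<bullet> b\<bar> + \<eta> < cell_radius T 1 b" and \<eta>: "\<eta> > 0"
  defines "C \<equiv> (\<Prod>b\<in>tx_basis. max 1 (2 * M / cell_radius T 1 b))"
  defines "vol \<equiv> (\<Prod>b\<in>tx_basis. 2 * cell_radius T 1 b)"
  shows "(LBNN \<xi>. ennreal ((mollified f \<eta> (t, x, \<xi>))\<^sup>2)) \<le> ennreal (256 * (C\<^sup>2 * vol * s))"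
proof -
  let ?J = tx_basis and ?c = "cell_centre T" and ?\<rho> = "cell_radius T 1"
  note J = tx_basis_facts(1)
  have \<rho>: "?\<rho> b > 0" for b using T by (auto simp: cell_radius_def)
  have vol: "vol \<ge> 0" unfolding vol_def using \<rho> by (intro prod_nonneg) (auto intro: less_imp_le)
  have C1: "C \<ge> 0" unfolding C_def by (intro prod_nonneg) auto
  have J\<xi>: "(t, x, \<xi>) \<bullet> b = (t, x, 0) \<bullet> b" if "b \<in> ?J" for \<xi> b using that by auto
  define Y where "Y = {p :: phase. \<forall>b\<in>?J. \<bar>p \<bullet> b - ?c \<bullet> b\<bar> < ?\<rho> b}"
  have Yopen: "open Y"
  proof -
    have "Y = (\<Inter>b\<in>?J. {p. \<bar>p \<bullet> b - ?c \<bullet> b\<bar> < ?\<rho> b})" unfolding Y_def by blast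
    moreover have "open {p :: phase. \<bar>p \<bullet> b - ?c \<bullet> b\<bar> < ?\<rho> b}" for b
      by (intro open_Collect_less continuous_intros)
    ultimately show ?thesis using tx_card(1) by (simp only:) (intro open_INT, auto)
  qed
  have Ym[measurable]: "Y \<in> sets borel" using Yopen by simp
  have Ycell: "Y \<subseteq> phase_cell T" "Y \<subseteq> phase_domain T"
  proof -
    have "p \<in> phase_cell T \<and> p \<in> phase_domain T" if "p \<in> Y" for p
    proof -
      obtain t x \<xi> where e: "p = (t, x, \<xi>)" by (cases p) auto
      have b: "\<bar>p \<bullet> b - ?c \<bullet> b\<bar> < ?\<rho> b" if "b \<in> ?J" for b using \<open>p \<in> Y\<close> that unfolding Y_def by blast
      have "\<bar>x $ j\<bar> < pi" for j using b[of "e_x j"] by (simp add: e inner_axis)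
      moreover have "\<bar>t - T / 2\<bar> < T / 2" using b[of e_t] by (simp add: e)
      then have "0 < t" "t < T" by linarith+
      ultimately show ?thesis by (auto simp: e phase_cell_def phase_domain_def torus_cube_def abs_less_iff intro: less_imp_le) (meson less_imp_le minus_less_iff)+
    qed
    then show "Y \<subseteq> phase_cell T" "Y \<subseteq> phase_domain T" by auto
  qed
  define \<psi> where "\<psi> p \<xi> = (\<Prod>b\<in>Basis. moll_at (\<xi> \<bullet> b) \<eta> (snd (snd p) \<bullet> b))" for p :: phase and \<xi> :: "real^3"
  have \<psi>0: "\<psi> p \<xi> \<ge> 0" for p \<xi> unfolding \<psi>_def by (intro prod_nonneg ballI step_at \<eta>)
  have mc: "continuous_on UNIV mollifier1"
    by (intro smooth1_continuous_on smooth1_deriv smooth1_step)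
  then have [measurable]: "mollifier1 \<in> borel_maps" by (rule borel_measurable_continuous_onI)
  have \<psi>c: "continuous_on UNIV (\<lambda>q :: (real^3) \<times> phase. \<psi> (snd q) (fst q))"
    unfolding \<psi>_def moll_at_def using \<eta>
    by (intro continuous_on_prod continuous_on_mult continuous_on_const continuous_on_compose2[OF mc] continuous_intros) auto
  have \<psi>m[measurable]: "(\<lambda>(\<xi>, p). \<psi> p \<xi>) \<in> borel_measurable (borel \<Otimes>\<^sub>M borel)"
    unfolding borel_prod case_prod_beta by (rule borel_measurable_continuous_onI[OF \<psi>c])
  have \<psi>m1[measurable]: "(\<lambda>p. \<psi> p \<xi>) \<in> borel_maps" "(\<lambda>\<xi>. \<psi> p \<xi>) \<in> borel_maps" for \<xi> p
    by (intro borel_measurable_continuous_onI continuous_on_compose2[OF \<psi>c, of _ "\<lambda>p. (\<xi>, p)", simplified] continuous_intros)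
      (intro borel_measurable_continuous_onI continuous_on_compose2[OF \<psi>c, of _ "\<lambda>\<xi>. (\<xi>, p)", simplified] continuous_intros)
  have \<psi>int: "(LBNN \<xi>. ennreal (\<psi> p \<xi>)) = 1" for p
  proof -
    have "(LBNN \<xi>. ennreal (\<psi> p \<xi>)) = (LBNN \<xi>. (\<Prod>b\<in>Basis. ennreal (moll_at (\<xi> \<bullet> b) \<eta> (snd (snd p) \<bullet> b))))"
      unfolding \<psi>_def by (intro nn_integral_cong prod_ennreal[symmetric] step_at \<eta>)
    also have "... = (\<Prod>b\<in>(Basis :: (real^3) set). LBNN c. ennreal (moll_at c \<eta> (snd (snd p) \<bullet> b)))"
      by (intro nn_integral_lborel_prod) (auto simp: moll_at_def)
    finally show ?thesis by (simp add: moll_at_integral_centre[OF \<eta>])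
  qed
  have \<psi>Y: "(LBNN p. ennreal (\<psi> p \<xi>) * indicator Y p) = ennreal vol" for \<xi>
  proof -
    let ?f = "\<lambda>b s. if b \<in> ?J then indicator {?c \<bullet> b - ?\<rho> b<..<?c \<bullet> b + ?\<rho> b} s else ennreal (moll_at ((0, 0, \<xi>) \<bullet> b) \<eta> s)"
    have "ennreal (\<psi> p \<xi>) * indicator Y p = (\<Prod>b\<in>Basis. ?f b (p \<bullet> b))" for p
    proof -
      obtain t' x' \<xi>' where p: "p = (t', x', \<xi>')" by (cases p) auto
      have "(\<Prod>b\<in>Basis - ?J. ?f b (p \<bullet> b)) = (\<Prod>b\<in>Basis - ?J. ennreal (moll_at ((0, 0, \<xi>) \<bullet> b) \<eta> (p \<bullet> b)))"
        by (intro prod.cong) auto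
      also have "... = ennreal (\<psi> p \<xi>)"
        unfolding prod_phase_v \<psi>_def using step_at(8)[OF \<eta>] by (subst prod_ennreal) (auto simp: p)
      finally have 1: "(\<Prod>b\<in>Basis - ?J. ?f b (p \<bullet> b)) = ennreal (\<psi> p \<xi>)" .
      have 2: "(\<Prod>b\<in>?J. ?f b (p \<bullet> b)) = indicator Y p"
      proof (cases "p \<in> Y")
        case True
        then have "?f b (p \<bullet> b) = 1" if "b \<in> ?J" for b
        proof -
          have "\<bar>p \<bullet> b - ?c \<bullet> b\<bar> < ?\<rho> b" using True that unfolding Y_def by blast
          then have "p \<bullet> b \<in> {?c \<bullet> b - ?\<rho> b<..<?c \<bullet> b + ?\<rho> b}" unfolding greaterThanLessThan_iff by linarith
          then show ?thesis using that by simp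
        qed
        then show ?thesis using True by (simp only: prod.neutral_const prod.cong) simp
      next
        case False
        then obtain b where b: "b \<in> ?J" "\<not> \<bar>p \<bullet> b - ?c \<bullet> b\<bar> < ?\<rho> b" unfolding Y_def by blast
        then have "p \<bullet> b \<notin> {?c \<bullet> b - ?\<rho> b<..<?c \<bullet> b + ?\<rho> b}" unfolding greaterThanLessThan_iff by linarith
        then have "(\<Prod>b\<in>?J. ?f b (p \<bullet> b)) = 0" using b(1) by (intro prod_zero tx_card bexI[of _ b]) auto
        then show ?thesis using False by simp
      qed
      show ?thesis using prod.subset_diff[OF J finite_Basis, of "\<lambda>b. ?f b (p \<bullet> b)"] unfolding 1 2 by simp
    qed
    then have "(LBNN p. ennreal (\<psi> p \<xi>) * indicator Y p) = (LBNN p. (\<Prod>b\<in>Basis. ?f b (p \<bullet> b)))" by simp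
    also have "... = (\<Prod>b\<in>Basis. LBNN s. ?f b s)"
    proof (rule nn_integral_lborel_prod)
      show "?f b \<in> borel_maps" if "b \<in> Basis" for b
      proof (cases "b \<in> ?J")
        case False
        then show ?thesis unfolding if_not_P[OF False] using moll_at_measurable[OF \<eta>] by measurable
      qed (simp only: if_True, measurable)
    qed auto
    also have "... = (\<Prod>b\<in>Basis - ?J. LBNN s. ?f b s) * (\<Prod>b\<in>?J. LBNN s. ?f b s)"
      by (rule prod.subset_diff[OF J finite_Basis])
    also have "(\<Prod>b\<in>Basis - ?J. LBNN s. ?f b s) = 1"
      by (intro prod.neutral ballI) (simp add: moll_at_integral[OF \<eta>] del: insert_iff)
    also have "(\<Prod>b\<in>?J. LBNN s. ?f b s) = (\<Prod>b\<in>?J. ennreal (2 * ?\<rho> b))"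
    proof (rule prod.cong[OF refl])
      fix b assume b: "b \<in> ?J"
      have "(LBNN s. ?f b s) = emeasure lborel {?c \<bullet> b - ?\<rho> b<..<?c \<bullet> b + ?\<rho> b}"
        unfolding if_P[OF b] by (rule nn_integral_indicator) simp
      also have "... = ennreal (2 * ?\<rho> b)" using \<rho>[of b] by (subst emeasure_lborel_Ioo) auto
      finally show "(LBNN s. ?f b s) = ennreal (2 * ?\<rho> b)" .
    qed
    also have "... = ennreal vol" unfolding vol_def by (rule prod_ennreal) (rule mult_nonneg_nonneg[OF _ less_imp_le[OF \<rho>]], simp)
    finally show ?thesis by simp
  qed
  have mi: "mset_set Q \<in> multi_indices 4" if "Q \<subseteq> ?J" for Q
  proof -
    have "finite Q" "card Q \<le> 4" using card_mono[OF tx_card(1) that] finite_subset[OF that tx_card(1)] tx_card(2) by auto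
    then show ?thesis using that J unfolding multi_indices_def by (auto simp del: insert_subset)
  qed
  define H where "H Q p = indicator Y p * (indicator (phase_domain T) p * G (mset_set Q) p)" for Q p
  have dom: "open (phase_domain T)" by (auto simp: phase_domain_def intro!: open_Times)
  have Hm[measurable]: "H Q \<in> borel_maps" if "Q \<subseteq> ?J" for Q
  proof -
    have [measurable]: "(\<lambda>p. indicator (phase_domain T) p * G (mset_set Q) p) \<in> borel_maps"
      using G[OF mi[OF that]] by (intro locally_integrable_measurable[OF dom]) (simp add: weak_deriv_def)
    show ?thesis unfolding H_def[abs_def] by measurable
  qed
  have HY: "H Q p = G (mset_set Q) p" if "p \<in> Y" for Q p using that Ycell(2) by (auto simp: H_def)
  have Hint: "(LBNN p. ennreal ((H Q p)\<^sup>2)) \<le> ennreal s" if "Q \<subseteq> ?J" for Q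
  proof -
    have "(LBNN p. ennreal ((H Q p)\<^sup>2)) \<le> l2_on (phase_cell T) (\<lambda>p. G (mset_set Q) p)"
      using Ycell by (intro nn_integral_mono) (auto simp: H_def indicator_def)
    also have "... \<le> ennreal s" by (rule S[OF mi[OF that]])
    finally show ?thesis .
  qed
  let ?I = "\<lambda>Q \<xi>. LBNN p. ennreal ((H Q p)\<^sup>2) * ennreal (\<psi> p \<xi>)"
  have key: "ennreal ((mollified f \<eta> (t, x, \<xi>))\<^sup>2) \<le> (\<Sum>Q\<in>Pow ?J. ennreal (16 * (C\<^sup>2 * vol)) * ?I Q \<xi>)" for \<xi>
  proof -
    define p0 where "p0 = (t, x, \<xi>)"
    define k where "k b = moll_at (p0 \<bullet> b) \<eta>" for b
    define A where "A b = moll_at (?c \<bullet> b) (?\<rho> b / 2)" for b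
    define B where "B b s = step_at (?c \<bullet> b) (?\<rho> b / 2) s - step_at (p0 \<bullet> b) \<eta> s" for b s
    have \<rho>2: "?\<rho> b / 2 > 0" for b using \<rho>[of b] by simp
    have B': "(B b has_real_derivative A b s - k b s) (at s)" for b s
      unfolding B_def[abs_def] A_def k_def by (intro DERIV_diff step_at \<rho>2 \<eta>)
    have dB: "deriv (B b) = (\<lambda>s. A b s - k b s)" for b by (intro ext DERIV_imp_deriv B')
    have sA: "smooth1 (A b)" and sk: "smooth1 (k b)" and sB: "smooth1 (B b)" for b
      unfolding A_def k_def B_def[abs_def] by (intro step_at \<rho>2 \<eta> smooth1_diff)+
    \<comment> \<open>A box that contains the supports of all 16 kernels and whose projection to \<open>(t, x)\<close> stays inside the cell.\<close>
    define R where "R b = (if b \<in> ?J then max (?\<rho> b / 2) (\<bar>p0 \<bullet> b - ?c \<bullet> b\<bar> + \<eta>) else \<eta>)" for b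
    define cc where "cc = (T / 2, 0 :: real^3, \<xi>)"
    have ccJ: "cc \<bullet> b = ?c \<bullet> b" if "b \<in> ?J" for b using that by (auto simp: cc_def)
    have ccv: "cc \<bullet> b = p0 \<bullet> b" if "b \<in> Basis - ?J" for b
      using that tx_basis_facts(3)[of b] by (auto simp: cc_def p0_def)
    have RJ: "?\<rho> b / 2 \<le> R b" "\<bar>p0 \<bullet> b - ?c \<bullet> b\<bar> + \<eta> \<le> R b" "R b < ?\<rho> b" if "b \<in> ?J" for b
    proof -
      have Rb: "R b = max (?\<rho> b / 2) (\<bar>p0 \<bullet> b - ?c \<bullet> b\<bar> + \<eta>)" unfolding R_def using that by (simp only: if_True)
      show "?\<rho> b / 2 \<le> R b" "\<bar>p0 \<bullet> b - ?c \<bullet> b\<bar> + \<eta> \<le> R b" unfolding Rb by simp_all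
      show "R b < ?\<rho> b" using y[OF that] \<rho>[of b] J\<xi>[OF that, of \<xi>] unfolding Rb p0_def by simp
    qed
    have Rv: "R b = \<eta>" if "b \<in> Basis - ?J" for b using that by (simp add: R_def)
    define l where "l = (\<Sum>b\<in>Basis. (cc \<bullet> b - R b) *\<^sub>R b)"
    define r where "r = (\<Sum>b\<in>Basis. (cc \<bullet> b + R b) *\<^sub>R b)"
    have lr: "cbox l r = cbox_at cc R" unfolding l_def r_def cbox_at_eq ..
    have lb: "l \<bullet> b = cc \<bullet> b - R b" "r \<bullet> b = cc \<bullet> b + R b" if "b \<in> Basis" for b
      using that unfolding l_def r_def by (simp_all only: inner_sum_left_Basis)
    have boxY: "cbox l r \<subseteq> Y"
    proof
      fix p assume "p \<in> cbox l r"
      then have p: "\<bar>p \<bullet> b - cc \<bullet> b\<bar> \<le> R b" if "b \<in> Basis" for b using that by (simp add: lr cbox_at_def)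
      have "\<bar>p \<bullet> b - ?c \<bullet> b\<bar> < ?\<rho> b" if b: "b \<in> ?J" for b
      proof -
        have "b \<in> Basis" using J b by blast
        from p[OF this] RJ(3)[OF b] show ?thesis unfolding ccJ[OF b] by (rule le_less_trans)
      qed
      then show "p \<in> Y" unfolding Y_def by blast
    qed
    have box\<Omega>: "cbox l r \<subseteq> phase_domain T" using boxY Ycell(2) by blast
    define h where "h Q b = (if b \<in> Q then B b else if b \<in> ?J then A b else k b)" for Q b
    have sh: "smooth1 (h Q b)" for Q b unfolding h_def using sA sB sk by simp
    have h0: "h Q b s = 0" if Q: "Q \<subseteq> ?J" and b: "b \<in> Basis" and s: "s \<notin> {l \<bullet> b..r \<bullet> b}" for Q b s
    proof -
      have s': "\<bar>s - cc \<bullet> b\<bar> > R b" using s unfolding lb[OF b] atLeastAtMost_iff by linarith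
      show ?thesis
      proof (cases "b \<in> ?J")
        case bJ: True
        have sR: "\<bar>s - ?c \<bullet> b\<bar> > ?\<rho> b / 2" "\<bar>s - ?c \<bullet> b\<bar> > \<bar>p0 \<bullet> b - ?c \<bullet> b\<bar> + \<eta>"
          using s' RJ(1,2)[OF bJ] unfolding ccJ[OF bJ] by linarith+
        have A0: "A b s = 0" unfolding A_def by (rule step_at(9)[OF \<rho>2]) (use sR in simp)
        have B0: "B b s = 0"
        proof (cases "s > ?c \<bullet> b")
          case True
          have "step_at (?c \<bullet> b) (?\<rho> b / 2) s = 1" "step_at (p0 \<bullet> b) \<eta> s = 1"
            by (rule step_at(7)[OF \<rho>2], use sR True in linarith) (rule step_at(7)[OF \<eta>], use sR True in linarith)
          then show ?thesis by (simp add: B_def)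
        next
          case False
          have "step_at (?c \<bullet> b) (?\<rho> b / 2) s = 0" "step_at (p0 \<bullet> b) \<eta> s = 0"
            by (rule step_at(6)[OF \<rho>2], use sR False in linarith) (rule step_at(6)[OF \<eta>], use sR False in linarith)
          then show ?thesis by (simp add: B_def)
        qed
        show ?thesis unfolding h_def using A0 B0 bJ by (simp del: insert_iff)
      next
        case bJ: False
        then have bv: "b \<in> Basis - ?J" "b \<notin> Q" using b Q by auto
        have "k b s = 0" unfolding k_def by (rule step_at(9)[OF \<eta>]) (use s'[unfolded Rv[OF bv(1)] ccv[OF bv(1)]] in simp)
        then show ?thesis unfolding h_def using bJ bv by (simp del: insert_iff)
      qed
    qed
    let ?D = "\<lambda>Q b. (deriv ^^ count (mset_set Q) b) (h Q b)"
    have expand: "tens k p = (\<Sum>Q\<in>Pow ?J. (-1) ^ card Q * tens (?D Q) p)" for p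
    proof -
      have DQ: "tens (?D Q) p = (\<Prod>b\<in>Basis - ?J. k b (p \<bullet> b)) * ((\<Prod>b\<in>Q. deriv (B b) (p \<bullet> b)) * (\<Prod>b\<in>?J - Q. A b (p \<bullet> b)))" if Q: "Q \<subseteq> ?J" for Q
      proof -
        have fQ: "finite Q" using finite_subset[OF Q tx_card(1)] .
        have "tens (?D Q) p = (\<Prod>b\<in>Basis - ?J. ?D Q b (p \<bullet> b)) * (\<Prod>b\<in>?J. ?D Q b (p \<bullet> b))"
          unfolding tens_def by (rule prod.subset_diff[OF J finite_Basis])
        also have "(\<Prod>b\<in>?J. ?D Q b (p \<bullet> b)) = (\<Prod>b\<in>?J - Q. ?D Q b (p \<bullet> b)) * (\<Prod>b\<in>Q. ?D Q b (p \<bullet> b))"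
          by (rule prod.subset_diff[OF Q tx_card(1)])
        also have "(\<Prod>b\<in>?J - Q. ?D Q b (p \<bullet> b)) = (\<Prod>b\<in>?J - Q. A b (p \<bullet> b))"
          by (intro prod.cong) (auto simp: h_def count_mset_set' fQ)
        also have "(\<Prod>b\<in>Q. ?D Q b (p \<bullet> b)) = (\<Prod>b\<in>Q. deriv (B b) (p \<bullet> b))"
          by (intro prod.cong) (auto simp: h_def count_mset_set' fQ)
        also have "(\<Prod>b\<in>Basis - ?J. ?D Q b (p \<bullet> b)) = (\<Prod>b\<in>Basis - ?J. k b (p \<bullet> b))"
          using Q by (intro prod.cong) (auto simp: h_def count_mset_set' fQ)
        finally show ?thesis by (simp add: mult.commute)
      qed
      have "tens k p = (\<Prod>b\<in>Basis - ?J. k b (p \<bullet> b)) * (\<Prod>b\<in>?J. k b (p \<bullet> b))"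
        unfolding tens_def by (rule prod.subset_diff[OF J finite_Basis])
      also have "(\<Prod>b\<in>?J. k b (p \<bullet> b)) = (\<Prod>b\<in>?J. - deriv (B b) (p \<bullet> b) + A b (p \<bullet> b))"
        by (intro prod.cong refl) (simp add: dB)
      also have "... = (\<Sum>Q\<in>Pow ?J. (\<Prod>b\<in>Q. - deriv (B b) (p \<bullet> b)) * (\<Prod>b\<in>?J - Q. A b (p \<bullet> b)))"
        by (rule prod_add[OF tx_card(1)])
      finally have e1: "tens k p = (\<Prod>b\<in>Basis - ?J. k b (p \<bullet> b)) * (\<Sum>Q\<in>Pow ?J. (\<Prod>b\<in>Q. - deriv (B b) (p \<bullet> b)) * (\<Prod>b\<in>?J - Q. A b (p \<bullet> b)))" .
      show ?thesis unfolding e1 sum_distrib_left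
      proof (rule sum.cong[OF refl])
        fix Q assume "Q \<in> Pow ?J"
        then have Q: "Q \<subseteq> ?J" by blast
        show "(\<Prod>b\<in>Basis - ?J. k b (p \<bullet> b)) * ((\<Prod>b\<in>Q. - deriv (B b) (p \<bullet> b)) * (\<Prod>b\<in>?J - Q. A b (p \<bullet> b))) = (-1) ^ card Q * tens (?D Q) p"
          unfolding DQ[OF Q] prod_uminus by (simp add: mult_ac)
      qed
    qed
    have si: "set_integrable lborel (cbox l r) f"
      using weak_deriv_set_integrable(1)[OF G[OF mi[of "{}"]] compact_cbox box\<Omega>] by simp
    have cD: "continuous_on (cbox l r) (tens (?D Q))" for Q
      by (intro continuous_on_tens smooth1_continuous_on smooth1_higher_deriv sh)
    have "mollified f \<eta> p0 = (LBINT p:cbox l r. f p * tens k p)"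
    proof -
      have sub: "cbox_at p0 (\<lambda>b. \<eta>) \<subseteq> cbox l r"
      proof
        fix p assume "p \<in> cbox_at p0 (\<lambda>b. \<eta>)"
        then have p: "\<bar>p \<bullet> b - p0 \<bullet> b\<bar> \<le> \<eta>" if "b \<in> Basis" for b using that by (simp add: cbox_at_def)
        have "\<bar>p \<bullet> b - cc \<bullet> b\<bar> \<le> R b" if b: "b \<in> Basis" for b
        proof (cases "b \<in> ?J")
          case True
          then show ?thesis using p[OF b] RJ(2)[OF True] unfolding ccJ[OF True] by linarith
        next
          case False
          then have bv: "b \<in> Basis - ?J" using b by blast
          show ?thesis using p[OF b] unfolding Rv[OF bv] ccv[OF bv] .
        qed
        then show "p \<in> cbox l r" by (simp add: lr cbox_at_def)
      qed
      show ?thesis unfolding mollified_def set_lebesgue_integral_def k_def[abs_def]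
        using sub tens_moll(2)[OF \<eta>, of _ p0]
        by (intro Bochner_Integration.integral_cong) (auto simp: indicator_def)
    qed
    also have "... = (LBINT p:cbox l r. (\<Sum>Q\<in>Pow ?J. (-1) ^ card Q * (f p * tens (?D Q) p)))"
      unfolding expand by (simp add: sum_distrib_left mult_ac)
    also have "... = (\<Sum>Q\<in>Pow ?J. LBINT p:cbox l r. (-1) ^ card Q * (f p * tens (?D Q) p))"
      unfolding set_lebesgue_integral_def scaleR_sum_right
    proof (rule Bochner_Integration.integral_sum)
      fix Q
      have "integrable lborel (\<lambda>p. (-1) ^ card Q * (indicator (cbox l r) p *\<^sub>R (f p * tens (?D Q) p)))"
        using set_integrable_times_continuous[OF si compact_cbox cD]
        unfolding set_integrable_def by (intro Bochner_Integration.integrable_mult_right)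
      then show "integrable lborel (\<lambda>p. indicator (cbox l r) p *\<^sub>R ((-1) ^ card Q * (f p * tens (?D Q) p)))"
        by (simp add: mult_ac)
    qed
    also have "... = (\<Sum>Q\<in>Pow ?J. LBINT p:cbox l r. G (mset_set Q) p * tens (h Q) p)"
    proof (rule sum.cong[OF refl])
      fix Q assume "Q \<in> Pow ?J"
      then have Q: "Q \<subseteq> ?J" by blast
      have fQ: "finite Q" using finite_subset[OF Q tx_card(1)] .
      have "(LBINT p:cbox l r. f p * tens (?D Q) p) = (-1) ^ size (mset_set Q) * (LBINT p:cbox l r. G (mset_set Q) p * tens (h Q) p)"
        by (rule weak_deriv_tens[OF G[OF mi[OF Q]] _ sh h0[OF Q] box\<Omega>]) (use Q J fQ in auto)
      moreover have "(LBINT p:cbox l r. (-1) ^ card Q * (f p * tens (?D Q) p)) = (-1) ^ card Q * (LBINT p:cbox l r. f p * tens (?D Q) p)"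
        by (rule set_integral_mult_right)
      moreover have "(-1) ^ card Q * ((-1) ^ size (mset_set Q) * I) = I" for I :: real
        by (simp add: mult.assoc[symmetric] power_mult_distrib[symmetric])
      ultimately show "(LBINT p:cbox l r. (-1) ^ card Q * (f p * tens (?D Q) p)) = (LBINT p:cbox l r. G (mset_set Q) p * tens (h Q) p)"
        by (simp only:)
    qed
    finally have F: "mollified f \<eta> p0 = (\<Sum>Q\<in>Pow ?J. LBINT p:cbox l r. G (mset_set Q) p * tens (h Q) p)" .
    let ?a = "\<lambda>Q. LBINT p:cbox l r. G (mset_set Q) p * tens (h Q) p"
    have hb: "\<bar>tens (h Q) p\<bar> \<le> C * \<psi> p \<xi>" if Q: "Q \<subseteq> ?J" for Q p
    proof -
      have "\<bar>tens (h Q) p\<bar> = (\<Prod>b\<in>Basis - ?J. \<bar>h Q b (p \<bullet> b)\<bar>) * (\<Prod>b\<in>?J. \<bar>h Q b (p \<bullet> b)\<bar>)"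
        unfolding tens_def abs_prod by (rule prod.subset_diff[OF J finite_Basis])
      also have "(\<Prod>b\<in>Basis - ?J. \<bar>h Q b (p \<bullet> b)\<bar>) = (\<Prod>b\<in>Basis - ?J. k b (p \<bullet> b))"
        using Q step_at(8)[OF \<eta>] by (intro prod.cong) (auto simp: h_def k_def)
      also have "... = \<psi> p \<xi>"
        unfolding prod_phase_v \<psi>_def k_def p0_def by (intro prod.cong) (auto simp: inner_prod_def)
      finally have e: "\<bar>tens (h Q) p\<bar> = \<psi> p \<xi> * (\<Prod>b\<in>?J. \<bar>h Q b (p \<bullet> b)\<bar>)" .
      have "(\<Prod>b\<in>?J. \<bar>h Q b (p \<bullet> b)\<bar>) \<le> C"
        unfolding C_def
      proof (rule prod_mono, intro conjI)
        fix b assume b: "b \<in> ?J"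
        have "A b s \<le> 2 * M / ?\<rho> b" "A b s \<ge> 0" for s
        proof -
          have "A b s = (2 / ?\<rho> b) * mollifier1 ((1 / (?\<rho> b / 2)) * s + (- (?c \<bullet> b) / (?\<rho> b / 2)))"
            by (simp add: A_def moll_at_def)
          also have "... \<le> (2 / ?\<rho> b) * M" using M(2) \<rho>[of b] by (intro mult_left_mono) auto
          finally show "A b s \<le> 2 * M / ?\<rho> b" by simp
          show "A b s \<ge> 0" unfolding A_def by (rule step_at(8)[OF \<rho>2])
        qed
        moreover have "\<bar>B b s\<bar> \<le> 1" for s
          using step_at(4,5)[OF \<rho>2, of "?c \<bullet> b" b s] step_at(4,5)[OF \<eta>, of "p0 \<bullet> b" s]
          unfolding B_def abs_le_iff by linarith
        ultimately show "\<bar>h Q b (p \<bullet> b)\<bar> \<le> max 1 (2 * M / ?\<rho> b)"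
          unfolding h_def using b by (simp add: le_max_iff_disj del: insert_iff)
      qed simp
      from mult_left_mono[OF this \<psi>0[of p \<xi>]] show ?thesis unfolding e by (simp only: mult.commute)
    qed
    have aQ: "ennreal ((?a Q)\<^sup>2) \<le> ennreal (C\<^sup>2 * vol) * ?I Q \<xi>" if Q: "Q \<subseteq> ?J" for Q
    proof -
      note [measurable] = Hm[OF Q]
      have "set_integrable lborel (cbox l r) (G (mset_set Q))"
        by (rule weak_deriv_set_integrable(2)[OF G[OF mi[OF Q]] compact_cbox box\<Omega>])
      then have "set_integrable lborel (cbox l r) (\<lambda>p. G (mset_set Q) p * tens (h Q) p)"
        by (rule set_integrable_times_continuous[OF _ compact_cbox]) (intro continuous_on_tens smooth1_continuous_on sh)
      then have "ennreal \<bar>?a Q\<bar> \<le> (LBNN p. norm (indicator (cbox l r) p *\<^sub>R (G (mset_set Q) p * tens (h Q) p)))"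
        unfolding set_lebesgue_integral_def set_integrable_def real_norm_def[symmetric] by (rule integral_norm_bound_ennreal)
      also have "... \<le> (LBNN p. ennreal (\<bar>H Q p\<bar> * sqrt (\<psi> p \<xi>)) * (ennreal (C * sqrt (\<psi> p \<xi>)) * indicator Y p))"
      proof (rule nn_integral_mono)
        fix p
        show "ennreal (norm (indicator (cbox l r) p *\<^sub>R (G (mset_set Q) p * tens (h Q) p))) \<le> ennreal (\<bar>H Q p\<bar> * sqrt (\<psi> p \<xi>)) * (ennreal (C * sqrt (\<psi> p \<xi>)) * indicator Y p)"
        proof (cases "p \<in> cbox l r")
          case True
          then have pY: "p \<in> Y" using boxY by blast
          have "\<bar>G (mset_set Q) p\<bar> * \<bar>tens (h Q) p\<bar> \<le> \<bar>H Q p\<bar> * (C * \<psi> p \<xi>)"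
            unfolding HY[OF pY] by (intro mult_left_mono hb[OF Q]) auto
          also have "... = (\<bar>H Q p\<bar> * sqrt (\<psi> p \<xi>)) * (C * sqrt (\<psi> p \<xi>))"
            using \<psi>0[of p \<xi>] by (simp add: mult_ac)
          finally show ?thesis using True pY C1 \<psi>0[of p \<xi>] by (simp add: ennreal_mult[symmetric] abs_mult)
        qed simp
      qed
      finally have "(ennreal \<bar>?a Q\<bar>)\<^sup>2 \<le> (LBNN p. ennreal (\<bar>H Q p\<bar> * sqrt (\<psi> p \<xi>)) * (ennreal (C * sqrt (\<psi> p \<xi>)) * indicator Y p))\<^sup>2"
        by (intro power_mono) auto
      also have "... \<le> (LBNN p. (ennreal (\<bar>H Q p\<bar> * sqrt (\<psi> p \<xi>)))\<^sup>2) * (LBNN p. (ennreal (C * sqrt (\<psi> p \<xi>)) * indicator Y p)\<^sup>2)"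
        by (rule Cauchy_Schwarz_nn_integral) measurable
      also have "(LBNN p. (ennreal (\<bar>H Q p\<bar> * sqrt (\<psi> p \<xi>)))\<^sup>2) = ?I Q \<xi>"
        using \<psi>0 by (intro nn_integral_cong) (simp add: ennreal_power power_mult_distrib ennreal_mult)
      also have "(LBNN p. (ennreal (C * sqrt (\<psi> p \<xi>)) * indicator Y p)\<^sup>2) = (LBNN p. ennreal (C\<^sup>2) * (ennreal (\<psi> p \<xi>) * indicator Y p))"
        using \<psi>0 C1 by (intro nn_integral_cong) (auto simp: ennreal_power power_mult_distrib ennreal_mult indicator_def)
      also have "... = ennreal (C\<^sup>2) * ennreal vol" by (simp add: nn_integral_cmult \<psi>Y)
      also have "... = ennreal (C\<^sup>2 * vol)" using vol by (simp add: ennreal_mult)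
      finally show ?thesis by (simp add: ennreal_power mult.commute)
    qed
    have cP: "card (Pow ?J) = 16" using card_Pow[OF tx_card(1)] tx_card(2) by simp
    have "(mollified f \<eta> p0)\<^sup>2 \<le> real (card (Pow ?J)) * (\<Sum>Q\<in>Pow ?J. (?a Q)\<^sup>2)"
      unfolding F by (rule sum_square_le) (use tx_card(1) in simp)
    then have "ennreal ((mollified f \<eta> p0)\<^sup>2) \<le> ennreal (16 * (\<Sum>Q\<in>Pow ?J. (?a Q)\<^sup>2))"
      unfolding cP by (intro ennreal_leI) simp
    also have "... = (\<Sum>Q\<in>Pow ?J. 16 * ennreal ((?a Q)\<^sup>2))"
      by (simp add: ennreal_mult sum_nonneg sum_ennreal sum_distrib_left[symmetric])
    also have "... \<le> (\<Sum>Q\<in>Pow ?J. 16 * (ennreal (C\<^sup>2 * vol) * ?I Q \<xi>))"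
      by (intro sum_mono mult_left_mono aQ) auto
    also have "... = (\<Sum>Q\<in>Pow ?J. ennreal (16 * (C\<^sup>2 * vol)) * ?I Q \<xi>)"
      using vol by (simp add: ennreal_mult mult.assoc)
    finally show ?thesis by (simp add: p0_def)
  qed
  have "(LBNN \<xi>. ennreal ((mollified f \<eta> (t, x, \<xi>))\<^sup>2))
    \<le> (LBNN \<xi>. (\<Sum>Q\<in>Pow ?J. ennreal (16 * (C\<^sup>2 * vol)) * ?I Q \<xi>))"
    by (intro nn_integral_mono key)
  also have "... = (\<Sum>Q\<in>Pow ?J. ennreal (16 * (C\<^sup>2 * vol)) * (LBNN \<xi>. ?I Q \<xi>))"
  proof (subst nn_integral_sum)
    fix Q assume "Q \<in> Pow ?J"
    then have [measurable]: "H Q \<in> borel_maps" using Hm by blast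
    show "(\<lambda>\<xi>. ennreal (16 * (C\<^sup>2 * vol)) * ?I Q \<xi>) \<in> borel_measurable lborel"
      by measurable
  next
    show "(\<Sum>Q\<in>Pow ?J. LBNN \<xi>. ennreal (16 * (C\<^sup>2 * vol)) * ?I Q \<xi>)
      = (\<Sum>Q\<in>Pow ?J. ennreal (16 * (C\<^sup>2 * vol)) * (LBNN \<xi>. ?I Q \<xi>))"
    proof (rule sum.cong[OF refl])
      fix Q assume "Q \<in> Pow ?J"
      then have [measurable]: "H Q \<in> borel_maps" using Hm by blast
      show "(LBNN \<xi>. ennreal (16 * (C\<^sup>2 * vol)) * ?I Q \<xi>)
        = ennreal (16 * (C\<^sup>2 * vol)) * (LBNN \<xi>. ?I Q \<xi>)"
        by (rule nn_integral_cmult) measurable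
    qed
  qed
  also have "... \<le> (\<Sum>Q\<in>Pow ?J. ennreal (16 * (C\<^sup>2 * vol)) * ennreal s)"
  proof (intro sum_mono mult_left_mono)
    fix Q assume "Q \<in> Pow ?J"
    then have Q: "Q \<subseteq> ?J" by blast
    note [measurable] = Hm[OF Q]
    have "(LBNN \<xi>. ?I Q \<xi>)
      = (LBNN p. (LBNN \<xi>. ennreal ((H Q p)\<^sup>2) * ennreal (\<psi> p \<xi>)))"
      by (rule lborel_pair.Fubini') measurable
    also have "... = (LBNN p. ennreal ((H Q p)\<^sup>2) * (LBNN \<xi>. ennreal (\<psi> p \<xi>)))"
      by (intro nn_integral_cong nn_integral_cmult) measurable
    also have "... \<le> ennreal s" unfolding \<psi>int using Hint[OF Q] by simp
    finally show "(LBNN \<xi>. ?I Q \<xi>) \<le> ennreal s" .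
  qed auto
  also have "... = ennreal (256 * (C\<^sup>2 * vol * s))"
    using card_Pow[OF tx_card(1)] tx_card(2) vol s by (simp add: ennreal_mult mult_ac)
  finally show ?thesis .
qed

lemma mollified_close:
  assumes "open \<Omega>" "continuous_on \<Omega> f" "p0 \<in> \<Omega>" "e > 0"
  shows "\<exists>\<eta>0>0. \<forall>\<eta>. 0 < \<eta> \<and> \<eta> \<le> \<eta>0 \<longrightarrow> \<bar>mollified f \<eta> p0 - f p0\<bar> \<le> e"
proof -
  obtain \<delta>1 where \<delta>1: "\<delta>1 > 0" "ball p0 \<delta>1 \<subseteq> \<Omega>" using assms(1,3) open_contains_ball by blast
  obtain \<delta>2 where \<delta>2: "\<delta>2 > 0" "\<And>p. p \<in> \<Omega> \<Longrightarrow> dist p p0 < \<delta>2 \<Longrightarrow> dist (f p) (f p0) < e"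
    using assms(2,3,4) unfolding continuous_on_iff by metis
  define \<eta>0 where "\<eta>0 = min \<delta>1 \<delta>2 / (2 * DIM(phase))"
  have \<eta>0: "\<eta>0 > 0" using \<delta>1 \<delta>2 by (simp add: \<eta>0_def)
  moreover have "\<bar>mollified f \<eta> p0 - f p0\<bar> \<le> e" if \<eta>: "0 < \<eta>" "\<eta> \<le> \<eta>0" for \<eta>
  proof -
    let ?B = "cbox_at p0 (\<lambda>b. \<eta>)"
    let ?k = "tens (\<lambda>b. moll_at (p0 \<bullet> b) \<eta>)"
    note k = tens_moll[OF \<eta>(1), where ?p0.0 = p0]
    have near: "p \<in> \<Omega>" "\<bar>f p - f p0\<bar> \<le> e" if p: "p \<in> ?B" for p
    proof -
      have "norm (p - p0) \<le> (\<Sum>b\<in>Basis. \<bar>(p - p0) \<bullet> b\<bar>)" by (rule norm_le_l1)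
      also have "... \<le> of_nat (card (Basis :: phase set)) * \<eta>"
        using p unfolding cbox_at_def by (intro sum_bounded_above) (auto simp: inner_diff_left)
      also have "... \<le> real DIM(phase) * \<eta>0" using \<eta> by (intro mult_left_mono) auto
      also have "... = min \<delta>1 \<delta>2 / 2" by (simp add: \<eta>0_def field_simps)
      finally have d: "dist p p0 < \<delta>1" "dist p p0 < \<delta>2" using \<delta>1 \<delta>2 by (auto simp: dist_norm)
      then show "p \<in> \<Omega>" using \<delta>1 by (auto simp: dist_commute)
      from \<delta>2(2)[OF this d(2)] show "\<bar>f p - f p0\<bar> \<le> e" by (simp add: dist_real_def)
    qed
    have Bc: "compact ?B" by (rule box_at_facts)
    have kc: "continuous_on S ?k" for S using k(4) continuous_on_subset by blast
    have i1: "integrable lborel (\<lambda>p. indicator ?B p *\<^sub>R (f p * ?k p))"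
      using near(1) assms(2) by (intro borel_integrable_compact[OF Bc] continuous_on_mult kc) (auto intro: continuous_on_subset)
    have i2: "integrable lborel (\<lambda>p. indicator ?B p *\<^sub>R (f p0 * ?k p))"
      by (intro borel_integrable_compact[OF Bc] continuous_on_mult kc continuous_on_const)
    have ik: "(\<lambda>p. indicator ?B p *\<^sub>R (f p0 * ?k p)) = (\<lambda>p. f p0 * ?k p)"
    proof
      fix p show "indicator ?B p *\<^sub>R (f p0 * ?k p) = f p0 * ?k p" using k(2)[of p] by (cases "p \<in> ?B") auto
    qed
    have km: "?k \<in> borel_measurable lborel" using borel_measurable_continuous_onI[OF kc] by simp
    have "(LBINT p. ?k p) = 1" using k(1,3) km by (subst integral_eq_nn_integral) auto
    then have f0: "f p0 = (LBINT p. indicator ?B p *\<^sub>R (f p0 * ?k p))" unfolding ik by simp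
    have "mollified f \<eta> p0 - f p0 = (LBINT p. indicator ?B p *\<^sub>R (f p * ?k p)) - (LBINT p. indicator ?B p *\<^sub>R (f p0 * ?k p))"
      using f0 by (simp only: mollified_def set_lebesgue_integral_def)
    also have "... = (LBINT p. indicator ?B p *\<^sub>R (f p * ?k p) - indicator ?B p *\<^sub>R (f p0 * ?k p))"
      by (rule Bochner_Integration.integral_diff[symmetric, OF i1 i2])
    finally have "ennreal \<bar>mollified f \<eta> p0 - f p0\<bar> \<le> (LBNN p. norm (indicator ?B p *\<^sub>R (f p * ?k p) - indicator ?B p *\<^sub>R (f p0 * ?k p)))"
      using integral_norm_bound_ennreal[OF Bochner_Integration.integrable_diff[OF i1 i2]] by simp
    also have "... \<le> (LBNN p. ennreal e * ennreal (?k p))"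
    proof (rule nn_integral_mono)
      fix p
      show "ennreal (norm (indicator ?B p *\<^sub>R (f p * ?k p) - indicator ?B p *\<^sub>R (f p0 * ?k p))) \<le> ennreal e * ennreal (?k p)"
      proof (cases "p \<in> ?B")
        case True
        have "\<bar>f p - f p0\<bar> * ?k p \<le> e * ?k p" using near(2)[OF True] k(1) by (intro mult_right_mono) auto
        then have "norm (f p * ?k p - f p0 * ?k p) \<le> e * ?k p"
          using k(1)[of p] by (simp add: left_diff_distrib[symmetric] abs_mult del: left_diff_distrib)
        then show ?thesis using True assms(4) k(1)[of p] by (simp add: ennreal_mult[symmetric])
      qed simp
    qed
    also have "... = ennreal e" using km by (subst nn_integral_cmult) (auto simp: k(3))
    finally show ?thesis using assms(4) by (subst (asm) ennreal_le_iff) auto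
  qed
  ultimately show ?thesis by blast
qed

lemma l2_fatou:
  fixes F :: "nat \<Rightarrow> 'a \<Rightarrow> real"
  assumes "\<And>n. F n \<in> borel_measurable M" "\<And>z. (\<lambda>n. F n z) \<longlonglongrightarrow> f z"
    and "\<And>n. (\<integral>\<^sup>+z. ennreal ((F n z)\<^sup>2) \<partial>M) \<le> B"
  shows "(\<integral>\<^sup>+z. ennreal ((f z)\<^sup>2) \<partial>M) \<le> B"
proof -
  have "(\<integral>\<^sup>+z. ennreal ((f z)\<^sup>2) \<partial>M) = (\<integral>\<^sup>+z. liminf (\<lambda>n. ennreal ((F n z)\<^sup>2)) \<partial>M)"
  proof (rule nn_integral_cong)
    fix z
    have "(\<lambda>n. ennreal ((F n z)\<^sup>2)) \<longlonglongrightarrow> ennreal ((f z)\<^sup>2)"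
      by (intro tendsto_ennrealI tendsto_power assms(2))
    from lim_imp_Liminf[OF _ this] show "ennreal ((f z)\<^sup>2) = liminf (\<lambda>n. ennreal ((F n z)\<^sup>2))" by simp
  qed
  also have "... \<le> liminf (\<lambda>n. \<integral>\<^sup>+z. ennreal ((F n z)\<^sup>2) \<partial>M)"
    by (rule nn_integral_liminf) (use assms(1) in measurable)
  also have "... \<le> B"
    using assms(3) by (intro order_trans[OF Liminf_le_Limsup Limsup_bounded]) auto
  finally show ?thesis .
qed

text \<open>
  By Fatou's lemma the bound for the mollified function passes to the limit at interior points of the
  cell, and a second time, by continuity of \<open>f\<close>, to the boundary points.  The latter include the initial
  time and the faces of the cube.
\<close>

lemma velocity_l2_sup_bound:
  fixes f :: "phase \<Rightarrow> real"
  assumes T: "T > 0" and fc: "continuous_on ({0..T} \<times> UNIV \<times> UNIV) f"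
    and fin: "sobolev_norm_sq 4 (phase_domain T) (phase_cell T) f < \<infinity>"
  shows "\<exists>B\<ge>0. \<forall>t\<in>{0..T}. \<forall>x\<in>torus_cube. (LBNN \<xi>. ennreal ((f (t, x, \<xi>))\<^sup>2)) \<le> ennreal B"
proof -
  obtain G where G: "\<And>\<alpha>. \<alpha> \<in> multi_indices 4 \<Longrightarrow> weak_deriv (phase_domain T) \<alpha> f (G \<alpha>)"
    and Gf: "(\<Sum>\<alpha>\<in>multi_indices 4. LBNN p. ennreal ((G \<alpha> p)\<^sup>2) * indicator (phase_cell T) p) < \<infinity>"
    using fin unfolding sobolev_norm_sq_def INF_less_iff by blast
  define s where "s = enn2real (\<Sum>\<alpha>\<in>multi_indices 4. LBNN p. ennreal ((G \<alpha> p)\<^sup>2) * indicator (phase_cell T) p)"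
  have s: "s \<ge> 0" by (simp add: s_def)
  have S: "l2_on (phase_cell T) (\<lambda>p. G \<alpha> p) \<le> ennreal s" if "\<alpha> \<in> multi_indices 4" for \<alpha>
  proof -
    have "l2_on (phase_cell T) (\<lambda>p. G \<alpha> p)
      \<le> (\<Sum>\<alpha>\<in>multi_indices 4. LBNN p. ennreal ((G \<alpha> p)\<^sup>2) * indicator (phase_cell T) p)"
      using that by (intro member_le_sum finite_multi_indices) auto
    also have "... = ennreal s" using Gf by (simp add: s_def less_top)
    finally show ?thesis .
  qed
  obtain M where M: "M > 0" "\<And>y. mollifier1 y \<le> M" using mollifier1_bound by blast
  define B where "B = 256 * ((\<Prod>b\<in>tx_basis. max 1 (2 * M / cell_radius T 1 b))\<^sup>2 * (\<Prod>b\<in>tx_basis. 2 * cell_radius T 1 b) * s)"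
  have \<rho>: "cell_radius T 1 b > 0" for b using T by (auto simp: cell_radius_def)
  have B: "B \<ge> 0" unfolding B_def using s
    by (intro mult_nonneg_nonneg prod_nonneg ballI less_imp_le[OF \<rho>]) auto
  have dom: "open (phase_domain T)" by (auto simp: phase_domain_def intro!: open_Times)
  have fd: "continuous_on (phase_domain T) f"
    by (rule continuous_on_subset[OF fc]) (auto simp: phase_domain_def)
  have fm[measurable]: "(\<lambda>p. indicator (phase_domain T) p * f p) \<in> borel_maps"
    using borel_measurable_continuous_on_indicator[OF _ fd] dom by simp
  have interior: "(LBNN \<xi>. ennreal ((f (t, x, \<xi>))\<^sup>2)) \<le> ennreal B"
    if tx: "0 < t" "t < T" "\<And>j. \<bar>x $ j\<bar> < pi" for t x
  proof -
    define gap where "gap b = (cell_radius T 1 b - \<bar>(t, x, 0) \<bullet> b - cell_centre T \<bullet> b\<bar>) / 2" for b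
    have gap: "gap b > 0" if "b \<in> tx_basis" for b
    proof -
      have "\<bar>t - T / 2\<bar> < T / 2" using tx by linarith
      then show ?thesis using that tx(3) by (auto simp: gap_def inner_axis)
    qed
    define d where "d = Min (gap ` tx_basis)"
    have d: "d > 0" unfolding d_def using gap tx_card(1) by (subst Min_gr_iff) auto
    have db: "d \<le> gap b" if "b \<in> tx_basis" for b unfolding d_def using that tx_card(1) by (intro Min_le) auto
    define \<eta> where "\<eta> n = d / (real n + 1)" for n
    have \<eta>: "\<eta> n > 0" "\<eta> n \<le> d" for n using d by (auto simp: \<eta>_def divide_le_eq mult_le_cancel_left1)
    have \<eta>b: "\<bar>(t, x, 0) \<bullet> b - cell_centre T \<bullet> b\<bar> + \<eta> n < cell_radius T 1 b" if "b \<in> tx_basis" for b n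
    proof -
      have "d' \<le> (r - A) / 2 \<Longrightarrow> 0 < (r - A) / 2 \<Longrightarrow> \<eta>' \<le> d' \<Longrightarrow> A + \<eta>' < r" for d' r A \<eta>' :: real
        by (simp add: field_simps)
      then show ?thesis using db[OF that] gap[OF that] \<eta>(2)[of n] unfolding gap_def by blast
    qed
    show ?thesis
    proof (rule l2_fatou[where F="\<lambda>n \<xi>. mollified f (\<eta> n) (t, x, \<xi>)"])
      fix n
      show "(LBNN \<xi>. ennreal ((mollified f (\<eta> n) (t, x, \<xi>))\<^sup>2)) \<le> ennreal B"
        unfolding B_def by (rule mixed_sobolev_mollified[OF T G S s M \<eta>b \<eta>(1)])
      have sub: "cbox_at (t, x, \<xi>) (\<lambda>b. \<eta> n) \<subseteq> phase_domain T" for \<xi>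
      proof
        fix p assume p: "p \<in> cbox_at (t, x, \<xi>) (\<lambda>b. \<eta> n)"
        obtain t' x' \<xi>' where e: "p = (t', x', \<xi>')" by (cases p) auto
        have "\<bar>p \<bullet> e_t - (t, x, \<xi>) \<bullet> e_t\<bar> \<le> \<eta> n" using p phase_Basis_mem(1) unfolding cbox_at_def by blast
        then have "\<bar>t' - t\<bar> \<le> \<eta> n" by (simp add: e)
        moreover have "\<bar>t - T / 2\<bar> + \<eta> n < T / 2" using \<eta>b[of e_t n] by simp
        ultimately have "0 < t'" "t' < T" by linarith+
        then show "p \<in> phase_domain T" by (simp add: e phase_domain_def)
      qed
      have eq: "mollified f (\<eta> n) (t, x, \<xi>) = (LBINT p. (indicator (phase_domain T) p * f p) * tens (\<lambda>b. moll_at ((t, x, \<xi>) \<bullet> b) (\<eta> n)) p)" for \<xi>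
        unfolding mollified_def set_lebesgue_integral_def
        using sub[of \<xi>] tens_moll(2)[OF \<eta>(1), of _ "(t, x, \<xi>)" n]
        by (intro Bochner_Integration.integral_cong) (auto simp: indicator_def)
      have mc: "continuous_on UNIV mollifier1" by (intro smooth1_continuous_on smooth1_deriv smooth1_step)
      have "continuous_on UNIV (\<lambda>q :: (real^3) \<times> phase. tens (\<lambda>b. moll_at ((t, x, fst q) \<bullet> b) (\<eta> n)) (snd q))"
        unfolding tens_def moll_at_def using \<eta>(1)[of n]
        by (intro continuous_on_prod continuous_on_mult continuous_on_const continuous_on_compose2[OF mc] continuous_intros) auto
      then have [measurable]: "(\<lambda>q :: (real^3) \<times> phase. tens (\<lambda>b. moll_at ((t, x, fst q) \<bullet> b) (\<eta> n)) (snd q)) \<in> borel_measurable (borel \<Otimes>\<^sub>M borel)"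
        unfolding borel_prod by (rule borel_measurable_continuous_onI)
      show "(\<lambda>\<xi>. mollified f (\<eta> n) (t, x, \<xi>)) \<in> borel_measurable lborel"
        unfolding eq
        by (rule lborel.borel_measurable_lebesgue_integral) (unfold case_prod_beta, measurable)
    next
      fix \<xi>
      have p0: "(t, x, \<xi>) \<in> phase_domain T" using tx by (simp add: phase_domain_def)
      show "(\<lambda>n. mollified f (\<eta> n) (t, x, \<xi>)) \<longlonglongrightarrow> f (t, x, \<xi>)"
      proof (rule LIMSEQ_I)
        fix e :: real assume "e > 0"
        then obtain \<eta>0 where \<eta>0: "\<eta>0 > 0" "\<And>\<eta>. 0 < \<eta> \<Longrightarrow> \<eta> \<le> \<eta>0 \<Longrightarrow> \<bar>mollified f \<eta> (t, x, \<xi>) - f (t, x, \<xi>)\<bar> \<le> e / 2"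
          using mollified_close[OF dom fd p0, of "e/2"] by auto
        obtain n0 :: nat where n0: "real n0 > d / \<eta>0" using reals_Archimedean2 by blast
        have "\<eta> n \<le> \<eta>0" if "n \<ge> n0" for n
        proof -
          have "d / \<eta>0 \<le> real n + 1" using n0 that by linarith
          then show ?thesis using \<eta>0(1) d by (simp add: \<eta>_def field_simps)
        qed
        then have "norm (mollified f (\<eta> n) (t, x, \<xi>) - f (t, x, \<xi>)) < e" if "n \<ge> n0" for n
          using \<eta>0(2)[OF \<eta>(1)[of n]] that \<open>e > 0\<close> by fastforce
        then show "\<exists>no. \<forall>n\<ge>no. norm (mollified f (\<eta> n) (t, x, \<xi>) - f (t, x, \<xi>)) < e" by blast
      qed
    qed
  qed
  have "(LBNN \<xi>. ennreal ((f (t, x, \<xi>))\<^sup>2)) \<le> ennreal B" if t: "t \<in> {0..T}" and x: "x \<in> torus_cube" for t x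
  proof -
    define a where "a n = 1 - 1 / (real n + 2)" for n
    have a: "0 < a n" "a n < 1" for n by (auto simp: a_def)
    define t' where "t' n = T / 2 + a n * (t - T / 2)" for n
    have t': "0 < t' n" "t' n < T" for n
    proof -
      have "0 \<le> t" "t \<le> T" using t by auto
      then have "\<bar>t - T / 2\<bar> \<le> T / 2" by linarith
      then have "a n * \<bar>t - T / 2\<bar> \<le> a n * (T / 2)" using a[of n] by (intro mult_left_mono) auto
      also have "... < 1 * (T / 2)" using a(2)[of n] T by (intro mult_strict_right_mono) auto
      finally have "\<bar>a n * (t - T / 2)\<bar> < T / 2" using a[of n] by (simp add: abs_mult)
      then show "0 < t' n" "t' n < T" unfolding t'_def by linarith+
    qed
    have x': "\<bar>(a n *\<^sub>R x) $ j\<bar> < pi" for n j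
    proof -
      have "\<bar>x $ j\<bar> \<le> pi" using x by (auto simp: torus_cube_def abs_le_iff minus_le_iff)
      then have "a n * \<bar>x $ j\<bar> \<le> a n * pi" using a[of n] by (intro mult_left_mono) auto
      also have "... < 1 * pi" using a(2)[of n] by (intro mult_strict_right_mono) auto
      finally show ?thesis using a[of n] by (simp add: abs_mult)
    qed
    have al: "a \<longlonglongrightarrow> 1"
    proof -
      have "(\<lambda>n. 1 / (real n + 2)) \<longlonglongrightarrow> 0" by real_asymp
      then have "(\<lambda>n. 1 - 1 / (real n + 2)) \<longlonglongrightarrow> 1 - 0" by (intro tendsto_diff tendsto_const)
      then show ?thesis by (simp add: a_def[abs_def])
    qed
    show ?thesis
    proof (rule l2_fatou[where F="\<lambda>n \<xi>. f (t' n, a n *\<^sub>R x, \<xi>)"])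
      fix n
      show "(LBNN \<xi>. ennreal ((f (t' n, a n *\<^sub>R x, \<xi>))\<^sup>2)) \<le> ennreal B"
        by (rule interior[OF t' x'])
      have "continuous_on UNIV (\<lambda>\<xi>. f (t' n, a n *\<^sub>R x, \<xi>))"
        by (rule continuous_on_compose2[OF fc]) (use t'[of n] in \<open>auto intro!: continuous_intros\<close>)
      then show "(\<lambda>\<xi>. f (t' n, a n *\<^sub>R x, \<xi>)) \<in> borel_measurable lborel"
        using borel_measurable_continuous_onI by auto
    next
      fix \<xi> :: "real^3"
      have "(\<lambda>n. T / 2 + a n * (t - T / 2)) \<longlonglongrightarrow> T / 2 + 1 * (t - T / 2)" by (intro tendsto_intros al)
      then have 1: "t' \<longlonglongrightarrow> t" by (simp add: t'_def[abs_def])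
      have "(\<lambda>n. a n *\<^sub>R x) \<longlonglongrightarrow> 1 *\<^sub>R x" by (intro tendsto_intros al)
      then have 2: "(\<lambda>n. (t' n, a n *\<^sub>R x, \<xi>)) \<longlonglongrightarrow> (t, x, \<xi>)" using 1 by (intro tendsto_Pair) auto
      show "(\<lambda>n. f (t' n, a n *\<^sub>R x, \<xi>)) \<longlonglongrightarrow> f (t, x, \<xi>)"
        by (rule continuous_on_tendsto_compose[OF fc 2])
          (use t t' in \<open>auto intro!: always_eventually less_imp_le\<close>)
    qed
  qed
  with B show ?thesis by blast
qed

abbreviation nu_l2 :: "(real \<Rightarrow> real \<Rightarrow> real) \<Rightarrow> (real^3 \<Rightarrow> real) \<Rightarrow> ennreal" where
  "nu_l2 q f \<equiv> l2sq (\<lambda>\<xi>. nu q \<xi> * f \<xi>)"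

abbreviation collision_rhs :: "(real \<Rightarrow> real \<Rightarrow> real) \<Rightarrow> (real^3 \<Rightarrow> real) \<Rightarrow> real^3 \<Rightarrow> real" where
  "collision_rhs q f \<xi> \<equiv> K_op q f \<xi> + Gamma_op q f f \<xi> - nu q \<xi> * f \<xi>"

abbreviation sphere_nn_integral :: "(real^3 \<Rightarrow> ennreal) \<Rightarrow> ennreal" (binder "SNN " 10) where
  "SNN \<omega>. F \<omega> \<equiv> nn_integral sphere_measure F"

section \<open>The collision operators on square integrable functions\<close>

text \<open>
  Outside \<open>[-1, 1]\<close> the value of \<open>arccos\<close> is unspecified but constant, which is what measurability needs.
\<close>

lemma arccos_outside: "\<not> (-1 \<le> y \<and> y \<le> 1) \<Longrightarrow> arccos y = arccos 2"
proof -
  assume y: "\<not> (-1 \<le> y \<and> y \<le> 1)"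
  have "\<not> (0 \<le> x \<and> x \<le> pi \<and> cos x = z)" if "\<not> (-1 \<le> z \<and> z \<le> 1)" for x z :: real
    using that cos_ge_minus_one[of x] cos_le_one[of x] by auto
  from this[OF y] this[of 2] have "(\<lambda>x. 0 \<le> x \<and> x \<le> pi \<and> cos x = y) = (\<lambda>x. 0 \<le> x \<and> x \<le> pi \<and> cos x = 2)"
    by fastforce
  then show ?thesis unfolding arccos_def by (simp only:)
qed

lemma borel_measurable_arccos [measurable]: "arccos \<in> borel_maps"
proof -
  have c: "(\<lambda>y. indicator {-1..1} y *\<^sub>R arccos y) \<in> borel_maps"
    using continuous_on_arccos' by (intro borel_measurable_continuous_on_indicator) auto
  have c': "(\<lambda>y::real. indicator (- {-1..1}) y * arccos 2) \<in> borel_maps"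
    by (intro borel_measurable_times borel_measurable_indicator borel_measurable_const) auto
  have eq: "arccos = (\<lambda>y. indicator {-1..1} y *\<^sub>R arccos y + indicator (- {-1..1}) y * arccos 2)"
  proof
    fix y show "arccos y = indicator {-1..1} y *\<^sub>R arccos y + indicator (- {-1..1}) y * arccos 2"
      using arccos_outside[of y] by (auto simp: indicator_def)
  qed
  show ?thesis by (subst eq) (rule borel_measurable_add[OF c c'])
qed

lemma maxwellian_facts: "maxwellian \<xi> > 0" "continuous_on S maxwellian" "maxwellian \<in> borel_maps"
proof -
  show "maxwellian \<xi> > 0" by (simp add: maxwellian_def)
  show c: "continuous_on S maxwellian" for S unfolding maxwellian_def[abs_def] by (intro continuous_intros) auto
  show "maxwellian \<in> borel_maps" by (rule borel_measurable_continuous_onI[OF c])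
qed

lemma sets_sphere_measure [simp, measurable_cong]: "sets sphere_measure = sets borel"
  by (simp add: sphere_measure_def)

lemma space_sphere_measure [simp]: "space sphere_measure = UNIV"
  using sets_eq_imp_space_eq[OF sets_sphere_measure] by simp

lemma nn_integral_sphere:
  assumes [measurable]: "f \<in> borel_maps"
  shows "(SNN \<omega>. f \<omega>) = 3 * (LBNN x. f (x /\<^sub>R norm x) * indicator (ball 0 1 - {0}) x)"
proof -
  have m: "(\<lambda>x::real^3. x /\<^sub>R norm x) \<in> measurable (restrict_space lborel (ball 0 1 - {0})) borel"
    by (rule measurable_restrict_space1) measurable
  have "(SNN \<omega>. f \<omega>) = 3 * (\<integral>\<^sup>+x. f (x /\<^sub>R norm x) \<partial>restrict_space lborel (ball 0 1 - {0}))"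
    unfolding sphere_measure_def using m by (simp add: nn_integral_scale_measure nn_integral_distr)
  also have "(\<integral>\<^sup>+x. f (x /\<^sub>R norm x) \<partial>restrict_space lborel (ball 0 1 - {0})) = (LBNN x. f (x /\<^sub>R norm x) * indicator (ball 0 1 - {0}) x)"
    by (rule nn_integral_restrict_space) simp
  finally show ?thesis .
qed

interpretation sphere: finite_measure sphere_measure
proof
  have "emeasure sphere_measure UNIV = (SNN \<omega>. 1)" by simp
  also have "... = 3 * emeasure lborel (ball 0 1 - {0 :: real^3})"
    by (subst nn_integral_sphere) auto
  also have "... < \<infinity>"
  proof -
    have "emeasure lborel (ball 0 1 - {0 :: real^3}) \<le> emeasure lborel (ball 0 1 :: (real^3) set)" by (intro emeasure_mono) auto
    also have "... < \<infinity>" by (rule emeasure_lborel_ball_finite)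
    finally show ?thesis by (simp add: ennreal_mult_less_top)
  qed
  finally show "emeasure sphere_measure (space sphere_measure) \<noteq> \<infinity>" by simp
qed

interpretation lborel_sphere: pair_sigma_finite "lborel :: (real^3) measure" sphere_measure ..

lemma nn_integral_sphere_uminus:
  assumes [measurable]: "f \<in> borel_maps"
  shows "(SNN \<omega>. f (- \<omega>)) = (SNN \<omega>. f \<omega>)"
proof -
  have "(LBNN x. f (- (x /\<^sub>R norm x)) * indicator (ball 0 1 - {0}) x)
     = (LBNN x. f ((0 - x) /\<^sub>R norm (0 - x)) * indicator (ball 0 1 - {0}) (0 - x))"
    by (intro nn_integral_cong) (auto simp: indicator_def)
  also have "... = (LBNN x. f (x /\<^sub>R norm x) * indicator (ball 0 1 - {0}) x)"
  proof (rule nn_integral_lborel_reflect)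
    have [measurable]: "ball (0 :: real^3) 1 - {0} \<in> sets borel" by simp
    show "(\<lambda>x. f (x /\<^sub>R norm x) * indicator (ball 0 1 - {0}) x) \<in> borel_maps" by measurable
  qed
  finally show ?thesis by (simp add: nn_integral_sphere)
qed

lemma AE_sphere_norm: "AE \<omega> in sphere_measure. norm \<omega> = 1"
proof -
  have "(SNN \<omega>. indicator {\<omega> :: real^3. norm \<omega> \<noteq> 1} \<omega>) = 3 * (LBNN x. indicator {\<omega> :: real^3. norm \<omega> \<noteq> 1} (x /\<^sub>R norm x) * indicator (ball 0 1 - {0}) x)"
    by (rule nn_integral_sphere) measurable
  also have "(LBNN x. indicator {\<omega>. norm \<omega> \<noteq> 1} (x /\<^sub>R norm x) * indicator (ball 0 1 - {0 :: real^3}) x) = (\<integral>\<^sup>+(x :: real^3). 0 \<partial>lborel)"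
    by (intro nn_integral_cong) (auto simp: indicator_def)
  finally have "emeasure sphere_measure {\<omega>. norm \<omega> \<noteq> 1} = 0" by simp
  then show ?thesis by (intro AE_I[of _ _ "{\<omega>. norm \<omega> \<noteq> 1}"]) auto
qed

definition reflect :: "real^3 \<Rightarrow> real^3 \<Rightarrow> real^3" where
  "reflect \<omega> v = v - (2 * (v \<bullet> \<omega>)) *\<^sub>R \<omega>"

lemma nn_integral_reflect:
  assumes \<omega>: "norm \<omega> = 1" and [measurable]: "f \<in> borel_maps"
  shows "(LBNN v. f (reflect \<omega> v)) = (LBNN v. f v)"
proof -
  have lin: "linear (reflect \<omega>)"
    unfolding reflect_def by (rule linearI) (auto simp: inner_add_left algebra_simps)
  have w2: "\<omega> \<bullet> \<omega> = 1" using \<omega> by (simp add: norm_eq_1)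
  have rr: "reflect \<omega> (reflect \<omega> v) = v" for v
    by (simp add: reflect_def inner_diff_left w2 algebra_simps)
  have nr: "norm (reflect \<omega> v) = norm v" for v
    unfolding norm_eq by (simp add: reflect_def inner_diff_left inner_diff_right w2 inner_commute algebra_simps)
  have orth: "orthogonal_transformation (reflect \<omega>)" using lin nr by (simp add: orthogonal_transformation)
  have [measurable]: "reflect \<omega> \<in> borel_maps" unfolding reflect_def[abs_def] by measurable
  have "lborel = distr lborel borel (reflect \<omega>)"
  proof (rule lborel_eqI)
    fix l u :: "real^3" assume lu: "\<And>b. b \<in> Basis \<Longrightarrow> l \<bullet> b \<le> u \<bullet> b"
    have pre: "reflect \<omega> -` box l u = reflect \<omega> ` box l u" using rr by (auto simp: image_iff) metis
    have pm: "reflect \<omega> -` box l u \<in> sets borel"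
      using measurable_sets[of "reflect \<omega>" borel borel "box l u"] \<open>reflect \<omega> \<in> borel_maps\<close> by simp
    have lm: "box l u \<in> lmeasurable" by simp
    have "emeasure (distr lborel borel (reflect \<omega>)) (box l u) = emeasure lborel (reflect \<omega> -` box l u)"
      by (subst emeasure_distr) auto
    also have "... = emeasure lebesgue (reflect \<omega> ` box l u)" using pm unfolding pre by simp
    also have "... = ennreal (measure lebesgue (reflect \<omega> ` box l u))"
      using measurable_orthogonal_image[OF orth lm] by (intro emeasure_eq_measure2) auto
    also have "measure lebesgue (reflect \<omega> ` box l u) = measure lebesgue (box l u)"
      by (rule measure_orthogonal_image[OF orth lm])
    also have "ennreal ... = (\<Prod>b\<in>Basis. (u - l) \<bullet> b)" using lu by (simp add: measure_lborel_box_eq)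
    finally show "emeasure (distr lborel borel (reflect \<omega>)) (box l u) = (\<Prod>b\<in>Basis. (u - l) \<bullet> b)" .
  qed simp
  then have "(LBNN v. f v) = (\<integral>\<^sup>+v. f v \<partial>distr lborel borel (reflect \<omega>))" by simp
  then show ?thesis by (simp add: nn_integral_distr)
qed

definition kern :: "(real \<Rightarrow> real \<Rightarrow> real) \<Rightarrow> real^3 \<Rightarrow> real^3 \<Rightarrow> real" where
  "kern q v \<omega> = q (norm v) (arccos ((v \<bullet> \<omega>) / norm v))"

lemma kern_collision: "q (norm (\<xi> - \<xi>s)) (collision_angle \<xi> \<xi>s \<omega>) = kern q (\<xi> - \<xi>s) \<omega>"
  by (simp add: kern_def collision_angle_def)

context
  fixes q :: "real \<Rightarrow> real \<Rightarrow> real" and \<gamma> :: real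
  assumes cutoff: "cutoff_kernel q \<gamma>"
begin

lemma q_measurable: "(\<lambda>(v, \<beta>). q v \<beta>) \<in> borel_maps"
  using cutoff unfolding cutoff_kernel_def by blast

lemma kern_measurable [measurable]: "(\<lambda>(v, \<omega>). kern q v \<omega>) \<in> borel_measurable (borel \<Otimes>\<^sub>M borel)"
proof -
  have [measurable]: "(\<lambda>(v, \<beta>). q v \<beta>) \<in> borel_measurable (borel \<Otimes>\<^sub>M borel)" using q_measurable by (simp add: borel_prod)
  have "(\<lambda>x :: (real^3) \<times> (real^3). (\<lambda>(v, \<beta>). q v \<beta>) (norm (fst x), arccos ((fst x \<bullet> snd x) / norm (fst x)))) \<in> borel_measurable (borel \<Otimes>\<^sub>M borel)"
    by measurable
  then show ?thesis by (simp add: kern_def case_prod_beta)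
qed

lemma kern_nonneg:
  assumes "norm \<omega> = 1"
  shows "kern q v \<omega> \<ge> 0"
proof -
  have "\<bar>v \<bullet> \<omega>\<bar> \<le> norm v" using Cauchy_Schwarz_ineq2[of v \<omega>] assms by simp
  then have "\<bar>(v \<bullet> \<omega>) / norm v\<bar> \<le> 1" by (simp add: divide_le_eq_1)
  then have "-1 \<le> (v \<bullet> \<omega>) / norm v" "(v \<bullet> \<omega>) / norm v \<le> 1" by (simp_all only: abs_le_iff) linarith
  from arccos_lbound[OF this] arccos_ubound[OF this] have "arccos ((v \<bullet> \<omega>) / norm v) \<in> {0..pi}" by simp
  then show ?thesis using cutoff unfolding kern_def cutoff_kernel_def by auto
qed

lemma kern_reflect:
  assumes "norm \<omega> = 1"
  shows "kern q (reflect \<omega> v) \<omega> = kern q v (- \<omega>)"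
proof -
  have w2: "\<omega> \<bullet> \<omega> = 1" using assms by (simp add: norm_eq_1)
  have "norm (reflect \<omega> v) = norm v"
    unfolding norm_eq by (simp add: reflect_def inner_diff_left inner_diff_right w2 inner_commute algebra_simps)
  moreover have "reflect \<omega> v \<bullet> \<omega> = v \<bullet> (- \<omega>)" by (simp add: reflect_def inner_diff_left w2)
  ultimately show ?thesis by (simp add: kern_def)
qed

lemma kern_swap: "kern q (- v) \<omega> = kern q v (- \<omega>)"
  by (simp add: kern_def)

lemma post_eq:
  assumes "norm \<omega> = 1"
  shows "post \<xi> \<xi>s \<omega> = \<xi> - ((\<xi> - \<xi>s) \<bullet> \<omega>) *\<^sub>R \<omega>" "post_star \<xi> \<xi>s \<omega> = \<xi>s + ((\<xi> - \<xi>s) \<bullet> \<omega>) *\<^sub>R \<omega>"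
proof -
  have "norm (\<xi> - \<xi>s) * cos (collision_angle \<xi> \<xi>s \<omega>) = (\<xi> - \<xi>s) \<bullet> \<omega>"
  proof (cases "\<xi> = \<xi>s")
    case False
    have "\<bar>(\<xi> - \<xi>s) \<bullet> \<omega>\<bar> \<le> norm (\<xi> - \<xi>s)" using Cauchy_Schwarz_ineq2[of "\<xi> - \<xi>s" \<omega>] assms by simp
    then have "\<bar>((\<xi> - \<xi>s) \<bullet> \<omega>) / norm (\<xi> - \<xi>s)\<bar> \<le> 1" by (simp add: divide_le_eq_1)
    then have "-1 \<le> ((\<xi> - \<xi>s) \<bullet> \<omega>) / norm (\<xi> - \<xi>s)" "((\<xi> - \<xi>s) \<bullet> \<omega>) / norm (\<xi> - \<xi>s) \<le> 1"
      by (simp_all only: abs_le_iff) linarith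
    then have "cos (collision_angle \<xi> \<xi>s \<omega>) = ((\<xi> - \<xi>s) \<bullet> \<omega>) / norm (\<xi> - \<xi>s)"
      unfolding collision_angle_def by (rule cos_arccos)
    then show ?thesis using False by simp
  qed simp
  then show "post \<xi> \<xi>s \<omega> = \<xi> - ((\<xi> - \<xi>s) \<bullet> \<omega>) *\<^sub>R \<omega>" "post_star \<xi> \<xi>s \<omega> = \<xi>s + ((\<xi> - \<xi>s) \<bullet> \<omega>) *\<^sub>R \<omega>"
    by (simp_all add: post_def post_star_def)
qed

lemma post_measurable [measurable (raw)]:
  assumes [measurable]: "f \<in> borel_measurable M" "g \<in> borel_measurable M" "h \<in> borel_measurable M"
  shows "(\<lambda>x. post (f x) (g x) (h x)) \<in> borel_measurable M"
    "(\<lambda>x. post_star (f x) (g x) (h x)) \<in> borel_measurable M"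
  unfolding post_def post_star_def collision_angle_def by measurable

abbreviation P :: "((real^3) \<times> (real^3)) measure" where "P \<equiv> lborel \<Otimes>\<^sub>M sphere_measure"

lemma AE_P_norm: "AE x in P. norm (snd x) = 1"
proof (rule lborel_sphere.AE_pair_measure)
  show "{x \<in> space P. norm (snd x) = 1} \<in> sets P" by measurable
qed (use AE_sphere_norm in auto)

lemma nu_facts:
  shows "nu q \<in> borel_maps"
    and "\<exists>\<nu>0>0. \<exists>\<nu>1>0. \<forall>\<xi>. \<nu>0 * (1 + norm \<xi>) powr \<gamma> \<le> nu q \<xi> \<and> nu q \<xi> \<le> \<nu>1 * (1 + norm \<xi>) powr \<gamma>"
    and "nu q \<xi> > 0"
    and "(LBNN \<xi>s. SNN \<omega>. ennreal (kern q (\<xi> - \<xi>s) \<omega> * maxwellian \<xi>s)) = ennreal (nu q \<xi>)"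
proof -
  note [measurable] = maxwellian_facts(3)
  have e: "nu q = (\<lambda>\<xi>. LINT x|P. kern q (\<xi> - fst x) (snd x) * maxwellian (fst x))"
    by (intro ext) (simp only: nu_def kern_collision case_prod_unfold)
  have sf: "sigma_finite_measure P" by (rule lborel_sphere.P.sigma_finite_measure_axioms)
  have "(\<lambda>(\<xi>, x). kern q (\<xi> - fst x) (snd x) * maxwellian (fst x)) \<in> borel_measurable (borel \<Otimes>\<^sub>M P)"
    by measurable
  then show "nu q \<in> borel_maps"
    unfolding e by (rule sigma_finite_measure.borel_measurable_lebesgue_integral[OF sf])
  show b: "\<exists>\<nu>0>0. \<exists>\<nu>1>0. \<forall>\<xi>. \<nu>0 * (1 + norm \<xi>) powr \<gamma> \<le> nu q \<xi> \<and> nu q \<xi> \<le> \<nu>1 * (1 + norm \<xi>) powr \<gamma>"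
    using cutoff unfolding cutoff_kernel_def by blast
  then obtain \<nu>0 where "\<nu>0 > 0" "\<nu>0 * (1 + norm \<xi>) powr \<gamma> \<le> nu q \<xi>" by blast
  moreover have "(1 + norm \<xi>) powr \<gamma> > 0" using norm_ge_zero[of \<xi>] by (subst powr_gt_zero) linarith
  ultimately show pos: "nu q \<xi> > 0" using mult_pos_pos[of \<nu>0 "(1 + norm \<xi>) powr \<gamma>"] by linarith
  let ?F = "\<lambda>x. kern q (\<xi> - fst x) (snd x) * maxwellian (fst x)"
  have int: "integrable P ?F" using pos not_integrable_integral_eq[of P ?F] unfolding e by fastforce
  have "AE x in P. 0 \<le> ?F x"
    using AE_P_norm by eventually_elim (auto intro!: mult_nonneg_nonneg kern_nonneg less_imp_le[OF maxwellian_facts(1)])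
  then have "(\<integral>\<^sup>+x. ennreal (?F x) \<partial>P) = ennreal (nu q \<xi>)"
    unfolding e by (rule nn_integral_eq_integral[OF int])
  moreover have "(\<integral>\<^sup>+x. ennreal (?F x) \<partial>P) = (LBNN \<xi>s. SNN \<omega>. ennreal (?F (\<xi>s, \<omega>)))"
    by (rule sphere.nn_integral_fst[symmetric]) measurable
  ultimately show "(LBNN \<xi>s. SNN \<omega>. ennreal (kern q (\<xi> - \<xi>s) \<omega> * maxwellian \<xi>s)) = ennreal (nu q \<xi>)"
    by simp
qed

text \<open>The collision transformation preserves the measure, for fixed \<open>\<omega>\<close>: it is a translation of
\<open>\<xi>\<close> followed by a reflection of the relative velocity.\<close>

lemma collision_change_of_variables:
  fixes \<Phi> :: "real^3 \<Rightarrow> real^3 \<Rightarrow> ennreal"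
  assumes [measurable]: "(\<lambda>(a, b). \<Phi> a b) \<in> borel_measurable (borel \<Otimes>\<^sub>M borel)"
  shows "(LBNN \<xi>. LBNN \<xi>s. SNN \<omega>. ennreal (kern q (\<xi> - \<xi>s) \<omega>) * \<Phi> (post \<xi> \<xi>s \<omega>) (post_star \<xi> \<xi>s \<omega>))
    = (LBNN \<xi>. LBNN \<xi>s. SNN \<omega>. ennreal (kern q (\<xi> - \<xi>s) \<omega>) * \<Phi> \<xi> \<xi>s)"
proof -
  have [measurable]: "reflect \<omega> \<in> borel_maps" for \<omega> unfolding reflect_def[abs_def] by measurable
  define \<Psi> where "\<Psi> v = (LBNN \<xi>. \<Phi> \<xi> (\<xi> - v))" for v
  have \<Psi>m[measurable]: "\<Psi> \<in> borel_maps" unfolding \<Psi>_def[abs_def] by measurable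
  have gen: "(LBNN \<xi>. LBNN \<xi>s. SNN \<omega>. ennreal (kern q (\<xi> - \<xi>s) \<omega>) * H (\<xi>, \<xi>s, \<omega>))
      = (SNN \<omega>. LBNN v. ennreal (kern q v \<omega>) * (LBNN \<xi>. H (\<xi>, \<xi> - v, \<omega>)))"
    if [measurable]: "H \<in> borel_measurable (borel \<Otimes>\<^sub>M (borel \<Otimes>\<^sub>M borel))" for H :: "(real^3) \<times> (real^3) \<times> (real^3) \<Rightarrow> ennreal"
  proof -
    have "(LBNN \<xi>. LBNN \<xi>s. SNN \<omega>. ennreal (kern q (\<xi> - \<xi>s) \<omega>) * H (\<xi>, \<xi>s, \<omega>))
      = (LBNN \<xi>. LBNN v. SNN \<omega>. ennreal (kern q v \<omega>) * H (\<xi>, \<xi> - v, \<omega>))"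
    proof (rule nn_integral_cong)
      fix \<xi> :: "real^3"
      have "(LBNN v. SNN \<omega>. ennreal (kern q (\<xi> - (\<xi> - v)) \<omega>) * H (\<xi>, \<xi> - v, \<omega>))
        = (LBNN \<xi>s. SNN \<omega>. ennreal (kern q (\<xi> - \<xi>s) \<omega>) * H (\<xi>, \<xi>s, \<omega>))"
        by (rule nn_integral_lborel_reflect) measurable
      then show "(LBNN \<xi>s. SNN \<omega>. ennreal (kern q (\<xi> - \<xi>s) \<omega>) * H (\<xi>, \<xi>s, \<omega>))
        = (LBNN v. SNN \<omega>. ennreal (kern q v \<omega>) * H (\<xi>, \<xi> - v, \<omega>))" by simp
    qed
    also have "... = (LBNN v. LBNN \<xi>. SNN \<omega>. ennreal (kern q v \<omega>) * H (\<xi>, \<xi> - v, \<omega>))"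
      by (rule lborel_pair.Fubini') measurable
    also have "... = (LBNN v. SNN \<omega>. LBNN \<xi>. ennreal (kern q v \<omega>) * H (\<xi>, \<xi> - v, \<omega>))"
      by (intro nn_integral_cong, rule lborel_sphere.Fubini'[symmetric]) measurable
    also have "... = (SNN \<omega>. LBNN v. LBNN \<xi>. ennreal (kern q v \<omega>) * H (\<xi>, \<xi> - v, \<omega>))"
      by (rule lborel_sphere.Fubini'[symmetric]) measurable
    also have "... = (SNN \<omega>. LBNN v. ennreal (kern q v \<omega>) * (LBNN \<xi>. H (\<xi>, \<xi> - v, \<omega>)))"
      by (intro nn_integral_cong nn_integral_cmult) measurable
    finally show ?thesis .
  qed
  have "(LBNN \<xi>. LBNN \<xi>s. SNN \<omega>. ennreal (kern q (\<xi> - \<xi>s) \<omega>) * \<Phi> (post \<xi> \<xi>s \<omega>) (post_star \<xi> \<xi>s \<omega>))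
    = (SNN \<omega>. LBNN v. ennreal (kern q v \<omega>) * (LBNN \<xi>. \<Phi> (post \<xi> (\<xi> - v) \<omega>) (post_star \<xi> (\<xi> - v) \<omega>)))"
    by (rule gen[of "\<lambda>(\<xi>, \<xi>s, \<omega>). \<Phi> (post \<xi> \<xi>s \<omega>) (post_star \<xi> \<xi>s \<omega>)", unfolded prod.case]) measurable
  also have "... = (SNN \<omega>. LBNN v. ennreal (kern q v (- \<omega>)) * \<Psi> v)"
  proof (rule nn_integral_cong_AE)
    show "AE \<omega> in sphere_measure. (LBNN v. ennreal (kern q v \<omega>) * (LBNN \<xi>. \<Phi> (post \<xi> (\<xi> - v) \<omega>) (post_star \<xi> (\<xi> - v) \<omega>)))
       = (LBNN v. ennreal (kern q v (- \<omega>)) * \<Psi> v)"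
      using AE_sphere_norm
    proof eventually_elim
      case (elim \<omega>)
      have "(LBNN \<xi>. \<Phi> (post \<xi> (\<xi> - v) \<omega>) (post_star \<xi> (\<xi> - v) \<omega>)) = \<Psi> (reflect \<omega> v)" for v
      proof -
        have "(LBNN \<xi>. \<Phi> (post \<xi> (\<xi> - v) \<omega>) (post_star \<xi> (\<xi> - v) \<omega>))
          = (LBNN \<xi>. \<Phi> (\<xi> - (v \<bullet> \<omega>) *\<^sub>R \<omega>) ((\<xi> - (v \<bullet> \<omega>) *\<^sub>R \<omega>) - reflect \<omega> v))"
          by (intro nn_integral_cong arg_cong2[where f=\<Phi>]) (simp_all add: post_eq[OF elim] reflect_def algebra_simps scaleR_2[symmetric])
        also have "... = \<Psi> (reflect \<omega> v)" unfolding \<Psi>_def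
          by (rule nn_integral_lborel_translate) measurable
        finally show ?thesis .
      qed
      then have "(LBNN v. ennreal (kern q v \<omega>) * (LBNN \<xi>. \<Phi> (post \<xi> (\<xi> - v) \<omega>) (post_star \<xi> (\<xi> - v) \<omega>)))
        = (LBNN v. ennreal (kern q v \<omega>) * \<Psi> (reflect \<omega> v))" by simp
      also have "... = (LBNN v. ennreal (kern q (reflect \<omega> v) (- \<omega>)) * \<Psi> (reflect \<omega> v))"
      proof -
        have "kern q (reflect \<omega> v) (- \<omega>) = kern q v \<omega>" for v
        proof -
          have "reflect \<omega> v = reflect (- \<omega>) v" by (simp add: reflect_def)
          then show ?thesis using kern_reflect[of "- \<omega>" v] elim by simp
        qed
        then show ?thesis by simp
      qed
      also have "... = (LBNN v. ennreal (kern q v (- \<omega>)) * \<Psi> v)"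
        by (rule nn_integral_reflect[OF elim]) measurable
      finally show ?case .
    qed
  qed
  also have "... = (SNN \<omega>. LBNN v. ennreal (kern q v \<omega>) * \<Psi> v)"
    by (rule nn_integral_sphere_uminus) measurable
  also have "... = (LBNN \<xi>. LBNN \<xi>s. SNN \<omega>. ennreal (kern q (\<xi> - \<xi>s) \<omega>) * \<Phi> \<xi> \<xi>s)"
    unfolding \<Psi>_def by (rule gen[of "\<lambda>(\<xi>, \<xi>s, \<omega>). \<Phi> \<xi> \<xi>s", unfolded prod.case, symmetric]) measurable
  finally show ?thesis .
qed

text \<open>
  From \<open>2 \<bar>x y\<bar> \<le> x\<^sup>2 + y\<^sup>2\<close> the integrand is at most \<open>M(\<xi>\<^sub>*) f(\<xi>)\<^sup>2 + M(\<xi>) f(\<xi>\<^sub>*)\<^sup>2\<close>.  Integration of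
  the Maxwellian against the kernel gives \<open>\<nu>\<close> in both terms.
\<close>

lemma collision_product_finite:
  assumes [measurable]: "f \<in> borel_maps"
    and fin: "(LBNN \<xi>. ennreal (nu q \<xi> * (f \<xi>)\<^sup>2)) < \<infinity>"
  defines "F \<equiv> \<lambda>\<xi>. sqrt (maxwellian \<xi>) * f \<xi>"
  shows "(LBNN \<xi>. LBNN \<xi>s. SNN \<omega>. ennreal (kern q (\<xi> - \<xi>s) \<omega>) * ennreal \<bar>F \<xi> * F \<xi>s\<bar>) < \<infinity>"
proof -
  note [measurable] = maxwellian_facts(3) nu_facts(1)
  let ?M = maxwellian
  have M0: "?M \<xi> \<ge> 0" for \<xi> using less_imp_le[OF maxwellian_facts(1)] .
  have am: "\<bar>F a * F b\<bar> \<le> ?M b * (f a)\<^sup>2 + ?M a * (f b)\<^sup>2" for a b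
  proof -
    have "2 * (\<bar>sqrt (?M b) * f a\<bar> * \<bar>sqrt (?M a) * f b\<bar>) \<le> (\<bar>sqrt (?M b) * f a\<bar>)\<^sup>2 + (\<bar>sqrt (?M a) * f b\<bar>)\<^sup>2"
      using sum_squares_bound[of "\<bar>sqrt (?M b) * f a\<bar>" "\<bar>sqrt (?M a) * f b\<bar>"] by (simp add: mult.assoc)
    also have "... = ?M b * (f a)\<^sup>2 + ?M a * (f b)\<^sup>2" using M0 by (simp add: power_mult_distrib)
    also have "\<bar>sqrt (?M b) * f a\<bar> * \<bar>sqrt (?M a) * f b\<bar> = \<bar>F a * F b\<bar>" by (simp add: F_def abs_mult)
    finally show ?thesis using abs_ge_zero[of "F a * F b"] by linarith
  qed
  have I1: "(LBNN \<xi>. LBNN \<xi>s. SNN \<omega>. ennreal (kern q (\<xi> - \<xi>s) \<omega> * ?M \<xi>s) * ennreal ((f \<xi>)\<^sup>2))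
     = (LBNN \<xi>. ennreal (nu q \<xi> * (f \<xi>)\<^sup>2))"
  proof (rule nn_integral_cong)
    fix \<xi> :: "real^3"
    have "(LBNN \<xi>s. SNN \<omega>. ennreal (kern q (\<xi> - \<xi>s) \<omega> * ?M \<xi>s) * ennreal ((f \<xi>)\<^sup>2))
      = (LBNN \<xi>s. SNN \<omega>. ennreal (kern q (\<xi> - \<xi>s) \<omega> * ?M \<xi>s)) * ennreal ((f \<xi>)\<^sup>2)"
      by (subst nn_integral_multc, measurable)+
    then show "(LBNN \<xi>s. SNN \<omega>. ennreal (kern q (\<xi> - \<xi>s) \<omega> * ?M \<xi>s) * ennreal ((f \<xi>)\<^sup>2)) = ennreal (nu q \<xi> * (f \<xi>)\<^sup>2)"
      unfolding nu_facts(4) using nu_facts(3)[of \<xi>] by (simp add: ennreal_mult)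
  qed
  have I2: "(LBNN \<xi>. LBNN \<xi>s. SNN \<omega>. ennreal (kern q (\<xi> - \<xi>s) \<omega> * ?M \<xi>) * ennreal ((f \<xi>s)\<^sup>2))
     = (LBNN \<xi>. ennreal (nu q \<xi> * (f \<xi>)\<^sup>2))"
  proof -
    have "(LBNN \<xi>. LBNN \<xi>s. SNN \<omega>. ennreal (kern q (\<xi> - \<xi>s) \<omega> * ?M \<xi>) * ennreal ((f \<xi>s)\<^sup>2))
      = (LBNN \<xi>s. LBNN \<xi>. SNN \<omega>. ennreal (kern q (\<xi> - \<xi>s) \<omega> * ?M \<xi>) * ennreal ((f \<xi>s)\<^sup>2))"
      by (rule lborel_pair.Fubini') measurable
    also have "... = (LBNN \<xi>s. LBNN \<xi>. SNN \<omega>. ennreal (kern q (\<xi>s - \<xi>) \<omega> * ?M \<xi>) * ennreal ((f \<xi>s)\<^sup>2))"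
    proof (rule nn_integral_cong, rule nn_integral_cong)
      fix \<xi>s \<xi> :: "real^3"
      have "(SNN \<omega>. ennreal (kern q (\<xi>s - \<xi>) (- \<omega>) * ?M \<xi>) * ennreal ((f \<xi>s)\<^sup>2))
        = (SNN \<omega>. ennreal (kern q (\<xi>s - \<xi>) \<omega> * ?M \<xi>) * ennreal ((f \<xi>s)\<^sup>2))"
        by (rule nn_integral_sphere_uminus) measurable
      moreover have "kern q (\<xi>s - \<xi>) (- \<omega>) = kern q (\<xi> - \<xi>s) \<omega>" for \<omega> using kern_swap[of "\<xi>s - \<xi>" \<omega>] by simp
      ultimately show "(SNN \<omega>. ennreal (kern q (\<xi> - \<xi>s) \<omega> * ?M \<xi>) * ennreal ((f \<xi>s)\<^sup>2))
        = (SNN \<omega>. ennreal (kern q (\<xi>s - \<xi>) \<omega> * ?M \<xi>) * ennreal ((f \<xi>s)\<^sup>2))" by simp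
    qed
    finally show ?thesis using I1 by simp
  qed
  have "(LBNN \<xi>. LBNN \<xi>s. SNN \<omega>. ennreal (kern q (\<xi> - \<xi>s) \<omega>) * ennreal \<bar>F \<xi> * F \<xi>s\<bar>)
    \<le> (LBNN \<xi>. LBNN \<xi>s. SNN \<omega>. ennreal (kern q (\<xi> - \<xi>s) \<omega> * ?M \<xi>s) * ennreal ((f \<xi>)\<^sup>2) + ennreal (kern q (\<xi> - \<xi>s) \<omega> * ?M \<xi>) * ennreal ((f \<xi>s)\<^sup>2))"
  proof (intro nn_integral_mono)
    fix \<xi> \<xi>s \<omega> :: "real^3"
    have "ennreal (kern q (\<xi> - \<xi>s) \<omega>) * ennreal \<bar>F \<xi> * F \<xi>s\<bar> \<le> ennreal (kern q (\<xi> - \<xi>s) \<omega>) * ennreal (?M \<xi>s * (f \<xi>)\<^sup>2 + ?M \<xi> * (f \<xi>s)\<^sup>2)"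
      using am by (intro mult_left_mono ennreal_leI) auto
    also have "... = ennreal (kern q (\<xi> - \<xi>s) \<omega> * ?M \<xi>s) * ennreal ((f \<xi>)\<^sup>2) + ennreal (kern q (\<xi> - \<xi>s) \<omega> * ?M \<xi>) * ennreal ((f \<xi>s)\<^sup>2)"
      using M0 by (simp add: ennreal_plus ennreal_mult'' distrib_left mult.assoc)
    finally show "ennreal (kern q (\<xi> - \<xi>s) \<omega>) * ennreal \<bar>F \<xi> * F \<xi>s\<bar> \<le> ennreal (kern q (\<xi> - \<xi>s) \<omega> * ?M \<xi>s) * ennreal ((f \<xi>)\<^sup>2) + ennreal (kern q (\<xi> - \<xi>s) \<omega> * ?M \<xi>) * ennreal ((f \<xi>s)\<^sup>2)" .
  qed
  also have "... = (LBNN \<xi>. ennreal (nu q \<xi> * (f \<xi>)\<^sup>2)) + (LBNN \<xi>. ennreal (nu q \<xi> * (f \<xi>)\<^sup>2))"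
    unfolding I1[symmetric] unfolding I1[unfolded I2[symmetric]]
    by (subst nn_integral_add, measurable)+ (simp add: I1 I2)
  also have "... < \<infinity>" using fin by simp
  finally show ?thesis .
qed

text \<open>
  The gain term is reduced to the loss term by the change of variables above.
\<close>

lemma collision_diag_integrable:
  assumes [measurable]: "f \<in> borel_maps"
    and fin: "(LBNN \<xi>. ennreal (nu q \<xi> * (f \<xi>)\<^sup>2)) < \<infinity>"
  defines "F \<equiv> \<lambda>\<xi>. sqrt (maxwellian \<xi>) * f \<xi>"
  shows "AE \<xi> in lborel. integrable P (\<lambda>x. kern q (\<xi> - fst x) (snd x) * (F (post \<xi> (fst x) (snd x)) * F (post_star \<xi> (fst x) (snd x))))
    \<and> integrable P (\<lambda>x. kern q (\<xi> - fst x) (snd x) * (F \<xi> * F (fst x)))"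
proof -
  note [measurable] = maxwellian_facts(3)
  have [measurable]: "F \<in> borel_maps" unfolding F_def by measurable
  have crit: "integrable P (\<lambda>x. kern q (\<xi> - fst x) (snd x) * X x)"
    if [measurable]: "X \<in> borel_measurable P"
      and fin: "(LBNN \<xi>s. SNN \<omega>. ennreal (kern q (\<xi> - \<xi>s) \<omega>) * ennreal \<bar>X (\<xi>s, \<omega>)\<bar>) \<noteq> \<infinity>" for \<xi> X
  proof (rule integrableI_bounded)
    show "(\<lambda>x. kern q (\<xi> - fst x) (snd x) * X x) \<in> borel_measurable P" by measurable
    have "(\<integral>\<^sup>+x. ennreal (norm (kern q (\<xi> - fst x) (snd x) * X x)) \<partial>P) = (\<integral>\<^sup>+x. ennreal (kern q (\<xi> - fst x) (snd x)) * ennreal \<bar>X x\<bar> \<partial>P)"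
    proof (rule nn_integral_cong_AE)
      show "AE x in P. ennreal (norm (kern q (\<xi> - fst x) (snd x) * X x)) = ennreal (kern q (\<xi> - fst x) (snd x)) * ennreal \<bar>X x\<bar>"
        using AE_P_norm by eventually_elim (simp add: abs_mult ennreal_mult kern_nonneg)
    qed
    also have "... = (LBNN \<xi>s. SNN \<omega>. ennreal (kern q (\<xi> - fst (\<xi>s, \<omega>)) (snd (\<xi>s, \<omega>))) * ennreal \<bar>X (\<xi>s, \<omega>)\<bar>)"
      by (rule sphere.nn_integral_fst[symmetric]) measurable
    also have "... < \<infinity>" using fin by (simp add: less_top)
    finally show "(\<integral>\<^sup>+x. ennreal (norm (kern q (\<xi> - fst x) (snd x) * X x)) \<partial>P) < \<infinity>" .
  qed
  have fin1: "(LBNN \<xi>. LBNN \<xi>s. SNN \<omega>. ennreal (kern q (\<xi> - \<xi>s) \<omega>) * ennreal \<bar>F \<xi> * F \<xi>s\<bar>) \<noteq> \<infinity>"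
    using collision_product_finite[OF assms(1) fin] unfolding F_def by simp
  have fin2: "(LBNN \<xi>. LBNN \<xi>s. SNN \<omega>. ennreal (kern q (\<xi> - \<xi>s) \<omega>) * ennreal \<bar>F (post \<xi> \<xi>s \<omega>) * F (post_star \<xi> \<xi>s \<omega>)\<bar>) \<noteq> \<infinity>"
    using fin1 by (subst collision_change_of_variables[of "\<lambda>a b. ennreal \<bar>F a * F b\<bar>"]) auto
  have "AE \<xi> in lborel. (LBNN \<xi>s. SNN \<omega>. ennreal (kern q (\<xi> - \<xi>s) \<omega>) * ennreal \<bar>F \<xi> * F \<xi>s\<bar>) \<noteq> \<infinity>"
    by (rule nn_integral_PInf_AE[OF _ fin1]) measurable
  moreover have "AE \<xi> in lborel. (LBNN \<xi>s. SNN \<omega>. ennreal (kern q (\<xi> - \<xi>s) \<omega>) * ennreal \<bar>F (post \<xi> \<xi>s \<omega>) * F (post_star \<xi> \<xi>s \<omega>)\<bar>) \<noteq> \<infinity>"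
    by (rule nn_integral_PInf_AE[OF _ fin2]) measurable
  ultimately show ?thesis
  proof eventually_elim
    case (elim \<xi>)
    show ?case
    proof
      show "integrable P (\<lambda>x. kern q (\<xi> - fst x) (snd x) * (F (post \<xi> (fst x) (snd x)) * F (post_star \<xi> (fst x) (snd x))))"
        by (rule crit) (measurable, use elim in simp)
      show "integrable P (\<lambda>x. kern q (\<xi> - fst x) (snd x) * (F \<xi> * F (fst x)))"
        by (rule crit) (measurable, use elim in simp)
    qed
  qed
qed

text \<open>
  Bilinearity of \<open>\<Gamma>\<close> is not available pointwise: the integral that defines \<open>\<Gamma>(f, g)\<close> need not split into
  convergent parts.  For equal arguments it does, almost everywhere, and the integrand on the right-hand
  side is the difference of two such integrands.  The identity is the polarization
  \<open>F F\<^sub>* - G G\<^sub>* = 1/2 ((F - G) (F + G)\<^sub>* + (F - G)\<^sub>* (F + G))\<close>.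
\<close>

lemma Gamma_diff_squares:
  assumes "f \<in> borel_maps" "(LBNN \<xi>. ennreal (nu q \<xi> * (f \<xi>)\<^sup>2)) < \<infinity>"
    and "g \<in> borel_maps" "(LBNN \<xi>. ennreal (nu q \<xi> * (g \<xi>)\<^sup>2)) < \<infinity>"
  shows "AE \<xi> in lborel. Gamma_op q f f \<xi> - Gamma_op q g g \<xi> = Gamma_op q (\<lambda>\<eta>. f \<eta> - g \<eta>) (\<lambda>\<eta>. f \<eta> + g \<eta>) \<xi>"
  using collision_diag_integrable[OF assms(1,2)] collision_diag_integrable[OF assms(3,4)]
proof eventually_elim
  case (elim \<xi>)
  define F where "F \<eta> = sqrt (maxwellian \<eta>) * f \<eta>" for \<eta>
  define G where "G \<eta> = sqrt (maxwellian \<eta>) * g \<eta>" for \<eta>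
  define A where "A F x = kern q (\<xi> - fst x) (snd x) * (F (post \<xi> (fst x) (snd x)) * F (post_star \<xi> (fst x) (snd x)) :: real)" for F x
  define B where "B F x = kern q (\<xi> - fst x) (snd x) * (F \<xi> * F (fst x) :: real)" for F :: "real^3 \<Rightarrow> real" and x :: "(real^3) \<times> (real^3)"
  have int: "integrable P (A F)" "integrable P (B F)" "integrable P (A G)" "integrable P (B G)"
    using elim unfolding A_def B_def F_def G_def by simp_all
  have diag: "collision q H H \<xi> = (LINT x|P. A H x) - (LINT x|P. B H x)" if "integrable P (A H)" "integrable P (B H)" for H
  proof -
    have "2 * (A H x - B H x) = kern q (\<xi> - fst x) (snd x) *
          (H (post \<xi> (fst x) (snd x)) * H (post_star \<xi> (fst x) (snd x)) + H (post_star \<xi> (fst x) (snd x)) * H (post \<xi> (fst x) (snd x))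
            - H \<xi> * H (fst x) - H (fst x) * H \<xi>)" for x
      unfolding A_def B_def by (simp add: algebra_simps)
    then have "collision q H H \<xi> = 1/2 * (LINT x|P. 2 * (A H x - B H x))"
      unfolding collision_def kern_collision case_prod_unfold by (simp only:)
    also have "... = (LINT x|P. A H x - B H x)" unfolding Bochner_Integration.integral_mult_right_zero by simp
    also have "... = (LINT x|P. A H x) - (LINT x|P. B H x)" by (rule Bochner_Integration.integral_diff[OF that])
    finally show ?thesis .
  qed
  have "2 * ((A F x - B F x) - (A G x - B G x)) = kern q (\<xi> - fst x) (snd x) *
          ((F (post \<xi> (fst x) (snd x)) - G (post \<xi> (fst x) (snd x))) * (F (post_star \<xi> (fst x) (snd x)) + G (post_star \<xi> (fst x) (snd x)))
            + (F (post_star \<xi> (fst x) (snd x)) - G (post_star \<xi> (fst x) (snd x))) * (F (post \<xi> (fst x) (snd x)) + G (post \<xi> (fst x) (snd x)))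
            - (F \<xi> - G \<xi>) * (F (fst x) + G (fst x)) - (F (fst x) - G (fst x)) * (F \<xi> + G \<xi>))" for x
    unfolding A_def B_def by (simp add: algebra_simps)
  then have "collision q (\<lambda>\<eta>. F \<eta> - G \<eta>) (\<lambda>\<eta>. F \<eta> + G \<eta>) \<xi> = 1/2 * (LINT x|P. 2 * ((A F x - B F x) - (A G x - B G x)))"
    unfolding collision_def kern_collision case_prod_unfold by (simp only:)
  also have "... = (LINT x|P. (A F x - B F x) - (A G x - B G x))"
    unfolding Bochner_Integration.integral_mult_right_zero by simp
  also have "... = (LINT x|P. A F x - B F x) - (LINT x|P. A G x - B G x)"
    by (intro Bochner_Integration.integral_diff Bochner_Integration.integrable_diff int)
  also have "... = collision q F F \<xi> - collision q G G \<xi>"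
    unfolding diag[OF int(1,2)] diag[OF int(3,4)] using int by (simp add: Bochner_Integration.integral_diff)
  finally have "collision q (\<lambda>\<eta>. F \<eta> - G \<eta>) (\<lambda>\<eta>. F \<eta> + G \<eta>) \<xi> = collision q F F \<xi> - collision q G G \<xi>" .
  moreover have "Gamma_op q f f \<xi> = 1 / sqrt (maxwellian \<xi>) * collision q F F \<xi>"
    "Gamma_op q g g \<xi> = 1 / sqrt (maxwellian \<xi>) * collision q G G \<xi>"
    unfolding Gamma_op_def F_def[abs_def] G_def[abs_def] by (rule refl)+
  moreover have "Gamma_op q (\<lambda>\<eta>. f \<eta> - g \<eta>) (\<lambda>\<eta>. f \<eta> + g \<eta>) \<xi>
      = 1 / sqrt (maxwellian \<xi>) * collision q (\<lambda>\<eta>. F \<eta> - G \<eta>) (\<lambda>\<eta>. F \<eta> + G \<eta>) \<xi>"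
    unfolding Gamma_op_def F_def[abs_def] G_def[abs_def] right_diff_distrib[symmetric] distrib_left[symmetric] by (rule refl)
  ultimately show ?case by (simp only: right_diff_distrib)
qed

lemma in_Lp2_iff: "in_Lp 2 f \<longleftrightarrow> f \<in> borel_maps \<and> l2sq f < \<infinity>"
  and l2sq_Lp_norm: "in_Lp 2 f \<Longrightarrow> l2sq f = ennreal ((Lp_norm 2 f)\<^sup>2)"
proof -
  have p2: "\<bar>f \<xi>\<bar> powr enn2real 2 = (f \<xi>)\<^sup>2" for \<xi> by (simp add: powr_numeral)
  show iff: "in_Lp 2 f \<longleftrightarrow> f \<in> borel_maps \<and> l2sq f < \<infinity>"
  proof -
    have "integrable lborel (\<lambda>\<xi>. (f \<xi>)\<^sup>2) \<longleftrightarrow> l2sq f < \<infinity>" if [measurable]: "f \<in> borel_maps"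
      unfolding l2sq_def by (subst integrable_iff_bounded) simp
    then show ?thesis unfolding in_Lp_def p2 by auto
  qed
  show "l2sq f = ennreal ((Lp_norm 2 f)\<^sup>2)" if "in_Lp 2 f"
  proof -
    have i: "integrable lborel (\<lambda>\<xi>. (f \<xi>)\<^sup>2)" using that unfolding in_Lp_def p2 by simp
    have "l2sq f = ennreal (LBINT \<xi>. (f \<xi>)\<^sup>2)" unfolding l2sq_def by (rule nn_integral_eq_integral[OF i]) simp
    moreover have "Lp_norm 2 f = (LBINT \<xi>. (f \<xi>)\<^sup>2) powr (1/2)" unfolding Lp_norm_def p2 by simp
    ultimately show ?thesis by (simp add: powr_half_sqrt)
  qed
qed

lemma Lp_norm_nonneg: "Lp_norm 2 f \<ge> 0"
  by (simp add: Lp_norm_def)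

lemma K_op_diff:
  assumes "in_Lp 2 f" "in_Lp 2 g"
  shows "AE \<xi> in lborel. K_op q (\<lambda>\<eta>. f \<eta> - g \<eta>) \<xi> = K_op q f \<xi> - K_op q g \<xi>"
proof -
  have "AE \<xi> in lborel. K_op q (\<lambda>\<eta>. 1 * f \<eta> + (-1) * g \<eta>) \<xi> = 1 * K_op q f \<xi> + (-1) * K_op q g \<xi>"
    using cutoff assms unfolding cutoff_kernel_def by blast
  then show ?thesis by simp
qed

lemma K_op_bound:
  "\<exists>C\<ge>0. \<forall>f. in_Lp 2 f \<longrightarrow> K_op q f \<in> borel_maps \<and> l2sq (K_op q f) \<le> ennreal C * l2sq f"
proof -
  have "\<exists>C. \<forall>f. in_Lp 2 f \<longrightarrow>
        in_Lp 2 (K_op q f) \<and> in_Lp \<infinity> (K_op q f) \<and>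
        Lp_norm 2 (K_op q f) \<le> C * Lp_norm 2 f \<and> Lp_norm \<infinity> (K_op q f) \<le> C * Lp_norm 2 f"
    using cutoff unfolding cutoff_kernel_def by (elim conjE)
  then obtain C where C: "\<And>f. in_Lp 2 f \<Longrightarrow> in_Lp 2 (K_op q f) \<and> Lp_norm 2 (K_op q f) \<le> C * Lp_norm 2 f"
    by blast
  have "K_op q f \<in> borel_maps \<and> l2sq (K_op q f) \<le> ennreal (C\<^sup>2) * l2sq f" if f: "in_Lp 2 f" for f
  proof
    have Kf: "in_Lp 2 (K_op q f)" "Lp_norm 2 (K_op q f) \<le> C * Lp_norm 2 f" using C[OF f] by auto
    show "K_op q f \<in> borel_maps" using Kf(1) in_Lp2_iff by blast
    have "(Lp_norm 2 (K_op q f))\<^sup>2 \<le> (C * Lp_norm 2 f)\<^sup>2" using Kf(2) Lp_norm_nonneg by (intro power_mono) auto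
    then show "l2sq (K_op q f) \<le> ennreal (C\<^sup>2) * l2sq f"
      unfolding l2sq_Lp_norm[OF f] l2sq_Lp_norm[OF Kf(1)] by (simp add: ennreal_mult[symmetric] power_mult_distrib ennreal_leI)
  qed
  then show ?thesis by (intro exI[of _ "C\<^sup>2"]) auto
qed

lemma nu_lower: "\<exists>n0>0. \<forall>\<xi>. n0 \<le> nu q \<xi>"
proof -
  obtain \<nu>0 where \<nu>0: "\<nu>0 > 0" "\<And>\<xi>. \<nu>0 * (1 + norm \<xi>) powr \<gamma> \<le> nu q \<xi>" using nu_facts(2) by blast
  have "\<gamma> \<ge> 0" using cutoff unfolding cutoff_kernel_def by blast
  then have *: "\<nu>0 * 1 \<le> \<nu>0 * (1 + norm \<xi>) powr \<gamma>" for \<xi> :: "real^3"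
    using \<nu>0(1) by (intro mult_left_mono ge_one_powr_ge_zero) auto
  have "\<nu>0 \<le> nu q \<xi>" for \<xi> using *[of \<xi>] \<nu>0(2)[of \<xi>] by linarith
  then show ?thesis using \<nu>0(1) by blast
qed

lemma weighted_l2:
  assumes [measurable]: "f \<in> borel_maps" and fin: "nu_l2 q f < \<infinity>"
    and n0: "n0 > 0" "\<And>\<xi>. n0 \<le> nu q \<xi>"
  shows "l2sq f \<le> ennreal (1 / n0\<^sup>2) * nu_l2 q f" "in_Lp 2 f" "in_Lp 2 (\<lambda>\<xi>. nu q \<xi> * f \<xi>)"
    "(LBNN \<xi>. ennreal (nu q \<xi> * (f \<xi>)\<^sup>2)) < \<infinity>"
proof -
  note [measurable] = nu_facts(1)
  have "l2sq f \<le> l2sq (\<lambda>\<xi>. (1 / n0) * (nu q \<xi> * f \<xi>))"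
  proof (rule l2sq_mono)
    fix \<xi>
    have "1 * \<bar>f \<xi>\<bar> \<le> (nu q \<xi> / n0) * \<bar>f \<xi>\<bar>" using n0 by (intro mult_right_mono) (auto simp: le_divide_eq)
    then show "\<bar>f \<xi>\<bar> \<le> \<bar>(1 / n0) * (nu q \<xi> * f \<xi>)\<bar>" using n0(1) nu_facts(3)[of \<xi>] by (simp add: abs_mult)
  qed
  also have "... = ennreal (1 / n0\<^sup>2) * nu_l2 q f"
    by (subst l2sq_cmult) (auto simp: power_divide)
  finally show le: "l2sq f \<le> ennreal (1 / n0\<^sup>2) * nu_l2 q f" .
  also have "... < \<infinity>" using fin by (simp add: ennreal_mult_less_top)
  finally have "l2sq f < \<infinity>" .
  then show "in_Lp 2 f" by (simp add: in_Lp2_iff)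
  show "in_Lp 2 (\<lambda>\<xi>. nu q \<xi> * f \<xi>)" using fin by (simp add: in_Lp2_iff)
  have "(LBNN \<xi>. ennreal (nu q \<xi> * (f \<xi>)\<^sup>2)) \<le> (LBNN \<xi>. ennreal (1 / n0) * ennreal ((nu q \<xi> * f \<xi>)\<^sup>2))"
  proof (rule nn_integral_mono)
    fix \<xi>
    have "n0 * nu q \<xi> * (f \<xi>)\<^sup>2 \<le> nu q \<xi> * nu q \<xi> * (f \<xi>)\<^sup>2"
      using n0 nu_facts(3)[of \<xi>] by (intro mult_right_mono) auto
    then have "nu q \<xi> * (f \<xi>)\<^sup>2 \<le> (1 / n0) * (nu q \<xi> * f \<xi>)\<^sup>2"
      using n0(1) by (simp add: power_mult_distrib power2_eq_square field_simps)
    then show "ennreal (nu q \<xi> * (f \<xi>)\<^sup>2) \<le> ennreal (1 / n0) * ennreal ((nu q \<xi> * f \<xi>)\<^sup>2)"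
      using n0(1) by (simp add: ennreal_mult[symmetric] ennreal_leI)
  qed
  also have "... = ennreal (1 / n0) * nu_l2 q f" unfolding l2sq_def by (rule nn_integral_cmult) measurable
  also have "... < \<infinity>" using fin by (simp add: ennreal_mult_less_top)
  finally show "(LBNN \<xi>. ennreal (nu q \<xi> * (f \<xi>)\<^sup>2)) < \<infinity>" .
qed

text \<open>
  The cut-off estimate with \<open>\<alpha> = 0\<close> and \<open>p = 2\<close>; since \<open>\<nu>\<close> is bounded below, the weighted norm also
  dominates the norm without weight.
\<close>

lemma Gamma_op_bound:
  "\<exists>C\<ge>0. \<forall>f g. f \<in> borel_maps \<longrightarrow> g \<in> borel_maps \<longrightarrow>
     nu_l2 q f < \<infinity> \<longrightarrow> nu_l2 q g < \<infinity> \<longrightarrow>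
     Gamma_op q f g \<in> borel_maps \<and>
     l2sq (Gamma_op q f g) \<le> ennreal C * (nu_l2 q f * nu_l2 q g)"
proof -
  obtain n0 where n0: "n0 > 0" "\<And>\<xi>. n0 \<le> nu q \<xi>" using nu_lower by blast
  have "\<forall>p\<ge>1. \<forall>\<alpha>\<in>{0..1}. \<exists>C0. \<forall>f g.
        in_Lp p f \<and> in_Lp p g \<and>
        in_Lp p (\<lambda>\<xi>. nu q \<xi> powr (1 - \<alpha>) * f \<xi>) \<and> in_Lp p (\<lambda>\<xi>. nu q \<xi> powr (1 - \<alpha>) * g \<xi>) \<longrightarrow>
        in_Lp p (\<lambda>\<xi>. nu q \<xi> powr (- \<alpha>) * Gamma_op q f g \<xi>) \<and>
        Lp_norm p (\<lambda>\<xi>. nu q \<xi> powr (- \<alpha>) * Gamma_op q f g \<xi>)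
          \<le> C0 * (Lp_norm p (\<lambda>\<xi>. nu q \<xi> powr (1 - \<alpha>) * f \<xi>) * Lp_norm p g
                + Lp_norm p (\<lambda>\<xi>. nu q \<xi> powr (1 - \<alpha>) * g \<xi>) * Lp_norm p f)"
    using cutoff unfolding cutoff_kernel_def by (elim conjE)
  from this[rule_format, of 2 0] obtain C0 where C0: "\<And>f g.
        in_Lp 2 f \<and> in_Lp 2 g \<and>
        in_Lp 2 (\<lambda>\<xi>. nu q \<xi> powr (1 - 0) * f \<xi>) \<and> in_Lp 2 (\<lambda>\<xi>. nu q \<xi> powr (1 - 0) * g \<xi>) \<longrightarrow>
        in_Lp 2 (\<lambda>\<xi>. nu q \<xi> powr (- 0) * Gamma_op q f g \<xi>) \<and>
        Lp_norm 2 (\<lambda>\<xi>. nu q \<xi> powr (- 0) * Gamma_op q f g \<xi>)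
          \<le> C0 * (Lp_norm 2 (\<lambda>\<xi>. nu q \<xi> powr (1 - 0) * f \<xi>) * Lp_norm 2 g
                + Lp_norm 2 (\<lambda>\<xi>. nu q \<xi> powr (1 - 0) * g \<xi>) * Lp_norm 2 f)"
    by auto
  have p1: "nu q \<xi> powr (1 - 0) = nu q \<xi>" "nu q \<xi> powr (- 0) = 1" for \<xi>
    using nu_facts(3)[of \<xi>] by auto
  define D where "D = 2 * \<bar>C0\<bar> / n0"
  have D: "D \<ge> 0" using n0 by (simp add: D_def)
  have "Gamma_op q f g \<in> borel_maps \<and> l2sq (Gamma_op q f g) \<le> ennreal (D\<^sup>2) * (nu_l2 q f * nu_l2 q g)"
    if f: "f \<in> borel_maps" "nu_l2 q f < \<infinity>"
      and g: "g \<in> borel_maps" "nu_l2 q g < \<infinity>" for f g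
  proof -
    note wf = weighted_l2[OF f n0] and wg = weighted_l2[OF g n0]
    let ?a = "Lp_norm 2 (\<lambda>\<xi>. nu q \<xi> * f \<xi>)" and ?b = "Lp_norm 2 (\<lambda>\<xi>. nu q \<xi> * g \<xi>)"
    have G: "in_Lp 2 (Gamma_op q f g)" "Lp_norm 2 (Gamma_op q f g) \<le> C0 * (?a * Lp_norm 2 g + ?b * Lp_norm 2 f)"
      using C0[of f g] wf(2,3) wg(2,3) unfolding p1 by auto
    have small: "Lp_norm 2 h \<le> Lp_norm 2 (\<lambda>\<xi>. nu q \<xi> * h \<xi>) / n0"
      if h: "h \<in> borel_maps" "nu_l2 q h < \<infinity>" for h
    proof -
      note wh = weighted_l2[OF h n0]
      have "ennreal ((Lp_norm 2 h)\<^sup>2) \<le> ennreal (1 / n0\<^sup>2) * ennreal ((Lp_norm 2 (\<lambda>\<xi>. nu q \<xi> * h \<xi>))\<^sup>2)"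
        using wh(1) unfolding l2sq_Lp_norm[OF wh(2)] l2sq_Lp_norm[OF wh(3)] .
      also have "... = ennreal ((Lp_norm 2 (\<lambda>\<xi>. nu q \<xi> * h \<xi>) / n0)\<^sup>2)"
        by (simp add: ennreal_mult[symmetric] power_divide)
      finally have "(Lp_norm 2 h)\<^sup>2 \<le> (Lp_norm 2 (\<lambda>\<xi>. nu q \<xi> * h \<xi>) / n0)\<^sup>2" by (subst (asm) ennreal_le_iff) auto
      then show ?thesis
        by (rule power2_le_imp_le) (rule divide_nonneg_pos[OF Lp_norm_nonneg n0(1)])
    qed
    have ab: "?a \<ge> 0" "?b \<ge> 0" by (rule Lp_norm_nonneg)+
    have "0 \<le> ?a * Lp_norm 2 g + ?b * Lp_norm 2 f"
      by (intro add_nonneg_nonneg mult_nonneg_nonneg Lp_norm_nonneg)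
    then have "C0 * (?a * Lp_norm 2 g + ?b * Lp_norm 2 f) \<le> \<bar>C0\<bar> * (?a * Lp_norm 2 g + ?b * Lp_norm 2 f)"
      by (intro mult_right_mono) auto
    also have "... \<le> \<bar>C0\<bar> * (?a * (?b / n0) + ?b * (?a / n0))"
      by (intro mult_left_mono add_mono small[OF f] small[OF g] ab abs_ge_zero)
    also have "... = D * (?a * ?b)" by (simp add: D_def add_divide_distrib[symmetric] algebra_simps)
    finally have "Lp_norm 2 (Gamma_op q f g) \<le> D * (?a * ?b)" using G(2) by (rule order_trans[rotated])
    then have "(Lp_norm 2 (Gamma_op q f g))\<^sup>2 \<le> (D * (?a * ?b))\<^sup>2" by (rule power_mono[OF _ Lp_norm_nonneg])
    then have "l2sq (Gamma_op q f g) \<le> ennreal (D\<^sup>2 * (?a\<^sup>2 * ?b\<^sup>2))"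
      unfolding l2sq_Lp_norm[OF G(1)] by (intro ennreal_leI) (simp add: power_mult_distrib)
    also have "... = ennreal (D\<^sup>2) * (nu_l2 q f * nu_l2 q g)"
      unfolding l2sq_Lp_norm[OF wf(3)] l2sq_Lp_norm[OF wg(3)] by (simp add: ennreal_mult)
    finally show ?thesis using G(1) in_Lp2_iff by blast
  qed
  then show ?thesis by (intro exI[of _ "D\<^sup>2"]) auto
qed

end

section \<open>Classical derivatives are weak derivatives\<close>

lemma partials_partial: "partials bs (partial b f) = partials (bs @ [b]) f"
  by (simp add: partials_def)

lemma smooth_partial:
  assumes "smooth f" "b \<in> Basis"
  shows "smooth (partial b f)"
  unfolding smooth_def partials_partial
proof (intro allI impI)
  fix bs p assume "set bs \<subseteq> (Basis :: 'a set)"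
  then have "set (bs @ [b]) \<subseteq> Basis" using assms(2) by simp
  then show "partials (bs @ [b]) f differentiable at p" using assms(1) unfolding smooth_def by blast
qed

lemma smooth_partials: "smooth f \<Longrightarrow> set bs \<subseteq> Basis \<Longrightarrow> smooth (partials bs f)"
  by (induction bs) (auto simp: partials_def intro: smooth_partial)

lemma smooth_line_DERIV:
  assumes "smooth f"
  shows "((\<lambda>s. f (p + s *\<^sub>R b)) has_real_derivative partial b f (p + s *\<^sub>R b)) (at s)"
proof -
  have "f differentiable at (p + s *\<^sub>R b)"
    using assms unfolding smooth_def partials_def by (metis empty_subsetI foldr_Nil id_apply list.set(1))
  then obtain D where D: "(f has_derivative D) (at (p + s *\<^sub>R b))" unfolding differentiable_def by blast
  have "((\<lambda>u. p + s *\<^sub>R b + u *\<^sub>R b) has_derivative (\<lambda>u. u *\<^sub>R b)) (at 0)"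
    by (auto intro!: derivative_eq_intros)
  from has_derivative_compose[OF this, of f D] D
  have "((\<lambda>u. f (p + s *\<^sub>R b + u *\<^sub>R b)) has_derivative (\<lambda>u. D (u *\<^sub>R b))) (at 0)" by simp
  then have "(\<lambda>u. f (p + s *\<^sub>R b + u *\<^sub>R b)) differentiable at 0" unfolding differentiable_def by blast
  then have "((\<lambda>u. f (p + s *\<^sub>R b + u *\<^sub>R b)) has_real_derivative partial b f (p + s *\<^sub>R b)) (at 0)"
    unfolding partial_def by (metis DERIV_imp_deriv real_differentiable_def)
  then show ?thesis
    using DERIV_shift[of "\<lambda>s. f (p + s *\<^sub>R b)" "partial b f (p + s *\<^sub>R b)" 0 s] by (simp add: algebra_simps)
qed

lemma integral_lborel_translate:
  fixes f :: "'a::euclidean_space \<Rightarrow> real"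
  assumes [measurable]: "f \<in> borel_maps"
  shows "(LBINT p. f (p + c)) = (LBINT p. f p)"
proof -
  have "(LBINT p. f p) = (LINT p|distr lborel borel ((+) c). f p)" by (simp add: lborel_distr_plus)
  also have "... = (LBINT p. f (c + p))" by (rule integral_distr) measurable
  finally show ?thesis by (simp add: add.commute)
qed

text \<open>
  By translation invariance every difference quotient has integral zero, and dominated convergence
  passes to the derivative.
\<close>

lemma integral_directional_derivative_zero:
  fixes h h' :: "'a::euclidean_space \<Rightarrow> real"
  assumes d: "\<And>p s. ((\<lambda>s. h (p + s *\<^sub>R b)) has_real_derivative h' (p + s *\<^sub>R b)) (at s)"
    and c: "continuous_on UNIV h" "continuous_on UNIV h'"
    and z: "\<And>p. norm p > r \<Longrightarrow> h p = 0" "\<And>p. norm p > r \<Longrightarrow> h' p = 0" and b: "norm b \<le> 1"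
  shows "(LBINT p. h' p) = 0"
proof -
  have [measurable]: "h \<in> borel_maps" "h' \<in> borel_maps"
    using c by (auto intro: borel_measurable_continuous_onI)
  obtain M where M: "\<And>p. \<bar>h' p\<bar> \<le> M" using bounded_support_unif_cont(1)[OF c(2) z(2)] by blast
  have M0: "M \<ge> 0" using M[of 0] by linarith
  define s where "s n = 1 / (real n + 1)" for n
  have s: "s n > 0" "s n \<le> 1" for n by (auto simp: s_def divide_le_eq)
  define D where "D n p = (h (p + s n *\<^sub>R b) - h p) / s n" for n p
  have [measurable]: "D n \<in> borel_maps" for n unfolding D_def[abs_def] by measurable
  have ih: "integrable lborel h"
    by (rule integrable_continuous_compact_support[OF c(1), of "cball 0 r"]) (use z in auto)
  have "integrable lborel (\<lambda>p. h (p + s n *\<^sub>R b))" for n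
  proof (rule integrable_continuous_compact_support[of _ "cball 0 (r + 1)"])
    show "continuous_on UNIV (\<lambda>p. h (p + s n *\<^sub>R b))"
      by (rule continuous_on_compose2[OF c(1)]) (auto intro!: continuous_intros)
    fix p :: 'a assume "p \<notin> cball 0 (r + 1)"
    moreover have "norm (s n *\<^sub>R b) \<le> 1" using s[of n] b by (simp add: mult_le_one)
    ultimately have "norm (p + s n *\<^sub>R b) > r" using norm_diff_ineq[of p "s n *\<^sub>R b"] by auto
    then show "h (p + s n *\<^sub>R b) = 0" by (rule z(1))
  qed simp
  then have "(LBINT p. h (p + s n *\<^sub>R b) - h p) = 0" for n
    using ih by (subst Bochner_Integration.integral_diff) (auto simp: integral_lborel_translate)
  then have D0: "(LBINT p. D n p) = 0" for n unfolding D_def by simp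
  have bound: "\<bar>D n p\<bar> \<le> M * indicator (cball 0 (r + 1)) p" for n p
  proof (cases "norm p \<le> r + 1")
    case True
    have "norm (h (p + s n *\<^sub>R b) - h (p + 0 *\<^sub>R b)) \<le> M * norm (s n - 0)"
      by (rule field_differentiable_bound[where S=UNIV and f'="\<lambda>s. h' (p + s *\<^sub>R b)", OF convex_UNIV
            has_field_derivative_at_within[OF d]]) (use M in auto)
    then have "\<bar>h (p + s n *\<^sub>R b) - h p\<bar> \<le> M * s n" using s(1)[of n] by simp
    then show ?thesis using True s(1)[of n] by (simp add: D_def abs_divide pos_divide_le_eq)
  next
    case False
    have "norm (s n *\<^sub>R b) \<le> 1" using s[of n] b by (simp add: mult_le_one)
    then have "norm (p + s n *\<^sub>R b) > r" using norm_diff_ineq[of p "s n *\<^sub>R b"] False by auto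
    then show ?thesis using z(1) False by (simp add: D_def)
  qed
  have sl: "s \<longlonglongrightarrow> 0" unfolding s_def by real_asymp
  have lim: "(\<lambda>n. D n p) \<longlonglongrightarrow> h' p" for p
  proof -
    have "((\<lambda>x. (h (p + (0 + x) *\<^sub>R b) - h (p + 0 *\<^sub>R b)) / x) \<longlongrightarrow> h' (p + 0 *\<^sub>R b)) (at 0)"
      using d[of p 0] unfolding DERIV_def .
    moreover have "filterlim s (at 0) sequentially"
      unfolding filterlim_at using sl s(1) by (auto simp: less_imp_neq[symmetric] intro!: always_eventually)
    ultimately have "(\<lambda>n. (h (p + (0 + s n) *\<^sub>R b) - h (p + 0 *\<^sub>R b)) / s n) \<longlonglongrightarrow> h' (p + 0 *\<^sub>R b)"
      by (rule filterlim_compose)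
    then show ?thesis by (simp add: D_def)
  qed
  have "(\<lambda>n. LBINT p. D n p) \<longlonglongrightarrow> (LBINT p. h' p)"
  proof (rule integral_dominated_convergence[where w="\<lambda>p. M * indicator (cball 0 (r + 1)) p"])
    show "integrable lborel (\<lambda>p. M * indicator (cball 0 (r + 1) :: 'a set) p)"
      using emeasure_lborel_cball_finite by (intro Bochner_Integration.integrable_mult_right integrable_real_indicator) auto
  qed (use lim bound in auto)
  then show ?thesis unfolding D0 using LIMSEQ_unique tendsto_const by blast
qed

lemma partial_zero_open:
  assumes "open U" "p \<in> U" "\<And>y. y \<in> U \<Longrightarrow> f y = 0"
  shows "partial b f p = 0"
proof -
  have "open ((\<lambda>s. p + s *\<^sub>R b) -` U)" by (intro open_vimage assms(1) continuous_intros)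
  moreover have "((\<lambda>s. 0 :: real) has_real_derivative 0) (at 0)" by simp
  ultimately have "((\<lambda>s. f (p + s *\<^sub>R b)) has_real_derivative 0) (at 0)"
    by (rule_tac has_field_derivative_transform_within_open[where S="(\<lambda>s. p + s *\<^sub>R b) -` U"]) (use assms in auto)
  then show ?thesis unfolding partial_def by (rule DERIV_imp_deriv)
qed

lemma partials_zero_open:
  assumes "open U" "\<And>y. y \<in> U \<Longrightarrow> f y = 0" "p \<in> U"
  shows "partials bs f p = 0"
  using assms(3)
proof (induction bs arbitrary: p)
  case (Cons b bs)
  then show ?case using partial_zero_open[OF assms(1), of p "partials bs f" b] by (simp add: partials_def)
qed (simp add: partials_def assms)

lemma integration_by_parts:
  fixes f \<phi> :: "'a::euclidean_space \<Rightarrow> real"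
  assumes f: "smooth f" and \<phi>: "smooth \<phi>" and z: "\<And>p. norm p > r \<Longrightarrow> \<phi> p = 0" and b: "b \<in> Basis"
  shows "(LBINT p. f p * partial b \<phi> p) = - (LBINT p. partial b f p * \<phi> p)"
proof -
  have z': "partial b \<phi> p = 0" if "norm p > r" for p
    by (rule partial_zero_open[of "{p. norm p > r}"]) (use that z in \<open>auto intro!: open_Collect_less continuous_intros\<close>)
  note cf = smooth_imp_continuous[OF f] smooth_imp_continuous[OF smooth_partial[OF f b]]
  note c\<phi> = smooth_imp_continuous[OF \<phi>] smooth_imp_continuous[OF smooth_partial[OF \<phi> b]]
  have i1: "integrable lborel (\<lambda>p. f p * partial b \<phi> p)"
    by (rule integrable_continuous_compact_support[of _ "cball 0 r"]) (use z' in \<open>auto intro!: continuous_on_mult cf c\<phi>\<close>)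
  have i2: "integrable lborel (\<lambda>p. partial b f p * \<phi> p)"
    by (rule integrable_continuous_compact_support[of _ "cball 0 r"]) (use z in \<open>auto intro!: continuous_on_mult cf c\<phi>\<close>)
  have "(LBINT p. partial b f p * \<phi> p + f p * partial b \<phi> p) = 0"
  proof (rule integral_directional_derivative_zero[where h="\<lambda>p. f p * \<phi> p" and b=b and r=r])
    fix p s
    show "((\<lambda>s. f (p + s *\<^sub>R b) * \<phi> (p + s *\<^sub>R b)) has_real_derivative
        partial b f (p + s *\<^sub>R b) * \<phi> (p + s *\<^sub>R b) + f (p + s *\<^sub>R b) * partial b \<phi> (p + s *\<^sub>R b)) (at s)"
      by (rule DERIV_cong[OF DERIV_mult[OF smooth_line_DERIV[OF f] smooth_line_DERIV[OF \<phi>]]]) (simp add: mult.commute)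
  qed (use z z' b in \<open>auto intro!: continuous_on_mult continuous_on_add cf c\<phi>\<close>)
  then show ?thesis using i1 i2 by (simp add: Bochner_Integration.integral_add)
qed

lemma iterated_integration_by_parts:
  fixes f \<phi> :: "'a::euclidean_space \<Rightarrow> real"
  assumes "smooth f" and \<phi>: "smooth \<phi>" and z: "\<And>p. norm p > r \<Longrightarrow> \<phi> p = 0" and "set bs \<subseteq> Basis"
  shows "(LBINT p. f p * partials bs \<phi> p) = (-1) ^ length bs * (LBINT p. partials (rev bs) f p * \<phi> p)"
  using assms(1,4)
proof (induction bs arbitrary: f)
  case Nil then show ?case by (simp add: partials_def)
next
  case (Cons b bs)
  have b: "b \<in> Basis" "set bs \<subseteq> Basis" using Cons.prems(2) by auto
  have z': "partials bs \<phi> p = 0" if "norm p > r" for p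
    by (rule partials_zero_open[of "{p. norm p > r}"]) (use that z in \<open>auto intro!: open_Collect_less continuous_intros\<close>)
  have "(LBINT p. f p * partials (b # bs) \<phi> p) = (LBINT p. f p * partial b (partials bs \<phi>) p)"
    by (simp add: partials_def)
  also have "... = - (LBINT p. partial b f p * partials bs \<phi> p)"
    by (rule integration_by_parts[OF Cons.prems(1) smooth_partials[OF \<phi> b(2)] z' b(1)])
  also have "... = - ((-1) ^ length bs * (LBINT p. partials (rev bs) (partial b f) p * \<phi> p))"
    by (subst Cons.IH[OF smooth_partial[OF Cons.prems(1) b(1)] b(2)]) simp
  finally show ?case by (simp add: partials_partial)
qed

text \<open>
  The definition of weak derivatives uses an unspecified enumeration of the multi-index for the test
  function; integration by parts yields the reverse enumeration for \<open>f\<close>.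
\<close>

lemma smooth_weak_deriv:
  fixes f :: "'a::euclidean_space \<Rightarrow> real"
  assumes f: "smooth f" and \<alpha>: "set_mset \<alpha> \<subseteq> Basis"
  shows "weak_deriv \<Omega> \<alpha> f (partials (rev (SOME bs. mset bs = \<alpha>)) f)"
proof -
  define bs where "bs = (SOME bs. mset bs = \<alpha>)"
  have m: "mset bs = \<alpha>" unfolding bs_def by (rule someI_ex) (rule ex_mset)
  have bs: "set bs \<subseteq> Basis" "length bs = size \<alpha>" using m \<alpha> by (auto simp flip: m)
  have li: "locally_integrable \<Omega> g" if "continuous_on UNIV g" for g :: "'a \<Rightarrow> real"
    unfolding locally_integrable_def set_integrable_def
    using borel_integrable_compact[OF _ continuous_on_subset[OF that]] by simp
  have "(LBINT p:\<Omega>. f p * mderiv \<alpha> \<phi> p) = (-1) ^ size \<alpha> * (LBINT p:\<Omega>. partials (rev bs) f p * \<phi> p)"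
    if t: "test_function \<Omega> \<phi>" for \<phi>
  proof -
    let ?S = "closure {p. \<phi> p \<noteq> 0}"
    have \<phi>: "smooth \<phi>" "compact ?S" "?S \<subseteq> \<Omega>" using t by (auto simp: test_function_def)
    have z: "\<phi> p = 0" if "p \<in> - ?S" for p
      using that subsetD[OF closure_subset, of p "{p. \<phi> p \<noteq> 0}"] unfolding Compl_iff mem_Collect_eq by argo
    have z': "mderiv \<alpha> \<phi> p = 0" if "p \<in> - ?S" for p
      unfolding mderiv_def bs_def[symmetric] by (rule partials_zero_open[OF _ z that]) auto
    obtain r where r: "\<And>p. p \<in> ?S \<Longrightarrow> norm p \<le> r" using compact_imp_bounded[OF \<phi>(2)] unfolding bounded_iff by blast
    have zr: "\<phi> p = 0" if "norm p > r" for p using z[of p] r[of p] that by fastforce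
    have ind: "(LBINT p:\<Omega>. g p * w p) = (LBINT p. g p * w p)" if w: "\<forall>p\<in>- ?S. w p = 0" for g w :: "'a \<Rightarrow> real"
      unfolding set_lebesgue_integral_def
    proof (rule arg_cong[where f="integral\<^sup>L lborel"], rule ext)
      fix p show "indicat_real \<Omega> p *\<^sub>R (g p * w p) = g p * w p"
        using bspec[OF w, of p] subsetD[OF \<phi>(3), of p] by (cases "p \<in> \<Omega>"; cases "p \<in> ?S") simp_all
    qed
    have "(LBINT p:\<Omega>. f p * mderiv \<alpha> \<phi> p) = (LBINT p. f p * partials bs \<phi> p)"
      unfolding mderiv_def bs_def[symmetric]
      by (rule ind, rule ballI, rule z'[unfolded mderiv_def bs_def[symmetric]])
    also have "... = (-1) ^ length bs * (LBINT p. partials (rev bs) f p * \<phi> p)"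
      by (rule iterated_integration_by_parts[OF f \<phi>(1) zr bs(1)])
    also have "(LBINT p. partials (rev bs) f p * \<phi> p) = (LBINT p:\<Omega>. partials (rev bs) f p * \<phi> p)"
      by (rule ind[symmetric], rule ballI, rule z)
    finally show ?thesis using bs(2) by simp
  qed
  then show ?thesis
    unfolding weak_deriv_def bs_def[symmetric] using f bs(1)
    by (auto intro!: li smooth_imp_continuous smooth_partials)
qed

section \<open>Regularity and realization of shallow networks\<close>

text \<open>
  The penalty term of the error takes Sobolev norms in \<open>(x, \<xi>)\<close> at a fixed time.  A network with frozen time
  is a network in \<open>(x, \<xi>)\<close> with the same weights and another bias, which gives bounds uniform in time.
\<close>

definition freeze_time :: "real \<Rightarrow> phase units \<Rightarrow> ((real^3) \<times> (real^3)) units" where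
  "freeze_time t L = map (\<lambda>(c, a, b). (c, snd a, fst a * t + b)) L"

lemma net_freeze_time: "net (freeze_time t L) y = net L (t, y)"
  by (induction L) (auto simp: freeze_time_def inner_prod_def algebra_simps)

lemma dnet_freeze_time_bound: "\<exists>C\<ge>0. \<forall>t y. \<bar>dnet (freeze_time t L) bs y\<bar> \<le> C"
proof (induction L)
  case Nil then show ?case by (auto simp: freeze_time_def intro: exI[of _ 0])
next
  case (Cons x L)
  obtain c a b where x: "x = (c, a, b)" by (cases x) auto
  obtain C where C: "C \<ge> 0" "\<And>t y. \<bar>dnet (freeze_time t L) bs y\<bar> \<le> C" using Cons by blast
  obtain D where D: "D \<ge> 0" "\<And>s. \<bar>dtanh (length bs) s\<bar> \<le> D" using dtanh_bounded by blast
  let ?k = "c * (\<Prod>e\<leftarrow>bs. snd a \<bullet> e)"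
  have "\<bar>dnet (freeze_time t (x # L)) bs y\<bar> \<le> \<bar>?k\<bar> * D + C" for t y
  proof -
    have "\<bar>?k * dtanh (length bs) (snd a \<bullet> y + (fst a * t + b))\<bar> \<le> \<bar>?k\<bar> * D"
      unfolding abs_mult[of ?k] using D by (intro mult_left_mono) auto
    then show ?thesis using C(2)[of t y]
      abs_triangle_ineq[of "?k * dtanh (length bs) (snd a \<bullet> y + (fst a * t + b))" "dnet (freeze_time t L) bs y"]
      by (simp add: x freeze_time_def)
  qed
  then show ?case using C D by (intro exI[of _ "\<bar>?k\<bar> * D + C"]) auto
qed

lemma net_sobolev_bound:
  fixes L :: "phase units" and \<Omega> :: "((real^3) \<times> (real^3)) set"
  assumes "emeasure lborel \<Omega> < \<infinity>" and \<Omega>[measurable]: "\<Omega> \<in> sets borel"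
  shows "\<exists>C. \<forall>t. sobolev_norm_sq k \<Omega> \<Omega> (\<lambda>y. net L (t, y)) \<le> ennreal C"
proof -
  let ?bs = "\<lambda>\<alpha> :: ((real^3) \<times> (real^3)) multiset. rev (SOME bs. mset bs = \<alpha>)"
  have "\<exists>C. \<forall>\<alpha>. C \<alpha> \<ge> 0 \<and> (\<forall>t y. \<bar>dnet (freeze_time t L) (?bs \<alpha>) y\<bar> \<le> C \<alpha>)"
    by (rule choice) (use dnet_freeze_time_bound in blast)
  then obtain C where C: "\<And>\<alpha>. C \<alpha> \<ge> 0" "\<And>\<alpha> t y. \<bar>dnet (freeze_time t L) (?bs \<alpha>) y\<bar> \<le> C \<alpha>" by blast
  define B where "B = (\<Sum>\<alpha>\<in>multi_indices k. ennreal ((C \<alpha>)\<^sup>2) * emeasure lborel \<Omega>)"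
  have B: "B < \<infinity>" unfolding B_def using assms(1) by (simp add: finite_multi_indices ennreal_mult_less_top)
  have "sobolev_norm_sq k \<Omega> \<Omega> (\<lambda>y. net L (t, y)) \<le> ennreal (enn2real B)" for t
  proof -
    have f: "(\<lambda>y. net L (t, y)) = net (freeze_time t L)" by (simp add: net_freeze_time fun_eq_iff)
    have "weak_deriv \<Omega> \<alpha> (net (freeze_time t L)) (dnet (freeze_time t L) (?bs \<alpha>))" if "\<alpha> \<in> multi_indices k" for \<alpha>
      using smooth_weak_deriv[OF smooth_dnet, of \<alpha> \<Omega> "freeze_time t L" "[]"] that by (simp add: partials_net multi_indices_def)
    then have "sobolev_norm_sq k \<Omega> \<Omega> (\<lambda>y. net L (t, y)) \<le> (\<Sum>\<alpha>\<in>multi_indices k. LBNN p. ennreal ((dnet (freeze_time t L) (?bs \<alpha>) p)\<^sup>2) * indicator \<Omega> p)"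
      unfolding sobolev_norm_sq_def f by (intro INF_lower2[of "\<lambda>\<alpha>. dnet (freeze_time t L) (?bs \<alpha>)"]) auto
    also have "... \<le> B" unfolding B_def
    proof (rule sum_mono)
      fix \<alpha>
      have "l2_on \<Omega> (\<lambda>p. dnet (freeze_time t L) (?bs \<alpha>) p) \<le> l2_on \<Omega> (\<lambda>p. C \<alpha>)"
      proof (intro nn_integral_mono mult_right_mono ennreal_leI)
        fix p
        show "(dnet (freeze_time t L) (?bs \<alpha>) p)\<^sup>2 \<le> (C \<alpha>)\<^sup>2" using C by (simp add: abs_le_square_iff[symmetric])
      qed auto
      also have "... = ennreal ((C \<alpha>)\<^sup>2) * emeasure lborel \<Omega>" by (simp add: nn_integral_cmult_indicator)
      finally show "l2_on \<Omega> (\<lambda>p. dnet (freeze_time t L) (?bs \<alpha>) p) \<le> ennreal ((C \<alpha>)\<^sup>2) * emeasure lborel \<Omega>" .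
    qed
    also have "B = ennreal (enn2real B)" using B by (simp add: less_top)
    finally show ?thesis .
  qed
  then show ?thesis by blast
qed

lemma affine_combination_zip:
  "(\<Sum>(a, x)\<leftarrow>zip (map f L) (map g L). a * x) = (\<Sum>u\<leftarrow>L. f u * (g u :: real))"
  by (induction L) auto

lemma phase_inner_coords:
  fixes a p :: phase
  shows "a \<bullet> p = fst a * fst p + (fst (snd a) $ 1 * fst (snd p) $ 1 + fst (snd a) $ 2 * fst (snd p) $ 2 + fst (snd a) $ 3 * fst (snd p) $ 3)
     + (snd (snd a) $ 1 * snd (snd p) $ 1 + snd (snd a) $ 2 * snd (snd p) $ 2 + snd (snd a) $ 3 * snd (snd p) $ 3)"
  by (simp add: inner_prod_def inner_vec_def sum_3)

text \<open>
  Six idle units ensure that the width exceeds 5, whatever the size of the given network.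
\<close>

lemma net_realization: "\<exists>N>5. \<exists>\<theta>. tanh_network N \<theta> \<and> realization \<theta> = net L"
proof -
  define L' where "L' = L @ replicate 6 (0, 0, 0)"
  have net0: "net (replicate n (0, 0, 0)) p = 0" for n and p :: phase by (induction n) auto
  have netL': "net L' = net L" by (auto simp: L'_def net0)
  define w where "w a = [fst a, fst (snd a) $ 1, fst (snd a) $ 2, fst (snd a) $ 3, snd (snd a) $ 1, snd (snd a) $ 2, snd (snd a) $ 3]" for a :: phase
  define l1 where "l1 = map (\<lambda>u. (w (fst (snd u)), snd (snd u))) L'"
  define l2 where "l2 = [(map fst L', 0 :: real)]"
  have len: "length l1 > 5" "l1 \<noteq> []" by (auto simp: l1_def L'_def)
  have "tanh_network (length l1) [l1, l2]"
    using len by (auto simp: tanh_network_def l2_def l1_def w_def)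
  moreover have "realization [l1, l2] = net L"
  proof
    fix p :: phase
    obtain t x \<xi> where p: "p = (t, x, \<xi>)" by (cases p) auto
    let ?xs = "[t, x $ 1, x $ 2, x $ 3, \<xi> $ 1, \<xi> $ 2, \<xi> $ 3]"
    have al: "affine_layer l1 ?xs = map (\<lambda>u. fst (snd u) \<bullet> p + snd (snd u)) L'"
      by (simp add: affine_layer_def l1_def w_def p phase_inner_coords o_def add.assoc)
    have "realization [l1, l2] p = (\<Sum>u\<leftarrow>L'. fst u * tanh (fst (snd u) \<bullet> p + snd (snd u)))"
      unfolding realization_def p prod.case feedforward.simps al[unfolded p]
      by (simp add: l2_def affine_layer_def affine_combination_zip o_def)
    also have "... = net L' p" by (simp add: dnet_def case_prod_unfold)
    finally show "realization [l1, l2] p = net L p" unfolding netL' .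
  qed
  ultimately show ?thesis using len by blast
qed

section \<open>Stability of the collision terms\<close>

lemma K_op_weighted_bound:
  assumes cutoff: "cutoff_kernel q \<gamma>"
  shows "\<exists>k\<ge>0. \<forall>h. h \<in> borel_maps \<longrightarrow> nu_l2 q h < \<infinity> \<longrightarrow>
    K_op q h \<in> borel_maps \<and> l2sq (K_op q h) \<le> ennreal k * nu_l2 q h"
proof -
  obtain n0 where n0: "n0 > 0" "\<And>\<xi>. n0 \<le> nu q \<xi>" using nu_lower[OF cutoff] by blast
  obtain C where C: "C \<ge> 0" "\<And>f. in_Lp 2 f \<Longrightarrow> K_op q f \<in> borel_maps \<and> l2sq (K_op q f) \<le> ennreal C * l2sq f"
    using K_op_bound[OF cutoff] by blast
  have "K_op q h \<in> borel_maps \<and> l2sq (K_op q h) \<le> ennreal (C / n0\<^sup>2) * nu_l2 q h"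
    if h: "h \<in> borel_maps" "nu_l2 q h < \<infinity>" for h
  proof -
    note w = weighted_l2[OF cutoff h n0]
    have "l2sq (K_op q h) \<le> ennreal C * l2sq h" using C(2)[OF w(2)] by blast
    also have "... \<le> ennreal C * (ennreal (1 / n0\<^sup>2) * nu_l2 q h)" by (intro mult_left_mono w(1)) simp
    also have "... = ennreal (C / n0\<^sup>2) * nu_l2 q h"
      using C(1) by (simp add: mult.assoc[symmetric] ennreal_mult[symmetric])
    finally show ?thesis using C(2)[OF w(2)] by blast
  qed
  then show ?thesis using C(1) by (intro exI[of _ "C / n0\<^sup>2"]) auto
qed

text \<open>
  For one \<open>t\<close> and \<open>x\<close>, the residual of an approximation \<open>v\<close> of \<open>f\<close> on the velocity set \<open>V\<close>, with transport
  part \<open>L\<close>.  What matters is the dependence of the constants: the coefficient of the tail of \<open>f\<close> outside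
  \<open>V\<close> does not involve \<open>V\<close> (or the bound \<open>S\<close> for it), so that the truncation radius can be chosen before
  the accuracy \<open>e\<close>.
\<close>

definition collision_stable :: "(real \<Rightarrow> real \<Rightarrow> real) \<Rightarrow> real \<Rightarrow> bool" where
  "collision_stable q C \<longleftrightarrow> C \<ge> 0 \<and> (\<forall>V f v L B S e. V \<in> sets borel \<longrightarrow> f \<in> borel_maps \<longrightarrow> v \<in> borel_maps \<longrightarrow>
     L \<in> borel_maps \<longrightarrow> 0 \<le> B \<longrightarrow> nu_l2 q f \<le> ennreal B \<longrightarrow>
     0 \<le> S \<longrightarrow> nu_l2 q (indicator V) \<le> ennreal S \<longrightarrow> 0 \<le> e \<longrightarrow> e \<le> 1 \<longrightarrow> (\<forall>\<xi>\<in>V. \<bar>v \<xi> - f \<xi>\<bar> \<le> e) \<longrightarrow>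
     l2_on V (\<lambda>\<xi>. L \<xi> + nu q \<xi> * v \<xi> - K_op q (\<lambda>\<eta>. v \<eta> * indicator V \<eta>) \<xi>
         - Gamma_op q (\<lambda>\<eta>. v \<eta> * indicator V \<eta>) (\<lambda>\<eta>. v \<eta> * indicator V \<eta>) \<xi>)
     \<le> 6 * l2_on V (\<lambda>\<xi>. L \<xi> - (collision_rhs q f \<xi>))
       + ennreal (C * (1 + B + S) * e\<^sup>2) * l2_on V (\<lambda>\<xi>. nu q \<xi>)
       + ennreal (C * (1 + B)) * l2_on (- V) (\<lambda>\<xi>. nu q \<xi> * f \<xi>))"

text \<open>
  With \<open>f\<^sub>1\<close>, \<open>v\<^sub>1\<close> the restrictions of \<open>f\<close>, \<open>v\<close> to \<open>V\<close>, the residual minus the equation for \<open>f\<close> consists of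
  the transport error, \<open>\<nu> (v\<^sub>1 - f\<^sub>1)\<close>, the images under \<open>K\<close> of \<open>f\<^sub>1 - v\<^sub>1\<close> and of \<open>f - f\<^sub>1\<close>, and two
  differences of \<open>\<Gamma>\<close>.  Polarization writes the latter as \<open>\<Gamma>(f\<^sub>1 - v\<^sub>1, f\<^sub>1 + v\<^sub>1)\<close> and
  \<open>\<Gamma>(f - f\<^sub>1, f + f\<^sub>1)\<close>.  Every term except the first has a factor that is either at most \<open>e\<close> on \<open>V\<close> or
  supported outside \<open>V\<close>.
\<close>

lemma collision_stable_exists:
  assumes cutoff: "cutoff_kernel q \<gamma>"
  shows "\<exists>C. collision_stable q C"
proof -
  note nu = nu_facts[OF cutoff] and [measurable] = nu_facts(1)[OF cutoff]
  obtain n0 where n0: "n0 > 0" "\<And>\<xi>. n0 \<le> nu q \<xi>" using nu_lower[OF cutoff] by blast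
  obtain k where k: "k \<ge> 0" and Kb: "\<And>h. h \<in> borel_maps \<Longrightarrow> nu_l2 q h < \<infinity> \<Longrightarrow>
      K_op q h \<in> borel_maps \<and> l2sq (K_op q h) \<le> ennreal k * nu_l2 q h"
    using K_op_weighted_bound[OF cutoff] by blast
  obtain CG where CG: "CG \<ge> 0" "\<And>f g. f \<in> borel_maps \<Longrightarrow> g \<in> borel_maps \<Longrightarrow>
     nu_l2 q f < \<infinity> \<Longrightarrow> nu_l2 q g < \<infinity> \<Longrightarrow>
     Gamma_op q f g \<in> borel_maps \<and>
     l2sq (Gamma_op q f g) \<le> ennreal CG * (nu_l2 q f * nu_l2 q g)"
    using Gamma_op_bound[OF cutoff] by blast
  define C where "C = 6 * (1 + k + 8 * CG)"
  have C0: "C \<ge> 0" using k CG(1) by (simp add: C_def)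
  show ?thesis unfolding collision_stable_def
  proof (rule exI[of _ C], intro conjI[OF C0] allI impI)
    fix V and f v L :: "real^3 \<Rightarrow> real" and B S e :: real
    assume [measurable]: "V \<in> sets borel" "f \<in> borel_maps" "v \<in> borel_maps" "L \<in> borel_maps"
      and B: "0 \<le> B" "nu_l2 q f \<le> ennreal B"
      and S: "0 \<le> S" "nu_l2 q (indicator V) \<le> ennreal S"
      and e: "0 \<le> e" "e \<le> 1" and close: "\<forall>\<xi>\<in>V. \<bar>v \<xi> - f \<xi>\<bar> \<le> e"
    define f1 where "f1 \<eta> = f \<eta> * indicator V \<eta>" for \<eta>
    define v1 where "v1 \<eta> = v \<eta> * indicator V \<eta>" for \<eta>
    define N where "N = l2_on V (\<lambda>\<xi>. nu q \<xi>)"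
    define d where "d = l2_on (- V) (\<lambda>\<xi>. nu q \<xi> * f \<xi>)"
    have [measurable]: "f1 \<in> borel_maps" "v1 \<in> borel_maps" unfolding f1_def[abs_def] v1_def[abs_def] by measurable
    let ?x = "\<lambda>\<xi>. f1 \<xi> - v1 \<xi>" and ?y = "\<lambda>\<xi>. f \<xi> - f1 \<xi>"
    have N: "nu_l2 q (indicator V) = N"
      unfolding l2sq_def N_def by (intro nn_integral_cong) (auto simp: indicator_def)
    have ev: "e\<^sup>2 \<le> 1" using e by (simp add: power_le_one)
    have "nu_l2 q ?x \<le> l2sq (\<lambda>\<xi>. e * (nu q \<xi> * indicator V \<xi>))"
    proof (rule l2sq_mono)
      fix \<xi> show "\<bar>nu q \<xi> * ?x \<xi>\<bar> \<le> \<bar>e * (nu q \<xi> * indicator V \<xi>)\<bar>"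
      proof (cases "\<xi> \<in> V")
        case True
        have "\<bar>nu q \<xi>\<bar> * \<bar>f \<xi> - v \<xi>\<bar> \<le> \<bar>nu q \<xi>\<bar> * e" using close True by (intro mult_left_mono) (auto simp: abs_minus_commute)
        then show ?thesis using True e by (simp add: f1_def v1_def abs_mult mult.commute)
      qed (simp add: f1_def v1_def)
    qed
    also have "... = ennreal (e\<^sup>2) * N" by (subst l2sq_cmult) (auto simp: N)
    finally have x: "nu_l2 q ?x \<le> ennreal (e\<^sup>2) * N" .
    have "ennreal (e\<^sup>2) * N \<le> ennreal 1 * ennreal S" using S(2) ev unfolding N by (intro mult_mono ennreal_leI) auto
    then have xS: "nu_l2 q ?x \<le> ennreal S" using x by (simp add: order_trans)
    have y: "nu_l2 q ?y = d"
      unfolding l2sq_def d_def by (intro nn_integral_cong) (auto simp: indicator_def f1_def)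
    have "nu_l2 q ?y \<le> nu_l2 q f"
      by (rule l2sq_mono) (auto simp: indicator_def f1_def)
    then have yB: "nu_l2 q ?y \<le> ennreal B" using B(2) by (rule order_trans)
    have "nu_l2 q f1 \<le> nu_l2 q f"
      by (rule l2sq_mono) (auto simp: indicator_def f1_def)
    then have f1B: "nu_l2 q f1 \<le> ennreal B" using B(2) by (rule order_trans)
    have "nu_l2 q (\<lambda>\<xi>. f \<xi> + f1 \<xi>) \<le> l2sq (\<lambda>\<xi>. 2 * (nu q \<xi> * f \<xi>))"
      by (rule l2sq_mono) (auto simp: indicator_def f1_def abs_mult)
    also have "... = 4 * nu_l2 q f" by (subst l2sq_cmult) auto
    also have "... \<le> 4 * ennreal B" using B(2) by (rule mult_left_mono) simp
    finally have fp: "nu_l2 q (\<lambda>\<xi>. f \<xi> + f1 \<xi>) \<le> ennreal (4 * B)" using B(1) by (simp add: ennreal_mult)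
    have "nu_l2 q (\<lambda>\<xi>. f1 \<xi> + v1 \<xi>) = l2sq (\<lambda>\<xi>. 2 * (nu q \<xi> * f1 \<xi>) - nu q \<xi> * ?x \<xi>)"
      by (simp add: algebra_simps)
    also have "... \<le> 2 * l2sq (\<lambda>\<xi>. 2 * (nu q \<xi> * f1 \<xi>)) + 2 * nu_l2 q ?x" by (rule l2sq_diff) measurable
    also have "l2sq (\<lambda>\<xi>. 2 * (nu q \<xi> * f1 \<xi>)) = 4 * nu_l2 q f1" by (subst l2sq_cmult) auto
    also have "2 * (4 * nu_l2 q f1) + 2 * nu_l2 q ?x \<le> 2 * (4 * ennreal B) + 2 * ennreal S"
      by (intro add_mono mult_left_mono f1B xS) auto
    also have "... = ennreal (8 * B + 2 * S)" using B(1) S(1) by (simp add: ennreal_plus ennreal_mult mult.assoc[symmetric])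
    finally have fv: "nu_l2 q (\<lambda>\<xi>. f1 \<xi> + v1 \<xi>) \<le> ennreal (8 * B + 2 * S)" .
    have "nu_l2 q v1 = l2sq (\<lambda>\<xi>. nu q \<xi> * f1 \<xi> - nu q \<xi> * ?x \<xi>)" by (simp add: algebra_simps)
    also have "... \<le> 2 * nu_l2 q f1 + 2 * nu_l2 q ?x" by (rule l2sq_diff) measurable
    also have "... \<le> 2 * ennreal B + 2 * ennreal S" by (intro add_mono mult_left_mono f1B xS) auto
    finally have v1f: "nu_l2 q v1 \<le> 2 * ennreal B + 2 * ennreal S" .
    have fin: "nu_l2 q f < \<infinity>" "nu_l2 q f1 < \<infinity>" "nu_l2 q ?x < \<infinity>"
      "nu_l2 q ?y < \<infinity>" "nu_l2 q (\<lambda>\<xi>. f \<xi> + f1 \<xi>) < \<infinity>"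
      "nu_l2 q (\<lambda>\<xi>. f1 \<xi> + v1 \<xi>) < \<infinity>" "nu_l2 q v1 < \<infinity>"
      using order.strict_trans1[OF B(2)] order.strict_trans1[OF f1B] order.strict_trans1[OF xS] order.strict_trans1[OF yB]
        order.strict_trans1[OF fp] order.strict_trans1[OF fv] order.strict_trans1[OF v1f] by (simp_all add: ennreal_mult_less_top)
    have meas: "f \<in> borel_maps" "f1 \<in> borel_maps" "v1 \<in> borel_maps"
      "?x \<in> borel_maps" "?y \<in> borel_maps" "(\<lambda>\<xi>. f \<xi> + f1 \<xi>) \<in> borel_maps"
      "(\<lambda>\<xi>. f1 \<xi> + v1 \<xi>) \<in> borel_maps" by measurable
    note wf = weighted_l2[OF cutoff meas(1) fin(1) n0] and wf1 = weighted_l2[OF cutoff meas(2) fin(2) n0]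
      and wv1 = weighted_l2[OF cutoff meas(3) fin(7) n0]
    have Kx: "l2sq (K_op q ?x) \<le> ennreal (k * e\<^sup>2) * N"
    proof -
      have "l2sq (K_op q ?x) \<le> ennreal k * (ennreal (e\<^sup>2) * N)"
        using Kb[OF meas(4) fin(3)] mult_left_mono[OF x, of "ennreal k"] by (meson order_trans zero_le)
      then show ?thesis using k by (simp add: ennreal_mult mult.assoc)
    qed
    have Ky: "l2sq (K_op q ?y) \<le> ennreal k * d" using Kb[OF meas(5) fin(4)] unfolding y by blast
    have Gx: "l2sq (Gamma_op q ?x (\<lambda>\<xi>. f1 \<xi> + v1 \<xi>)) \<le> ennreal (CG * (8 * B + 2 * S) * e\<^sup>2) * N"
    proof -
      have "l2sq (Gamma_op q ?x (\<lambda>\<xi>. f1 \<xi> + v1 \<xi>)) \<le> ennreal CG * (nu_l2 q ?x * nu_l2 q (\<lambda>\<xi>. f1 \<xi> + v1 \<xi>))"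
        using CG(2)[OF meas(4,7) fin(3,6)] by blast
      also have "... \<le> ennreal CG * ((ennreal (e\<^sup>2) * N) * ennreal (8 * B + 2 * S))"
        by (intro mult_left_mono mult_mono x fv) auto
      also have "... = ennreal (CG * (8 * B + 2 * S) * e\<^sup>2) * N" using CG(1) B(1) S(1) by (simp add: ennreal_mult mult_ac)
      finally show ?thesis .
    qed
    have Gy: "l2sq (Gamma_op q ?y (\<lambda>\<xi>. f \<xi> + f1 \<xi>)) \<le> ennreal (CG * (4 * B)) * d"
    proof -
      have "l2sq (Gamma_op q ?y (\<lambda>\<xi>. f \<xi> + f1 \<xi>)) \<le> ennreal CG * (nu_l2 q ?y * nu_l2 q (\<lambda>\<xi>. f \<xi> + f1 \<xi>))"
        using CG(2)[OF meas(5,6) fin(4,5)] by blast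
      also have "... \<le> ennreal CG * (d * ennreal (4 * B))" unfolding y by (intro mult_left_mono fp) auto
      also have "... = ennreal (CG * (4 * B)) * d" using CG(1) B(1) by (simp add: ennreal_mult mult_ac)
      finally show ?thesis .
    qed
    let ?a = "\<lambda>\<xi>. L \<xi> - (collision_rhs q f \<xi>)"
    have [measurable]: "K_op q f \<in> borel_maps" "Gamma_op q f f \<in> borel_maps"
      "K_op q ?x \<in> borel_maps" "K_op q ?y \<in> borel_maps"
      "Gamma_op q ?x (\<lambda>\<xi>. f1 \<xi> + v1 \<xi>) \<in> borel_maps" "Gamma_op q ?y (\<lambda>\<xi>. f \<xi> + f1 \<xi>) \<in> borel_maps"
      using Kb[OF meas(1) fin(1)] Kb[OF meas(4) fin(3)] Kb[OF meas(5) fin(4)]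
        CG(2)[OF meas(1,1) fin(1,1)] CG(2)[OF meas(4,7) fin(3,6)] CG(2)[OF meas(5,6) fin(4,5)] by blast+
    define A where "A = l2_on V ?a"
    have "l2_on V (\<lambda>\<xi>. L \<xi> + nu q \<xi> * v \<xi> - K_op q v1 \<xi> - Gamma_op q v1 v1 \<xi>)
      \<le> (LBNN \<xi>. 6 * (ennreal ((?a \<xi>)\<^sup>2) * indicator V \<xi> + ennreal ((nu q \<xi> * ?x \<xi>)\<^sup>2) + ennreal ((K_op q ?y \<xi>)\<^sup>2)
          + ennreal ((K_op q ?x \<xi>)\<^sup>2) + ennreal ((Gamma_op q ?x (\<lambda>\<xi>. f1 \<xi> + v1 \<xi>) \<xi>)\<^sup>2)
          + ennreal ((Gamma_op q ?y (\<lambda>\<xi>. f \<xi> + f1 \<xi>) \<xi>)\<^sup>2)))"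
    proof (rule nn_integral_mono_AE)
      show "AE \<xi> in lborel. ennreal ((L \<xi> + nu q \<xi> * v \<xi> - K_op q v1 \<xi> - Gamma_op q v1 v1 \<xi>)\<^sup>2) * indicator V \<xi>
        \<le> 6 * (ennreal ((?a \<xi>)\<^sup>2) * indicator V \<xi> + ennreal ((nu q \<xi> * ?x \<xi>)\<^sup>2) + ennreal ((K_op q ?y \<xi>)\<^sup>2)
          + ennreal ((K_op q ?x \<xi>)\<^sup>2) + ennreal ((Gamma_op q ?x (\<lambda>\<xi>. f1 \<xi> + v1 \<xi>) \<xi>)\<^sup>2)
          + ennreal ((Gamma_op q ?y (\<lambda>\<xi>. f \<xi> + f1 \<xi>) \<xi>)\<^sup>2))"
        using K_op_diff[OF cutoff wf(2) wf1(2)] K_op_diff[OF cutoff wf1(2) wv1(2)]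
          Gamma_diff_squares[OF cutoff meas(2) wf1(4) meas(3) wv1(4)] Gamma_diff_squares[OF cutoff meas(1) wf(4) meas(2) wf1(4)]
      proof eventually_elim
        case (elim \<xi>)
        show ?case
        proof (cases "\<xi> \<in> V")
          case True
          have m: "nu q \<xi> * (f1 \<xi> - v1 \<xi>) = nu q \<xi> * f \<xi> - nu q \<xi> * v \<xi>"
            using True by (simp add: f1_def v1_def right_diff_distrib)
          have eq: "L \<xi> + nu q \<xi> * v \<xi> - K_op q v1 \<xi> - Gamma_op q v1 v1 \<xi>
            = ?a \<xi> + (- (nu q \<xi> * ?x \<xi>)) + K_op q ?y \<xi> + K_op q ?x \<xi>
             + Gamma_op q ?x (\<lambda>\<xi>. f1 \<xi> + v1 \<xi>) \<xi> + Gamma_op q ?y (\<lambda>\<xi>. f \<xi> + f1 \<xi>) \<xi>"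
            using elim m by linarith
          have "(L \<xi> + nu q \<xi> * v \<xi> - K_op q v1 \<xi> - Gamma_op q v1 v1 \<xi>)\<^sup>2
             \<le> 6 * ((?a \<xi>)\<^sup>2 + (- (nu q \<xi> * ?x \<xi>))\<^sup>2 + (K_op q ?y \<xi>)\<^sup>2 + (K_op q ?x \<xi>)\<^sup>2
             + (Gamma_op q ?x (\<lambda>\<xi>. f1 \<xi> + v1 \<xi>) \<xi>)\<^sup>2 + (Gamma_op q ?y (\<lambda>\<xi>. f \<xi> + f1 \<xi>) \<xi>)\<^sup>2)"
            unfolding eq by (rule power2_sum6)
          from ennreal_leI[OF this] have "ennreal ((L \<xi> + nu q \<xi> * v \<xi> - K_op q v1 \<xi> - Gamma_op q v1 v1 \<xi>)\<^sup>2)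
             \<le> ennreal (6 * ((?a \<xi>)\<^sup>2 + (nu q \<xi> * ?x \<xi>)\<^sup>2 + (K_op q ?y \<xi>)\<^sup>2 + (K_op q ?x \<xi>)\<^sup>2
             + (Gamma_op q ?x (\<lambda>\<xi>. f1 \<xi> + v1 \<xi>) \<xi>)\<^sup>2 + (Gamma_op q ?y (\<lambda>\<xi>. f \<xi> + f1 \<xi>) \<xi>)\<^sup>2))"
            unfolding power2_minus .
          also have "ennreal (6 * (a + b + c + d + e + f)) = 6 * (ennreal a + ennreal b + ennreal c + ennreal d + ennreal e + ennreal f)"
            if "0 \<le> a" "0 \<le> b" "0 \<le> c" "0 \<le> d" "0 \<le> e" "0 \<le> f" for a b c d e f :: real
            using that by (simp add: ennreal_mult ennreal_plus)
          finally show ?thesis using True by simp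
        qed simp
      qed
    qed
    also have "... = 6 * (A + nu_l2 q ?x + l2sq (K_op q ?y) + l2sq (K_op q ?x)
        + l2sq (Gamma_op q ?x (\<lambda>\<xi>. f1 \<xi> + v1 \<xi>)) + l2sq (Gamma_op q ?y (\<lambda>\<xi>. f \<xi> + f1 \<xi>)))"
      unfolding A_def l2sq_def by (simp add: nn_integral_cmult nn_integral_add)
    also have "... \<le> 6 * (A + ennreal (e\<^sup>2) * N + ennreal k * d + ennreal (k * e\<^sup>2) * N
        + ennreal (CG * (8 * B + 2 * S) * e\<^sup>2) * N + ennreal (CG * (4 * B)) * d)"
      by (intro mult_left_mono add_mono x Kx Ky Gx Gy order_refl) simp
    also have "... = 6 * A + ennreal (6 * (e\<^sup>2 + k * e\<^sup>2 + CG * (8 * B + 2 * S) * e\<^sup>2)) * N + ennreal (6 * (k + CG * (4 * B))) * d"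
    proof -
      have 1: "ennreal (6 * (e\<^sup>2 + k * e\<^sup>2 + CG * (8 * B + 2 * S) * e\<^sup>2))
          = 6 * (ennreal (e\<^sup>2) + ennreal (k * e\<^sup>2) + ennreal (CG * (8 * B + 2 * S) * e\<^sup>2))"
        using k CG(1) B(1) S(1) by (subst ennreal_mult) (auto simp: ennreal_plus simp del: ennreal_mult)
      have 2: "ennreal (6 * (k + CG * (4 * B))) = 6 * (ennreal k + ennreal (CG * (4 * B)))"
        using k CG(1) B(1) by (subst ennreal_mult) (auto simp: ennreal_plus)
      show ?thesis unfolding 1 2 by (simp only: distrib_left distrib_right add_ac mult_ac)
    qed
    also have "... \<le> 6 * A + ennreal (C * (1 + B + S) * e\<^sup>2) * N + ennreal (C * (1 + B)) * d"
    proof -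
      have nn: "0 \<le> k * B" "0 \<le> k * S" "0 \<le> CG * B" "0 \<le> CG * S" using k CG(1) B(1) S(1) by simp_all
      have "6 * (1 + k + CG * (8 * B + 2 * S)) \<le> C * (1 + B + S)"
        using nn CG(1) k B(1) S(1) unfolding C_def by (simp add: algebra_simps)
      then have "6 * (1 + k + CG * (8 * B + 2 * S)) * e\<^sup>2 \<le> C * (1 + B + S) * e\<^sup>2" by (rule mult_right_mono) simp
      then have a: "6 * (e\<^sup>2 + k * e\<^sup>2 + CG * (8 * B + 2 * S) * e\<^sup>2) \<le> C * (1 + B + S) * e\<^sup>2" by (simp add: algebra_simps)
      have b: "6 * (k + CG * (4 * B)) \<le> C * (1 + B)"
        using nn CG(1) k B(1) S(1) unfolding C_def by (simp add: algebra_simps)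
      show ?thesis by (intro add_mono mult_right_mono ennreal_leI a b order_refl) auto
    qed
    finally show "l2_on V (\<lambda>\<xi>. L \<xi> + nu q \<xi> * v \<xi> - K_op q (\<lambda>\<eta>. v \<eta> * indicator V \<eta>) \<xi>
         - Gamma_op q (\<lambda>\<eta>. v \<eta> * indicator V \<eta>) (\<lambda>\<eta>. v \<eta> * indicator V \<eta>) \<xi>)
      \<le> 6 * l2_on V ?a
       + ennreal (C * (1 + B + S) * e\<^sup>2) * l2_on V (\<lambda>\<xi>. nu q \<xi>)
       + ennreal (C * (1 + B)) * l2_on (- V) (\<lambda>\<xi>. nu q \<xi> * f \<xi>)"
      unfolding A_def N_def d_def v1_def .
  qed
qed

section \<open>Integration over the phase cell\<close>

text \<open>
  Weak derivatives are only determined on \<open>\<Omega>\<close>; a version that vanishes elsewhere is Borel measurable.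
\<close>

lemma weak_deriv_restrict:
  assumes "open \<Omega>" "weak_deriv \<Omega> \<alpha> f g"
  shows "weak_deriv \<Omega> \<alpha> f (\<lambda>p. indicator \<Omega> p * g p)" "(\<lambda>p. indicator \<Omega> p * g p) \<in> borel_maps"
proof -
  have li: "locally_integrable \<Omega> g" using assms(2) by (simp add: weak_deriv_def)
  show "(\<lambda>p. indicator \<Omega> p * g p) \<in> borel_maps"
    by (rule locally_integrable_measurable[OF assms(1) li])
  have 1: "set_integrable lborel S (\<lambda>p. indicator \<Omega> p * g p) \<longleftrightarrow> set_integrable lborel S g" if "S \<subseteq> \<Omega>" for S
    using that unfolding set_integrable_def by (intro Bochner_Integration.integrable_cong) (auto simp: indicator_def)
  have 2: "(LBINT p:\<Omega>. indicator \<Omega> p * g p * \<phi> p) = (LBINT p:\<Omega>. g p * \<phi> p)" for \<phi>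
    unfolding set_lebesgue_integral_def by (intro Bochner_Integration.integral_cong) (auto simp: indicator_def)
  show "weak_deriv \<Omega> \<alpha> f (\<lambda>p. indicator \<Omega> p * g p)"
    using assms(2) unfolding weak_deriv_def 2 locally_integrable_def using 1 by blast
qed

lemma nn_integral_phase:
  fixes F :: "phase \<Rightarrow> ennreal"
  assumes [measurable]: "F \<in> borel_maps"
  shows "(LBNN p. F p) = (LBNN t. LBNN x. LBNN \<xi>. F (t, x, \<xi>))"
proof -
  have "(LBNN p. F p) = (\<integral>\<^sup>+p. F p \<partial>(lborel \<Otimes>\<^sub>M (lborel :: ((real^3) \<times> (real^3)) measure)))"
    by (simp only: lborel_prod)
  also have "... = (LBNN t. LBNN y. F (t, y))"
    by (rule lborel.nn_integral_fst[symmetric]) (simp add: lborel_prod)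
  also have "... = (\<integral>\<^sup>+t. \<integral>\<^sup>+y. F (t, y) \<partial>((lborel :: (real^3) measure) \<Otimes>\<^sub>M (lborel :: (real^3) measure)) \<partial>lborel)"
    by (simp only: lborel_prod)
  also have "... = (LBNN t. LBNN x. LBNN \<xi>. F (t, x, \<xi>))"
  proof (rule nn_integral_cong)
    fix t
    have "(\<lambda>y. F (t, y)) \<in> borel_maps" by measurable
    then show "(\<integral>\<^sup>+y. F (t, y) \<partial>((lborel :: (real^3) measure) \<Otimes>\<^sub>M (lborel :: (real^3) measure))) = (LBNN x. LBNN \<xi>. F (t, x, \<xi>))"
      by (intro lborel.nn_integral_fst[symmetric]) (simp add: lborel_prod)
  qed
  finally show ?thesis .
qed

lemma AE_phase:
  fixes P :: "phase \<Rightarrow> bool"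
  assumes "AE p in lborel. P p"
  shows "AE t in lborel. AE x in lborel. AE \<xi> in lborel. P (t, x, \<xi>)"
proof -
  have "AE p in lborel \<Otimes>\<^sub>M (lborel :: ((real^3) \<times> (real^3)) measure). P p" using assms by (simp only: lborel_prod)
  from lborel_pair.AE_pair[OF this] have "AE t in lborel. AE y in lborel. P (t, y)" .
  then show ?thesis
  proof eventually_elim
    case (elim t)
    then have "AE y in (lborel :: (real^3) measure) \<Otimes>\<^sub>M (lborel :: (real^3) measure). P (t, y)" by (simp only: lborel_prod)
    from lborel_pair.AE_pair[OF this] show ?case .
  qed
qed

lemma AE_not_endpoints: "AE t in (lborel :: real measure). t \<noteq> a \<and> t \<noteq> b"
proof -
  have "AE t in (lborel :: real measure). t \<noteq> c" for c :: real
    by (rule AE_I[where N="{c}"]) auto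
  then show ?thesis by (intro AE_conjI)
qed

lemma cell_box_mem:
  "(t, x, \<xi>) \<in> cbox_at (cell_centre T) (cell_radius T r) \<longleftrightarrow> 0 \<le> t \<and> t \<le> T \<and> (\<forall>j. \<bar>x $ j\<bar> \<le> pi) \<and> (\<forall>j. \<bar>\<xi> $ j\<bar> \<le> r)"
  "(t, x, \<xi>) \<in> box_at (cell_centre T) (cell_radius T r) \<longleftrightarrow> 0 < t \<and> t < T \<and> (\<forall>j. \<bar>x $ j\<bar> < pi) \<and> (\<forall>j. \<bar>\<xi> $ j\<bar> < r)"
proof -
  have a: "\<bar>t - T / 2\<bar> \<le> T / 2 \<longleftrightarrow> 0 \<le> t \<and> t \<le> T" "\<bar>t - T / 2\<bar> < T / 2 \<longleftrightarrow> 0 < t \<and> t < T" for t :: real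
    by (auto simp: abs_le_iff abs_less_iff field_simps)
  show "(t, x, \<xi>) \<in> cbox_at (cell_centre T) (cell_radius T r) \<longleftrightarrow> 0 \<le> t \<and> t \<le> T \<and> (\<forall>j. \<bar>x $ j\<bar> \<le> pi) \<and> (\<forall>j. \<bar>\<xi> $ j\<bar> \<le> r)"
    unfolding cbox_at_def mem_Collect_eq phase_Basis ball_Un ball_simps image_iff
    using a[of t] by (simp add: inner_axis)
  show "(t, x, \<xi>) \<in> box_at (cell_centre T) (cell_radius T r) \<longleftrightarrow> 0 < t \<and> t < T \<and> (\<forall>j. \<bar>x $ j\<bar> < pi) \<and> (\<forall>j. \<bar>\<xi> $ j\<bar> < r)"
    unfolding box_at_def mem_Collect_eq phase_Basis ball_Un ball_simps image_iff
    using a[of t] by (simp add: inner_axis)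
qed

lemma torus_cube_cbox: "torus_cube = cbox (\<chi> j. - pi) (\<chi> j. pi)"
  by (auto simp: torus_cube_def mem_box_cart)

lemma vel_cube_cbox: "vel_cube R = cbox (\<chi> j. - (R / (2 * sqrt 3))) (\<chi> j. R / (2 * sqrt 3))"
  unfolding vel_cube_def by (auto simp: mem_box_cart abs_le_iff minus_le_iff)

lemma cube_measure:
  "torus_cube \<in> sets borel" "emeasure lborel torus_cube < \<infinity>"
  "vel_cube R \<in> sets borel" "emeasure lborel (vel_cube R) < \<infinity>" "compact (vel_cube R)"
  unfolding torus_cube_cbox vel_cube_cbox using emeasure_lborel_cbox_finite by (auto simp: less_top)

section \<open>Initial, boundary and penalty error\<close>

lemma error_t_sq_bound:
  assumes "e \<ge> 0" "\<And>x \<xi>. x \<in> torus_cube \<Longrightarrow> \<xi> \<in> vel_cube R \<Longrightarrow> \<bar>v (0, x, \<xi>) - u (0, x, \<xi>)\<bar> \<le> e"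
  shows "error_t_sq R u v \<le> ennreal (e\<^sup>2) * (emeasure lborel (vel_cube R) * emeasure lborel torus_cube)"
proof -
  note [measurable] = cube_measure(1,3)
  have "error_t_sq R u v \<le> (LBNN x. (LBNN \<xi>. ennreal (e\<^sup>2) * indicator (vel_cube R) \<xi>) * indicator torus_cube x)"
    unfolding error_t_sq_def
  proof (rule nn_integral_mono)
    fix x
    show "l2_on (vel_cube R) (\<lambda>\<xi>. residual_t u v x \<xi>) * indicator torus_cube x
      \<le> (LBNN \<xi>. ennreal (e\<^sup>2) * indicator (vel_cube R) \<xi>) * indicator torus_cube x"
    proof (cases "x \<in> torus_cube")
      case True
      have "l2_on (vel_cube R) (\<lambda>\<xi>. residual_t u v x \<xi>)
        \<le> (LBNN \<xi>. ennreal (e\<^sup>2) * indicator (vel_cube R) \<xi>)"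
      proof (rule nn_integral_mono)
        fix \<xi>
        show "ennreal ((residual_t u v x \<xi>)\<^sup>2) * indicator (vel_cube R) \<xi> \<le> ennreal (e\<^sup>2) * indicator (vel_cube R) \<xi>"
          using assms(2)[OF True, of \<xi>] assms(1)
          by (cases "\<xi> \<in> vel_cube R") (auto simp: residual_t_def intro!: ennreal_leI simp flip: abs_le_square_iff)
      qed
      then show ?thesis using True by simp
    qed simp
  qed
  also have "... = ennreal (e\<^sup>2) * (emeasure lborel (vel_cube R) * emeasure lborel torus_cube)"
    using cube_measure by (simp add: nn_integral_cmult_indicator) (simp add: mult.assoc)
  finally show ?thesis .
qed

lemma set_coord_shift: "set_coord x j pi = set_coord x j (- pi) + axis j (2 * pi)"
  by (simp add: vec_eq_iff set_coord_def axis_def)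

lemma set_coord_torus: "x \<in> torus_cube \<Longrightarrow> s \<in> {- pi..pi} \<Longrightarrow> set_coord x j s \<in> torus_cube"
  by (auto simp: torus_cube_def set_coord_def)

lemma face_point_torus:
  assumes "s \<in> {- pi, pi}" "y \<in> {- pi..pi} \<times> {- pi..pi}"
  shows "face_point j s y \<in> torus_cube"
proof -
  have pi: "s \<in> {- pi..pi}" using assms(1) pi_gt_zero by auto
  obtain a b where y: "y = (a, b)" "a \<in> {- pi..pi}" "b \<in> {- pi..pi}" using assms(2) by auto
  have "\<forall>i. (vector [c1, c2, c3] :: real^3) $ i \<in> {- pi..pi}"
    if "c1 \<in> {- pi..pi}" "c2 \<in> {- pi..pi}" "c3 \<in> {- pi..pi}" for c1 c2 c3
    using that unfolding forall_3 by simp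
  then show ?thesis unfolding torus_cube_def face_point_def y(1) mem_Collect_eq prod.case
    using pi y(2,3) by presburger
qed

text \<open>
  Opposite faces carry the same values of \<open>u\<close>, so the jump of \<open>v\<close> is at most \<open>2 e\<close>.  The boundary residual
  is itself a sum of squares and at most \<open>12 e\<^sup>2\<close>; its square is at most \<open>144 e\<^sup>4\<close>.
\<close>

lemma residual_b_periodic_bound:
  assumes per: "x_periodic u" and e: "0 \<le> e" "e \<le> 1"
    and c: "\<And>x. x \<in> torus_cube \<Longrightarrow> \<bar>v (t, x, \<xi>) - u (t, x, \<xi>)\<bar> \<le> e" and x: "x \<in> torus_cube"
  shows "(residual_b v (t, x, \<xi>))\<^sup>2 \<le> 144 * e"
proof -
  have "(v (t, set_coord x j pi, \<xi>) - v (t, set_coord x j (- pi), \<xi>))\<^sup>2 \<le> (2 * e)\<^sup>2" for j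
  proof -
    have "u (t, set_coord x j pi, \<xi>) = u (t, set_coord x j (- pi), \<xi>)"
      using per unfolding set_coord_shift x_periodic_def by blast
    moreover have "\<bar>v (t, set_coord x j pi, \<xi>) - u (t, set_coord x j pi, \<xi>)\<bar> \<le> e"
      "\<bar>v (t, set_coord x j (- pi), \<xi>) - u (t, set_coord x j (- pi), \<xi>)\<bar> \<le> e"
      by (rule c, rule set_coord_torus[OF x], simp)+
    ultimately have "\<bar>v (t, set_coord x j pi, \<xi>) - v (t, set_coord x j (- pi), \<xi>)\<bar> \<le> \<bar>2 * e\<bar>" by linarith
    then show ?thesis by (simp only: abs_le_square_iff)
  qed
  then have "residual_b v (t, x, \<xi>) \<le> (\<Sum>j\<in>(UNIV :: 3 set). (2 * e)\<^sup>2)"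
    unfolding residual_b_def prod.case by (rule sum_mono)
  also have "... = 12 * e\<^sup>2" by (simp add: power_mult_distrib)
  finally have "(residual_b v (t, x, \<xi>))\<^sup>2 \<le> (12 * e\<^sup>2)\<^sup>2"
    by (rule power_mono) (simp add: residual_b_def sum_nonneg)
  also have "... = 144 * e ^ 4" by (simp add: power_mult_distrib)
  also have "... \<le> 144 * e" using power_decreasing[of 1 4 e] e by simp
  finally show ?thesis .
qed

lemma error_b_sq_bound:
  assumes T: "T > 0" and b: "\<And>t x \<xi>. t \<in> {0..T} \<Longrightarrow> x \<in> torus_cube \<Longrightarrow> \<xi> \<in> vel_cube R \<Longrightarrow> (residual_b v (t, x, \<xi>))\<^sup>2 \<le> c"
    and c: "c \<ge> 0"
  shows "error_b_sq T R v \<le> ennreal c * (6 * emeasure lborel (vel_cube R) * ennreal ((2 * pi)\<^sup>2) * ennreal T)"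
proof -
  note [measurable] = cube_measure(1,3)
  let ?I = "\<lambda>t x. LBNN \<xi>. ennreal ((residual_b v (t, x, \<xi>))\<^sup>2) * indicator (vel_cube R) \<xi>"
  let ?V = "emeasure lborel (vel_cube R)"
  have I: "?I t x \<le> ennreal c * ?V" if "t \<in> {0..T}" "x \<in> torus_cube" for t x
  proof -
    have "?I t x \<le> (LBNN \<xi>. ennreal c * indicator (vel_cube R) \<xi>)"
    proof (rule nn_integral_mono)
      fix \<xi> show "ennreal ((residual_b v (t, x, \<xi>))\<^sup>2) * indicator (vel_cube R) \<xi> \<le> ennreal c * indicator (vel_cube R) \<xi>"
        using b[OF that, of \<xi>] by (cases "\<xi> \<in> vel_cube R") (auto intro: ennreal_leI)
    qed
    then show ?thesis by (simp add: nn_integral_cmult_indicator)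
  qed
  have sq: "emeasure lborel ({- pi..pi} \<times> {- pi..pi}) = ennreal ((2 * pi)\<^sup>2)"
  proof -
    have "emeasure lborel ({- pi..pi} \<times> {- pi..pi}) = emeasure (lborel \<Otimes>\<^sub>M lborel) ({- pi..pi} \<times> {- pi..pi})"
      by (simp only: lborel_prod)
    also have "... = emeasure lborel {- pi..pi} * emeasure lborel {- pi..pi}"
      by (rule lborel.emeasure_pair_measure_Times) auto
    finally show ?thesis by (simp add: ennreal_mult[symmetric] power2_eq_square)
  qed
  have bI: "boundary_integral (?I t) \<le> ennreal c * (6 * ?V * ennreal ((2 * pi)\<^sup>2))" if t: "t \<in> {0..T}" for t
  proof -
    have "(LBNN y. ?I t (face_point j s y) * indicator ({- pi..pi} \<times> {- pi..pi}) y) \<le> ennreal c * ?V * ennreal ((2 * pi)\<^sup>2)"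
      if s: "s \<in> {- pi, pi}" for j s
    proof -
      have "(LBNN y. ?I t (face_point j s y) * indicator ({- pi..pi} \<times> {- pi..pi}) y)
        \<le> (LBNN y. ennreal c * ?V * indicator ({- pi..pi} \<times> {- pi..pi}) y)"
      proof (rule nn_integral_mono)
        fix y show "?I t (face_point j s y) * indicator ({- pi..pi} \<times> {- pi..pi}) y \<le> ennreal c * ?V * indicator ({- pi..pi} \<times> {- pi..pi}) y"
          using I[OF t face_point_torus[OF s, of y]] by (cases "y \<in> {- pi..pi} \<times> {- pi..pi}") simp_all
      qed
      also have "... = ennreal c * ?V * ennreal ((2 * pi)\<^sup>2)"
        unfolding sq[symmetric] by (rule nn_integral_cmult_indicator) (simp add: borel_closed closed_Times)
      finally show ?thesis .
    qed
    then have "boundary_integral (?I t) \<le> (\<Sum>j\<in>(UNIV :: 3 set). \<Sum>s\<in>{- pi, pi}. ennreal c * ?V * ennreal ((2 * pi)\<^sup>2))"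
      unfolding boundary_integral_def by (intro sum_mono)
    also have "... = ennreal c * (6 * ?V * ennreal ((2 * pi)\<^sup>2))"
      by (simp add: mult_ac)
    finally show ?thesis .
  qed
  have "error_b_sq T R v \<le> (LBNN t. ennreal c * (6 * ?V * ennreal ((2 * pi)\<^sup>2)) * indicator {0..T} t)"
    unfolding error_b_sq_def
  proof (rule nn_integral_mono)
    fix t show "boundary_integral (?I t) * indicator {0..T} t \<le> ennreal c * (6 * ?V * ennreal ((2 * pi)\<^sup>2)) * indicator {0..T} t"
      using bI[of t] by (cases "t \<in> {0..T}") simp_all
  qed
  also have "... = ennreal c * (6 * ?V * ennreal ((2 * pi)\<^sup>2) * ennreal T)"
    using T by (subst nn_integral_cmult_indicator) (auto simp: mult.assoc)
  finally show ?thesis .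
qed

lemma error_p_sq_finite:
  assumes "T > 0"
  shows "error_p_sq \<gamma> T R (net L) < \<infinity>"
proof -
  let ?\<Omega> = "interior (torus_cube \<times> vel_cube R)"
  note [measurable] = cube_measure(1,3)
  have "bounded (torus_cube \<times> vel_cube R)" unfolding torus_cube_cbox vel_cube_cbox by (intro bounded_Times bounded_cbox)
  then have "bounded ?\<Omega>" using interior_subset bounded_subset by blast
  then have "emeasure lborel ?\<Omega> < \<infinity>" using emeasure_bounded_finite by (simp add: less_top)
  from net_sobolev_bound[OF this, of 2 L] obtain C where
    C: "\<And>t. sobolev_norm_sq 2 ?\<Omega> ?\<Omega> (\<lambda>y. net L (t, y)) \<le> ennreal C" by (auto simp: borel_open)
  have "(LBNN t. sobolev_norm_sq 2 ?\<Omega> ?\<Omega> (\<lambda>(x, \<xi>). net L (t, x, \<xi>)) * indicator {0..T} t)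
    \<le> (LBNN t. ennreal C * indicator {0..T} t)"
  proof (intro nn_integral_mono mult_right_mono)
    fix t
    have "(\<lambda>(x, \<xi>). net L (t, x, \<xi>)) = (\<lambda>y. net L (t, y))" by (simp add: fun_eq_iff)
    then show "sobolev_norm_sq 2 ?\<Omega> ?\<Omega> (\<lambda>(x, \<xi>). net L (t, x, \<xi>)) \<le> ennreal C" using C by simp
  qed simp
  also have "... < \<infinity>" using assms by (simp add: nn_integral_cmult_indicator ennreal_mult_less_top)
  finally show ?thesis unfolding error_p_sq_def by (simp add: ennreal_mult_less_top)
qed

section \<open>Truncation of the velocity and the transport term\<close>

lemma continuous_slices_measurable:
  fixes u :: "phase \<Rightarrow> real"
  assumes "continuous_on ({0..T} \<times> UNIV \<times> UNIV) u"
  shows "t \<in> {0..T} \<Longrightarrow> (\<lambda>\<xi>. u (t, x, \<xi>)) \<in> borel_maps"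
    "(\<lambda>p. indicator ({0..T} \<times> UNIV \<times> UNIV) p * u p) \<in> borel_maps"
proof -
  assume t: "t \<in> {0..T}"
  have "continuous_on UNIV (\<lambda>\<xi>. u (t, x, \<xi>))"
    by (rule continuous_on_compose2[OF assms]) (use t in \<open>auto intro!: continuous_intros\<close>)
  then show "(\<lambda>\<xi>. u (t, x, \<xi>)) \<in> borel_maps" by (rule borel_measurable_continuous_onI)
next
  have "(\<lambda>p. indicator ({0..T} \<times> UNIV \<times> UNIV) p *\<^sub>R u p) \<in> borel_maps"
    by (rule borel_measurable_continuous_on_indicator[OF _ assms]) (intro borel_closed closed_Times closed_UNIV closed_atLeastAtMost)
  then show "(\<lambda>p. indicator ({0..T} \<times> UNIV \<times> UNIV) p * u p) \<in> borel_maps" by simp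
qed

text \<open>
  The Sobolev bound applies to \<open>(1 + \<bar>\<xi>\<bar>)\<^sup>\<gamma> u\<close>, and \<open>\<nu>\<close> grows no faster than this weight.
\<close>

lemma weighted_solution_bound:
  assumes cutoff: "cutoff_kernel q \<gamma>" and T: "T > 0" and uc: "continuous_on ({0..T} \<times> UNIV \<times> UNIV) u"
    and fin: "sobolev_norm_sq 4 (phase_domain T) (phase_cell T) (\<lambda>(t, x, \<xi>). (1 + norm \<xi>) powr \<gamma> * u (t, x, \<xi>)) < \<infinity>"
  shows "\<exists>B\<ge>0. \<forall>t\<in>{0..T}. \<forall>x\<in>torus_cube. nu_l2 q (\<lambda>\<xi>. u (t, x, \<xi>)) \<le> ennreal B"
proof -
  obtain \<nu>1 where \<nu>1: "\<nu>1 > 0" "\<And>\<xi>. nu q \<xi> \<le> \<nu>1 * (1 + norm \<xi>) powr \<gamma>" using nu_facts(2)[OF cutoff] by blast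
  have "continuous_on ({0..T} \<times> UNIV \<times> UNIV) (\<lambda>p :: phase. (1 + norm (snd (snd p))) powr \<gamma> * u p)"
    by (intro continuous_on_mult uc continuous_on_powr continuous_intros) (smt (verit) norm_ge_zero)
  moreover have "(\<lambda>p :: phase. (1 + norm (snd (snd p))) powr \<gamma> * u p) = (\<lambda>(t, x, \<xi>). (1 + norm \<xi>) powr \<gamma> * u (t, x, \<xi>))"
    by (simp add: fun_eq_iff)
  ultimately have c: "continuous_on ({0..T} \<times> UNIV \<times> UNIV) (\<lambda>(t, x, \<xi>). (1 + norm \<xi>) powr \<gamma> * u (t, x, \<xi>))" by metis
  from velocity_l2_sup_bound[OF T c fin] obtain B where B: "B \<ge> 0"
    "\<And>t x. t \<in> {0..T} \<Longrightarrow> x \<in> torus_cube \<Longrightarrow> l2sq (\<lambda>\<xi>. (1 + norm \<xi>) powr \<gamma> * u (t, x, \<xi>)) \<le> ennreal B"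
    unfolding l2sq_def prod.case by blast
  have "nu_l2 q (\<lambda>\<xi>. u (t, x, \<xi>)) \<le> ennreal (\<nu>1\<^sup>2 * B)" if t: "t \<in> {0..T}" and x: "x \<in> torus_cube" for t x
  proof -
    note [measurable] = continuous_slices_measurable(1)[OF uc t, of x]
    have "nu_l2 q (\<lambda>\<xi>. u (t, x, \<xi>)) \<le> l2sq (\<lambda>\<xi>. \<nu>1 * ((1 + norm \<xi>) powr \<gamma> * u (t, x, \<xi>)))"
    proof (rule l2sq_mono)
      fix \<xi>
      have "\<bar>nu q \<xi>\<bar> * \<bar>u (t, x, \<xi>)\<bar> \<le> (\<nu>1 * (1 + norm \<xi>) powr \<gamma>) * \<bar>u (t, x, \<xi>)\<bar>"
        using \<nu>1(2)[of \<xi>] nu_facts(3)[OF cutoff, of \<xi>] by (intro mult_right_mono) auto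
      then show "\<bar>nu q \<xi> * u (t, x, \<xi>)\<bar> \<le> \<bar>\<nu>1 * ((1 + norm \<xi>) powr \<gamma> * u (t, x, \<xi>))\<bar>"
        using \<nu>1(1) by (simp add: abs_mult mult.assoc)
    qed
    also have "... = ennreal (\<nu>1\<^sup>2) * l2sq (\<lambda>\<xi>. (1 + norm \<xi>) powr \<gamma> * u (t, x, \<xi>))" by (rule l2sq_cmult) measurable
    also have "... \<le> ennreal (\<nu>1\<^sup>2) * ennreal B" by (intro mult_left_mono B(2) t x) simp
    finally show ?thesis using B(1) by (simp add: ennreal_mult)
  qed
  then show ?thesis using B(1) by (intro exI[of _ "\<nu>1\<^sup>2 * B"]) auto
qed

text \<open>
  The integral over the whole velocity space is finite, and the tails decrease to the empty set.
\<close>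

lemma velocity_tail_small:
  fixes u :: "phase \<Rightarrow> real" and n :: "real^3 \<Rightarrow> real"
  assumes T: "T > 0" and uc: "continuous_on ({0..T} \<times> UNIV \<times> UNIV) u" and n[measurable]: "n \<in> borel_maps"
    and B: "\<And>t x. t \<in> {0..T} \<Longrightarrow> x \<in> torus_cube \<Longrightarrow> l2sq (\<lambda>\<xi>. n \<xi> * u (t, x, \<xi>)) \<le> ennreal B" and \<delta>: "\<delta> > (0::real)"
  shows "\<exists>R0>0. \<forall>R\<ge>R0. l2_on ({0..T} \<times> torus_cube \<times> - vel_cube R) (\<lambda>p. n (snd (snd p)) * u p) \<le> ennreal \<delta>"
proof -
  note [measurable] = cube_measure(1,3)
  define u' where "u' p = indicator ({0..T} \<times> UNIV \<times> UNIV) p * u p" for p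
  have [measurable]: "u' \<in> borel_maps" unfolding u'_def[abs_def] by (rule continuous_slices_measurable(2)[OF uc])
  have ms[measurable]: "{0..T} \<times> torus_cube \<times> W \<in> sets borel" if "W \<in> sets borel" for W :: "(real^3) set"
    using that cube_measure(1) by (intro borel_Times) auto
  define F where "F R p = ennreal ((n (snd (snd p)) * u' p)\<^sup>2) * indicator ({0..T} \<times> torus_cube \<times> - vel_cube R) p" for R and p :: phase
  have Fu: "F R p = ennreal ((n (snd (snd p)) * u p)\<^sup>2) * indicator ({0..T} \<times> torus_cube \<times> - vel_cube R) p" for R p
    unfolding F_def u'_def by (cases p) (auto simp: indicator_def)
  have [measurable]: "(\<lambda>p :: phase. n (snd (snd p))) \<in> borel_maps"
    by (rule measurable_compose[OF _ n], rule borel_measurable_continuous_onI, intro continuous_intros)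
  have [measurable]: "F R \<in> borel_maps" for R
  proof -
    have [measurable]: "{0..T} \<times> torus_cube \<times> - vel_cube R \<in> sets borel" by (rule ms) simp
    show ?thesis unfolding F_def[abs_def] by measurable
  qed
  have mono: "F R p \<le> F R' p" if "R' \<le> R" for R R' p
  proof -
    have "vel_cube R' \<subseteq> vel_cube R"
      using divide_right_mono[OF that, of "2 * sqrt 3"] unfolding vel_cube_def by (auto intro: order_trans)
    then have "{0..T} \<times> torus_cube \<times> - vel_cube R \<subseteq> {0..T} \<times> torus_cube \<times> - vel_cube R'" by blast
    then show ?thesis unfolding F_def by (intro mult_left_mono) (auto simp: indicator_def)
  qed
  have fin: "(LBNN p. F R p) < \<infinity>" for R
  proof -
    have "(LBNN p. F R p) = (LBNN t. LBNN x. LBNN \<xi>. F R (t, x, \<xi>))"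
      by (rule nn_integral_phase) measurable
    also have "... \<le> (LBNN t. LBNN x. ennreal B * indicator torus_cube x * indicator {0..T} t)"
    proof (intro nn_integral_mono)
      fix t :: real and x :: "real^3"
      show "(LBNN \<xi>. F R (t, x, \<xi>)) \<le> ennreal B * indicator torus_cube x * indicator {0..T} t"
      proof (cases "t \<in> {0..T} \<and> x \<in> torus_cube")
        case True
        have "(LBNN \<xi>. F R (t, x, \<xi>)) \<le> l2sq (\<lambda>\<xi>. n \<xi> * u (t, x, \<xi>))"
          unfolding l2sq_def Fu by (intro nn_integral_mono) (auto simp: indicator_def)
        also have "... \<le> ennreal B" using B True by blast
        finally show ?thesis using True by simp
      next
        case False
        then have "F R (t, x, \<xi>) = 0" for \<xi> by (auto simp: F_def indicator_def)
        then show ?thesis by simp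
      qed
    qed
    also have "... = (LBNN t. ennreal B * emeasure lborel torus_cube * indicator {0..T} t)"
      by (simp add: nn_integral_multc nn_integral_cmult_indicator)
    also have "... < \<infinity>" using T cube_measure(2) by (simp add: nn_integral_cmult_indicator ennreal_mult_less_top)
    finally show ?thesis .
  qed
  have "(LBNN p. (INF i. F (real i) p)) = (INF i. LBNN p. F (real i) p)"
  proof (rule nn_integral_monotone_convergence_INF_decseq)
    show "decseq (\<lambda>i. F (real i))"
    proof (rule antimonoI, rule le_funI)
      fix i j :: nat and p assume "i \<le> j"
      then show "F (real j) p \<le> F (real i) p" by (intro mono) simp
    qed
  qed (use fin in auto)
  moreover have "(INF i. F (real i) p) = 0" for p
  proof -
    obtain t x \<xi> where p: "p = (t, x, \<xi>)" by (cases p) auto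
    obtain i :: nat where i: "real i \<ge> norm \<xi> * (2 * sqrt 3)" using real_arch_simple by blast
    have "norm \<xi> \<le> real i / (2 * sqrt 3)" using i by (simp add: le_divide_eq)
    then have "\<xi> \<in> vel_cube (real i)"
      unfolding vel_cube_def mem_Collect_eq using component_le_norm_cart[of \<xi>] by (meson order_trans)
    then have "F (real i) p = 0" by (simp add: F_def p)
    then have "(INF i. F (real i) p) \<le> 0" by (metis INF_lower UNIV_I)
    then show ?thesis by simp
  qed
  ultimately have "(INF i. LBNN p. F (real i) p) < ennreal \<delta>" using \<delta> by simp
  then obtain i where i: "(LBNN p. F (real i) p) < ennreal \<delta>" unfolding INF_less_iff by blast
  have "(LBNN p. F R p) \<le> ennreal \<delta>" if "R \<ge> real i + 1" for R
    using nn_integral_mono[of lborel "F R" "F (real i)"] mono[of "real i" R] that i by (meson add_increasing2 less_imp_le order_trans le_add_same_cancel1 zero_le_one)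
  then show ?thesis unfolding Fu by (intro exI[of _ "real i + 1"]) auto
qed

lemma collision_rhs_bound:
  assumes cutoff: "cutoff_kernel q \<gamma>" and B: "B \<ge> 0"
  shows "\<exists>H. \<forall>f. f \<in> borel_maps \<longrightarrow> nu_l2 q f \<le> ennreal B \<longrightarrow>
    l2sq (\<lambda>\<xi>. collision_rhs q f \<xi>) \<le> ennreal H"
proof -
  note [measurable] = nu_facts(1)[OF cutoff]
  obtain k where k: "k \<ge> 0" "\<And>h. h \<in> borel_maps \<Longrightarrow> nu_l2 q h < \<infinity> \<Longrightarrow>
      K_op q h \<in> borel_maps \<and> l2sq (K_op q h) \<le> ennreal k * nu_l2 q h"
    using K_op_weighted_bound[OF cutoff] by blast
  obtain CG where CG: "CG \<ge> 0" "\<And>f g. f \<in> borel_maps \<Longrightarrow> g \<in> borel_maps \<Longrightarrow>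
     nu_l2 q f < \<infinity> \<Longrightarrow> nu_l2 q g < \<infinity> \<Longrightarrow>
     Gamma_op q f g \<in> borel_maps \<and>
     l2sq (Gamma_op q f g) \<le> ennreal CG * (nu_l2 q f * nu_l2 q g)"
    using Gamma_op_bound[OF cutoff] by blast
  define H where "H = enn2real (2 * (2 * (ennreal k * ennreal B) + 2 * (ennreal CG * (ennreal B * ennreal B))) + 2 * ennreal B)"
  have "l2sq (\<lambda>\<xi>. collision_rhs q f \<xi>) \<le> ennreal H"
    if f[measurable]: "f \<in> borel_maps" and fB: "nu_l2 q f \<le> ennreal B" for f
  proof -
    have fin: "nu_l2 q f < \<infinity>" using order.strict_trans1[OF fB] by simp
    have [measurable]: "K_op q f \<in> borel_maps" "Gamma_op q f f \<in> borel_maps"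
      using k(2)[OF f fin] CG(2)[OF f f fin fin] by blast+
    have kB: "l2sq (K_op q f) \<le> ennreal k * ennreal B"
      using k(2)[OF f fin] mult_left_mono[OF fB, of "ennreal k"] by (meson order_trans zero_le)
    have "l2sq (Gamma_op q f f) \<le> ennreal CG * (nu_l2 q f * nu_l2 q f)"
      using CG(2)[OF f f fin fin] by blast
    also have "... \<le> ennreal CG * (ennreal B * ennreal B)" by (intro mult_left_mono mult_mono fB) simp_all
    finally have g: "l2sq (Gamma_op q f f) \<le> ennreal CG * (ennreal B * ennreal B)" .
    have "l2sq (\<lambda>\<xi>. (K_op q f \<xi> + Gamma_op q f f \<xi>) - nu q \<xi> * f \<xi>) \<le> 2 * l2sq (\<lambda>\<xi>. K_op q f \<xi> + Gamma_op q f f \<xi>) + 2 * nu_l2 q f"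
      by (rule l2sq_diff) measurable
    also have "... \<le> 2 * (2 * l2sq (K_op q f) + 2 * l2sq (Gamma_op q f f)) + 2 * nu_l2 q f"
      by (intro add_mono mult_left_mono l2sq_add order_refl) simp_all
    also have "... \<le> 2 * (2 * (ennreal k * ennreal B) + 2 * (ennreal CG * (ennreal B * ennreal B))) + 2 * ennreal B"
      by (intro add_mono mult_left_mono kB g fB) simp_all
    also have "... = ennreal H" unfolding H_def by (subst ennreal_enn2real) (simp_all add: ennreal_mult_eq_top_iff ennreal_mult_less_top)
    finally show ?thesis .
  qed
  then show ?thesis by blast
qed

text \<open>
  By the equation, the transport derivative equals the collision terms, and these are bounded in
  \<open>L\<^sup>2\<close> of the velocity uniformly in \<open>t\<close> and \<open>x\<close>.
\<close>

lemma transport_term_finite: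
  fixes u :: "phase \<Rightarrow> real"
  assumes cutoff: "cutoff_kernel q \<gamma>" and T: "T > 0" and uc: "continuous_on ({0..T} \<times> UNIV \<times> UNIV) u"
    and B: "B \<ge> 0" "\<And>t x. t \<in> {0..T} \<Longrightarrow> x \<in> torus_cube \<Longrightarrow> nu_l2 q (\<lambda>\<xi>. u (t, x, \<xi>)) \<le> ennreal B"
    and g[measurable]: "g \<in> borel_maps"
    and eq: "AE t in lborel. AE x in lborel. AE \<xi> in lborel. (t, x, \<xi>) \<in> phase_cell T \<longrightarrow>
      g (t, x, \<xi>) = collision_rhs q (\<lambda>\<eta>. u (t, x, \<eta>)) \<xi>"
  shows "l2sq (\<lambda>z. indicator (box_at (cell_centre T) (cell_radius T r)) z * g z) < \<infinity>"
proof -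
  note [measurable] = cube_measure(1)
  define D where "D = box_at (cell_centre T) (cell_radius T r)"
  have [measurable]: "D \<in> sets borel" unfolding D_def by (rule box_at_facts)
  obtain H where H: "\<And>f. f \<in> borel_maps \<Longrightarrow> nu_l2 q f \<le> ennreal B \<Longrightarrow>
    l2sq (\<lambda>\<xi>. collision_rhs q f \<xi>) \<le> ennreal H"
    using collision_rhs_bound[OF cutoff B(1)] by blast
  have D: "t \<in> {0..T} \<and> x \<in> torus_cube \<and> (t, x, \<xi>) \<in> phase_cell T" if "(t, x, \<xi>) \<in> D" for t x \<xi>
    using that unfolding D_def cell_box_mem phase_cell_def torus_cube_def by (auto simp: abs_less_iff less_imp_le minus_less_iff intro: less_imp_le)
  have "l2sq (\<lambda>z. indicator D z * g z) = (LBNN t. LBNN x. LBNN \<xi>. ennreal ((indicator D (t, x, \<xi>) * g (t, x, \<xi>))\<^sup>2))"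
    unfolding l2sq_def by (rule nn_integral_phase) measurable
  also have "... \<le> (LBNN t. LBNN x. ennreal H * indicator torus_cube x * indicator {0..T} t)"
  proof (rule nn_integral_mono_AE, use eq in eventually_elim)
    case (elim t)
    show ?case
    proof (rule nn_integral_mono_AE, use elim in eventually_elim)
      case (elim x)
      show ?case
      proof (cases "t \<in> {0..T} \<and> x \<in> torus_cube")
        case True
        let ?f = "\<lambda>\<eta>. u (t, x, \<eta>)"
        have "(LBNN \<xi>. ennreal ((indicator D (t, x, \<xi>) * g (t, x, \<xi>))\<^sup>2))
          \<le> l2sq (\<lambda>\<xi>. collision_rhs q ?f \<xi>)"
          unfolding l2sq_def
        proof (rule nn_integral_mono_AE, use elim in eventually_elim)
          case (elim \<xi>)
          then show ?case using D[of t x \<xi>] by (cases "(t, x, \<xi>) \<in> D") auto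
        qed
        also have "... \<le> ennreal H"
          using True by (intro H B(2) continuous_slices_measurable(1)[OF uc]) auto
        finally show ?thesis using True by simp
      next
        case False
        then have "indicat_real D (t, x, \<xi>) = 0" for \<xi> using D[of t x \<xi>] by (auto simp: indicator_def)
        then show ?thesis by simp
      qed
    qed
  qed
  also have "... = (LBNN t. ennreal H * emeasure lborel torus_cube * indicator {0..T} t)"
    by (simp add: nn_integral_multc nn_integral_cmult_indicator)
  also have "... < \<infinity>" using T cube_measure(2) by (simp add: nn_integral_cmult_indicator ennreal_mult_less_top)
  finally show ?thesis unfolding D_def .
qed

section \<open>Choice of the radius, the network and the weight\<close>

text \<open>
  The stability estimate is integrated over \<open>t\<close> and \<open>x\<close>.  The equation holds only almost everywhere, which
  Fubini's theorem turns into almost every \<open>\<xi>\<close> for almost every \<open>(t, x)\<close>; the end points of the time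
  interval are a null set.
\<close>

lemma interior_error_bound:
  fixes u :: "phase \<Rightarrow> real" and L :: "phase units"
  assumes cutoff: "cutoff_kernel q \<gamma>" and uc: "continuous_on ({0..T} \<times> UNIV \<times> UNIV) u"
    and C: "collision_stable q C"
    and B: "B \<ge> 0" "\<And>t x. t \<in> {0..T} \<Longrightarrow> x \<in> torus_cube \<Longrightarrow> nu_l2 q (\<lambda>\<xi>. u (t, x, \<xi>)) \<le> ennreal B"
    and g[measurable]: "g \<in> borel_maps"
    and eq: "AE t in lborel. AE x in lborel. AE \<xi> in lborel. (t, x, \<xi>) \<in> phase_cell T \<longrightarrow>
      g (t, x, \<xi>) = collision_rhs q (\<lambda>\<eta>. u (t, x, \<eta>)) \<xi>"
    and S: "S \<ge> 0" "nu_l2 q (indicator (vel_cube R)) \<le> ennreal S"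
    and e: "0 \<le> e" "e \<le> 1" and close: "\<And>p. p \<in> {0..T} \<times> torus_cube \<times> vel_cube R \<Longrightarrow> \<bar>net L p - u p\<bar> \<le> e"
  shows "error_i_sq q T R (net L)
    \<le> 6 * l2_on ({0..T} \<times> torus_cube \<times> vel_cube R) (\<lambda>p. dnet L [e_t] p + (\<Sum>j\<in>UNIV. (p \<bullet> e_v j) * dnet L [e_x j] p) - g p)
      + ennreal (C * (1 + B + S) * e\<^sup>2) * l2_on ({0..T} \<times> torus_cube \<times> vel_cube R) (\<lambda>p. nu q (snd (snd p)))
      + ennreal (C * (1 + B)) * l2_on ({0..T} \<times> torus_cube \<times> - vel_cube R) (\<lambda>p. nu q (snd (snd p)) * u p)"
proof -
  note [measurable] = cube_measure(1,3) nu_facts(1)[OF cutoff]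
  let ?V = "vel_cube R"
  let ?D = "{0..T} \<times> torus_cube \<times> ?V" and ?E = "{0..T} \<times> torus_cube \<times> - ?V"
  define Lv where "Lv p = dnet L [e_t] p + (\<Sum>j\<in>UNIV. (p \<bullet> e_v j) * dnet L [e_x j] p)" for p
  \<comment> \<open>Nothing is known about \<open>u\<close> at times outside \<open>[0, T]\<close>; the truncation makes it measurable.\<close>
  define u' where "u' p = indicator ({0..T} \<times> UNIV \<times> UNIV) p * u p" for p
  have [measurable]: "u' \<in> borel_maps" unfolding u'_def[abs_def] by (rule continuous_slices_measurable(2)[OF uc])
  have dc: "continuous_on UNIV (dnet L bs)" for bs by (rule smooth_imp_continuous[OF smooth_dnet])
  have Lvc: "continuous_on UNIV Lv" unfolding Lv_def[abs_def] by (intro continuous_intros dc)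
  then have [measurable]: "Lv \<in> borel_maps" by (rule borel_measurable_continuous_onI)
  have slice: "(\<lambda>\<xi>. w (t, x, \<xi>)) \<in> borel_maps" if "continuous_on UNIV w" for w :: "phase \<Rightarrow> real" and t x
    by (rule borel_measurable_continuous_onI, rule continuous_on_compose2[OF that]) (auto intro!: continuous_intros)
  have [measurable]: "?D \<in> sets borel" "?E \<in> sets borel" by (intro borel_Times; simp)+
  have [measurable]: "(\<lambda>p :: phase. nu q (snd (snd p))) \<in> borel_maps"
    by (rule measurable_compose[OF _ nu_facts(1)[OF cutoff]], rule borel_measurable_continuous_onI, intro continuous_intros)
  define F1 where "F1 p = ennreal ((Lv p - g p)\<^sup>2) * indicator ?D p" for p
  define F2 where "F2 p = ennreal ((nu q (snd (snd p)))\<^sup>2) * indicator ?D p" for p :: phase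
  define F3 where "F3 p = ennreal ((nu q (snd (snd p)) * u' p)\<^sup>2) * indicator ?E p" for p :: phase
  have [measurable]: "F1 \<in> borel_maps" "F2 \<in> borel_maps" "F3 \<in> borel_maps"
    unfolding F1_def[abs_def] F2_def[abs_def] F3_def[abs_def] by measurable
  have F3u: "F3 p = ennreal ((nu q (snd (snd p)) * u p)\<^sup>2) * indicator ?E p" for p
    unfolding F3_def u'_def by (cases p) (auto simp: indicator_def)
  let ?c2 = "ennreal (C * (1 + B + S) * e\<^sup>2)" and ?c3 = "ennreal (C * (1 + B))"
  have res: "residual_i q R (net L) (t, x, \<xi>) = Lv (t, x, \<xi>) + nu q \<xi> * net L (t, x, \<xi>)
      - K_op q (\<lambda>\<eta>. net L (t, x, \<eta>) * indicator ?V \<eta>) \<xi>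
      - Gamma_op q (\<lambda>\<eta>. net L (t, x, \<eta>) * indicator ?V \<eta>) (\<lambda>\<eta>. net L (t, x, \<eta>) * indicator ?V \<eta>) \<xi>" for t x \<xi>
    unfolding residual_i_def Let_def prod.case partial_dnet Lv_def by (simp add: inner_axis)
  have "error_i_sq q T R (net L) \<le> (LBNN t. LBNN x. LBNN \<xi>. 6 * F1 (t, x, \<xi>) + ?c2 * F2 (t, x, \<xi>) + ?c3 * F3 (t, x, \<xi>))"
    unfolding error_i_sq_def
  proof (rule nn_integral_mono_AE, use eq AE_not_endpoints[of 0 T] in eventually_elim)
    case (elim t)
    show ?case
    proof (cases "t \<in> {0..T}")
      case t: True
      have "(LBNN x. l2_on ?V (\<lambda>\<xi>. residual_i q R (net L) (t, x, \<xi>)) * indicator torus_cube x)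
        \<le> (LBNN x. LBNN \<xi>. 6 * F1 (t, x, \<xi>) + ?c2 * F2 (t, x, \<xi>) + ?c3 * F3 (t, x, \<xi>))"
      proof (rule nn_integral_mono_AE, use elim(1) in eventually_elim)
        case (elim x)
        show ?case
        proof (cases "x \<in> torus_cube")
          case x: True
          let ?f = "\<lambda>\<xi>. u (t, x, \<xi>)" and ?v = "\<lambda>\<xi>. net L (t, x, \<xi>)" and ?L = "\<lambda>\<xi>. Lv (t, x, \<xi>)"
          have cell: "(t, x, \<xi>) \<in> phase_cell T" for \<xi>
            using t x \<open>t \<noteq> 0 \<and> t \<noteq> T\<close> by (auto simp: phase_cell_def)
          have a: "?V \<in> sets borel" "?f \<in> borel_maps" "?v \<in> borel_maps" "?L \<in> borel_maps"
            using continuous_slices_measurable(1)[OF uc t] slice[OF dc] slice[OF Lvc] by auto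
          have "\<forall>\<xi>\<in>?V. \<bar>?v \<xi> - ?f \<xi>\<bar> \<le> e" using close t x by auto
          from conjunct2[OF C[unfolded collision_stable_def], rule_format, OF a B(1) B(2)[OF t x] S e this[rule_format]]
          have "l2_on ?V (\<lambda>\<xi>. residual_i q R (net L) (t, x, \<xi>))
            \<le> 6 * l2_on ?V (\<lambda>\<xi>. ?L \<xi> - (collision_rhs q ?f \<xi>))
             + ?c2 * l2_on ?V (\<lambda>\<xi>. nu q \<xi>)
             + ?c3 * l2_on (- ?V) (\<lambda>\<xi>. nu q \<xi> * ?f \<xi>)"
            unfolding res .
          also have "l2_on ?V (\<lambda>\<xi>. ?L \<xi> - (collision_rhs q ?f \<xi>))
            = (LBNN \<xi>. F1 (t, x, \<xi>))"
          proof (rule nn_integral_cong_AE, use elim in eventually_elim)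
            case (elim \<xi>)
            then show ?case using cell[of \<xi>] t x by (simp add: F1_def indicator_def)
          qed
          also have "l2_on ?V (\<lambda>\<xi>. nu q \<xi>) = (LBNN \<xi>. F2 (t, x, \<xi>))"
            using t x by (simp add: F2_def indicator_def)
          also have "l2_on (- ?V) (\<lambda>\<xi>. nu q \<xi> * ?f \<xi>) = (LBNN \<xi>. F3 (t, x, \<xi>))"
            using t x by (simp add: F3u indicator_def)
          also have "6 * (LBNN \<xi>. F1 (t, x, \<xi>)) + ?c2 * (LBNN \<xi>. F2 (t, x, \<xi>)) + ?c3 * (LBNN \<xi>. F3 (t, x, \<xi>))
            = (LBNN \<xi>. 6 * F1 (t, x, \<xi>) + ?c2 * F2 (t, x, \<xi>) + ?c3 * F3 (t, x, \<xi>))"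
            by (simp add: nn_integral_add nn_integral_cmult)
          finally show ?thesis using x by simp
        qed simp
      qed
      then show ?thesis using t by simp
    qed simp
  qed
  also have "... = (LBNN p. 6 * F1 p + ?c2 * F2 p + ?c3 * F3 p)"
    by (rule nn_integral_phase[symmetric]) measurable
  also have "... = 6 * (LBNN p. F1 p) + ?c2 * (LBNN p. F2 p) + ?c3 * (LBNN p. F3 p)"
    by (simp add: nn_integral_add nn_integral_cmult)
  finally show ?thesis unfolding F1_def F2_def F3u Lv_def .
qed

lemma nu_bounded_vel_cube:
  assumes cutoff: "cutoff_kernel q \<gamma>"
  shows "\<exists>M. \<forall>\<xi>\<in>vel_cube R. nu q \<xi> \<le> M"
proof -
  obtain \<nu>1 where \<nu>1: "\<nu>1 > 0" "\<And>\<xi>. nu q \<xi> \<le> \<nu>1 * (1 + norm \<xi>) powr \<gamma>" using nu_facts(2)[OF cutoff] by blast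
  have "continuous_on (vel_cube R) (\<lambda>\<xi>. \<nu>1 * (1 + norm \<xi>) powr \<gamma>)"
    by (intro continuous_on_mult continuous_on_powr continuous_intros) (smt (verit) norm_ge_zero)
  then have "bounded ((\<lambda>\<xi>. \<nu>1 * (1 + norm \<xi>) powr \<gamma>) ` vel_cube R)"
    by (intro compact_imp_bounded compact_continuous_image cube_measure(5))
  then obtain M where M: "\<And>\<xi>. \<xi> \<in> vel_cube R \<Longrightarrow> \<bar>\<nu>1 * (1 + norm \<xi>) powr \<gamma>\<bar> \<le> M" unfolding bounded_iff by auto
  have "nu q \<xi> \<le> M" if "\<xi> \<in> vel_cube R" for \<xi> using M[OF that] \<nu>1(2)[of \<xi>] by linarith
  then show ?thesis by blast
qed

lemma ennreal_sqrt_le: "a \<le> ennreal (e\<^sup>2) \<Longrightarrow> e \<ge> 0 \<Longrightarrow> ennreal_sqrt a \<le> ennreal e"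
  by (cases a) (auto simp: ennreal_sqrt_def top_unique intro!: ennreal_leI real_le_lsqrt)

theorem theorem3p2:
  fixes q :: "real \<Rightarrow> real \<Rightarrow> real" and \<gamma> T \<epsilon> :: real and u :: "phase \<Rightarrow> real"
  assumes "cutoff_kernel q \<gamma>"
    and "T > 0"
    and "boltzmann_solution q T u"
    and "sobolev_norm_sq 4 (phase_domain T) (phase_cell T)
           (\<lambda>(t, x, \<xi>). (1 + norm \<xi>) powr \<gamma> * u (t, x, \<xi>)) < \<infinity>"
    and "\<epsilon> > 0"
  shows "\<exists>R0>0. \<forall>R\<ge>R0. \<exists>lam>0. \<exists>N>5. \<exists>\<theta>.
           tanh_network N \<theta> \<and> generalization_error q \<gamma> T u lam R \<theta> \<le> ennreal \<epsilon>"
proof -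
  note cutoff = assms(1) and T = assms(2) and \<epsilon> = assms(5)
  note [measurable] = cube_measure(1,3) nu_facts(1)[OF cutoff]
  have per: "x_periodic u" and uc: "continuous_on ({0..T} \<times> UNIV \<times> UNIV) u"
    using assms(3) unfolding boltzmann_solution_def by blast+
  obtain ut0 ux0 where w0: "weak_deriv (phase_domain T) {#e_t#} u ut0"
    "\<And>j. weak_deriv (phase_domain T) {#e_x j#} u (\<lambda>p. ux0 p $ j)"
    and pde: "AE p in lborel. p \<in> phase_cell T \<longrightarrow> (case p of (t, x, \<xi>) \<Rightarrow>
           ut0 (t, x, \<xi>) + \<xi> \<bullet> ux0 (t, x, \<xi>) + nu q \<xi> * u (t, x, \<xi>)
             = K_op q (\<lambda>\<eta>. u (t, x, \<eta>)) \<xi> + Gamma_op q (\<lambda>\<eta>. u (t, x, \<eta>)) (\<lambda>\<eta>. u (t, x, \<eta>)) \<xi>)"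
    using assms(3) unfolding boltzmann_solution_def by blast
  define ut where "ut p = indicator (phase_domain T) p * ut0 p" for p
  define ux where "ux p = indicat_real (phase_domain T) p *\<^sub>R ux0 p" for p
  have op: "open (phase_domain T)" unfolding phase_domain_def by (intro open_Times open_UNIV open_greaterThanLessThan)
  have wt: "weak_deriv (phase_domain T) {#e_t#} u ut" and [measurable]: "ut \<in> borel_maps"
    using weak_deriv_restrict[OF op w0(1)] unfolding ut_def[abs_def] by auto
  have wx: "weak_deriv (phase_domain T) {#e_x j#} u (\<lambda>p. ux p $ j)"
    and [measurable]: "(\<lambda>p. ux p $ j) \<in> borel_maps" for j
    using weak_deriv_restrict[OF op w0(2)[of j]] unfolding ux_def[abs_def] by auto
  define g where "g z = ut z + (\<Sum>j\<in>UNIV. (z \<bullet> e_v j) * ux z $ j)" for z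
  have gm[measurable]: "g \<in> borel_maps" unfolding g_def[abs_def] by measurable
  have "AE p in lborel. p \<in> phase_cell T \<longrightarrow> (case p of (t, x, \<xi>) \<Rightarrow>
      g (t, x, \<xi>) = collision_rhs q (\<lambda>\<eta>. u (t, x, \<eta>)) \<xi>)"
    using pde
  proof eventually_elim
    case (elim p)
    obtain t x \<xi> where p: "p = (t, x, \<xi>)" by (cases p) auto
    have "g p = ut0 p + \<xi> \<bullet> ux0 p" if "p \<in> phase_cell T"
    proof -
      have "p \<in> phase_domain T" using that by (auto simp: phase_cell_def phase_domain_def)
      moreover have "\<xi> \<bullet> ux0 p = (\<Sum>j\<in>UNIV. \<xi> $ j * ux0 p $ j)" by (simp add: inner_vec_def)
      ultimately show ?thesis by (simp add: g_def ut_def ux_def p inner_axis)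
    qed
    then show ?case using elim unfolding p prod.case by (auto simp: algebra_simps)
  qed
  from AE_phase[OF this] have eq: "AE t in lborel. AE x in lborel. AE \<xi> in lborel. (t, x, \<xi>) \<in> phase_cell T \<longrightarrow>
      g (t, x, \<xi>) = collision_rhs q (\<lambda>\<eta>. u (t, x, \<eta>)) \<xi>"
    by simp
  obtain B where B: "B \<ge> 0" "\<And>t x. t \<in> {0..T} \<Longrightarrow> x \<in> torus_cube \<Longrightarrow> nu_l2 q (\<lambda>\<xi>. u (t, x, \<xi>)) \<le> ennreal B"
    using weighted_solution_bound[OF cutoff T uc assms(4)] by blast
  obtain C where Cb: "collision_stable q C" using collision_stable_exists[OF cutoff] by blast
  then have C: "C \<ge> 0" by (simp add: collision_stable_def)
  \<comment> \<open>The tail is allotted a quarter of \<open>\<epsilon>\<^sup>2\<close>; this determines the radius \<open>R0\<close>.\<close>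
  define \<delta> where "\<delta> = \<epsilon>\<^sup>2 / (4 * (C * (1 + B) + 1))"
  have CB: "C * (1 + B) \<ge> 0" using C B(1) by simp
  have \<delta>: "\<delta> > 0" unfolding \<delta>_def using \<epsilon> CB by (intro divide_pos_pos mult_pos_pos add_nonneg_pos) auto
  have C\<delta>: "C * (1 + B) * \<delta> \<le> \<epsilon>\<^sup>2 / 4"
  proof -
    have "C * (1 + B) * \<delta> \<le> (C * (1 + B) + 1) * \<delta>" using \<delta> by (intro mult_right_mono) auto
    also have "... = \<epsilon>\<^sup>2 / 4"
    proof -
      have "y * (\<epsilon>\<^sup>2 / (4 * y)) = \<epsilon>\<^sup>2 / 4" if "y > 0" for y :: real using that by simp
      from this[of "C * (1 + B) + 1"] show ?thesis using CB unfolding \<delta>_def by linarith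
    qed
    finally show ?thesis .
  qed
  obtain R0 where R0: "R0 > 0" "\<And>R. R \<ge> R0 \<Longrightarrow>
      l2_on ({0..T} \<times> torus_cube \<times> - vel_cube R) (\<lambda>p. nu q (snd (snd p)) * u p) \<le> ennreal \<delta>"
    using velocity_tail_small[OF T uc nu_facts(1)[OF cutoff] B(2) \<delta>] by blast
  have "\<exists>lam>0. \<exists>N>5. \<exists>\<theta>. tanh_network N \<theta> \<and> generalization_error q \<gamma> T u lam R \<theta> \<le> ennreal \<epsilon>" if R: "R \<ge> R0" for R
  proof -
    define r where "r = R / (2 * sqrt 3)"
    have r: "0 < r" "r < r + 1" using R R0(1) by (auto simp: r_def)
    let ?D = "{0..T} \<times> torus_cube \<times> vel_cube R"
    have K: "cbox_at (cell_centre T) (cell_radius T r) = ?D"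
    proof (rule set_eqI)
      fix p :: phase
      obtain t x \<xi> where p: "p = (t, x, \<xi>)" by (cases p) auto
      show "p \<in> cbox_at (cell_centre T) (cell_radius T r) \<longleftrightarrow> p \<in> ?D"
        unfolding p cell_box_mem(1) r_def torus_cube_def vel_cube_def by (auto simp: abs_le_iff minus_le_iff)
    qed
    have Dm[measurable]: "?D \<in> sets borel" and Dfin: "emeasure lborel ?D < \<infinity>"
      using box_at_facts(1,3)[of "cell_centre T" "cell_radius T r"] emeasure_bounded_finite[OF compact_imp_bounded]
      unfolding K by (auto simp: less_top)
    obtain M where M: "\<And>\<xi>. \<xi> \<in> vel_cube R \<Longrightarrow> nu q \<xi> \<le> M" using nu_bounded_vel_cube[OF cutoff] by blast
    have nuM: "(nu q \<xi>)\<^sup>2 \<le> M\<^sup>2" if "\<xi> \<in> vel_cube R" for \<xi>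
      using M[OF that] nu_facts(3)[OF cutoff, of \<xi>] by (intro power_mono) auto
    define S where "S = enn2real (ennreal (M\<^sup>2) * emeasure lborel (vel_cube R))"
    define P where "P = enn2real (ennreal (M\<^sup>2) * emeasure lborel ?D)"
    have S: "S \<ge> 0" "nu_l2 q (indicator (vel_cube R)) \<le> ennreal S"
    proof -
      have "nu_l2 q (indicator (vel_cube R)) \<le> (LBNN \<xi>. ennreal (M\<^sup>2) * indicator (vel_cube R) \<xi>)"
        unfolding l2sq_def by (intro nn_integral_mono) (use nuM in \<open>auto simp: indicator_def intro!: ennreal_leI\<close>)
      also have "... = ennreal (M\<^sup>2) * emeasure lborel (vel_cube R)" by (simp add: nn_integral_cmult_indicator)
      also have "... = ennreal S" unfolding S_def using cube_measure(4) by (subst ennreal_enn2real) (auto simp: ennreal_mult_less_top)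
      finally show "nu_l2 q (indicator (vel_cube R)) \<le> ennreal S" .
    qed (simp add: S_def)
    have P: "P \<ge> 0" "l2_on ?D (\<lambda>p. nu q (snd (snd p))) \<le> ennreal P"
    proof -
      have "l2_on ?D (\<lambda>p. nu q (snd (snd p))) \<le> (LBNN p. ennreal (M\<^sup>2) * indicator ?D p)"
        by (intro nn_integral_mono) (use nuM in \<open>auto simp: indicator_def intro!: ennreal_leI\<close>)
      also have "... = ennreal (M\<^sup>2) * emeasure lborel ?D" by (rule nn_integral_cmult_indicator) (simp add: Dm)
      also have "... = ennreal P" unfolding P_def using Dfin by (subst ennreal_enn2real) (auto simp: ennreal_mult_less_top)
      finally show "l2_on ?D (\<lambda>p. nu q (snd (snd p))) \<le> ennreal P" .
    qed (simp add: P_def)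
    \<comment> \<open>Initial, boundary and the remaining interior error are at most \<open>e\<close> times these constants, which depend on \<open>R\<close>.\<close>
    define Z1 where "Z1 = 6 + C * (1 + B + S) * P"
    define Z2 where "Z2 = enn2real (emeasure lborel (vel_cube R) * emeasure lborel torus_cube)"
    define Z3 where "Z3 = 144 * enn2real (6 * emeasure lborel (vel_cube R) * ennreal ((2 * pi)\<^sup>2) * ennreal T)"
    have Z: "Z1 \<ge> 0" "Z2 \<ge> 0" "Z3 \<ge> 0" using C B(1) S(1) P(1) by (simp_all add: Z1_def Z2_def Z3_def)
    define e where "e = min 1 (\<epsilon>\<^sup>2 / (4 * (1 + Z1 + Z2 + Z3)))"
    have e: "0 < e" "e \<le> 1" using \<epsilon> Z by (auto simp: e_def)
    have e2: "e\<^sup>2 \<le> e" using e by (simp add: power2_eq_square mult_left_le)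
    have eZ: "e * (Z1 + Z2 + Z3) \<le> \<epsilon>\<^sup>2 / 4"
    proof -
      have "e * (1 + Z1 + Z2 + Z3) \<le> \<epsilon>\<^sup>2 / (4 * (1 + Z1 + Z2 + Z3)) * (1 + Z1 + Z2 + Z3)"
        using Z by (intro mult_right_mono) (auto simp: e_def)
      also have "... = \<epsilon>\<^sup>2 / 4" using Z by (simp add: divide_simps)
      finally show ?thesis using e(1) by (simp add: algebra_simps)
    qed
    have Gm: "(\<lambda>z. indicator (box_at (cell_centre T) (cell_radius T (r + 1))) z * g z) \<in> borel_maps"
      using box_at_facts(4) by measurable
    obtain L where L: "\<And>p. p \<in> ?D \<Longrightarrow> \<bar>net L p - u p\<bar> \<le> e"
      "l2_on ?D (\<lambda>p. dnet L [e_t] p + (\<Sum>j\<in>UNIV. (p \<bullet> e_v j) * dnet L [e_x j] p) - g p) \<le> ennreal e"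
      using transport_approx[OF T r e(1) uc wt wx, folded g_def, OF Gm transport_term_finite[OF cutoff T uc B gm eq]]
      unfolding K by blast
    have Ei: "error_i_sq q T R (net L) \<le> ennreal (e * Z1 + \<epsilon>\<^sup>2 / 4)"
    proof -
      have "error_i_sq q T R (net L) \<le> 6 * ennreal e + ennreal (C * (1 + B + S) * e\<^sup>2) * ennreal P + ennreal (C * (1 + B)) * ennreal \<delta>"
        by (rule order_trans[OF interior_error_bound[OF cutoff uc Cb B gm eq S less_imp_le[OF e(1)] e(2) L(1)]])
          (auto intro!: add_mono mult_left_mono L(2) P(2) R0(2) R)
      also have "... = ennreal (6 * e + C * (1 + B + S) * e\<^sup>2 * P + C * (1 + B) * \<delta>)"
        using C B(1) S(1) P(1) \<delta> e(1) by (simp add: ennreal_mult ennreal_plus)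
      also have "... \<le> ennreal (e * Z1 + \<epsilon>\<^sup>2 / 4)"
      proof (rule ennreal_leI)
        have "C * (1 + B + S) * P * e\<^sup>2 \<le> C * (1 + B + S) * P * e" using C B(1) S(1) P(1) e2 by (intro mult_left_mono) auto
        moreover have "e * Z1 = 6 * e + C * (1 + B + S) * P * e" "C * (1 + B + S) * e\<^sup>2 * P = C * (1 + B + S) * P * e\<^sup>2"
          by (simp_all add: Z1_def algebra_simps)
        ultimately show "6 * e + C * (1 + B + S) * e\<^sup>2 * P + C * (1 + B) * \<delta> \<le> e * Z1 + \<epsilon>\<^sup>2 / 4" using C\<delta> by linarith
      qed
      finally show ?thesis .
    qed
    have Et: "error_t_sq R u (net L) \<le> ennreal (e * Z2)"
    proof -
      have "error_t_sq R u (net L) \<le> ennreal (e\<^sup>2) * (emeasure lborel (vel_cube R) * emeasure lborel torus_cube)"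
        by (rule error_t_sq_bound) (use e L(1) T in auto)
      also have "emeasure lborel (vel_cube R) * emeasure lborel torus_cube = ennreal Z2"
        unfolding Z2_def using cube_measure by (subst ennreal_enn2real) (auto simp: ennreal_mult_less_top)
      also have "ennreal (e\<^sup>2) * ennreal Z2 \<le> ennreal (e * Z2)"
        using Z(2) e2 by (simp add: ennreal_mult[symmetric] ennreal_leI mult_right_mono)
      finally show ?thesis .
    qed
    have Eb: "error_b_sq T R (net L) \<le> ennreal (e * Z3)"
    proof -
      have "error_b_sq T R (net L) \<le> ennreal (144 * e) * (6 * emeasure lborel (vel_cube R) * ennreal ((2 * pi)\<^sup>2) * ennreal T)"
        by (rule error_b_sq_bound[OF T], rule residual_b_periodic_bound[OF per]) (use e L(1) in auto)
      also have "6 * emeasure lborel (vel_cube R) * ennreal ((2 * pi)\<^sup>2) * ennreal T = ennreal (Z3 / 144)"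
        unfolding Z3_def using cube_measure by (simp add: ennreal_mult_less_top)
      also have "ennreal (144 * e) * ennreal (Z3 / 144) = ennreal (e * Z3)"
        using Z(3) e(1) by (simp add: ennreal_mult[symmetric])
      finally show ?thesis .
    qed
    define P' where "P' = enn2real (error_p_sq \<gamma> T R (net L))"
    have Ep: "error_p_sq \<gamma> T R (net L) = ennreal P'" "P' \<ge> 0"
      using error_p_sq_finite[OF T, of \<gamma> R L] by (auto simp: P'_def less_top)
    \<comment> \<open>The network is fixed by now and its penalty is finite; the weight makes its contribution small.\<close>
    define lam where "lam = \<epsilon>\<^sup>2 / (4 * (1 + P'))"
    have lam: "lam > 0" using \<epsilon> Ep(2) by (simp add: lam_def)
    have "lam * P' \<le> lam * (1 + P')" using lam by (intro mult_left_mono) auto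
    also have "... = \<epsilon>\<^sup>2 / 4" using Ep(2) by (simp add: lam_def divide_simps)
    finally have lamP: "lam * P' \<le> \<epsilon>\<^sup>2 / 4" .
    have "error_i_sq q T R (net L) + error_t_sq R u (net L) + error_b_sq T R (net L) + ennreal lam * error_p_sq \<gamma> T R (net L)
      \<le> ennreal (e * Z1 + \<epsilon>\<^sup>2 / 4) + ennreal (e * Z2) + ennreal (e * Z3) + ennreal lam * ennreal P'"
      unfolding Ep(1) by (intro add_mono Ei Et Eb order_refl)
    also have "... = ennreal (e * Z1 + \<epsilon>\<^sup>2 / 4 + e * Z2 + e * Z3 + lam * P')"
      using e Z lam Ep(2) by (simp add: ennreal_plus ennreal_mult)
    also have "... \<le> ennreal (\<epsilon>\<^sup>2)"
    proof (rule ennreal_leI)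
      have "e * Z1 + e * Z2 + e * Z3 \<le> \<epsilon>\<^sup>2 / 4" using eZ by (simp add: algebra_simps)
      then show "e * Z1 + \<epsilon>\<^sup>2 / 4 + e * Z2 + e * Z3 + lam * P' \<le> \<epsilon>\<^sup>2"
        using lamP zero_le_power2[of \<epsilon>] by linarith
    qed
    finally have tot: "error_i_sq q T R (net L) + error_t_sq R u (net L) + error_b_sq T R (net L)
        + ennreal lam * error_p_sq \<gamma> T R (net L) \<le> ennreal (\<epsilon>\<^sup>2)" .
    obtain N \<theta> where N: "N > 5" "tanh_network N \<theta>" "realization \<theta> = net L" using net_realization by blast
    have "generalization_error q \<gamma> T u lam R \<theta> \<le> ennreal \<epsilon>"
      unfolding generalization_error_def Let_def N(3) using \<epsilon> by (intro ennreal_sqrt_le[OF tot]) simp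
    then show ?thesis using lam N(1,2) by blast
  qed
  then show ?thesis using R0(1) by blast
qed

end
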